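(* Let $u(x,t)$ be the solution of the regularized logarithmic Schrödinger equation with Dirac delta potential on $\Omega=(-a,a)$ described in the context, with fixed regularization parameter $0<\varepsilon\ll 1$, let $0<T<T^*$, where $T^*$ is the maximal existence time of $u$, and suppose that $u$ satisfies assumption (A) of the context with constant $M_1$. Let $U^k\in Z_h^0$ be the numerical solution given by the CNFD scheme described in the context, and let $e^k\in Z_h^0$ be the error function $e_j^k=u(x_j,t_k)-U_j^k$, $0\le j\le 2M$. Put $$C_\varepsilon=M_1\max\left(|\ln(\varepsilon+M_1)|,\ \frac{1}{M_1^4},\ \varepsilon^{-2}\right).$$ Then there exist $h_0>0$ and $\tau_0>0$ sufficiently small and a constant $C>0$ independent of $h$, $\tau$ and $k$ such that, whenever $0<h\le h_0$ and $0<\tau\le\tau_0$, for all integers $0\le k\le T/\tau$, $$\|e^k\|\le C_\varepsilon(\tau^2+\tau h)+Ch^2,\qquad \|\delta_x^+e^k\|\le C_\varepsilon(\tau^2+\tau h)+Ch^2,\qquad \|e^k\|_\infty\le C_\varepsilon(\tau^2+\tau h)+Ch^2 .$$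
   Context: **Continuous problem.** Let $a>0$, $\Omega=(-a,a)$, $\lambda,\mu\in\mathbb{R}$, $\varepsilon>0$ small and fixed. The complex-valued function $u(x,t)$ solves $$i\partial_t u=-\partial_{xx}u+\lambda\delta(x)u+\mu u\ln\big((\varepsilon+|u|)^2\big),\quad x\in\Omega,\ t>0,\qquad u(x,0)=u_0(x),\qquad u(\pm a,t)=0,$$ where $\delta$ is the Dirac delta. Equivalently, $u$ is continuous at $x=0$, satisfies $i\partial_t u=-\partial_{xx}u+\mu u\ln((\varepsilon+|u|)^2)$ on $(-a,0)$ and on $(0,a)$, the homogeneous Dirichlet conditions, the initial condition, and the interface condition $\partial_xu(0+,t)-\partial_xu(0-,t)=\lambda u(0,t)$. **Assumption (A).** $u\in L^\infty([0,T],H_0^1(\Omega)\cap H^2(\Omega\setminus\{0\}))$, $\partial_xu(0+,t)-\partial_xu(0-,t)=\lambda u(0,t)$, and $$\|u\|_{W^{1,\infty}([0,T],W^{4,\infty}(\Omega\setminus\{0\}))}+\|u\|_{W^{2,\infty}([0,T],L^\infty(\Omega\setminus\{0\}))}+\|u\|_{W^{3,\infty}([0,T],W^{2,\infty}(\Omega\setminus\{0\}))}+\|u\|_{W^{4,\infty}([0,T],L^\infty(\Omega\setminus\{0\}))}\le M_1 .$$ **Grid and notation.** For a positive integer $M$ let $h=a/M$, $x_j=-a+jh$ ($0\le j\le 2M$, so $x_M=0$); let $\tau>0$ be the time step and $t_k=k\tau$. $Z_h^0$ is the space of complex mesh functions $(u_j)_{0\le j\le 2M}$ with $u_0=u_{2M}=0$.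 Set $\delta_t^+U_j^k=\frac{1}{\tau}(U_j^{k+1}-U_j^k)$, $U_j^{k+1/2}=\frac12(U_j^{k+1}+U_j^k)$, $\delta_x^+U_j=\frac1h(U_{j+1}-U_j)$ (for $0\le j\le 2M-1$), $\delta_x^2U_j=\frac1{h^2}(U_{j+1}-2U_j+U_{j-1})$. Norms: $\|U\|^2=h\sum_{j=0}^{2M-1}|U_j|^2$ (and likewise for $\delta_x^+U$), $\|U\|_\infty=\max_{0\le j\le 2M}|U_j|$. **CNFD scheme.** $U_j^0=u_0(x_j)$ for $0\le j\le 2M$, and for $k\ge0$, $U^{k+1}\in Z_h^0$ satisfies $$i\delta_t^+U_j^k=-\delta_x^2U_j^{k+1/2}+\lambda b_jU_j^{k+1/2}+\mu\tilde Q(U_j^{k+1},U_j^k),\quad 1\le j\le 2M-1,$$ with $b_M=\frac1h$, $b_j=0$ for $j\ne M$, and, for $z_1,z_2\in\mathbb{C}$, $$\tilde Q(z_1,z_2)=\frac12\int_0^1q\big(\theta|z_1|^2+(1-\theta)|z_2|^2\big)\,d\theta\,(z_1+z_2),\qquad q(s)=\ln\big((\varepsilon+\sqrt s)^2\big)=2\ln(\varepsilon+\sqrt s),\ s\ge0.$$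
   Formalization: The condition 0<ε≪1 is made precise as 0<ε<ε0 with a threshold ε0>0 depending only on a, λ, μ, T and M1; with ε fixed independently of T the bound with the explicit C_ε fails for large T, already for λ=μ=0. *)

theory Defs
  imports "HOL-Analysis.Analysis" "HOL-Probability.Essential_Supremum"
begin

section \<open>Function spaces\<close>

text \<open>
  Function spaces are given by extended norms \<open>N :: (real \<Rightarrow> complex) \<Rightarrow> ennreal\<close>:
  \<open>N f = top\<close> means that \<open>f\<close> is not in the space.
\<close>

definition vderiv :: "(real \<Rightarrow> complex) \<Rightarrow> real \<Rightarrow> complex" where
  "vderiv f = (\<lambda>x. vector_derivative f (at x))"

definition test_function :: "real set \<Rightarrow> (real \<Rightarrow> complex) \<Rightarrow> bool" where
  "test_function S \<phi> \<longleftrightarrow>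
     (\<forall>j x. (vderiv ^^ j) \<phi> differentiable (at x)) \<and>
     (\<exists>K. compact K \<and> K \<subseteq> S \<and> (\<forall>x. x \<notin> K \<longrightarrow> \<phi> x = 0))"

definition has_weak_deriv ::
    "nat \<Rightarrow> real set \<Rightarrow> (real \<Rightarrow> complex) \<Rightarrow> (real \<Rightarrow> complex) \<Rightarrow> bool" where
  "has_weak_deriv j S f g \<longleftrightarrow>
     (\<forall>K. compact K \<and> K \<subseteq> S \<longrightarrow> integrable (lebesgue_on K) f \<and> integrable (lebesgue_on K) g) \<and>
     (\<forall>\<phi>. test_function S \<phi> \<longrightarrow>
        (LINT x|lebesgue_on S. f x * (vderiv ^^ j) \<phi> x) =
        (-1) ^ j * (LINT x|lebesgue_on S. g x * \<phi> x))"

definition Linf_norm :: "real set \<Rightarrow> (real \<Rightarrow> complex) \<Rightarrow> ennreal" where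
  "Linf_norm S f =
     (if f \<in> borel_measurable (lebesgue_on S)
      then esssup (lebesgue_on S) (\<lambda>x. ennreal (norm (f x))) else top)"

definition L2_norm :: "real set \<Rightarrow> (real \<Rightarrow> complex) \<Rightarrow> ennreal" where
  "L2_norm S f =
     (if f \<in> borel_measurable (lebesgue_on S) \<and> integrable (lebesgue_on S) (\<lambda>x. (norm (f x))\<^sup>2)
      then ennreal (sqrt (LINT x|lebesgue_on S. (norm (f x))\<^sup>2)) else top)"

text \<open>
  The Sobolev norm of order \<open>m\<close> built on \<open>L = Linf_norm\<close> or \<open>L = L2_norm\<close>, i.e. the sum of the
  norms of the weak derivatives of order at most \<open>m\<close>.  Weak derivatives are unique almost
  everywhere, so the infimum is over equal values; it is \<open>top\<close> if a weak derivative is missing.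
  For \<open>L2_norm\<close> this is equivalent to the usual Hilbert norm, and only finiteness and convergence
  are used in that case.
\<close>

definition sobolev_norm ::
    "(real set \<Rightarrow> (real \<Rightarrow> complex) \<Rightarrow> ennreal) \<Rightarrow> nat \<Rightarrow> real set \<Rightarrow> (real \<Rightarrow> complex) \<Rightarrow> ennreal" where
  "sobolev_norm L m S f =
     (INF g \<in> {g. \<forall>j\<le>m. has_weak_deriv j S f (g j)}. \<Sum>j\<le>m. L S (g j))"

text \<open>\<open>H\<^sub>0\<^sup>1(S)\<close> is the closure of the test functions in \<open>H\<^sup>1(S)\<close>.\<close>

definition in_H10 :: "real set \<Rightarrow> (real \<Rightarrow> complex) \<Rightarrow> bool" where
  "in_H10 S f \<longleftrightarrow>
     sobolev_norm L2_norm 1 S f < top \<and>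
     (\<exists>\<phi>. (\<forall>n. test_function S (\<phi> n)) \<and>
          (\<lambda>n. sobolev_norm L2_norm 1 S (\<lambda>x. f x - \<phi> n x)) \<longlonglongrightarrow> 0)"

definition H10_H2_norm :: "real \<Rightarrow> (real \<Rightarrow> complex) \<Rightarrow> ennreal" where
  "H10_H2_norm a f =
     (if in_H10 {-a<..<a} f
      then sobolev_norm L2_norm 1 {-a<..<a} f + sobolev_norm L2_norm 2 ({-a<..<a} - {0}) f
      else top)"

text \<open>
  Bochner spaces over \<open>[0,T]\<close>.  In \<open>v :: real \<Rightarrow> real \<Rightarrow> complex\<close> the first argument is the time,
  so \<open>v t\<close> is an element of the space with norm \<open>N\<close>.
\<close>

definition bochner_measurable ::
    "real \<Rightarrow> ((real \<Rightarrow> complex) \<Rightarrow> ennreal) \<Rightarrow> (real \<Rightarrow> real \<Rightarrow> complex) \<Rightarrow> bool" where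
  "bochner_measurable T N v \<longleftrightarrow>
     (\<exists>s. (\<forall>n. simple_function (lebesgue_on {0..T}) (s n)) \<and>
          (\<forall>n. \<forall>t\<in>{0..T}. N (s n t) < top) \<and>
          (AE t in lebesgue_on {0..T}. (\<lambda>n. N (\<lambda>x. v t x - s n t x)) \<longlonglongrightarrow> 0))"

text \<open>
  The identity \<open>\<integral> \<phi>\<^sup>(\<^sup>i\<^sup>) v dt = (-1)\<^sup>i \<integral> \<phi> w dt\<close> between Bochner integrals of functions on \<open>S\<close>, tested
  against \<open>\<psi>\<close>.  This does not depend on the choice of representatives, and test functions on \<open>S\<close>
  separate locally integrable functions.
\<close>

definition has_weak_time_deriv ::
    "nat \<Rightarrow> real \<Rightarrow> real set \<Rightarrow> (real \<Rightarrow> real \<Rightarrow> complex) \<Rightarrow> (real \<Rightarrow> real \<Rightarrow> complex) \<Rightarrow> bool" where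
  "has_weak_time_deriv i T S v w \<longleftrightarrow>
     (\<forall>\<phi> \<psi>. test_function {0<..<T} \<phi> \<and> test_function S \<psi> \<longrightarrow>
        (LINT t|lebesgue_on {0..T}. (vderiv ^^ i) \<phi> t * (LINT x|lebesgue_on S. v t x * \<psi> x)) =
        (-1) ^ i * (LINT t|lebesgue_on {0..T}. \<phi> t * (LINT x|lebesgue_on S. w t x * \<psi> x)))"

text \<open>
  The norm of \<open>W\<^sup>k\<^sup>,\<^sup>\<infinity>([0,T],X)\<close>, where \<open>N\<close> is the norm of the space \<open>X\<close> of functions on \<open>S\<close>:
  the essential supremum over \<open>t\<close> of the sum of the \<open>X\<close>-norms of the time derivatives of order at
  most \<open>k\<close>; again the infimum is over equal values.
\<close>

definition bochner_Winf_norm ::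
    "nat \<Rightarrow> real \<Rightarrow> real set \<Rightarrow> ((real \<Rightarrow> complex) \<Rightarrow> ennreal) \<Rightarrow> (real \<Rightarrow> real \<Rightarrow> complex) \<Rightarrow> ennreal" where
  "bochner_Winf_norm k T S N v =
     (INF w \<in> {w. w 0 = v \<and> (\<forall>i\<le>k. bochner_measurable T N (w i) \<and> has_weak_time_deriv i T S v (w i))}.
        esssup (lebesgue_on {0..T}) (\<lambda>t. \<Sum>i\<le>k. N (w i t)))"

section \<open>The continuous problem\<close>

text \<open>
  \<open>solves a lam \<mu> \<epsilon> u0 S u\<close>: \<open>u\<close> (written \<open>u x t\<close>) is a classical solution on \<open>[-a,a] \<times> [0,S)\<close> of the
  problem with the delta potential of strength \<open>lam\<close> expressed by the interface condition; \<open>S = \<infinity>\<close> is allowed.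
\<close>

definition solves ::
    "real \<Rightarrow> real \<Rightarrow> real \<Rightarrow> real \<Rightarrow> (real \<Rightarrow> complex) \<Rightarrow> ereal \<Rightarrow> (real \<Rightarrow> real \<Rightarrow> complex) \<Rightarrow> bool" where
  "solves a lam \<mu> \<epsilon> u0 S u \<longleftrightarrow>
     continuous_on ({-a..a} \<times> {t. 0 \<le> t \<and> ereal t < S}) (\<lambda>(x, t). u x t) \<and>
     (\<forall>x\<in>{-a..a}. u x 0 = u0 x) \<and>
     (\<forall>t. 0 \<le> t \<and> ereal t < S \<longrightarrow> u (-a) t = 0 \<and> u a t = 0) \<and>
     (\<exists>ut ux uxx. \<forall>t. 0 < t \<and> ereal t < S \<longrightarrow>
        (\<forall>x\<in>{-a<..<a} - {0}.
           ((\<lambda>s. u x s) has_vector_derivative ut x t) (at t) \<and>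
           ((\<lambda>y. u y t) has_vector_derivative ux x t) (at x) \<and>
           ((\<lambda>y. ux y t) has_vector_derivative uxx x t) (at x) \<and>
           \<i> * ut x t =
             - uxx x t + of_real \<mu> * u x t * of_real (ln ((\<epsilon> + norm (u x t))\<^sup>2))) \<and>
        (\<exists>dp dm. ((\<lambda>x. ux x t) \<longlongrightarrow> dp) (at_right 0) \<and>
                 ((\<lambda>x. ux x t) \<longlongrightarrow> dm) (at_left 0) \<and>
                 dp - dm = of_real lam * u 0 t))"

definition maximal_solution ::
    "real \<Rightarrow> real \<Rightarrow> real \<Rightarrow> real \<Rightarrow> (real \<Rightarrow> complex) \<Rightarrow> ereal \<Rightarrow> (real \<Rightarrow> real \<Rightarrow> complex) \<Rightarrow> bool" where
  "maximal_solution a lam \<mu> \<epsilon> u0 Tstar u \<longleftrightarrow>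
     solves a lam \<mu> \<epsilon> u0 Tstar u \<and>
     (\<forall>S v. Tstar < S \<and> (\<forall>x\<in>{-a..a}. \<forall>t. 0 \<le> t \<and> ereal t < Tstar \<longrightarrow> v x t = u x t)
        \<longrightarrow> \<not> solves a lam \<mu> \<epsilon> u0 S v)"

definition assumption_A :: "real \<Rightarrow> real \<Rightarrow> real \<Rightarrow> real \<Rightarrow> (real \<Rightarrow> real \<Rightarrow> complex) \<Rightarrow> bool" where
  "assumption_A a lam T M1 u \<longleftrightarrow>
     (let v = (\<lambda>t x. u x t); S = {-a<..<a} - {0}; W = (\<lambda>m. sobolev_norm Linf_norm m S) in
       bochner_Winf_norm 0 T {-a<..<a} (H10_H2_norm a) v < top \<and>
       (\<forall>t\<in>{0..T}. \<exists>ux dp dm.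
          (\<forall>x\<in>S. ((\<lambda>y. u y t) has_vector_derivative ux x) (at x)) \<and>
          (ux \<longlongrightarrow> dp) (at_right 0) \<and> (ux \<longlongrightarrow> dm) (at_left 0) \<and>
          dp - dm = of_real lam * u 0 t) \<and>
       bochner_Winf_norm 1 T S (W 4) v + bochner_Winf_norm 2 T S (Linf_norm S) v +
       bochner_Winf_norm 3 T S (W 2) v + bochner_Winf_norm 4 T S (Linf_norm S) v
         \<le> ennreal M1)"

section \<open>The Crank--Nicolson finite difference scheme\<close>

text \<open>
  A mesh function is a map \<open>nat \<Rightarrow> complex\<close> of which only the values at \<open>0, \<dots>, 2M\<close> matter; \<open>U k j\<close>
  is the value at \<open>(x\<^sub>j, t\<^sub>k)\<close>.
\<close>

definition grid_x :: "real \<Rightarrow> nat \<Rightarrow> nat \<Rightarrow> real" where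
  "grid_x a M j = - a + real j * (a / real M)"

definition in_Zh0 :: "nat \<Rightarrow> (nat \<Rightarrow> complex) \<Rightarrow> bool" where
  "in_Zh0 M V \<longleftrightarrow> V 0 = 0 \<and> V (2 * M) = 0"

definition dx_plus :: "real \<Rightarrow> (nat \<Rightarrow> complex) \<Rightarrow> nat \<Rightarrow> complex" where
  "dx_plus h V j = (V (j + 1) - V j) / of_real h"

definition dx2 :: "real \<Rightarrow> (nat \<Rightarrow> complex) \<Rightarrow> nat \<Rightarrow> complex" where
  "dx2 h V j = (V (j + 1) - 2 * V j + V (j - 1)) / of_real (h\<^sup>2)"

definition dt_plus :: "real \<Rightarrow> (nat \<Rightarrow> nat \<Rightarrow> complex) \<Rightarrow> nat \<Rightarrow> nat \<Rightarrow> complex" where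
  "dt_plus \<tau> U k j = (U (k + 1) j - U k j) / of_real \<tau>"

definition half_step :: "(nat \<Rightarrow> nat \<Rightarrow> complex) \<Rightarrow> nat \<Rightarrow> nat \<Rightarrow> complex" where
  "half_step U k j = (U (k + 1) j + U k j) / 2"

definition mesh_norm :: "real \<Rightarrow> nat \<Rightarrow> (nat \<Rightarrow> complex) \<Rightarrow> real" where
  "mesh_norm h M V = sqrt (h * (\<Sum>j<2 * M. (norm (V j))\<^sup>2))"

definition mesh_norm_inf :: "nat \<Rightarrow> (nat \<Rightarrow> complex) \<Rightarrow> real" where
  "mesh_norm_inf M V = (MAX j\<in>{0..2 * M}. norm (V j))"

definition qlog :: "real \<Rightarrow> real \<Rightarrow> real" where
  "qlog \<epsilon> s = ln ((\<epsilon> + sqrt s)\<^sup>2)"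

definition Qtilde :: "real \<Rightarrow> complex \<Rightarrow> complex \<Rightarrow> complex" where
  "Qtilde \<epsilon> z1 z2 =
     of_real (1 / 2 * integral {0..1} (\<lambda>\<theta>. qlog \<epsilon> (\<theta> * (norm z1)\<^sup>2 + (1 - \<theta>) * (norm z2)\<^sup>2)))
       * (z1 + z2)"

definition delta_coeff :: "real \<Rightarrow> nat \<Rightarrow> nat \<Rightarrow> real" where
  "delta_coeff h M j = (if j = M then 1 / h else 0)"

definition cnfd_solution ::
    "real \<Rightarrow> real \<Rightarrow> real \<Rightarrow> real \<Rightarrow> (real \<Rightarrow> complex) \<Rightarrow> nat \<Rightarrow> real \<Rightarrow> (nat \<Rightarrow> nat \<Rightarrow> complex) \<Rightarrow> bool" where
  "cnfd_solution a lam \<mu> \<epsilon> u0 M \<tau> U \<longleftrightarrow>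
     (let h = a / real M in
       (\<forall>j\<le>2 * M. U 0 j = u0 (grid_x a M j)) \<and>
       (\<forall>k. in_Zh0 M (U (k + 1)) \<and>
          (\<forall>j\<in>{1..2 * M - 1}.
             \<i> * dt_plus \<tau> U k j =
               - dx2 h (half_step U k) j
               + of_real (lam * delta_coeff h M j) * half_step U k j
               + of_real \<mu> * Qtilde \<epsilon> (U (k + 1) j) (U k j))))"

definition cnfd_error ::
    "real \<Rightarrow> nat \<Rightarrow> real \<Rightarrow> (real \<Rightarrow> real \<Rightarrow> complex) \<Rightarrow> (nat \<Rightarrow> nat \<Rightarrow> complex) \<Rightarrow> nat \<Rightarrow> nat \<Rightarrow> complex" where
  "cnfd_error a M \<tau> u U k j = u (grid_x a M j) (real k * \<tau>) - U k j"

definition C_eps :: "real \<Rightarrow> real \<Rightarrow> real" where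
  "C_eps \<epsilon> M1 = M1 * Max {\<bar>ln (\<epsilon> + M1)\<bar>, 1 / M1 ^ 4, 1 / \<epsilon>\<^sup>2}"

end

theory Submission
  imports Defs
begin

text \<open>
  The error \<open>e\<close> at the grid points is governed by the scheme with three sources: the consistency
  residual, of size \<open>\<tau>\<^sup>2 + h\<^sup>2\<close> (and \<open>h\<close> at the interface node), the difference \<open>P\<close> between the arithmetic mean
  of \<open>f z = 2 ln (\<epsilon> + |z|) z\<close> over two time levels and \<open>Qtilde\<close> on the exact solution, and the
  difference of \<open>Qtilde\<close> between the exact and the numerical solution.
  Pairing the error equation with \<open>e\<close> gives an \<open>L\<^sup>2\<close> bound of order \<open>\<tau>\<^sup>2/\<epsilon>\<close>, because the imaginary part of
  the last difference is bounded independently of \<open>\<epsilon>\<close>.  Pairing it with the time increment of \<open>e\<close> gives the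
  \<open>H\<^sup>1\<close> bound: \<open>Qtilde\<close> is a discrete gradient of a potential, so the nonlinear work telescopes up to terms
  controlled by the \<open>L\<^sup>2\<close> bound, and the sources are summed by parts in time.  This needs the total variation
  of \<open>P\<close> in time, which is of order \<open>\<tau>\<^sup>2/\<epsilon>\<^sup>2\<close> since \<open>|u|\<close> is semiconvex in time.
  The resulting inequalities for \<open>L\<^sup>2\<close>, \<open>H\<^sup>1\<close> and maximum norms are coupled but interpolation gains a
  power of \<open>\<epsilon>\<close> over \<open>\<tau>\<^sup>2/\<epsilon>\<^sup>2\<close>; hence for small \<open>\<epsilon>\<close> the coefficient of \<open>\<tau>\<^sup>2\<close> stays below \<open>M1/\<epsilon>\<^sup>2\<close>, while
  all \<open>h\<^sup>2\<close> contributions go into \<open>C\<close>.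
  Classical derivatives of the exact solution are extracted from the weak norms by mollification, and one-sided
  Taylor expansions at \<open>0\<close> turn the interface condition into consistency of the discrete delta.
\<close>

text \<open>The claim leaves no free constant in front of \<open>\<tau>\<^sup>2\<close>: it must
  stay below \<open>M1 / \<epsilon>\<^sup>2\<close>, so every estimate has to keep its exact power
  of 1/\<epsilon>, and a Gronwall factor such as \<open>exp (T / \<epsilon>)\<close> is excluded.
  The obstacle is a zero of the exact solution. There \<open>flog\<close> has a second derivative of
  size 1/\<epsilon> that jumps, and the direction of u can turn round within one time step, so
  single time increments of P need not be of order \<tau>^3; only their sum is small. The weight
  1/\<epsilon>^2 obtained for that sum is already the permitted one, hence its constant would spoil
  the bound. What saves it is that P is paired with the maximum norm E, and E \<le> sqrt (2 X Y)
  with Y of order \<epsilon> X yields a spare factor sqrt \<epsilon>. Nor is the numerical solution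
  bounded beforehand: the growth of the logarithm enters as E Y^2, and the L2 inequality turns Y^2
  into small sources times Y and E. Therefore the three norms can be taken as maxima over all time
  levels at once, without induction over the levels.\<close>

section \<open>Elementary inequalities for the shifted logarithm\<close>

lemma ln_diff_le:
  fixes x y e :: real
  assumes "0 < e" "0 \<le> x" "0 \<le> y"
  shows "ln (e + y) - ln (e + x) \<le> (y - x) / (e + x)"
proof -
  have "ln ((e + y) / (e + x)) \<le> (e + y) / (e + x) - 1"
    using assms by (intro ln_le_minus_one) auto
  also have "(e + y) / (e + x) - 1 = (y - x) / (e + x)"
    using assms by (simp add: field_simps)
  finally show ?thesis using assms by (simp add: ln_div)
qed

text \<open>The tangent inequality is used at both points; the gap between the two tangent slopes is
  exactly the right-hand side. Keeping both factors \<open>e + x\<close> and \<open>e + y\<close>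
  lets a weight cancel one of them later.\<close>

lemma ln_taylor_bound:
  fixes x y e :: real
  assumes "0 < e" "0 \<le> x" "0 \<le> y"
  shows "\<bar>ln (e + y) - ln (e + x) - (y - x) / (e + x)\<bar> \<le> (y - x)\<^sup>2 / ((e + x) * (e + y))"
proof -
  have 1: "ln (e + y) - ln (e + x) \<le> (y - x) / (e + x)"
    using ln_diff_le[OF assms] .
  have "ln (e + x) - ln (e + y) \<le> (x - y) / (e + y)"
    using ln_diff_le[of e y x] assms by simp
  then have "ln (e + y) - ln (e + x) - (y - x) / (e + x) \<ge> (y - x) / (e + y) - (y - x) / (e + x)"
    by (simp add: diff_divide_distrib)
  moreover have "(y - x) / (e + y) - (y - x) / (e + x) = - ((y - x)\<^sup>2 / ((e + x) * (e + y)))"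
    using assms by (simp add: divide_simps) (simp add: algebra_simps power2_eq_square)
  ultimately show ?thesis using 1 by linarith
qed

text \<open>The slope between the two points is at most 1 / (e + min x y), and the factor
  \<open>min x y\<close> cancels it. No 1/e survives, which is what keeps the L2 estimate free of
  \<epsilon>.\<close>

lemma min_ln_diff_le:
  fixes x y e :: real
  assumes "0 < e" "0 \<le> x" "0 \<le> y"
  shows "min x y * \<bar>ln (e + x) - ln (e + y)\<bar> \<le> \<bar>x - y\<bar>"
proof -
  have *: "x * (ln (e + y) - ln (e + x)) \<le> y - x" if "x \<le> y" "0 \<le> x" for x y :: real
  proof -
    have "ln (e + y) - ln (e + x) \<le> (y - x) / (e + x)"
      using ln_diff_le[of e x y] assms that by simp
    then have "x * (ln (e + y) - ln (e + x)) \<le> x * ((y - x) / (e + x))"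
      using that by (intro mult_left_mono) auto
    also have "\<dots> = (y - x) * (x / (e + x))" by simp
    also have "\<dots> \<le> (y - x) * 1"
      using assms that by (intro mult_left_mono) auto
    finally show ?thesis by simp
  qed
  have m: "ln (e + x) \<le> ln (e + y) \<longleftrightarrow> x \<le> y" using assms by simp
  show ?thesis
  proof (cases "x \<le> y")
    case True then show ?thesis using *[of x y] m assms by (simp add: min_def abs_if)
  next
    case False then show ?thesis using *[of y x] m assms by (simp add: min_def abs_if)
  qed
qed

lemma ln_lipschitz:
  fixes x y e :: real
  assumes "0 < e" "0 \<le> x" "0 \<le> y"
  shows "\<bar>ln (e + x) - ln (e + y)\<bar> \<le> \<bar>x - y\<bar> / e"
proof -
  have *: "ln (e + y) - ln (e + x) \<le> (y - x) / e" if "x \<le> y" "0 \<le> x" for x y :: real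
  proof -
    have "ln (e + y) - ln (e + x) \<le> (y - x) / (e + x)"
      using ln_diff_le[of e x y] assms that by simp
    also have "\<dots> \<le> (y - x) / e"
      using assms that by (intro divide_left_mono) auto
    finally show ?thesis .
  qed
  have m: "ln (e + x) \<le> ln (e + y) \<longleftrightarrow> x \<le> y" using assms by simp
  show ?thesis
  proof (cases "x \<le> y")
    case True then show ?thesis using *[of x y] m assms by (simp add: abs_if)
  next
    case False then show ?thesis using *[of y x] m assms by (simp add: abs_if)
  qed
qed

lemma abs_ln_bound:
  fixes x e :: real
  assumes "0 < e" "e \<le> 1" "0 \<le> x"
  shows "\<bar>ln (e + x)\<bar> \<le> 1 / e + x"
proof -
  have "ln (e + x) \<le> e + x - 1" using assms by (intro ln_le_minus_one) auto
  moreover have "- ln e \<le> 1 / e - 1"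
    using ln_le_minus_one[of "1 / e"] assms by (simp add: ln_div)
  moreover have "ln e \<le> ln (e + x)" using assms by simp
  moreover have "0 < 1 / e" using assms by simp
  ultimately show ?thesis using assms unfolding abs_le_iff by linarith
qed

text \<open>The second-order remainder of the norm at a behaves like 1 / norm a; the weight
  \<open>norm a\<close> compensates. Real inner product spaces are the right generality because the
  lemma is applied to pairs of complex numbers.\<close>

lemma ln_norm_remainder:
  fixes a b :: "'a::real_inner"
  assumes "0 < e" "a \<noteq> 0"
  shows "norm a * \<bar>ln (e + norm b) - ln (e + norm a) - inner a (b - a) / (norm a * (e + norm a))\<bar>
           \<le> 2 * (norm (b - a))\<^sup>2 / e"
proof -
  define A B E where "A = norm a" and "B = norm b" and "E = norm (b - a)"
  have A: "A > 0" and B: "B \<ge> 0" and E: "E \<ge> 0" using assms by (auto simp: A_def B_def E_def)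
  have AB: "\<bar>B - A\<bar> \<le> E" unfolding A_def B_def E_def by (rule norm_triangle_ineq3)
  define p where "p = inner a (b - a)"
  have B2: "B\<^sup>2 = A\<^sup>2 + 2 * p + E\<^sup>2"
    unfolding A_def B_def E_def p_def by (simp add: power2_norm_eq_inner algebra_simps inner_commute)
  \<comment> \<open>The lower bound is Cauchy-Schwarz; the matching upper bound comes from
    \<open>2 * A * B \<le> A\<^sup>2 + B\<^sup>2\<close>.\<close>
  have lo: "A + p / A \<le> B"
  proof -
    have "A * B \<ge> inner a b" unfolding A_def B_def by (rule norm_cauchy_schwarz)
    moreover have "p = inner a b - A\<^sup>2" unfolding p_def A_def by (simp add: power2_norm_eq_inner algebra_simps)
    ultimately show ?thesis using A by (simp add: field_simps power2_eq_square)
  qed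
  have up: "B \<le> A + p / A + E\<^sup>2 / (2 * A)"
  proof -
    have "2 * A * B \<le> A\<^sup>2 + B\<^sup>2" using sum_squares_bound[of A B] by simp
    then have "B \<le> (A\<^sup>2 + B\<^sup>2) / (2 * A)" using A by (simp add: pos_le_divide_eq mult_ac)
    also have "\<dots> = A + p / A + E\<^sup>2 / (2 * A)"
      unfolding B2 using A by (simp add: add_divide_distrib power2_eq_square)
    finally show ?thesis .
  qed
  have r1: "\<bar>B - A - p / A\<bar> \<le> E\<^sup>2 / (2 * A)" using lo up by linarith
  have "\<bar>ln (e + B) - ln (e + A) - p / (A * (e + A))\<bar>
      \<le> \<bar>ln (e + B) - ln (e + A) - (B - A) / (e + A)\<bar> + \<bar>(B - A - p / A) / (e + A)\<bar>"
  proof -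
    have "p / (A * (e + A)) = (B - A) / (e + A) - (B - A - p / A) / (e + A)"
      by (simp add: diff_divide_distrib)
    then show ?thesis by linarith
  qed
  also have "\<dots> \<le> (B - A)\<^sup>2 / ((e + A) * (e + B)) + (E\<^sup>2 / (2 * A)) / (e + A)"
  proof (rule add_mono)
    show "\<bar>ln (e + B) - ln (e + A) - (B - A) / (e + A)\<bar> \<le> (B - A)\<^sup>2 / ((e + A) * (e + B))"
      using ln_taylor_bound[of e A B] A B assms by simp
    show "\<bar>(B - A - p / A) / (e + A)\<bar> \<le> (E\<^sup>2 / (2 * A)) / (e + A)"
      using r1 A assms by (simp add: abs_divide divide_right_mono del: divide_divide_eq_left)
  qed
  also have "\<dots> \<le> E\<^sup>2 / (A * e) + E\<^sup>2 / (A * e)"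
  proof (rule add_mono)
    have "(B - A)\<^sup>2 \<le> E\<^sup>2" using AB E by (metis abs_le_square_iff abs_of_nonneg)
    moreover have "A * e \<le> (e + A) * (e + B)"
    proof -
      have "(e + A) * (e + B) = e*e + e * B + A * e + A * B" by (simp add: algebra_simps)
      then show ?thesis using A B assms by simp
    qed
    ultimately show "(B - A)\<^sup>2 / ((e + A) * (e + B)) \<le> E\<^sup>2 / (A * e)"
      using A B assms by (intro frac_le) auto
    have "A * e \<le> 2 * A * (e + A)" using A assms by (simp add: algebra_simps)
    then show "(E\<^sup>2 / (2 * A)) / (e + A) \<le> E\<^sup>2 / (A * e)"
      using A B assms by (auto intro!: divide_left_mono mult_pos_pos)
  qed
  finally have "\<bar>ln (e + B) - ln (e + A) - p / (A * (e + A))\<bar> \<le> 2 * E\<^sup>2 / (A * e)" by simp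
  then have "A * \<bar>ln (e + B) - ln (e + A) - p / (A * (e + A))\<bar> \<le> A * (2 * E\<^sup>2 / (A * e))"
    using A by (intro mult_left_mono) auto
  also have "\<dots> = 2 * E\<^sup>2 / e" using A by simp
  finally show ?thesis by (simp add: A_def B_def E_def p_def)
qed

lemma norm_of_real_mult_add_le:
  fixes z w :: complex
  shows "norm (of_real r * z + of_real s * w) \<le> \<bar>r\<bar> * norm z + \<bar>s\<bar> * norm w"
  by (rule order_trans[OF norm_triangle_ineq]) (simp add: norm_mult)

section \<open>The averaged logarithmic nonlinearity\<close>

text \<open>Encodes the square root inside \<open>qlog\<close> as a Euclidean norm on pairs, so that
  the triangle inequality and inner products apply to it.\<close>

definition wvec :: "real \<Rightarrow> complex \<Rightarrow> complex \<Rightarrow> complex \<times> complex" where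
  "wvec \<theta> z1 z2 = (sqrt \<theta> *\<^sub>R z1, sqrt (1 - \<theta>) *\<^sub>R z2)"

definition wnorm :: "real \<Rightarrow> complex \<Rightarrow> complex \<Rightarrow> real" where
  "wnorm \<theta> z1 z2 = sqrt (\<theta> * (norm z1)\<^sup>2 + (1 - \<theta>) * (norm z2)\<^sup>2)"

text \<open>As \<theta> approaches 0 or 1, \<open>wnorm\<close> loses sight of z1 or z2; this
  integrable weight is the price of bounding \<open>norm (z1 + z2)\<close> by
  \<open>wnorm\<close>.\<close>

definition sing :: "real \<Rightarrow> real" where
  "sing \<theta> = 1 / sqrt \<theta> + 1 / sqrt (1 - \<theta>)"

text \<open>The integrand of \<open>Qtilde\<close>: the 2 from the squared argument of the logarithm
  cancels the 1/2 in front of the integral.\<close>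

definition logker :: "real \<Rightarrow> real \<Rightarrow> complex \<Rightarrow> complex \<Rightarrow> complex" where
  "logker \<epsilon> \<theta> z1 z2 = of_real (ln (\<epsilon> + wnorm \<theta> z1 z2)) * (z1 + z2)"

lemma wnorm_eq_norm: "0 \<le> \<theta> \<Longrightarrow> \<theta> \<le> 1 \<Longrightarrow> wnorm \<theta> z1 z2 = norm (wvec \<theta> z1 z2)"
  by (simp add: wnorm_def wvec_def norm_Pair power_mult_distrib)

lemma wnorm_nonneg: "0 \<le> \<theta> \<Longrightarrow> \<theta> \<le> 1 \<Longrightarrow> 0 \<le> wnorm \<theta> z1 z2"
  by (simp add: wnorm_def)

lemma wvec_diff: "wvec \<theta> a1 a2 - wvec \<theta> b1 b2 = wvec \<theta> (a1 - b1) (a2 - b2)"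
  by (simp add: wvec_def scaleR_diff_right)

lemma wnorm_diff_le:
  "0 \<le> \<theta> \<Longrightarrow> \<theta> \<le> 1 \<Longrightarrow> \<bar>wnorm \<theta> a1 a2 - wnorm \<theta> b1 b2\<bar> \<le> wnorm \<theta> (a1 - b1) (a2 - b2)"
  by (simp add: wnorm_eq_norm wvec_diff[symmetric] norm_triangle_ineq3)

lemma wnorm_le: "0 \<le> \<theta> \<Longrightarrow> \<theta> \<le> 1 \<Longrightarrow> wnorm \<theta> z1 z2 \<le> sqrt ((norm z1)\<^sup>2 + (norm z2)\<^sup>2)"
  unfolding wnorm_def by (intro real_sqrt_le_mono add_mono mult_left_le_one_le) auto

lemma norm_add_le_sing:
  assumes "0 < \<theta>" "\<theta> < 1"
  shows "norm (z1 + z2) \<le> sing \<theta> * wnorm \<theta> z1 z2"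
proof -
  have "sqrt \<theta> * norm z1 = sqrt (\<theta> * (norm z1)\<^sup>2)" by (simp add: real_sqrt_mult)
  also have "\<dots> \<le> wnorm \<theta> z1 z2" unfolding wnorm_def using assms by simp
  finally have 1: "norm z1 \<le> 1 / sqrt \<theta> * wnorm \<theta> z1 z2" using assms by (simp add: field_simps)
  have "sqrt (1 - \<theta>) * norm z2 = sqrt ((1 - \<theta>) * (norm z2)\<^sup>2)" by (simp add: real_sqrt_mult)
  also have "\<dots> \<le> wnorm \<theta> z1 z2" unfolding wnorm_def using assms by simp
  finally have 2: "norm z2 \<le> 1 / sqrt (1 - \<theta>) * wnorm \<theta> z1 z2" using assms by (simp add: field_simps)
  show ?thesis using norm_triangle_ineq[of z1 z2] 1 2 unfolding sing_def by (simp only: distrib_right)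
qed

lemma sing_pos: "0 < \<theta> \<Longrightarrow> \<theta> < 1 \<Longrightarrow> 0 < sing \<theta>"
  by (simp add: sing_def add_pos_pos)

lemma sing_has_integral: "(sing has_integral 4) {0..1}"
proof -
  have "(sing has_integral (2 * sqrt 1 - 2 * sqrt (1 - 1)) - (2 * sqrt 0 - 2 * sqrt (1 - 0))) {0..1}"
  proof (rule fundamental_theorem_of_calculus_interior)
    show "continuous_on {0..1} (\<lambda>x::real. 2 * sqrt x - 2 * sqrt (1 - x))"
      by (intro continuous_intros)
    fix x :: real assume x: "x \<in> {0<..<1}"
    show "((\<lambda>x::real. 2 * sqrt x - 2 * sqrt (1 - x)) has_vector_derivative sing x) (at x)"
      unfolding sing_def has_real_derivative_iff_has_vector_derivative[symmetric]
      using x by (auto intro!: derivative_eq_intros simp: field_simps)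
  qed simp
  then show ?thesis by simp
qed

text \<open>The bound is asked for only inside the interval: with 1/0 = 0, \<open>sing\<close>
  equals 1 at both ends, where the pointwise estimates may fail.\<close>

lemma integral_sing_bound:
  fixes F :: "real \<Rightarrow> 'a::euclidean_space"
  assumes "F integrable_on {0..1}" "\<And>\<theta>. 0 < \<theta> \<Longrightarrow> \<theta> < 1 \<Longrightarrow> norm (F \<theta>) \<le> sing \<theta> * K"
  shows "norm (integral {0..1} F) \<le> 4 * K"
proof -
  have s: "((\<lambda>\<theta>. sing \<theta> * K) has_integral 4 * K) {0..1}"
    using has_integral_mult_left[OF sing_has_integral] .
  have "norm (integral {0<..<1} F) \<le> integral {0<..<1} (\<lambda>\<theta>. sing \<theta> * K)"
  proof (rule integral_norm_bound_integral)
    show "F integrable_on {0<..<1}" using assms(1) by (simp add: integrable_on_open_interval_real)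
    show "(\<lambda>\<theta>. sing \<theta> * K) integrable_on {0<..<1}"
      using s by (simp add: integrable_on_open_interval_real has_integral_integrable)
  qed (use assms(2) in auto)
  then show ?thesis using integral_unique[OF s] by (simp only: integral_open_interval_real)
qed

lemma continuous_on_wnorm: "continuous_on S (\<lambda>\<theta>. wnorm \<theta> z1 z2)"
  unfolding wnorm_def by (intro continuous_intros)

lemma continuous_on_ln_wnorm:
  assumes "0 < \<epsilon>" shows "continuous_on {0..1} (\<lambda>\<theta>. ln (\<epsilon> + wnorm \<theta> z1 z2))"
  using assms wnorm_nonneg[of _ z1 z2]
  by (intro continuous_intros continuous_on_wnorm) (auto simp: add_pos_nonneg less_imp_neq[symmetric])

lemma qlog_eq: "0 < \<epsilon> \<Longrightarrow> 0 \<le> s \<Longrightarrow> qlog \<epsilon> s = 2 * ln (\<epsilon> + sqrt s)"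
  unfolding qlog_def by (subst ln_realpow) (auto simp: add_pos_nonneg)

definition Jint :: "real \<Rightarrow> complex \<Rightarrow> complex \<Rightarrow> real" where
  "Jint \<epsilon> z1 z2 = integral {0..1} (\<lambda>\<theta>. ln (\<epsilon> + wnorm \<theta> z1 z2))"

lemma Qtilde_eq_Jint:
  assumes "0 < \<epsilon>" shows "Qtilde \<epsilon> z1 z2 = of_real (Jint \<epsilon> z1 z2) * (z1 + z2)"
proof -
  have "integral {0..1} (\<lambda>\<theta>. qlog \<epsilon> (\<theta> * (norm z1)\<^sup>2 + (1 - \<theta>) * (norm z2)\<^sup>2)) =
        integral {0..1} (\<lambda>\<theta>. 2 * ln (\<epsilon> + wnorm \<theta> z1 z2))"
    by (intro integral_cong) (auto simp: qlog_eq assms wnorm_def)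
  then show ?thesis by (simp add: Qtilde_def Jint_def)
qed

lemma logker_has_integral:
  assumes "0 < \<epsilon>" shows "((\<lambda>\<theta>. logker \<epsilon> \<theta> z1 z2) has_integral Qtilde \<epsilon> z1 z2) {0..1}"
proof -
  have "((\<lambda>\<theta>. ln (\<epsilon> + wnorm \<theta> z1 z2)) has_integral Jint \<epsilon> z1 z2) {0..1}"
    unfolding Jint_def by (intro integrable_integral integrable_continuous_interval continuous_on_ln_wnorm assms)
  from has_integral_mult_left[OF has_integral_of_real[OF this], of "z1 + z2"]
  show ?thesis unfolding logker_def Qtilde_eq_Jint[OF assms] by (simp add: o_def)
qed

text \<open>The difference of the two kernels can be written with either argument carrying the
  logarithmic difference; the smaller one is chosen, so the constant does not depend on \<open>\<epsilon>\<close>.\<close>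

lemma Im_logker_diff:
  assumes "0 < \<epsilon>" "0 < \<theta>" "\<theta> < 1"
  shows "\<bar>Im ((logker \<epsilon> \<theta> a1 a2 - logker \<epsilon> \<theta> b1 b2) * cnj ((a1 - b1) + (a2 - b2)))\<bar>
           \<le> sing \<theta> * (wnorm \<theta> (a1 - b1) (a2 - b2) * norm ((a1 - b1) + (a2 - b2)))"
proof -
  define A B where "A = wnorm \<theta> a1 a2" and "B = wnorm \<theta> b1 b2"
  define w where "w = (a1 - b1) + (a2 - b2)"
  define l where "l = ln (\<epsilon> + A) - ln (\<epsilon> + B)"
  have pos: "0 \<le> A" "0 \<le> B" using assms by (auto simp: A_def B_def wnorm_nonneg)
  have Imw: "Im (of_real x * (w * cnj w)) = 0" for x by (simp add: complex_mult_cnj)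
  have d1: "logker \<epsilon> \<theta> a1 a2 - logker \<epsilon> \<theta> b1 b2 = of_real (ln (\<epsilon> + A)) * w + of_real l * (b1 + b2)"
    unfolding logker_def A_def B_def l_def w_def by (simp add: algebra_simps)
  have d2: "logker \<epsilon> \<theta> a1 a2 - logker \<epsilon> \<theta> b1 b2 = of_real (ln (\<epsilon> + B)) * w + of_real l * (a1 + a2)"
    unfolding logker_def A_def B_def l_def w_def by (simp add: algebra_simps)
  have e1: "Im ((logker \<epsilon> \<theta> a1 a2 - logker \<epsilon> \<theta> b1 b2) * cnj w) = Im (of_real l * (b1 + b2) * cnj w)"
    unfolding d1 distrib_right using Imw[of "ln (\<epsilon> + A)"] by (simp add: mult.assoc)
  have e2: "Im ((logker \<epsilon> \<theta> a1 a2 - logker \<epsilon> \<theta> b1 b2) * cnj w) = Im (of_real l * (a1 + a2) * cnj w)"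
    unfolding d2 distrib_right using Imw[of "ln (\<epsilon> + B)"] by (simp add: mult.assoc)
  have bnd: "\<bar>Im (of_real l * z * cnj w)\<bar> \<le> \<bar>l\<bar> * norm z * norm w" for z
    by (rule order_trans[OF abs_Im_le_cmod]) (simp add: norm_mult)
  define Q where "Q = \<bar>Im ((logker \<epsilon> \<theta> a1 a2 - logker \<epsilon> \<theta> b1 b2) * cnj w)\<bar>"
  have "Q \<le> \<bar>l\<bar> * norm (b1 + b2) * norm w" unfolding Q_def e1 by (rule bnd)
  also have "\<dots> \<le> \<bar>l\<bar> * (sing \<theta> * B) * norm w"
    unfolding B_def using assms by (intro mult_right_mono mult_left_mono norm_add_le_sing) auto
  finally have q1: "Q \<le> (\<bar>l\<bar> * sing \<theta> * norm w) * B" by (simp add: mult_ac)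
  have "Q \<le> \<bar>l\<bar> * norm (a1 + a2) * norm w" unfolding Q_def e2 by (rule bnd)
  also have "\<dots> \<le> \<bar>l\<bar> * (sing \<theta> * A) * norm w"
    unfolding A_def using assms by (intro mult_right_mono mult_left_mono norm_add_le_sing) auto
  finally have q2: "Q \<le> (\<bar>l\<bar> * sing \<theta> * norm w) * A" by (simp add: mult_ac)
  have "Q \<le> (\<bar>l\<bar> * sing \<theta> * norm w) * min A B" using q1 q2 by (simp add: min_def)
  also have "\<dots> = sing \<theta> * ((min A B * \<bar>l\<bar>) * norm w)" by (simp add: mult_ac)
  also have "\<dots> \<le> sing \<theta> * (\<bar>A - B\<bar> * norm w)"
    unfolding l_def using assms pos sing_pos[of \<theta>]
    by (intro mult_right_mono mult_left_mono min_ln_diff_le) auto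
  also have "\<dots> \<le> sing \<theta> * (wnorm \<theta> (a1 - b1) (a2 - b2) * norm w)"
    unfolding A_def B_def using assms sing_pos[of \<theta>]
    by (intro mult_right_mono mult_left_mono wnorm_diff_le) auto
  finally show ?thesis unfolding Q_def w_def .
qed

text \<open>The only nonlinear estimate that enters the Gronwall exponent. The 4 is the integral of
  \<open>sing\<close>, sqrt 2 compares the sum of the two errors with their Euclidean norm, and
  \<open>4 * sqrt 2\<close> is rounded up to 8.\<close>

lemma Im_Qtilde_diff:
  assumes "0 < \<epsilon>"
  shows "\<bar>Im ((Qtilde \<epsilon> a1 a2 - Qtilde \<epsilon> b1 b2) * cnj ((a1 - b1) + (a2 - b2)))\<bar>
           \<le> 8 * ((norm (a1 - b1))\<^sup>2 + (norm (a2 - b2))\<^sup>2)"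
proof -
  define e1 e2 where "e1 = a1 - b1" and "e2 = a2 - b2"
  define s where "s = (norm e1)\<^sup>2 + (norm e2)\<^sup>2"
  have s: "0 \<le> s" by (simp add: s_def)
  let ?F = "\<lambda>\<theta>. (logker \<epsilon> \<theta> a1 a2 - logker \<epsilon> \<theta> b1 b2) * cnj (e1 + e2)"
  have "(?F has_integral (Qtilde \<epsilon> a1 a2 - Qtilde \<epsilon> b1 b2) * cnj (e1 + e2)) {0..1}"
    by (intro has_integral_mult_left has_integral_diff logker_has_integral assms)
  from has_integral_linear[OF this bounded_linear_Im]
  have I: "((\<lambda>\<theta>. Im (?F \<theta>)) has_integral Im ((Qtilde \<epsilon> a1 a2 - Qtilde \<epsilon> b1 b2) * cnj (e1 + e2))) {0..1}"
    by (simp add: o_def)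
  have n12: "norm (e1 + e2) \<le> sqrt 2 * sqrt s"
  proof -
    have "(norm e1 + norm e2)\<^sup>2 \<le> 2 * s" unfolding s_def
      using sum_squares_bound[of "norm e1" "norm e2"] by (simp add: power2_sum)
    then have "norm e1 + norm e2 \<le> sqrt (2 * s)" by (rule real_le_rsqrt)
    then show ?thesis using norm_triangle_ineq[of e1 e2] by (simp add: real_sqrt_mult)
  qed
  have "norm (integral {0..1} (\<lambda>\<theta>. Im (?F \<theta>))) \<le> 4 * (sqrt s * (sqrt 2 * sqrt s))"
  proof (rule integral_sing_bound)
    show "(\<lambda>\<theta>. Im (?F \<theta>)) integrable_on {0..1}" using I by (rule has_integral_integrable)
    fix \<theta> :: real assume t: "0 < \<theta>" "\<theta> < 1"
    have "\<bar>Im (?F \<theta>)\<bar> \<le> sing \<theta> * (wnorm \<theta> e1 e2 * norm (e1 + e2))"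
      unfolding e1_def e2_def by (rule Im_logker_diff[OF assms t])
    also have "\<dots> \<le> sing \<theta> * (sqrt s * (sqrt 2 * sqrt s))"
      using t sing_pos[of \<theta>] wnorm_le[of \<theta> e1 e2] n12 s
      by (intro mult_left_mono mult_mono) (auto simp: s_def)
    finally show "norm (Im (?F \<theta>)) \<le> sing \<theta> * (sqrt s * (sqrt 2 * sqrt s))" by simp
  qed
  also have "\<dots> = 4 * sqrt 2 * s" using s by simp
  also have "\<dots> \<le> 4 * 2 * s" using s sqrt2_less_2 by (intro mult_right_mono) auto
  finally show ?thesis using I by (simp add: integral_unique s_def e1_def e2_def)
qed

section \<open>The potential and the discrete gradient structure\<close>

definition flog :: "real \<Rightarrow> complex \<Rightarrow> complex" where
  "flog \<epsilon> z = of_real (2 * ln (\<epsilon> + norm z)) * z"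

text \<open>Radial antiderivative of \<open>2 * r * ln (\<epsilon> + r)\<close>, so its gradient is
  \<open>flog\<close>. The additive constant is immaterial because only differences occur.\<close>

definition Gpot :: "real \<Rightarrow> complex \<Rightarrow> real" where
  "Gpot \<epsilon> z = ((norm z)\<^sup>2 - \<epsilon>\<^sup>2) * ln (\<epsilon> + norm z) - (norm z)\<^sup>2 / 2 + \<epsilon> * norm z"

lemma logker_diag: "logker \<epsilon> \<theta> z z = flog \<epsilon> z"
  by (simp add: logker_def flog_def wnorm_def distrib_right[symmetric])

lemma Qtilde_diag: "0 < \<epsilon> \<Longrightarrow> Qtilde \<epsilon> z z = flog \<epsilon> z"
  using logker_has_integral[of \<epsilon> z z] by (simp add: logker_diag has_integral_iff)

lemma Gpot_radial_deriv:
  fixes r \<epsilon> :: real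
  assumes "0 < \<epsilon>" "0 \<le> r"
  shows "((\<lambda>r. (r\<^sup>2 - \<epsilon>\<^sup>2) * ln (\<epsilon> + r) - r\<^sup>2 / 2 + \<epsilon> * r) has_real_derivative 2 * r * ln (\<epsilon> + r)) (at r)"
proof (rule DERIV_cong)
  show "((\<lambda>r. (r\<^sup>2 - \<epsilon>\<^sup>2) * ln (\<epsilon> + r) - r\<^sup>2 / 2 + \<epsilon> * r) has_real_derivative
          2 * r * ln (\<epsilon> + r) + (r\<^sup>2 - \<epsilon>\<^sup>2) / (\<epsilon> + r) - r + \<epsilon>) (at r)"
    using assms by (auto intro!: derivative_eq_intros)
  have "(r\<^sup>2 - \<epsilon>\<^sup>2) / (\<epsilon> + r) = r - \<epsilon>"
    using assms by (simp add: field_simps power2_eq_square)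
  then show "2 * r * ln (\<epsilon> + r) + (r\<^sup>2 - \<epsilon>\<^sup>2) / (\<epsilon> + r) - r + \<epsilon> = 2 * r * ln (\<epsilon> + r)" by simp
qed

text \<open>Along \<theta> the square of \<open>wnorm\<close> moves linearly from
  \<open>(norm z2)\<^sup>2\<close> to \<open>(norm z1)\<^sup>2\<close>, so the factor
  1/\<open>wnorm\<close> from differentiating the root cancels the factor r in the radial derivative
  of the potential and leaves exactly the integrand of \<open>Jint\<close>.\<close>

lemma Gpot_diff:
  assumes "0 < \<epsilon>"
  shows "Re (Qtilde \<epsilon> z1 z2 * cnj (z1 - z2)) = Gpot \<epsilon> z1 - Gpot \<epsilon> z2"
proof -
  define \<rho> where "\<rho> = (norm z1)\<^sup>2 - (norm z2)\<^sup>2"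
  define H where "H = (\<lambda>r. (r\<^sup>2 - \<epsilon>\<^sup>2) * ln (\<epsilon> + r) - r\<^sup>2 / 2 + \<epsilon> * r)"
  have eq: "Re ((z1 + z2) * cnj (z1 - z2)) = \<rho>"
    unfolding \<rho>_def cmod_power2 by (simp add: algebra_simps power2_eq_square)
  have lhs: "Re (Qtilde \<epsilon> z1 z2 * cnj (z1 - z2)) = Jint \<epsilon> z1 z2 * \<rho>"
  proof -
    have "Re (of_real x * w) = x * Re w" for x :: real and w by simp
    then show ?thesis unfolding Qtilde_eq_Jint[OF assms] mult.assoc eq[symmetric] .
  qed
  have G: "Gpot \<epsilon> z = H (norm z)" for z by (simp add: Gpot_def H_def)
  \<comment> \<open>If the norms differ they do not both vanish, so the interpolated norm is
    positive inside the interval and the root is differentiable there.\<close>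
  have wpos: "0 < wnorm x z1 z2" if "\<rho> \<noteq> 0" "x \<in> {0<..<1}" for x
  proof -
    have "0 < x * (norm z1)\<^sup>2 + (1 - x) * (norm z2)\<^sup>2"
    proof (cases "z1 = 0")
      case True
      then show ?thesis using that by (auto simp: \<rho>_def)
    next
      case False
      then show ?thesis using that by (auto intro!: add_pos_nonneg)
    qed
    then show ?thesis by (simp add: wnorm_def)
  qed
  show ?thesis
  proof (cases "\<rho> = 0")
    case True
    then have "norm z1 = norm z2" by (simp add: \<rho>_def power2_eq_iff_nonneg)
    then show ?thesis using True lhs by (simp add: Gpot_def)
  next
    case False
    have "((\<lambda>x. ln (\<epsilon> + wnorm x z1 z2) * \<rho>) has_integral (H (wnorm 1 z1 z2) - H (wnorm 0 z1 z2))) {0..1}"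
    proof (rule fundamental_theorem_of_calculus_interior)
      show "continuous_on {0..1} (\<lambda>x. H (wnorm x z1 z2))"
        unfolding H_def
        by (intro continuous_intros continuous_on_wnorm continuous_on_ln_wnorm assms)
          (use assms wnorm_nonneg[of _ z1 z2] in \<open>auto simp: add_pos_nonneg less_imp_neq[symmetric]\<close>)
      fix x :: real assume x: "x \<in> {0<..<1}"
      have w: "0 < wnorm x z1 z2" by (rule wpos[OF False x])
      then have w2: "0 < x * (norm z1)\<^sup>2 + (1 - x) * (norm z2)\<^sup>2" by (simp add: wnorm_def)
      have dw: "((\<lambda>x. wnorm x z1 z2) has_real_derivative \<rho> / (2 * wnorm x z1 z2)) (at x)"
        unfolding wnorm_def using w2
        by (auto intro!: derivative_eq_intros simp: \<rho>_def field_simps)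
      have "(H has_real_derivative 2 * wnorm x z1 z2 * ln (\<epsilon> + wnorm x z1 z2)) (at (wnorm x z1 z2))"
        unfolding H_def using Gpot_radial_deriv[OF assms, of "wnorm x z1 z2"] w by simp
      from DERIV_chain2[OF this dw] w
      show "((\<lambda>x. H (wnorm x z1 z2)) has_vector_derivative ln (\<epsilon> + wnorm x z1 z2) * \<rho>) (at x)"
        unfolding has_real_derivative_iff_has_vector_derivative[symmetric] by (simp add: mult_ac)
    qed simp
    moreover have "((\<lambda>x. ln (\<epsilon> + wnorm x z1 z2) * \<rho>) has_integral (Jint \<epsilon> z1 z2 * \<rho>)) {0..1}"
      unfolding Jint_def
      by (intro has_integral_mult_left integrable_integral integrable_continuous_interval
            continuous_on_ln_wnorm assms)
    ultimately have "Jint \<epsilon> z1 z2 * \<rho> = H (wnorm 1 z1 z2) - H (wnorm 0 z1 z2)"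
      by (metis has_integral_unique)
    then show ?thesis unfolding lhs G by (simp add: wnorm_def)
  qed
qed

text \<open>The crude bound \<open>abs_ln_bound\<close> is applied only to the term with b - a; the
  change of the logarithm multiplies the smaller of the two weighted norms and so costs no further
  1/\<epsilon>.\<close>

lemma Qtilde_diag_diff:
  assumes "0 < \<epsilon>" "\<epsilon> \<le> 1"
  shows "norm (Qtilde \<epsilon> b a - flog \<epsilon> a) \<le> (6 / \<epsilon> + 2 * norm a + 2 * norm (b - a)) * norm (b - a)"
proof -
  define e where "e = b - a"
  have I: "((\<lambda>\<theta>. logker \<epsilon> \<theta> b a - logker \<epsilon> \<theta> a a) has_integral (Qtilde \<epsilon> b a - flog \<epsilon> a)) {0..1}"
    using has_integral_diff[OF logker_has_integral[OF assms(1)] logker_has_integral[OF assms(1)], of b a a a]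
    by (simp add: Qtilde_diag assms)
  have one: "1 \<le> 1 / \<epsilon>" using assms by simp
  have bnd0: "norm (logker \<epsilon> \<theta> b a - logker \<epsilon> \<theta> a a) \<le> sing \<theta> * norm e
          + (1 / \<epsilon> + norm a + norm e) * norm e"
    if t: "0 < \<theta>" "\<theta> < 1" for \<theta>
  proof -
    define A B where "A = wnorm \<theta> a a" and "B = wnorm \<theta> b a"
    have A: "A = norm a" unfolding A_def wnorm_def by (simp add: distrib_right[symmetric])
    have E: "wnorm \<theta> e 0 \<le> norm e" using wnorm_le[of \<theta> e 0] t by simp
    have BA: "\<bar>B - A\<bar> \<le> norm e"
      using wnorm_diff_le[of \<theta> b a a a] t E unfolding A_def B_def e_def by simp
    have pos: "0 \<le> A" "0 \<le> B" using t by (auto simp: A_def B_def wnorm_nonneg)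
    define l where "l = ln (\<epsilon> + B) - ln (\<epsilon> + A)"
    have lA: "\<bar>ln (\<epsilon> + A)\<bar> \<le> 1 / \<epsilon> + norm a + norm e" using abs_ln_bound[of \<epsilon> A] assms pos A norm_ge_zero[of e] by linarith
    have lB: "\<bar>ln (\<epsilon> + B)\<bar> \<le> 1 / \<epsilon> + norm a + norm e" using abs_ln_bound[of \<epsilon> B] assms pos A BA by linarith
    have d1: "logker \<epsilon> \<theta> b a - logker \<epsilon> \<theta> a a = of_real (ln (\<epsilon> + B)) * e + of_real l * (a + a)"
      unfolding logker_def A_def B_def l_def e_def by (simp add: algebra_simps)
    have d2: "logker \<epsilon> \<theta> b a - logker \<epsilon> \<theta> a a = of_real (ln (\<epsilon> + A)) * e + of_real l * (b + a)"
      unfolding logker_def A_def B_def l_def e_def by (simp add: algebra_simps)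
    define Q where "Q = norm (logker \<epsilon> \<theta> b a - logker \<epsilon> \<theta> a a)"
    have nab: "norm (a + a) \<le> sing \<theta> * A" "norm (b + a) \<le> sing \<theta> * B"
      using t norm_add_le_sing[of \<theta> a a] norm_add_le_sing[of \<theta> b a] by (auto simp: A_def B_def)
    have "Q \<le> \<bar>ln (\<epsilon> + B)\<bar> * norm e + \<bar>l\<bar> * norm (a + a)"
      unfolding Q_def d1 by (rule norm_of_real_mult_add_le)
    also have "\<dots> \<le> (1 / \<epsilon> + norm a + norm e) * norm e + \<bar>l\<bar> * (sing \<theta> * A)"
      using lB nab by (intro add_mono mult_right_mono mult_left_mono) auto
    finally have q1: "Q \<le> (1 / \<epsilon> + norm a + norm e) * norm e + sing \<theta> * \<bar>l\<bar> * A" by (simp add: mult_ac)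
    have "Q \<le> \<bar>ln (\<epsilon> + A)\<bar> * norm e + \<bar>l\<bar> * norm (b + a)"
      unfolding Q_def d2 by (rule norm_of_real_mult_add_le)
    also have "\<dots> \<le> (1 / \<epsilon> + norm a + norm e) * norm e + \<bar>l\<bar> * (sing \<theta> * B)"
      using lA nab by (intro add_mono mult_right_mono mult_left_mono) auto
    finally have q2: "Q \<le> (1 / \<epsilon> + norm a + norm e) * norm e + sing \<theta> * \<bar>l\<bar> * B" by (simp add: mult_ac)
    have "Q \<le> (1 / \<epsilon> + norm a + norm e) * norm e + sing \<theta> * \<bar>l\<bar> * min B A"
      using q1 q2 by (simp add: min_def)
    also have "sing \<theta> * \<bar>l\<bar> * min B A = sing \<theta> * (min B A * \<bar>l\<bar>)" by simp
    also have "\<dots> \<le> sing \<theta> * \<bar>B - A\<bar>"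
      unfolding l_def using assms pos sing_pos[OF t] by (intro mult_left_mono min_ln_diff_le) auto
    also have "\<dots> \<le> sing \<theta> * norm e" using BA sing_pos[OF t] by (intro mult_left_mono) auto
    finally show ?thesis by (simp add: Q_def)
  qed
  \<comment> \<open>Since \<open>sing\<close> is at least 2, the part without weight can be given
    the weight \<open>sing / 2\<close>, so that one integration lemma covers both parts.\<close>
  have bnd: "norm (logker \<epsilon> \<theta> b a - logker \<epsilon> \<theta> a a) \<le> sing \<theta> * (norm e + (1 / \<epsilon> + norm a + norm e) * norm e / 2)"
    if t: "0 < \<theta>" "\<theta> < 1" for \<theta>
  proof -
    have "1 \<le> 1 / sqrt \<theta>" "1 \<le> 1 / sqrt (1 - \<theta>)" using t by auto
    then have "2 \<le> sing \<theta>" by (simp add: sing_def)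
    moreover have "0 \<le> (1 / \<epsilon> + norm a + norm e) * norm e" using assms by simp
    ultimately have *: "X \<le> sing \<theta> * (X / 2)" if "X = (1 / \<epsilon> + norm a + norm e) * norm e" for X
      using mult_right_mono[of 2 "sing \<theta>" "X / 2"] that by simp
    show ?thesis using bnd0[OF t] *[OF refl] unfolding distrib_left[of "sing \<theta>"] by linarith
  qed
  have "norm (integral {0..1} (\<lambda>\<theta>. logker \<epsilon> \<theta> b a - logker \<epsilon> \<theta> a a))
     \<le> 4 * (norm e + (1 / \<epsilon> + norm a + norm e) * norm e / 2)"
    using I bnd by (intro integral_sing_bound) (auto intro: has_integral_integrable)
  also have "\<dots> = (4 + 2 / \<epsilon> + 2 * norm a + 2 * norm e) * norm e" by (simp add: algebra_simps)
  also have "\<dots> \<le> (6 / \<epsilon> + 2 * norm a + 2 * norm e) * norm e"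
    using one by (intro mult_right_mono) auto
  finally show ?thesis using I by (simp add: integral_unique e_def)
qed

text \<open>The derivative of \<open>Qtilde\<close> at \<open>(a1, a2)\<close> in direction \<open>(w1, w2)\<close>, paired with
  \<open>a1 - a2\<close>, is computed by integrating by parts in \<open>\<theta>\<close>.\<close>

definition ipw :: "real \<Rightarrow> complex \<Rightarrow> complex \<Rightarrow> complex \<Rightarrow> complex \<Rightarrow> real" where
  "ipw \<theta> a1 a2 w1 w2 = \<theta> * inner a1 w1 + (1 - \<theta>) * inner a2 w2"

lemma ipw_eq_inner: "0 \<le> \<theta> \<Longrightarrow> \<theta> \<le> 1 \<Longrightarrow> ipw \<theta> a1 a2 w1 w2 = inner (wvec \<theta> a1 a2) (wvec \<theta> w1 w2)"
  by (simp add: ipw_def wvec_def mult.assoc[symmetric])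

text \<open>The integrand is the \<theta>-derivative of \<open>2 * ln (\<epsilon> + wnorm \<theta>
  a1 a2) * ipw \<theta> a1 a2 w1 w2\<close>, whose end values are the two inner products with
  \<open>flog\<close>. Equal norms are treated apart, since \<open>wnorm\<close> is then constant
  and may vanish.\<close>

lemma flog_ipw_has_integral:
  assumes "0 < \<epsilon>"
  shows "((\<lambda>\<theta>. 2 * ln (\<epsilon> + wnorm \<theta> a1 a2) * (inner a1 w1 - inner a2 w2)
             + ipw \<theta> a1 a2 w1 w2 / (wnorm \<theta> a1 a2 * (\<epsilon> + wnorm \<theta> a1 a2)) * ((norm a1)\<^sup>2 - (norm a2)\<^sup>2))
           has_integral (inner (flog \<epsilon> a1) w1 - inner (flog \<epsilon> a2) w2)) {0..1}"
proof -
  define \<rho> where "\<rho> = (norm a1)\<^sup>2 - (norm a2)\<^sup>2"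
  have fl: "inner (flog \<epsilon> z) w = 2 * ln (\<epsilon> + norm z) * inner z w" for z w
    unfolding flog_def by (simp add: inner_complex_def algebra_simps)
  show ?thesis
  proof (cases "\<rho> = 0")
    case True
    then have r: "norm a1 = norm a2" by (simp add: \<rho>_def power2_eq_iff_nonneg)
    then have w: "wnorm \<theta> a1 a2 = norm a2" for \<theta> by (simp add: wnorm_def distrib_right[symmetric])
    have "((\<lambda>\<theta>::real. 2 * ln (\<epsilon> + norm a2) * (inner a1 w1 - inner a2 w2)) has_integral
       2 * ln (\<epsilon> + norm a2) * (inner a1 w1 - inner a2 w2)) {0..1}"
      using has_integral_const_real[of _ 0 1] by simp
    then show ?thesis by (simp add: w r fl algebra_simps)
  next
    case False
    have wpos: "0 < \<theta> * (norm a1)\<^sup>2 + (1 - \<theta>) * (norm a2)\<^sup>2" if "\<theta> \<in> {0<..<1}" for \<theta>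
    proof (cases "a1 = 0")
      case True
      then show ?thesis using that False by (auto simp: \<rho>_def)
    next
      case False
      then show ?thesis using that by (auto intro!: add_pos_nonneg)
    qed
    have "((\<lambda>\<theta>. 2 * ln (\<epsilon> + wnorm \<theta> a1 a2) * (inner a1 w1 - inner a2 w2)
             + ipw \<theta> a1 a2 w1 w2 / (wnorm \<theta> a1 a2 * (\<epsilon> + wnorm \<theta> a1 a2)) * \<rho>)
           has_integral (2 * ln (\<epsilon> + wnorm 1 a1 a2) * ipw 1 a1 a2 w1 w2
              - 2 * ln (\<epsilon> + wnorm 0 a1 a2) * ipw 0 a1 a2 w1 w2)) {0..1}"
    proof (rule fundamental_theorem_of_calculus_interior)
      show "continuous_on {0..1} (\<lambda>\<theta>. 2 * ln (\<epsilon> + wnorm \<theta> a1 a2) * ipw \<theta> a1 a2 w1 w2)"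
        unfolding ipw_def by (intro continuous_intros continuous_on_ln_wnorm assms)
      fix \<theta> :: real assume t: "\<theta> \<in> {0<..<1}"
      have w: "0 < wnorm \<theta> a1 a2" using wpos[OF t] by (simp add: wnorm_def)
      have dw: "((\<lambda>x. wnorm x a1 a2) has_real_derivative \<rho> / (2 * wnorm \<theta> a1 a2)) (at \<theta>)"
        unfolding wnorm_def using wpos[OF t]
        by (auto intro!: derivative_eq_intros simp: \<rho>_def field_simps)
      have dl: "((\<lambda>x. ln (\<epsilon> + wnorm x a1 a2)) has_real_derivative \<rho> / (wnorm \<theta> a1 a2 * (\<epsilon> + wnorm \<theta> a1 a2)) / 2) (at \<theta>)"
        using w assms by (auto intro!: derivative_eq_intros dw simp: field_simps)
      have di: "((\<lambda>x. ipw x a1 a2 w1 w2) has_real_derivative inner a1 w1 - inner a2 w2) (at \<theta>)"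
        unfolding ipw_def by (auto intro!: derivative_eq_intros)
      have "((\<lambda>x. 2 * ln (\<epsilon> + wnorm x a1 a2) * ipw x a1 a2 w1 w2) has_real_derivative
           (2 * ln (\<epsilon> + wnorm \<theta> a1 a2) * (inner a1 w1 - inner a2 w2)
             + ipw \<theta> a1 a2 w1 w2 / (wnorm \<theta> a1 a2 * (\<epsilon> + wnorm \<theta> a1 a2)) * \<rho>)) (at \<theta>)"
        by (rule DERIV_cong[OF DERIV_mult[OF DERIV_cmult[OF dl] di]]) simp
      then show "((\<lambda>x. 2 * ln (\<epsilon> + wnorm x a1 a2) * ipw x a1 a2 w1 w2) has_vector_derivative
           (2 * ln (\<epsilon> + wnorm \<theta> a1 a2) * (inner a1 w1 - inner a2 w2)
             + ipw \<theta> a1 a2 w1 w2 / (wnorm \<theta> a1 a2 * (\<epsilon> + wnorm \<theta> a1 a2)) * \<rho>)) (at \<theta>)"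
        unfolding has_real_derivative_iff_has_vector_derivative .
    qed simp
    then show ?thesis by (simp add: \<rho>_def wnorm_def ipw_def fl)
  qed
qed

text \<open>First-order Taylor expansion of the kernel about (a1, a2). One unit of the 3 is the
  product of two increments, the other two come from \<open>ln_norm_remainder\<close> in the space
  of pairs; the weight \<open>sing\<close> again trades a1 + a2 for \<open>wnorm\<close>.\<close>

lemma logker_second_order:
  assumes "0 < \<epsilon>" "0 < \<theta>" "\<theta> < 1"
  shows "norm (logker \<epsilon> \<theta> b1 b2 - logker \<epsilon> \<theta> a1 a2
           - of_real (ln (\<epsilon> + wnorm \<theta> a1 a2)) * ((b1 - a1) + (b2 - a2))
           - of_real (ipw \<theta> a1 a2 (b1 - a1) (b2 - a2) / (wnorm \<theta> a1 a2 * (\<epsilon> + wnorm \<theta> a1 a2))) * (a1 + a2))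
         \<le> sing \<theta> * (3 * ((norm (b1 - a1))\<^sup>2 + (norm (b2 - a2))\<^sup>2) / \<epsilon>)"
proof -
  define w1 w2 where "w1 = b1 - a1" and "w2 = b2 - a2"
  define A B W where "A = wnorm \<theta> a1 a2" and "B = wnorm \<theta> b1 b2" and "W = wnorm \<theta> w1 w2"
  define s where "s = (norm w1)\<^sup>2 + (norm w2)\<^sup>2"
  define p where "p = ipw \<theta> a1 a2 w1 w2 / (A * (\<epsilon> + A))"
  have pos: "0 \<le> A" "0 \<le> B" "0 \<le> W" "0 \<le> s" using assms by (auto simp: A_def B_def W_def s_def wnorm_nonneg)
  have W2: "W\<^sup>2 \<le> s"
  proof -
    have "W \<le> sqrt s" unfolding W_def s_def using assms by (intro wnorm_le) auto
    then show ?thesis using pos real_sqrt_pow2[of s] power_mono[of W "sqrt s" 2] by simp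
  qed
  have BA: "\<bar>B - A\<bar> \<le> W" using wnorm_diff_le[of \<theta> b1 b2 a1 a2] assms by (simp add: A_def B_def W_def w1_def w2_def)
  have rem: "norm (a1 + a2) * \<bar>ln (\<epsilon> + B) - ln (\<epsilon> + A) - p\<bar> \<le> sing \<theta> * (2 * W\<^sup>2 / \<epsilon>)"
  proof (cases "wvec \<theta> a1 a2 = 0")
    case True
    then have "a1 + a2 = 0" using assms by (simp add: wvec_def zero_prod_def)
    then show ?thesis using sing_pos[of \<theta>] assms by simp
  next
    case False
    have "A * \<bar>ln (\<epsilon> + B) - ln (\<epsilon> + A) - p\<bar> \<le> 2 * W\<^sup>2 / \<epsilon>"
      using ln_norm_remainder[OF assms(1) False, of "wvec \<theta> b1 b2"] assms
      by (simp add: A_def B_def W_def p_def wnorm_eq_norm ipw_eq_inner wvec_diff w1_def w2_def)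
    moreover have "norm (a1 + a2) * \<bar>ln (\<epsilon> + B) - ln (\<epsilon> + A) - p\<bar>
        \<le> (sing \<theta> * A) * \<bar>ln (\<epsilon> + B) - ln (\<epsilon> + A) - p\<bar>"
      unfolding A_def using assms by (intro mult_right_mono norm_add_le_sing) auto
    moreover have "(sing \<theta> * A) * \<bar>ln (\<epsilon> + B) - ln (\<epsilon> + A) - p\<bar> \<le> sing \<theta> * (2 * W\<^sup>2 / \<epsilon>)"
      unfolding mult.assoc using sing_pos[of \<theta>] assms calculation(1) by (intro mult_left_mono) auto
    ultimately show ?thesis by linarith
  qed
  have "norm (w1 + w2) * \<bar>ln (\<epsilon> + B) - ln (\<epsilon> + A)\<bar> \<le> (sing \<theta> * W) * (W / \<epsilon>)"
  proof (rule mult_mono)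
    show "norm (w1 + w2) \<le> sing \<theta> * W" unfolding W_def using assms by (intro norm_add_le_sing) auto
    show "\<bar>ln (\<epsilon> + B) - ln (\<epsilon> + A)\<bar> \<le> W / \<epsilon>"
      using ln_lipschitz[of \<epsilon> B A] divide_right_mono[OF BA, of \<epsilon>] assms pos by linarith
  qed (use sing_pos[of \<theta>] assms pos in auto)
  then have r1: "norm (w1 + w2) * \<bar>ln (\<epsilon> + B) - ln (\<epsilon> + A)\<bar> \<le> sing \<theta> * (W\<^sup>2 / \<epsilon>)"
    by (simp add: power2_eq_square mult_ac)
  have "logker \<epsilon> \<theta> b1 b2 - logker \<epsilon> \<theta> a1 a2 - of_real (ln (\<epsilon> + A)) * (w1 + w2) - of_real p * (a1 + a2)
     = of_real (ln (\<epsilon> + B) - ln (\<epsilon> + A)) * (w1 + w2) + of_real (ln (\<epsilon> + B) - ln (\<epsilon> + A) - p) * (a1 + a2)"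
    unfolding logker_def A_def B_def w1_def w2_def by (simp add: algebra_simps)
  also have "norm \<dots> \<le> \<bar>ln (\<epsilon> + B) - ln (\<epsilon> + A)\<bar> * norm (w1 + w2) + \<bar>ln (\<epsilon> + B) - ln (\<epsilon> + A) - p\<bar> * norm (a1 + a2)"
    by (rule norm_of_real_mult_add_le)
  also have "\<dots> \<le> sing \<theta> * (W\<^sup>2 / \<epsilon>) + sing \<theta> * (2 * W\<^sup>2 / \<epsilon>)"
    using add_mono[OF r1 rem] by (simp only: mult.commute)
  also have "\<dots> = sing \<theta> * (3 * W\<^sup>2 / \<epsilon>)" by (simp add: field_simps)
  also have "\<dots> \<le> sing \<theta> * (3 * s / \<epsilon>)"
    using sing_pos[of \<theta>] assms W2 by (intro mult_left_mono divide_right_mono) auto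
  finally show ?thesis by (simp add: A_def p_def w1_def w2_def s_def)
qed

text \<open>Bregman remainder of the potential: its increment over a time step is the part of the
  nonlinear work that telescopes.\<close>

definition Grel :: "real \<Rightarrow> complex \<Rightarrow> complex \<Rightarrow> real" where
  "Grel \<epsilon> a b = Gpot \<epsilon> b - Gpot \<epsilon> a - inner (flog \<epsilon> a) (b - a)"

text \<open>The discrete gradient identity rewrites the difference of potentials, so the remainder
  becomes \<open>Qtilde\<close> minus \<open>flog\<close>, paired with b - a.\<close>

lemma Grel_bound:
  assumes "0 < \<epsilon>" "\<epsilon> \<le> 1"
  shows "\<bar>Grel \<epsilon> a b\<bar> \<le> (6 / \<epsilon> + 2 * norm a + 2 * norm (b - a)) * (norm (b - a))\<^sup>2"
proof -
  have "Grel \<epsilon> a b = inner (Qtilde \<epsilon> b a - flog \<epsilon> a) (b - a)"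
    unfolding Grel_def Gpot_diff[OF assms(1), symmetric]
    by (simp add: inner_complex_def algebra_simps)
  also have "\<bar>\<dots>\<bar> \<le> norm (Qtilde \<epsilon> b a - flog \<epsilon> a) * norm (b - a)"
    by (rule Cauchy_Schwarz_ineq2)
  also have "\<dots> \<le> ((6 / \<epsilon> + 2 * norm a + 2 * norm (b - a)) * norm (b - a)) * norm (b - a)"
    by (intro mult_right_mono Qtilde_diag_diff assms) auto
  finally show ?thesis by (simp add: power2_eq_square mult_ac)
qed

text \<open>Applying the discrete gradient identity to both pairs turns the expression on the left
  into minus the Taylor remainder of \<open>Qtilde\<close> paired with a1 - a2; integration by parts
  in \<theta> identifies its linear term with the \<open>flog\<close> parts of \<open>Grel\<close>.
  The factor \<open>norm (a1 - a2)\<close> will be a time increment of the exact solution, so the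
  remainder can be summed over all steps.\<close>

lemma Qtilde_diff_work:
  assumes "0 < \<epsilon>"
  shows "\<bar>inner (Qtilde \<epsilon> b1 b2 - Qtilde \<epsilon> a1 a2) ((b1 - a1) - (b2 - a2)) - (Grel \<epsilon> a1 b1 - Grel \<epsilon> a2 b2)\<bar>
     \<le> 12 / \<epsilon> * norm (a1 - a2) * ((norm (b1 - a1))\<^sup>2 + (norm (b2 - a2))\<^sup>2)"
proof -
  define w1 w2 where "w1 = b1 - a1" and "w2 = b2 - a2"
  define s where "s = (norm w1)\<^sup>2 + (norm w2)\<^sup>2"
  let ?L = "\<lambda>\<theta>. of_real (ln (\<epsilon> + wnorm \<theta> a1 a2)) :: complex"
  let ?p = "\<lambda>\<theta>. ipw \<theta> a1 a2 w1 w2 / (wnorm \<theta> a1 a2 * (\<epsilon> + wnorm \<theta> a1 a2))"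
  let ?R = "\<lambda>\<theta>. logker \<epsilon> \<theta> b1 b2 - logker \<epsilon> \<theta> a1 a2 - ?L \<theta> * (w1 + w2) - of_real (?p \<theta>) * (a1 + a2)"
  let ?V = "inner (Qtilde \<epsilon> b1 b2 - Qtilde \<epsilon> a1 a2) (a1 - a2) + inner (Qtilde \<epsilon> a1 a2) (w1 - w2)
      - (inner (flog \<epsilon> a1) w1 - inner (flog \<epsilon> a2) w2)"
  have "((\<lambda>\<theta>. inner (logker \<epsilon> \<theta> b1 b2 - logker \<epsilon> \<theta> a1 a2) (a1 - a2) + inner (logker \<epsilon> \<theta> a1 a2) (w1 - w2)
      - (2 * ln (\<epsilon> + wnorm \<theta> a1 a2) * (inner a1 w1 - inner a2 w2) + ?p \<theta> * ((norm a1)\<^sup>2 - (norm a2)\<^sup>2)))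
     has_integral ?V) {0..1}"
    by (intro has_integral_diff has_integral_add flog_ipw_has_integral assms
         has_integral_linear[OF _ bounded_linear_inner_left, unfolded o_def] logker_has_integral)
  also have "(\<lambda>\<theta>. inner (logker \<epsilon> \<theta> b1 b2 - logker \<epsilon> \<theta> a1 a2) (a1 - a2) + inner (logker \<epsilon> \<theta> a1 a2) (w1 - w2)
      - (2 * ln (\<epsilon> + wnorm \<theta> a1 a2) * (inner a1 w1 - inner a2 w2) + ?p \<theta> * ((norm a1)\<^sup>2 - (norm a2)\<^sup>2)))
     = (\<lambda>\<theta>. inner (?R \<theta>) (a1 - a2))"
  proof
    fix \<theta>
    obtain p where p: "?p \<theta> = p" by simp
    obtain l where l: "ln (\<epsilon> + wnorm \<theta> a1 a2) = l" by simp
    \<comment> \<open>Polarisation: isolates the logarithmic terms so that they cancel against the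
      logarithmic part of the identity integrated by parts.\<close>
    have h1: "inner (a1 + a2) (w1 - w2) = 2 * (inner a1 w1 - inner a2 w2) - inner (w1 + w2) (a1 - a2)"
      by (simp add: inner_add_left inner_add_right inner_diff_left inner_diff_right inner_commute)
    have h2: "(norm a1)\<^sup>2 - (norm a2)\<^sup>2 = inner (a1 + a2) (a1 - a2)"
      by (simp add: power2_norm_eq_inner inner_add_left inner_add_right inner_diff_left inner_diff_right inner_commute)
    have h3: "inner (of_real r * z) w = r * inner z w" for r and z w :: complex
      by (simp add: scaleR_conv_of_real[symmetric])
    show "inner (logker \<epsilon> \<theta> b1 b2 - logker \<epsilon> \<theta> a1 a2) (a1 - a2) + inner (logker \<epsilon> \<theta> a1 a2) (w1 - w2)
      - (2 * ln (\<epsilon> + wnorm \<theta> a1 a2) * (inner a1 w1 - inner a2 w2) + ?p \<theta> * ((norm a1)\<^sup>2 - (norm a2)\<^sup>2))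
     = inner (?R \<theta>) (a1 - a2)"
      unfolding p h2 logker_def[of _ _ a1 a2] l inner_diff_left h3 h1
      by (simp add: right_diff_distrib)
  qed
  finally have I: "((\<lambda>\<theta>. inner (?R \<theta>) (a1 - a2)) has_integral ?V) {0..1}" .
  have "norm (integral {0..1} (\<lambda>\<theta>. inner (?R \<theta>) (a1 - a2))) \<le> 4 * (3 * s / \<epsilon> * norm (a1 - a2))"
  proof (rule integral_sing_bound)
    show "(\<lambda>\<theta>. inner (?R \<theta>) (a1 - a2)) integrable_on {0..1}" using I by (rule has_integral_integrable)
    fix \<theta> :: real assume t: "0 < \<theta>" "\<theta> < 1"
    have "norm (inner (?R \<theta>) (a1 - a2)) \<le> norm (?R \<theta>) * norm (a1 - a2)"
      using Cauchy_Schwarz_ineq2[of "?R \<theta>" "a1 - a2"] by simp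
    also have "\<dots> \<le> sing \<theta> * (3 * s / \<epsilon>) * norm (a1 - a2)"
      unfolding w1_def w2_def s_def by (intro mult_right_mono logker_second_order assms t) auto
    finally show "norm (inner (?R \<theta>) (a1 - a2)) \<le> sing \<theta> * (3 * s / \<epsilon> * norm (a1 - a2))" by (simp only: mult.assoc)
  qed
  then have V: "\<bar>?V\<bar> \<le> 12 / \<epsilon> * norm (a1 - a2) * s" using I by (simp add: integral_unique mult_ac)
  have "inner (Qtilde \<epsilon> b1 b2 - Qtilde \<epsilon> a1 a2) (w1 - w2) - (Grel \<epsilon> a1 b1 - Grel \<epsilon> a2 b2) = - ?V"
  proof -
    have g: "inner (Qtilde \<epsilon> z1 z2) (z1 - z2) = Gpot \<epsilon> z1 - Gpot \<epsilon> z2" for z1 z2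
      using Gpot_diff[OF assms, of z1 z2] by (simp add: inner_complex_def algebra_simps)
    have "w1 - w2 = (b1 - b2) - (a1 - a2)" by (simp add: w1_def w2_def)
    then have "inner (Qtilde \<epsilon> b1 b2) (w1 - w2) = (Gpot \<epsilon> b1 - Gpot \<epsilon> b2) - inner (Qtilde \<epsilon> b1 b2) (a1 - a2)"
      by (simp add: inner_diff_right[of _ "b1 - b2"] g)
    then show ?thesis unfolding Grel_def w1_def[symmetric] w2_def[symmetric] inner_diff_left g by simp
  qed
  then show ?thesis using V unfolding s_def w1_def w2_def by simp
qed

section \<open>Total variation of the averaging error\<close>

text \<open>The P of the overview, for one pair of time levels.\<close>

definition qerr :: "real \<Rightarrow> complex \<Rightarrow> complex \<Rightarrow> complex" where
  "qerr \<epsilon> z1 z2 = (flog \<epsilon> z1 + flog \<epsilon> z2) / 2 - Qtilde \<epsilon> z1 z2"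

text \<open>With W s = s ln (\<epsilon> + s), the first part is the Peano kernel \<theta> (1 -
  \<theta>) W'' of the trapezoidal rule; the subtracted part absorbs half the logarithmic increment,
  which \<open>qerr_decomp\<close> carries as a separate term.\<close>

definition Kker :: "real \<Rightarrow> real \<Rightarrow> real \<Rightarrow> real" where
  "Kker \<epsilon> \<theta> s = \<theta> * (1 - \<theta>) * (1 / (\<epsilon> + s) + \<epsilon> / (\<epsilon> + s)\<^sup>2) - 1 / (2 * (\<epsilon> + s))"

definition kap :: "real \<Rightarrow> real \<Rightarrow> real \<Rightarrow> real" where
  "kap \<epsilon> y d = integral {0..1} (\<lambda>\<theta>. Kker \<epsilon> \<theta> (y + \<theta> * d))"

lemma segment_nonneg:
  fixes y d \<theta> :: real
  assumes "0 \<le> y" "0 \<le> y + d" "0 \<le> \<theta>" "\<theta> \<le> 1"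
  shows "0 \<le> y + \<theta> * d"
proof -
  have "y + \<theta> * d = (1 - \<theta>) * y + \<theta> * (y + d)" by (simp add: algebra_simps)
  then show ?thesis using assms by simp
qed

lemma abs_half_le: "\<bar>x\<bar> \<le> c \<Longrightarrow> \<bar>x / 2\<bar> \<le> c" for x c :: real
  by linarith

lemma Kker_integrable:
  assumes "0 < \<epsilon>" "0 \<le> y" "0 \<le> y + d"
  shows "(\<lambda>\<theta>. Kker \<epsilon> \<theta> (y + \<theta> * d)) integrable_on {0..1}"
proof (rule integrable_continuous_interval)
  have "\<epsilon> + (y + \<theta> * d) \<noteq> 0" if "\<theta> \<in> {0..1}" for \<theta>
    using segment_nonneg[of y d \<theta>] assms that by auto
  then show "continuous_on {0..1} (\<lambda>\<theta>. Kker \<epsilon> \<theta> (y + \<theta> * d))"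
    unfolding Kker_def by (intro continuous_intros) (auto simp del: distrib_left_numeral)
qed

lemma Kker_aux:
  fixes x :: real
  assumes "0 \<le> x" "x \<le> 1" shows "0 \<le> x * (1 - x)" "x * (1 - x) \<le> 1 / 4"
proof -
  show "0 \<le> x * (1 - x)" using assms by simp
  have "0 \<le> (x - 1 / 2)\<^sup>2" by simp
  then show "x * (1 - x) \<le> 1 / 4" by (simp add: power2_eq_square algebra_simps)
qed

lemma Kker_bound:
  assumes "0 < \<epsilon>" "0 \<le> s" "0 \<le> \<theta>" "\<theta> \<le> 1"
  shows "\<bar>Kker \<epsilon> \<theta> s\<bar> \<le> 1 / \<epsilon>"
proof -
  define t where "t = 1 / (\<epsilon> + s)"
  have t: "0 \<le> t" "t \<le> 1 / \<epsilon>" "\<epsilon> * t \<le> 1" using assms by (auto simp: t_def frac_le)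
  have K: "Kker \<epsilon> \<theta> s = \<theta> * (1 - \<theta>) * (t + (\<epsilon> * t) * t) - t / 2"
    unfolding Kker_def t_def by (simp add: power2_eq_square)
  have "0 \<le> t + (\<epsilon> * t) * t" using t assms by (intro add_nonneg_nonneg mult_nonneg_nonneg) auto
  moreover have "(\<epsilon> * t) * t \<le> 1 * t" using t by (intro mult_right_mono) auto
  ultimately have w: "0 \<le> t + (\<epsilon> * t) * t" "t + (\<epsilon> * t) * t \<le> 2 * t" by auto
  have "0 \<le> \<theta> * (1 - \<theta>) * (t + (\<epsilon> * t) * t)"
    by (rule mult_nonneg_nonneg[OF Kker_aux(1)[OF assms(3,4)] w(1)])
  moreover have "\<theta> * (1 - \<theta>) * (t + (\<epsilon> * t) * t) \<le> 1 / 4 * (2 * t)"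
    by (rule mult_mono[OF Kker_aux(2)[OF assms(3,4)] w(2) _ w(1)]) simp
  ultimately have "0 \<le> \<theta> * (1 - \<theta>) * (t + (\<epsilon> * t) * t)" "\<theta> * (1 - \<theta>) * (t + (\<epsilon> * t) * t) \<le> 1 / 4 * (2 * t)" .
  then show ?thesis unfolding K using t by linarith
qed

lemma Kker_lipschitz:
  assumes "0 < \<epsilon>" "0 \<le> s" "0 \<le> s'" "0 \<le> \<theta>" "\<theta> \<le> 1"
  shows "\<bar>Kker \<epsilon> \<theta> s - Kker \<epsilon> \<theta> s'\<bar> \<le> 2 / \<epsilon>\<^sup>2 * \<bar>s - s'\<bar>"
proof -
  define t t' where "t = 1 / (\<epsilon> + s)" and "t' = 1 / (\<epsilon> + s')"
  have t: "0 \<le> t" "\<epsilon> * t \<le> 1" "0 \<le> t'" "\<epsilon> * t' \<le> 1" using assms by (auto simp: t_def t'_def)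
  have "t - t' = (s' - s) / ((\<epsilon> + s) * (\<epsilon> + s'))"
    using assms unfolding t_def t'_def by (simp add: divide_simps)
  then have "\<bar>t - t'\<bar> = \<bar>s - s'\<bar> / ((\<epsilon> + s) * (\<epsilon> + s'))"
    using assms by (simp add: abs_divide abs_mult abs_minus_commute)
  also have "\<dots> \<le> \<bar>s - s'\<bar> / (\<epsilon> * \<epsilon>)"
    using assms by (intro divide_left_mono mult_mono) auto
  finally have tt: "\<bar>t - t'\<bar> \<le> \<bar>s - s'\<bar> / \<epsilon>\<^sup>2" by (simp add: power2_eq_square)
  have "Kker \<epsilon> \<theta> s - Kker \<epsilon> \<theta> s' = \<theta> * (1 - \<theta>) * (1 + \<epsilon> * t + \<epsilon> * t') * (t - t') - 1 / 2 * (t - t')"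
  proof -
    have "Kker \<epsilon> \<theta> s = \<theta> * (1 - \<theta>) * (t + \<epsilon> * t * t) - t / 2" "Kker \<epsilon> \<theta> s' = \<theta> * (1 - \<theta>) * (t' + \<epsilon> * t' * t') - t' / 2"
      unfolding Kker_def t_def t'_def by (simp_all add: power2_eq_square)
    then show ?thesis by (simp add: algebra_simps diff_divide_distrib)
  qed
  also have "\<bar>\<dots>\<bar> \<le> \<bar>\<theta> * (1 - \<theta>) * (1 + \<epsilon> * t + \<epsilon> * t')\<bar> * \<bar>t - t'\<bar> + 1 / 2 * \<bar>t - t'\<bar>"
    by (rule order_trans[OF abs_triangle_ineq4]) (simp add: abs_mult)
  also have "\<dots> \<le> 1 / 4 * 3 * \<bar>t - t'\<bar> + 1 / 2 * \<bar>t - t'\<bar>"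
  proof -
    have "0 \<le> \<epsilon> * t" "0 \<le> \<epsilon> * t'" using t assms by auto
    then have "\<bar>\<theta> * (1 - \<theta>) * (1 + \<epsilon> * t + \<epsilon> * t')\<bar> \<le> 1 / 4 * 3"
      using Kker_aux[OF assms(4,5)] t assms unfolding abs_mult by (intro mult_mono) (auto simp del: abs_mult)
    then show ?thesis by (intro add_right_mono mult_right_mono) auto
  qed
  also have "\<dots> \<le> 2 * (\<bar>s - s'\<bar> / \<epsilon>\<^sup>2)"
  proof -
    have *: "1 / 4 * 3 * x + 1 / 2 * x \<le> 2 * q" if "x \<le> q" "0 \<le> q" for x q :: real using that by linarith
    show ?thesis by (rule *[OF tt order_trans[OF abs_ge_zero tt]])
  qed
  finally show ?thesis by simp
qed

lemma kap_bound:
  assumes "0 < \<epsilon>" "0 \<le> y" "0 \<le> y + d"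
  shows "\<bar>kap \<epsilon> y d\<bar> \<le> 1 / \<epsilon>"
proof -
  have "norm (kap \<epsilon> y d) \<le> integral {0..1} (\<lambda>\<theta>::real. 1 / \<epsilon>)"
    unfolding kap_def using assms
    by (intro integral_norm_bound_integral Kker_integrable) (auto intro!: Kker_bound segment_nonneg)
  then show ?thesis by simp
qed

lemma kap_lipschitz:
  assumes "0 < \<epsilon>" "0 \<le> y" "0 \<le> y + d" "0 \<le> y'" "0 \<le> y' + d'"
  shows "\<bar>kap \<epsilon> y d - kap \<epsilon> y' d'\<bar> \<le> 2 / \<epsilon>\<^sup>2 * (\<bar>y - y'\<bar> + \<bar>d - d'\<bar>)"
proof -
  have "norm (integral {0..1} (\<lambda>\<theta>. Kker \<epsilon> \<theta> (y + \<theta> * d) - Kker \<epsilon> \<theta> (y' + \<theta> * d')))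
      \<le> integral {0..1} (\<lambda>\<theta>::real. 2 / \<epsilon>\<^sup>2 * (\<bar>y - y'\<bar> + \<bar>d - d'\<bar>))"
  proof (rule integral_norm_bound_integral)
    show "(\<lambda>\<theta>. Kker \<epsilon> \<theta> (y + \<theta> * d) - Kker \<epsilon> \<theta> (y' + \<theta> * d')) integrable_on {0..1}"
      by (intro integrable_diff Kker_integrable assms)
    fix \<theta> :: real assume t: "\<theta> \<in> {0..1}"
    have "\<bar>Kker \<epsilon> \<theta> (y + \<theta> * d) - Kker \<epsilon> \<theta> (y' + \<theta> * d')\<bar> \<le> 2 / \<epsilon>\<^sup>2 * \<bar>(y + \<theta> * d) - (y' + \<theta> * d')\<bar>"
      using assms t by (intro Kker_lipschitz segment_nonneg) auto
    also have "(y + \<theta> * d) - (y' + \<theta> * d') = (y - y') + \<theta> * (d - d')" by (simp add: algebra_simps)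
    also have "\<bar>(y - y') + \<theta> * (d - d')\<bar> \<le> \<bar>y - y'\<bar> + \<bar>d - d'\<bar>"
    proof -
      have "\<bar>\<theta> * (d - d')\<bar> \<le> 1 * \<bar>d - d'\<bar>" unfolding abs_mult using t by (intro mult_right_mono) auto
      then show ?thesis using abs_triangle_ineq[of "y - y'" "\<theta> * (d - d')"] by (simp only: mult_1)
    qed
    finally show "norm (Kker \<epsilon> \<theta> (y + \<theta> * d) - Kker \<epsilon> \<theta> (y' + \<theta> * d')) \<le> 2 / \<epsilon>\<^sup>2 * (\<bar>y - y'\<bar> + \<bar>d - d'\<bar>)"
      using assms by (auto simp: mult_left_mono divide_right_mono)
  qed (intro integrable_continuous_interval continuous_intros)
  then show ?thesis using assms by (simp add: kap_def integral_diff Kker_integrable)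
qed

lemma trapezoid_kap:
  assumes "0 < \<epsilon>" "0 \<le> y" "0 \<le> y + d"
  shows "((\<lambda>\<theta>. 2 * ((y + \<theta> * d) * ln (\<epsilon> + (y + \<theta> * d)))) has_integral
     ((y + d) * ln (\<epsilon> + (y + d)) + y * ln (\<epsilon> + y)
       - d / 2 * (ln (\<epsilon> + (y + d)) - ln (\<epsilon> + y)) - d\<^sup>2 * kap \<epsilon> y d)) {0..1}"
proof -
  define W W1 where "W = (\<lambda>s. s * ln (\<epsilon> + s))" and "W1 = (\<lambda>s. ln (\<epsilon> + s) + s / (\<epsilon> + s))"
  \<comment> \<open>The antiderivative is found by integrating \<theta> (1 - \<theta>) times the
    second derivative of W by parts twice; the last term accounts for the subtracted part of the
    kernel.\<close>
  define H where "H = (\<lambda>\<theta>. d * (\<theta> * (1 - \<theta>)) * W1 (y + \<theta> * d) - (1 - 2 * \<theta>) * W (y + \<theta> * d)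
     - d / 2 * ln (\<epsilon> + (y + \<theta> * d)))"
  have "((\<lambda>\<theta>. d\<^sup>2 * Kker \<epsilon> \<theta> (y + \<theta> * d) + 2 * W (y + \<theta> * d)) has_integral (H 1 - H 0)) {0..1}"
  proof (rule fundamental_theorem_of_calculus)
    fix \<theta> :: real assume t: "\<theta> \<in> {0..1}"
    have s: "0 < \<epsilon> + (y + \<theta> * d)" using segment_nonneg[of y d \<theta>] assms t by auto
    have ds: "((\<lambda>\<theta>. y + \<theta> * d) has_real_derivative d) (at \<theta> within {0..1})"
      by (auto intro!: derivative_eq_intros)
    define q where "q = \<epsilon> + (y + \<theta> * d)"
    have q: "0 < q" "y + \<theta> * d = q - \<epsilon>" using s by (auto simp: q_def)
    have dl: "((\<lambda>\<theta>. ln (\<epsilon> + (y + \<theta> * d))) has_real_derivative d / q) (at \<theta> within {0..1})"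
      using s by (auto intro!: derivative_eq_intros simp: q_def)
    have di: "((\<lambda>\<theta>. (y + \<theta> * d) / (\<epsilon> + (y + \<theta> * d))) has_real_derivative (d * \<epsilon> / q\<^sup>2)) (at \<theta> within {0..1})"
      using s by (auto intro!: derivative_eq_intros simp: q_def field_simps power2_eq_square)
    have dW: "((\<lambda>\<theta>. W (y + \<theta> * d)) has_real_derivative d * ln q + (q - \<epsilon>) * (d / q)) (at \<theta> within {0..1})"
      unfolding W_def by (rule DERIV_cong[OF DERIV_mult[OF ds dl]]) (simp add: q_def)
    have dW1: "((\<lambda>\<theta>. W1 (y + \<theta> * d)) has_real_derivative d / q + d * \<epsilon> / q\<^sup>2) (at \<theta> within {0..1})"
      unfolding W1_def by (rule DERIV_add[OF dl di])
    have dp: "((\<lambda>\<theta>. d * (\<theta> * (1 - \<theta>))) has_real_derivative d * (1 - 2 * \<theta>)) (at \<theta> within {0..1})"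
      by (auto intro!: derivative_eq_intros simp: algebra_simps)
    have dm: "((\<lambda>\<theta>. 1 - 2 * \<theta>) has_real_derivative - 2) (at \<theta> within {0..1})"
      by (auto intro!: derivative_eq_intros)
    have "(H has_real_derivative (d * (1 - 2 * \<theta>) * W1 (y + \<theta> * d) + (d / q + d * \<epsilon> / q\<^sup>2) * (d * (\<theta> * (1 - \<theta>))))
        - (- 2 * W (y + \<theta> * d) + (d * ln q + (q - \<epsilon>) * (d / q)) * (1 - 2 * \<theta>)) - d / 2 * (d / q)) (at \<theta> within {0..1})"
      unfolding H_def by (intro DERIV_diff DERIV_mult DERIV_cmult dp dm dW dW1 dl)
    also have "(d * (1 - 2 * \<theta>) * W1 (y + \<theta> * d) + (d / q + d * \<epsilon> / q\<^sup>2) * (d * (\<theta> * (1 - \<theta>))))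
        - (- 2 * W (y + \<theta> * d) + (d * ln q + (q - \<epsilon>) * (d / q)) * (1 - 2 * \<theta>)) - d / 2 * (d / q)
       = d\<^sup>2 * Kker \<epsilon> \<theta> (y + \<theta> * d) + 2 * W (y + \<theta> * d)"
    proof -
      have W1q: "W1 (y + \<theta> * d) = ln q + (q - \<epsilon>) / q" unfolding W1_def by (simp add: q_def)
      have Kq: "Kker \<epsilon> \<theta> (y + \<theta> * d) = \<theta> * (1 - \<theta>) * (1 / q + \<epsilon> / q\<^sup>2) - 1 / (2 * q)"
        unfolding Kker_def by (simp add: q_def)
      define i j where "i = 1 / q" and "j = 1 / q\<^sup>2"
      have "x / q = x * i" "x / q\<^sup>2 = x * j" "x / (2 * q) = x * i / 2" for x by (auto simp: i_def j_def)
      then show ?thesis unfolding W1q Kq by (simp add: algebra_simps power2_eq_square)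
    qed
    finally show "(H has_vector_derivative d\<^sup>2 * Kker \<epsilon> \<theta> (y + \<theta> * d) + 2 * W (y + \<theta> * d)) (at \<theta> within {0..1})"
      unfolding has_real_derivative_iff_has_vector_derivative .
  qed simp
  moreover have "((\<lambda>\<theta>. d\<^sup>2 * Kker \<epsilon> \<theta> (y + \<theta> * d)) has_integral d\<^sup>2 * kap \<epsilon> y d) {0..1}"
    unfolding kap_def by (intro has_integral_mult_right integrable_integral Kker_integrable assms)
  ultimately have "((\<lambda>\<theta>. (d\<^sup>2 * Kker \<epsilon> \<theta> (y + \<theta> * d) + 2 * W (y + \<theta> * d)) - d\<^sup>2 * Kker \<epsilon> \<theta> (y + \<theta> * d)) has_integral
     (H 1 - H 0) - d\<^sup>2 * kap \<epsilon> y d) {0..1}" by (rule has_integral_diff)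
  moreover have "H 1 - H 0 = (y + d) * ln (\<epsilon> + (y + d)) + y * ln (\<epsilon> + y)
       - d / 2 * (ln (\<epsilon> + (y + d)) - ln (\<epsilon> + y))"
    by (simp add: H_def W_def algebra_simps)
  ultimately show ?thesis by (simp add: W_def)
qed

text \<open>\<open>Jint\<close> interpolates the squared norm, the integrand here the norm itself.
  Both integrate the same radial derivative of the potential, so for different norms each side
  equals the potential difference divided by the difference of norms.\<close>

lemma Jint_radial:
  assumes "0 < \<epsilon>"
  shows "((\<lambda>\<theta>. 2 * ((norm z2 + \<theta> * (norm z1 - norm z2)) * ln (\<epsilon> + (norm z2 + \<theta> * (norm z1 - norm z2)))))
     has_integral (Jint \<epsilon> z1 z2 * (norm z1 + norm z2))) {0..1}"
proof -
  define y d where "y = norm z2" and "d = norm z1 - norm z2"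
  have y: "0 \<le> y" "0 \<le> y + d" by (auto simp: y_def d_def)
  show ?thesis
  proof (cases "d = 0")
    case True
    then have n: "norm z1 = norm z2" by (simp add: d_def)
    then have "Jint \<epsilon> z1 z2 = ln (\<epsilon> + norm z2)"
      by (simp add: Jint_def wnorm_def distrib_right[symmetric])
    then show ?thesis using has_integral_const_real[of "2 * (norm z2 * ln (\<epsilon> + norm z2))" 0 1]
      by (simp add: n algebra_simps)
  next
    case False
    define H where "H = (\<lambda>r. (r\<^sup>2 - \<epsilon>\<^sup>2) * ln (\<epsilon> + r) - r\<^sup>2 / 2 + \<epsilon> * r)"
    have "((\<lambda>\<theta>. 2 * ((y + \<theta> * d) * ln (\<epsilon> + (y + \<theta> * d))) * d) has_integral (H (y + 1 * d) - H (y + 0 * d))) {0..1}"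
    proof (rule fundamental_theorem_of_calculus)
      fix \<theta> :: real assume t: "\<theta> \<in> {0..1}"
      have s: "0 \<le> y + \<theta> * d" using segment_nonneg[of y d \<theta>] y t by auto
      have ds: "((\<lambda>\<theta>. y + \<theta> * d) has_real_derivative d) (at \<theta> within {0..1})"
        by (auto intro!: derivative_eq_intros)
      have "((\<lambda>\<theta>. H (y + \<theta> * d)) has_real_derivative 2 * (y + \<theta> * d) * ln (\<epsilon> + (y + \<theta> * d)) * d) (at \<theta> within {0..1})"
        unfolding H_def by (rule DERIV_chain2[OF Gpot_radial_deriv[OF assms s] ds])
      then show "((\<lambda>\<theta>. H (y + \<theta> * d)) has_vector_derivative 2 * ((y + \<theta> * d) * ln (\<epsilon> + (y + \<theta> * d))) * d) (at \<theta> within {0..1})"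
        unfolding has_real_derivative_iff_has_vector_derivative by (simp only: mult.assoc)
    qed simp
    from has_integral_mult_left[OF this, of "1 / d"] False
    have "((\<lambda>\<theta>. 2 * ((y + \<theta> * d) * ln (\<epsilon> + (y + \<theta> * d)))) has_integral ((H (y + d) - H y) / d)) {0..1}" by simp
    moreover have "(H (y + d) - H y) / d = Jint \<epsilon> z1 z2 * (norm z1 + norm z2)"
    proof -
      have "Re ((z1 + z2) * cnj (z1 - z2)) = (norm z1)\<^sup>2 - (norm z2)\<^sup>2"
        unfolding cmod_power2 by (simp add: algebra_simps power2_eq_square)
      moreover have "Re (of_real x * w) = x * Re w" for x :: real and w by simp
      ultimately have "Re (Qtilde \<epsilon> z1 z2 * cnj (z1 - z2)) = Jint \<epsilon> z1 z2 * ((norm z1)\<^sup>2 - (norm z2)\<^sup>2)"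
        unfolding Qtilde_eq_Jint[OF assms] mult.assoc by metis
      also have "(norm z1)\<^sup>2 - (norm z2)\<^sup>2 = (norm z1 + norm z2) * d"
        by (simp add: d_def power2_eq_square algebra_simps)
      finally have "H (y + d) - H y = Jint \<epsilon> z1 z2 * ((norm z1 + norm z2) * d)"
        using Gpot_diff[OF assms, of z1 z2] by (simp add: Gpot_def H_def y_def d_def)
      then show ?thesis using False by simp
    qed
    ultimately show ?thesis by (simp add: y_def d_def)
  qed
qed

text \<open>Isolates the direction of the solution, the only factor that is discontinuous at a zero,
  and multiplies it by the squared increment of the modulus. For z1 = z2 = 0 the quotient is 0/0 = 0
  and both sides vanish.\<close>

lemma qerr_decomp:
  assumes "0 < \<epsilon>"
  shows "qerr \<epsilon> z1 z2 = of_real ((ln (\<epsilon> + norm z1) - ln (\<epsilon> + norm z2)) / 2) * (z1 - z2)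
    + of_real ((norm z1 - norm z2)\<^sup>2 * kap \<epsilon> (norm z2) (norm z1 - norm z2)) * ((z1 + z2) / of_real (norm z1 + norm z2))"
proof -
  define x y J g1 g2 k where "x = norm z1" and "y = norm z2" and "J = Jint \<epsilon> z1 z2"
    and "g1 = ln (\<epsilon> + norm z1)" and "g2 = ln (\<epsilon> + norm z2)" and "k = kap \<epsilon> y (x - y)"
  have "J * (x + y) = x * g1 + y * g2 - (x - y) / 2 * (g1 - g2) - (x - y)\<^sup>2 * k"
    using has_integral_unique[OF Jint_radial[OF assms, of z2 z1]
        trapezoid_kap[OF assms, of "norm z2" "norm z1 - norm z2"]]
    by (simp add: x_def y_def J_def g1_def g2_def k_def)
  then have B: "((g1 + g2) / 2 - J) * (x + y) = (x - y)\<^sup>2 * k" by (simp add: field_simps)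
  have z: "of_real ((x - y)\<^sup>2 * k) * ((z1 + z2) / of_real (x + y)) = of_real ((g1 + g2) / 2 - J) * (z1 + z2)"
  proof (cases "x + y = 0")
    case True
    then have "z1 = 0" "z2 = 0" by (auto simp: x_def y_def add_nonneg_eq_0_iff)
    then show ?thesis by simp
  next
    case False
    then show ?thesis unfolding B[symmetric] by (simp del: of_real_add)
  qed
  have "qerr \<epsilon> z1 z2 = of_real ((g1 - g2) / 2) * (z1 - z2) + of_real ((g1 + g2) / 2 - J) * (z1 + z2)"
    unfolding qerr_def flog_def Qtilde_eq_Jint[OF assms] J_def g1_def g2_def by (simp add: field_simps)
  then show ?thesis unfolding z[symmetric] by (simp add: x_def y_def g1_def g2_def k_def)
qed

lemma norm_sum_quotient_le_one: "norm ((z1 + z2) / of_real (norm z1 + norm z2)) \<le> (1::real)" for z1 z2 :: complex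
proof (cases "norm z1 + norm z2 = 0")
  case False
  then have "0 < norm z1 + norm z2" using norm_ge_zero[of z1] norm_ge_zero[of z2] by linarith
  then show ?thesis using norm_triangle_ineq[of z1 z2] by (simp add: norm_divide del: of_real_add)
qed (simp del: of_real_add)

lemma qerr_bound:
  assumes "0 < \<epsilon>"
  shows "norm (qerr \<epsilon> z1 z2) \<le> 2 / \<epsilon> * (norm (z1 - z2))\<^sup>2"
proof -
  define D d where "D = norm (z1 - z2)" and "d = norm z1 - norm z2"
  have dD: "\<bar>d\<bar> \<le> D" unfolding D_def d_def by (rule norm_triangle_ineq3)
  have "norm (qerr \<epsilon> z1 z2) \<le> \<bar>(ln (\<epsilon> + norm z1) - ln (\<epsilon> + norm z2)) / 2\<bar> * D
      + \<bar>d\<^sup>2 * kap \<epsilon> (norm z2) d\<bar> * norm ((z1 + z2) / of_real (norm z1 + norm z2))"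
    unfolding qerr_decomp[OF assms] D_def d_def by (rule norm_of_real_mult_add_le)
  also have "\<dots> \<le> (D / \<epsilon>) * D + (D\<^sup>2 * (1 / \<epsilon>)) * 1"
  proof (intro add_mono mult_mono)
    have "\<bar>ln (\<epsilon> + norm z1) - ln (\<epsilon> + norm z2)\<bar> \<le> \<bar>d\<bar> / \<epsilon>"
      unfolding d_def using ln_lipschitz assms by simp
    also have "\<dots> \<le> D / \<epsilon>" using dD assms by (simp add: divide_right_mono)
    finally have h: "\<bar>ln (\<epsilon> + norm z1) - ln (\<epsilon> + norm z2)\<bar> \<le> D / \<epsilon>" .
    then show "\<bar>(ln (\<epsilon> + norm z1) - ln (\<epsilon> + norm z2)) / 2\<bar> \<le> D / \<epsilon>" by (rule abs_half_le)
    have "d\<^sup>2 \<le> D\<^sup>2" using dD by (metis abs_ge_self abs_le_square_iff order_trans)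
    moreover have "\<bar>kap \<epsilon> (norm z2) d\<bar> \<le> 1 / \<epsilon>" using assms by (intro kap_bound) (auto simp: d_def)
    ultimately show "\<bar>d\<^sup>2 * kap \<epsilon> (norm z2) d\<bar> \<le> D\<^sup>2 * (1 / \<epsilon>)"
      unfolding abs_mult by (intro mult_mono) auto
  qed (use assms norm_sum_quotient_le_one in \<open>auto simp: D_def\<close>)
  also have "\<dots> = 2 / \<epsilon> * D\<^sup>2" by (simp add: power2_eq_square)
  finally show ?thesis by (simp add: D_def)
qed

lemma abs_le_plus_of_lower:
  fixes x c :: real assumes "- c \<le> x" "0 \<le> c" shows "\<bar>x\<bar> \<le> x + 2 * c"
  using assms by linarith

text \<open>For unit vectors at an acute angle with cosine c and sine s, the squared chord 2 - 2c is
  at most 4 (1 - c) (1 + c) = 4 s^2.\<close>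

lemma norm_sgn_diff_le:
  fixes a b :: complex
  assumes "0 < Re (a * cnj b)"
  shows "norm (sgn a - sgn b) \<le> 2 * \<bar>Im (cnj b * a)\<bar> / (norm a * norm b)"
proof -
  have nz: "a \<noteq> 0" "b \<noteq> 0" using assms by auto
  define x where "x = sgn a * cnj (sgn b)"
  have xr: "x = (a * cnj b) / of_real (norm a * norm b)" by (simp add: x_def sgn_eq)
  define c s where "c = Re x" and "s = Im x"
  have c: "0 < c" using assms nz unfolding c_def xr by (simp only: Re_divide_of_real) (simp add: zero_less_divide_iff)
  have "norm x = 1" using nz by (simp add: x_def norm_mult norm_sgn)
  then have cs: "c\<^sup>2 + s\<^sup>2 = 1" unfolding c_def s_def by (metis cmod_power2 one_power2)
  then have c1: "c \<le> 1" using abs_square_le_1[of c] zero_le_power2[of s] by linarith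
  have "(norm (sgn a - sgn b))\<^sup>2 = (norm (sgn a))\<^sup>2 + (norm (sgn b))\<^sup>2 - 2 * inner (sgn a) (sgn b)"
    by (simp add: power2_norm_eq_inner inner_diff_left inner_diff_right inner_commute)
  also have "inner (sgn a) (sgn b) = c" by (simp add: c_def x_def inner_complex_def)
  finally have "(norm (sgn a - sgn b))\<^sup>2 = 2 - 2 * c" using nz by (simp add: norm_sgn)
  also have "\<dots> \<le> 4 * ((1 - c) * (1 + c))"
  proof -
    define P where "P = (1 - c) * (1 + c)"
    have "(1 - c) * 1 \<le> P" unfolding P_def using c c1 by (intro mult_left_mono) auto
    then have "1 - c \<le> P" by simp
    then have "2 - 2 * c \<le> 4 * P" using c1 by simp
    then show ?thesis by (simp add: P_def)
  qed
  also have "\<dots> = (2 * \<bar>s\<bar>)\<^sup>2" using cs by (simp add: power_mult_distrib power2_eq_square algebra_simps)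
  finally have "norm (sgn a - sgn b) \<le> 2 * \<bar>s\<bar>" by (rule power2_le_imp_le) simp
  also have "\<bar>s\<bar> = \<bar>Im (cnj b * a)\<bar> / (norm a * norm b)"
    unfolding s_def xr by (simp only: Im_divide_of_real) (simp add: abs_divide abs_mult mult.commute)
  finally show ?thesis by simp
qed

lemma Im_cnj_mult_le:
  fixes a b :: complex
  shows "\<bar>Im (cnj a * b)\<bar> \<le> norm (b - a) * norm a" "\<bar>Im (cnj a * b)\<bar> \<le> norm (b - a) * norm b"
proof -
  have "Im (cnj a * b) = Im (cnj a * (b - a))" by (simp add: algebra_simps)
  also have "\<bar>\<dots>\<bar> \<le> norm (cnj a * (b - a))" by (rule abs_Im_le_cmod)
  finally show "\<bar>Im (cnj a * b)\<bar> \<le> norm (b - a) * norm a" by (simp add: norm_mult mult.commute)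
  have "Im (cnj a * b) = Im (cnj (a - b) * b)" by (simp add: algebra_simps)
  also have "\<bar>\<dots>\<bar> \<le> norm (cnj (a - b) * b)" by (rule abs_Im_le_cmod)
  finally show "\<bar>Im (cnj a * b)\<bar> \<le> norm (b - a) * norm b" by (simp add: norm_mult norm_minus_commute del: complex_cnj_diff)
qed

lemma abel_sum_inverse:
  fixes a r :: "nat \<Rightarrow> real"
  shows "(\<Sum>l\<le>n. a l * (1 / r l - 1 / r (Suc l))) =
     a 0 / r 0 - a n / r (Suc n) + (\<Sum>l<n. (a (Suc l) - a l) / r (Suc l))"
  by (induction n) (simp_all add: algebra_simps diff_divide_distrib)

section \<open>Sampled curves: variation of their modulus and of their direction\<close>

text \<open>The exact solution sampled in time at one grid point, to be used with \<delta> = m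
  \<tau> and \<delta>2 = m \<tau>^2. Here n counts second differences, so the samples run from 0 to
  n + 1.\<close>

locale smooth_seq =
  fixes u :: "nat \<Rightarrow> complex" and \<delta> \<delta>2 :: real and n :: nat
  assumes step: "\<And>l. l \<le> n \<Longrightarrow> norm (u (Suc l) - u l) \<le> \<delta>"
    and second: "\<And>l. l < n \<Longrightarrow> norm (u (Suc (Suc l)) - 2 * u (Suc l) + u l) \<le> \<delta>2"
    and nonneg2: "0 \<le> \<delta>2"
begin

abbreviation r :: "nat \<Rightarrow> real" where "r l \<equiv> norm (u l)"
definition d :: "nat \<Rightarrow> real" where "d l = r (Suc l) - r l"
definition L :: "nat \<Rightarrow> real" where "L l = Im (cnj (u l) * u (Suc l))"
definition V :: real where "V = \<delta> + real n * \<delta>2"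

lemma nonneg: "0 \<le> \<delta>" by (rule order_trans[OF norm_ge_zero step[of 0]]) simp

lemma V_nonneg: "0 \<le> V" "\<delta> \<le> V" "real n * \<delta>2 \<le> V" using nonneg nonneg2 by (auto simp: V_def)

lemma d_bound: "l \<le> n \<Longrightarrow> \<bar>d l\<bar> \<le> \<delta>"
  unfolding d_def using norm_triangle_ineq3[of "u (Suc l)" "u l"] step[of l] by linarith

lemma d_sq_bound: "l \<le> n \<Longrightarrow> (d l)\<^sup>2 \<le> \<delta> * \<bar>d l\<bar>" "l \<le> n \<Longrightarrow> (d l)\<^sup>2 \<le> \<delta>\<^sup>2"
  using d_bound[of l] mult_right_mono[of "\<bar>d l\<bar>" \<delta> "\<bar>d l\<bar>"] abs_le_square_iff[of "d l" \<delta>] nonneg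
  by (auto simp: power2_eq_square)

text \<open>The modulus is semiconvex along the sequence, so its increments have bounded variation.\<close>

lemma d_lower:
  assumes "l < n" shows "- \<delta>2 \<le> d (Suc l) - d l"
proof -
  have "2 * u (Suc l) = (u (Suc (Suc l)) + u l) - (u (Suc (Suc l)) - 2 * u (Suc l) + u l)" by simp
  then have "norm (2 * u (Suc l)) \<le> norm (u (Suc (Suc l)) + u l) + norm (u (Suc (Suc l)) - 2 * u (Suc l) + u l)"
    by (metis norm_triangle_ineq4)
  then have "2 * r (Suc l) \<le> (r (Suc (Suc l)) + r l) + \<delta>2"
    using norm_triangle_ineq[of "u (Suc (Suc l))" "u l"] second[OF assms] by (simp add: norm_mult)
  then show ?thesis by (simp add: d_def)
qed

text \<open>A number bounded below by -\<delta>2 has absolute value at most itself plus 2 \<delta>2,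
  and the sum of the numbers themselves telescopes.\<close>

lemma d_variation: "(\<Sum>l<n. \<bar>d (Suc l) - d l\<bar>) \<le> 2 * V"
proof -
  have "(\<Sum>l<n. \<bar>d (Suc l) - d l\<bar>) \<le> (\<Sum>l<n. (d (Suc l) - d l) + 2 * \<delta>2)"
    by (intro sum_mono abs_le_plus_of_lower) (use d_lower nonneg2 in auto)
  also have "\<dots> = (d n - d 0) + 2 * (real n * \<delta>2)"
    by (simp add: sum.distrib sum_lessThan_telescope)
  also have "\<dots> \<le> 2 * V" using d_bound[of n] d_bound[of 0] by (simp add: V_def)
  finally show ?thesis .
qed

text \<open>In the difference of two consecutive cross products any real multiple of the middle
  sample can be inserted, because \<open>cnj z * z\<close> is real; only the second difference
  remains.\<close>

lemma L_step: "l < n \<Longrightarrow> \<bar>\<bar>L (Suc l)\<bar> - \<bar>L l\<bar>\<bar> \<le> r (Suc l) * \<delta>2"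
proof -
  assume l: "l < n"
  have "L (Suc l) - L l = Im (cnj (u (Suc l)) * (u (Suc (Suc l)) - 2 * u (Suc l) + u l))"
    unfolding L_def by (simp add: algebra_simps)
  also have "\<bar>\<dots>\<bar> \<le> norm (cnj (u (Suc l)) * (u (Suc (Suc l)) - 2 * u (Suc l) + u l))" by (rule abs_Im_le_cmod)
  also have "\<dots> \<le> r (Suc l) * \<delta>2" using second[OF l] by (simp add: norm_mult mult_left_mono)
  finally show ?thesis by linarith
qed

lemma L_div_bound: "l \<le> n \<Longrightarrow> \<bar>L l\<bar> / r l \<le> \<delta>" "l \<le> n \<Longrightarrow> \<bar>L l\<bar> / r (Suc l) \<le> \<delta>"
proof -
  assume l: "l \<le> n"
  have "\<bar>L l\<bar> \<le> \<delta> * r l" "\<bar>L l\<bar> \<le> \<delta> * r (Suc l)"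
    using Im_cnj_mult_le[of "u l" "u (Suc l)"] mult_right_mono[OF step[OF l], of "r l"]
      mult_right_mono[OF step[OF l], of "r (Suc l)"] by (auto simp: L_def)
  then show "\<bar>L l\<bar> / r l \<le> \<delta>" "\<bar>L l\<bar> / r (Suc l) \<le> \<delta>"
    using nonneg by (auto simp: divide_le_eq)
qed

text \<open>Summation by parts against \<open>1 / r\<close>: the discrete angular momentum \<open>L\<close> changes by at most
  \<open>r \<delta>2\<close> per step, which cancels the singular weight.\<close>

lemma angular_sum: "(\<Sum>l\<le>n. (d l)\<^sup>2 * \<bar>L l\<bar> / (r l * r (Suc l))) \<le> 5 * \<delta> * V"
proof -
  define a where "a l = d l * \<bar>L l\<bar>" for l
  \<comment> \<open>If one of the moduli vanishes then \<open>L l = 0\<close>, so the identity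
    survives division by zero.\<close>
  have "(d l)\<^sup>2 * \<bar>L l\<bar> / (r l * r (Suc l)) = a l * (1 / r l - 1 / r (Suc l))" for l
  proof (cases "r l = 0 \<or> r (Suc l) = 0")
    case True then have "L l = 0" by (auto simp: L_def) then show ?thesis by (simp add: a_def)
  next
    case False
    then have "1 / r l - 1 / r (Suc l) = d l / (r l * r (Suc l))" by (simp add: d_def field_simps)
    then show ?thesis by (simp add: a_def power2_eq_square)
  qed
  then have "(\<Sum>l\<le>n. (d l)\<^sup>2 * \<bar>L l\<bar> / (r l * r (Suc l))) =
      a 0 / r 0 - a n / r (Suc n) + (\<Sum>l<n. (a (Suc l) - a l) / r (Suc l))"
    using abel_sum_inverse[of a r n] by simp
  also have "\<dots> \<le> \<delta> * \<delta> + \<delta> * \<delta> + (\<Sum>l<n. \<delta> * \<bar>d (Suc l) - d l\<bar> + \<delta> * \<delta>2)"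
  proof -
    have a: "\<bar>a 0 / r 0\<bar> \<le> \<delta> * \<delta>" "\<bar>a n / r (Suc n)\<bar> \<le> \<delta> * \<delta>"
      using mult_mono[OF d_bound[of 0] L_div_bound(1)[of 0]] mult_mono[OF d_bound[of n] L_div_bound(2)[of n]] nonneg
      by (auto simp: a_def abs_mult)
    have "(a (Suc l) - a l) / r (Suc l) \<le> \<delta> * \<bar>d (Suc l) - d l\<bar> + \<delta> * \<delta>2" if l: "l < n" for l
    proof -
      have "(a (Suc l) - a l) / r (Suc l) = (d (Suc l) - d l) * (\<bar>L l\<bar> / r (Suc l)) + d (Suc l) * ((\<bar>L (Suc l)\<bar> - \<bar>L l\<bar>) / r (Suc l))"
        unfolding a_def by (simp add: algebra_simps add_divide_distrib diff_divide_distrib)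
      also have "\<dots> \<le> \<bar>d (Suc l) - d l\<bar> * (\<bar>L l\<bar> / r (Suc l)) + \<bar>d (Suc l)\<bar> * \<bar>(\<bar>L (Suc l)\<bar> - \<bar>L l\<bar>) / r (Suc l)\<bar>"
        by (intro add_mono mult_right_mono order_trans[OF abs_ge_self eq_refl[OF abs_mult]]) auto
      also have "\<dots> \<le> \<bar>d (Suc l) - d l\<bar> * \<delta> + \<delta> * \<delta>2"
      proof (intro add_mono mult_mono)
        show "\<bar>L l\<bar> / r (Suc l) \<le> \<delta>" using L_div_bound l by simp
        show "\<bar>d (Suc l)\<bar> \<le> \<delta>" using d_bound l by simp
        show "\<bar>(\<bar>L (Suc l)\<bar> - \<bar>L l\<bar>) / r (Suc l)\<bar> \<le> \<delta>2"
          using L_step[OF l] nonneg2 by (auto simp: abs_divide divide_le_eq mult.commute)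
      qed (use nonneg in auto)
      finally show ?thesis by (simp add: mult.commute)
    qed
    then have "(\<Sum>l<n. (a (Suc l) - a l) / r (Suc l)) \<le> (\<Sum>l<n. \<delta> * \<bar>d (Suc l) - d l\<bar> + \<delta> * \<delta>2)"
      by (intro sum_mono) auto
    then show ?thesis using a by linarith
  qed
  also have "(\<Sum>l<n. \<delta> * \<bar>d (Suc l) - d l\<bar> + \<delta> * \<delta>2) = \<delta> * (\<Sum>l<n. \<bar>d (Suc l) - d l\<bar>) + \<delta> * (real n * \<delta>2)"
    by (simp add: sum.distrib sum_distrib_left algebra_simps)
  also have "\<delta> * \<delta> + \<delta> * \<delta> + (\<delta> * (\<Sum>l<n. \<bar>d (Suc l) - d l\<bar>) + \<delta> * (real n * \<delta>2)) \<le> \<delta> * V + \<delta> * V + (\<delta> * (2 * V) + \<delta> * V)"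
    using d_variation V_nonneg nonneg by (intro add_mono mult_left_mono) auto
  finally show ?thesis by (simp add: algebra_simps)
qed

text \<open>When the sample turns by at least a right angle, linear extrapolation forward and
  backward at least doubles the modulus. Up to \<delta>2, d is therefore at most -r l before and at
  least r (Suc l) after the step, and \<open>\<bar>d l\<bar>\<close> can be charged to the variation
  of d.\<close>

lemma d_small_at_turn:
  assumes "Re (u (Suc l) * cnj (u l)) \<le> 0" "0 < l" "l < n"
  shows "\<bar>d l\<bar> \<le> \<bar>d (Suc l) - d l\<bar> + \<bar>d l - d (l - 1)\<bar> + \<delta>2"
proof -
  have key: "2 * norm a \<le> norm (2 * a - b)" if "Re (a * cnj b) \<le> 0" for a b :: complex
  proof -
    have "(norm (2 * a - b))\<^sup>2 = (2 * norm a)\<^sup>2 + (norm b)\<^sup>2 - 4 * Re (a * cnj b)"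
      unfolding cmod_power2 power_mult_distrib by (simp add: power2_eq_square algebra_simps)
    then have "(2 * norm a)\<^sup>2 \<le> (norm (2 * a - b))\<^sup>2" using that zero_le_power2[of "norm b"] by linarith
    then show ?thesis by (rule power2_le_imp_le) simp
  qed
  obtain k where k: "l = Suc k" using assms by (cases l) auto
  have R: "Re (u l * cnj (u (Suc l))) \<le> 0" using assms(1) by (simp add: mult.commute)
  have f: "2 * r (Suc l) - \<delta>2 \<le> r (Suc (Suc l))"
  proof -
    have "2 * u (Suc l) - u l = u (Suc (Suc l)) - (u (Suc (Suc l)) - 2 * u (Suc l) + u l)" by simp
    then have "norm (2 * u (Suc l) - u l) \<le> r (Suc (Suc l)) + \<delta>2"
      using norm_triangle_ineq4[of "u (Suc (Suc l))"] second[OF assms(3)] by (metis add_left_mono order_trans)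
    then show ?thesis using key[OF assms(1)] by linarith
  qed
  have b: "2 * r l - \<delta>2 \<le> r k"
  proof -
    have "2 * u l - u (Suc l) = u k - (u (Suc (Suc k)) - 2 * u (Suc k) + u k)" using k by simp
    then have "norm (2 * u l - u (Suc l)) \<le> r k + \<delta>2"
      using norm_triangle_ineq4[of "u k"] second[of k] assms k by (metis add_left_mono order_trans Suc_lessD)
    then show ?thesis using key[OF R] by linarith
  qed
  have kl: "d (l - 1) = r l - r k" by (simp add: d_def k)
  show ?thesis using f b norm_ge_zero[of "u l"] norm_ge_zero[of "u (Suc l)"] unfolding kl unfolding d_def by linarith
qed

text \<open>Steps at an acute angle are charged to \<open>angular_sum\<close>, all others to the
  variation of d: 24 = 2 * 5 + 2 * 7.\<close>

lemma direction_variation: "(\<Sum>l\<le>n. (d l)\<^sup>2 * norm (sgn (u (Suc l)) - sgn (u l))) \<le> 24 * \<delta> * V"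
proof -
  \<comment> \<open>Charge of a turning step; the first and the last step lack a neighbour and pay
    \<delta>. The charges add up to at most 7 V: twice the variation 2 V, once n \<delta>2 and twice
    \<delta>.\<close>
  define X where "X l = (if 0 < l \<and> l < n then \<bar>d (Suc l) - d l\<bar> + \<bar>d l - d (l - 1)\<bar> + \<delta>2 else \<delta>)" for l
  have Xn: "0 \<le> X l" for l using nonneg nonneg2 by (simp add: X_def)
  have tm: "(d l)\<^sup>2 * norm (sgn (u (Suc l)) - sgn (u l)) \<le> 2 * ((d l)\<^sup>2 * \<bar>L l\<bar> / (r l * r (Suc l))) + 2 * \<delta> * X l"
    if l: "l \<le> n" for l
  proof (cases "0 < Re (u (Suc l) * cnj (u l))")
    case True
    from mult_left_mono[OF norm_sgn_diff_le[OF True], of "(d l)\<^sup>2"]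
    have "(d l)\<^sup>2 * norm (sgn (u (Suc l)) - sgn (u l)) \<le> 2 * ((d l)\<^sup>2 * \<bar>L l\<bar> / (r l * r (Suc l)))"
      by (simp add: L_def mult_ac)
    moreover have "0 \<le> 2 * \<delta> * X l" using nonneg Xn by simp
    ultimately show ?thesis by linarith
  next
    case False
    have "norm (sgn (u (Suc l)) - sgn (u l)) \<le> norm (sgn (u (Suc l))) + norm (sgn (u l))" by (rule norm_triangle_ineq4)
    also have "\<dots> \<le> 2" by (simp add: norm_sgn)
    finally have s: "norm (sgn (u (Suc l)) - sgn (u l)) \<le> 2" .
    have "\<bar>d l\<bar> \<le> X l"
      using d_small_at_turn[of l] False d_bound[OF l] by (auto simp: X_def)
    then have "(d l)\<^sup>2 \<le> \<delta> * X l" using d_sq_bound(1)[OF l] mult_left_mono[of "\<bar>d l\<bar>" "X l" \<delta>] nonneg by linarith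
    then have "(d l)\<^sup>2 * norm (sgn (u (Suc l)) - sgn (u l)) \<le> (\<delta> * X l) * 2"
      using s nonneg Xn by (intro mult_mono) auto
    moreover have "0 \<le> 2 * ((d l)\<^sup>2 * \<bar>L l\<bar> / (r l * r (Suc l)))" by simp
    ultimately show ?thesis by (simp only: mult_ac)
  qed
  have "(\<Sum>l\<le>n. (d l)\<^sup>2 * norm (sgn (u (Suc l)) - sgn (u l)))
     \<le> (\<Sum>l\<le>n. 2 * ((d l)\<^sup>2 * \<bar>L l\<bar> / (r l * r (Suc l))) + 2 * \<delta> * X l)"
    by (intro sum_mono tm) simp
  also have "\<dots> = 2 * (\<Sum>l\<le>n. (d l)\<^sup>2 * \<bar>L l\<bar> / (r l * r (Suc l))) + 2 * \<delta> * (\<Sum>l\<le>n. X l)"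
    by (simp add: sum.distrib sum_distrib_left)
  also have "\<dots> \<le> 2 * (5 * \<delta> * V) + 2 * \<delta> * (7 * V)"
  proof (intro add_mono mult_left_mono angular_sum)
    show "(\<Sum>l\<le>n. X l) \<le> 7 * V"
    proof -
      have "(\<Sum>l\<le>n. X l) \<le> (\<Sum>l\<le>n. (if l < n then \<bar>d (Suc l) - d l\<bar> else 0) + (if 0 < l then \<bar>d l - d (l - 1)\<bar> else 0)
          + (if l < n then \<delta>2 else 0) + ((if l = 0 then \<delta> else 0) + (if l = n then \<delta> else 0)))"
        by (intro sum_mono) (use nonneg nonneg2 in \<open>auto simp: X_def\<close>)
      also have "\<dots> = (\<Sum>l\<le>n. (if l < n then \<bar>d (Suc l) - d l\<bar> else 0)) + (\<Sum>l\<le>n. (if 0 < l then \<bar>d l - d (l - 1)\<bar> else 0))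
          + (\<Sum>l\<le>n. (if l < n then \<delta>2 else 0)) + (\<delta> + \<delta>)"
        by (simp add: sum.distrib)
      also have "(\<Sum>l\<le>n. (if l < n then \<bar>d (Suc l) - d l\<bar> else 0)) = (\<Sum>l<n. \<bar>d (Suc l) - d l\<bar>)"
        by (simp add: sum.If_cases Int_def lessThan_def[symmetric] flip: Collect_conj_eq)
          (intro sum.cong, auto)
      also have "(\<Sum>l\<le>n. (if l < n then \<delta>2 else 0)) = real n * \<delta>2"
      proof -
        have "(\<Sum>l\<le>n. (if l < n then \<delta>2 else 0)) = (\<Sum>l<n. \<delta>2)"
          by (simp add: lessThan_Suc_atMost[symmetric])
        then show ?thesis by simp
      qed
      also have "(\<Sum>l\<le>n. (if 0 < l then \<bar>d l - d (l - 1)\<bar> else 0)) = (\<Sum>l<n. \<bar>d (Suc l) - d l\<bar>)"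
        by (simp add: sum.atMost_shift)
      finally show ?thesis using d_variation V_nonneg by linarith
    qed
  qed (use nonneg in auto)
  finally show ?thesis by (simp add: algebra_simps)
qed

text \<open>Each quotient is a convex combination of two consecutive directions, hence both lie
  close to the direction they share, \<open>sgn (u (Suc l))\<close>.\<close>

lemma direction_factor_step:
  assumes "l < n"
  shows "norm ((u (Suc (Suc l)) + u (Suc l)) / of_real (r (Suc (Suc l)) + r (Suc l)) - (u (Suc l) + u l) / of_real (r (Suc l) + r l))
    \<le> norm (sgn (u (Suc (Suc l))) - sgn (u (Suc l))) + norm (sgn (u (Suc l)) - sgn (u l))"
proof -
  have conv: "norm ((b + a) / of_real (norm b + norm a) - sgn b) \<le> norm (sgn b - sgn a)" for a b :: complex
  proof (cases "norm b + norm a = 0")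
    case True
    then have "a = 0" "b = 0" by (auto simp: add_nonneg_eq_0_iff)
    then show ?thesis by simp
  next
    case False
    then have pos: "0 < norm b + norm a" using norm_ge_zero[of a] norm_ge_zero[of b] by linarith
    have nz: "of_real (norm b + norm a) \<noteq> (0::complex)" using pos by (simp del: of_real_add)
    have eq: "z = of_real (norm z) * sgn z" for z :: complex by (cases "z = 0") (simp_all add: sgn_eq)
    have "(b + a) = of_real (norm b + norm a) * sgn b + of_real (norm a) * (sgn a - sgn b)"
      by (subst (1) eq[of a], subst (1) eq[of b]) (simp add: algebra_simps)
    then have "(b + a) / of_real (norm b + norm a) - sgn b = of_real (norm a) * (sgn a - sgn b) / of_real (norm b + norm a)"
      using nz by (simp add: add_divide_distrib del: of_real_add)
    also have "norm \<dots> = (norm a / (norm b + norm a)) * norm (sgn b - sgn a)"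
      using pos by (simp add: norm_mult norm_divide norm_minus_commute del: of_real_add)
    also have "\<dots> \<le> 1 * norm (sgn b - sgn a)" using pos by (intro mult_right_mono) auto
    finally show ?thesis by simp
  qed
  have c1: "norm ((u (Suc (Suc l)) + u (Suc l)) / of_real (r (Suc (Suc l)) + r (Suc l)) - sgn (u (Suc l)))
     \<le> norm (sgn (u (Suc (Suc l))) - sgn (u (Suc l)))"
    using conv[of "u (Suc l)" "u (Suc (Suc l))"] by (simp add: add.commute norm_minus_commute del: of_real_add)
  have c2: "norm (sgn (u (Suc l)) - (u (Suc l) + u l) / of_real (r (Suc l) + r l)) \<le> norm (sgn (u (Suc l)) - sgn (u l))"
    using conv[of "u (Suc l)" "u l"] by (simp add: norm_minus_commute del: of_real_add)
  show ?thesis using norm_diff_triangle_ineq[of "(u (Suc (Suc l)) + u (Suc l)) / of_real (r (Suc (Suc l)) + r (Suc l))"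
      "sgn (u (Suc l))" "sgn (u (Suc l))" "(u (Suc l) + u l) / of_real (r (Suc l) + r l)"] c1 c2
      norm_diff_triangle_le[OF c1 c2] by simp
qed

text \<open>Discrete product rule on \<open>qerr_decomp\<close>. Apart from
  \<open>\<delta> ^ 3\<close> and \<open>\<delta> * \<delta>2\<close>, every term multiplies either
  a second increment of the modulus or a change of direction, and both are summable.\<close>

lemma qerr_step:
  assumes \<epsilon>: "0 < \<epsilon>" "\<epsilon> \<le> 1" and l: "l < n"
  shows "norm (qerr \<epsilon> (u (Suc (Suc l))) (u (Suc l)) - qerr \<epsilon> (u (Suc l)) (u l)) \<le>
     1 / \<epsilon>\<^sup>2 * (7 * \<delta> * \<bar>d (Suc l) - d l\<bar> + \<delta> * \<delta>2 + 8 * \<delta> ^ 3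
       + ((d (Suc l))\<^sup>2 * norm (sgn (u (Suc (Suc l))) - sgn (u (Suc l))) + (d l)\<^sup>2 * norm (sgn (u (Suc l)) - sgn (u l))))"
proof -
  define g where "g k = ln (\<epsilon> + r k)" for k
  define D where "D k = u (Suc k) - u k" for k
  define kp where "kp k = kap \<epsilon> (r k) (d k)" for k
  define N where "N k = (u (Suc k) + u k) / of_real (r (Suc k) + r k)" for k
  define x where "x = \<bar>d (Suc l) - d l\<bar>"
  define s0 s1 where "s0 = norm (sgn (u (Suc l)) - sgn (u l))" and "s1 = norm (sgn (u (Suc (Suc l))) - sgn (u (Suc l)))"
  have q: "qerr \<epsilon> (u (Suc k)) (u k) = of_real ((g (Suc k) - g k) / 2) * D k + of_real ((d k)\<^sup>2 * kp k) * N k" for k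
    unfolding qerr_decomp[OF \<epsilon>(1)] g_def D_def kp_def N_def d_def ..
  have e: "1 / \<epsilon> \<le> 1 / \<epsilon>\<^sup>2" "0 < 1 / \<epsilon>" "0 < 1 / \<epsilon>\<^sup>2"
    using \<epsilon> by (auto intro!: divide_left_mono simp: power2_eq_square mult_le_one)
  have d0: "\<bar>d l\<bar> \<le> \<delta>" and d1: "\<bar>d (Suc l)\<bar> \<le> \<delta>" using d_bound l by auto
  have x: "0 \<le> x" "x \<le> 2 * \<delta>" using d0 d1 by (auto simp: x_def)
  have D0: "norm (D l) \<le> \<delta>" using step l by (simp add: D_def)
  have D2: "norm (D (Suc l) - D l) \<le> \<delta>2" using second[OF l] by (simp add: D_def algebra_simps)
  have gg: "\<bar>g (Suc k) - g k\<bar> \<le> \<bar>d k\<bar> / \<epsilon>" for k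
    unfolding g_def d_def using ln_lipschitz[of \<epsilon> "r (Suc k)" "r k"] \<epsilon> by simp
  have k0: "\<bar>kp k\<bar> \<le> 1 / \<epsilon>" for k unfolding kp_def d_def using \<epsilon> by (intro kap_bound) auto
  have N1: "norm (N k) \<le> 1" for k unfolding N_def by (rule norm_sum_quotient_le_one)
  have N2: "norm (N (Suc l) - N l) \<le> s1 + s0" unfolding N_def s0_def s1_def by (rule direction_factor_step[OF l])
  have g2: "\<bar>(g (Suc (Suc l)) - g (Suc l)) - (g (Suc l) - g l)\<bar> \<le> 1 / \<epsilon>\<^sup>2 * (x + 2 * \<delta>\<^sup>2)"
  proof -
    \<comment> \<open>Both neighbours are expanded about the middle modulus, so the first-order
      terms combine into \<open>d (Suc l) - d l\<close> over a single denominator.\<close>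
    have a: "\<bar>g k' - g (Suc l) - (r k' - r (Suc l)) / (\<epsilon> + r (Suc l))\<bar> \<le> 1 / \<epsilon>\<^sup>2 * (r k' - r (Suc l))\<^sup>2" for k'
    proof -
      have "\<bar>g k' - g (Suc l) - (r k' - r (Suc l)) / (\<epsilon> + r (Suc l))\<bar>
          \<le> (r k' - r (Suc l))\<^sup>2 / ((\<epsilon> + r (Suc l)) * (\<epsilon> + r k'))"
        unfolding g_def using \<epsilon> by (intro ln_taylor_bound) auto
      also have "\<dots> \<le> (r k' - r (Suc l))\<^sup>2 / (\<epsilon> * \<epsilon>)"
        using \<epsilon> by (intro divide_left_mono mult_mono) (auto intro!: mult_pos_pos add_pos_nonneg)
      finally show ?thesis by (simp add: power2_eq_square)
    qed
    have dd: "(d k)\<^sup>2 \<le> \<delta>\<^sup>2" if "k \<le> n" for k using d_sq_bound(2)[OF that] .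
    have b1: "\<bar>g (Suc (Suc l)) - g (Suc l) - d (Suc l) / (\<epsilon> + r (Suc l))\<bar> \<le> 1 / \<epsilon>\<^sup>2 * \<delta>\<^sup>2"
      using a[of "Suc (Suc l)"] mult_left_mono[OF dd[of "Suc l"], of "1 / \<epsilon>\<^sup>2"] l e by (simp add: d_def)
    have b0: "\<bar>g l - g (Suc l) + d l / (\<epsilon> + r (Suc l))\<bar> \<le> 1 / \<epsilon>\<^sup>2 * \<delta>\<^sup>2"
      using a[of l] mult_left_mono[OF dd[of l], of "1 / \<epsilon>\<^sup>2"] l e
      by (simp add: d_def power2_commute[of "r l"] diff_divide_distrib algebra_simps)
    have c: "\<bar>(d (Suc l) - d l) / (\<epsilon> + r (Suc l))\<bar> \<le> 1 / \<epsilon>\<^sup>2 * x"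
    proof -
      have "\<bar>(d (Suc l) - d l) / (\<epsilon> + r (Suc l))\<bar> = x / (\<epsilon> + r (Suc l))"
        using \<epsilon> by (simp add: x_def abs_divide add_pos_nonneg)
      also have "\<dots> \<le> x / \<epsilon>" using \<epsilon> x by (intro divide_left_mono) (auto simp: add_pos_nonneg)
      also have "\<dots> \<le> 1 / \<epsilon>\<^sup>2 * x" using mult_right_mono[OF e(1) x(1)] by simp
      finally show ?thesis .
    qed
    have "(g (Suc (Suc l)) - g (Suc l)) - (g (Suc l) - g l)
       = (g (Suc (Suc l)) - g (Suc l) - d (Suc l) / (\<epsilon> + r (Suc l))) + (g l - g (Suc l) + d l / (\<epsilon> + r (Suc l)))
         + (d (Suc l) - d l) / (\<epsilon> + r (Suc l))" by (simp add: diff_divide_distrib)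
    then show ?thesis using b1 b0 c unfolding distrib_left by linarith
  qed
  have A: "norm (of_real ((g (Suc (Suc l)) - g (Suc l)) / 2) * D (Suc l) - of_real ((g (Suc l) - g l) / 2) * D l)
     \<le> 1 / \<epsilon>\<^sup>2 * (\<delta> * x + 2 * \<delta> ^ 3 + \<delta> * \<delta>2)"
  proof -
    have "of_real ((g (Suc (Suc l)) - g (Suc l)) / 2) * D (Suc l) - of_real ((g (Suc l) - g l) / 2) * D l
      = of_real (((g (Suc (Suc l)) - g (Suc l)) - (g (Suc l) - g l)) / 2) * D l
        + of_real ((g (Suc (Suc l)) - g (Suc l)) / 2) * (D (Suc l) - D l)"
      by (simp add: algebra_simps diff_divide_distrib)
    also have "norm \<dots> \<le> \<bar>((g (Suc (Suc l)) - g (Suc l)) - (g (Suc l) - g l)) / 2\<bar> * norm (D l)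
        + \<bar>(g (Suc (Suc l)) - g (Suc l)) / 2\<bar> * norm (D (Suc l) - D l)"
      by (rule norm_of_real_mult_add_le)
    also have "\<dots> \<le> (1 / \<epsilon>\<^sup>2 * (x + 2 * \<delta>\<^sup>2)) * \<delta> + (1 / \<epsilon>\<^sup>2 * \<delta>) * \<delta>2"
    proof (intro add_mono mult_mono D0 D2)
      show "\<bar>((g (Suc (Suc l)) - g (Suc l)) - (g (Suc l) - g l)) / 2\<bar> \<le> 1 / \<epsilon>\<^sup>2 * (x + 2 * \<delta>\<^sup>2)"
        by (rule abs_half_le[OF g2])
      have "\<bar>g (Suc (Suc l)) - g (Suc l)\<bar> \<le> 1 / \<epsilon> * \<delta>" using gg[of "Suc l"] divide_right_mono[OF d1, of \<epsilon>] \<epsilon> by simp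
      also have "\<dots> \<le> 1 / \<epsilon>\<^sup>2 * \<delta>" using e nonneg by (intro mult_right_mono)
      finally show "\<bar>(g (Suc (Suc l)) - g (Suc l)) / 2\<bar> \<le> 1 / \<epsilon>\<^sup>2 * \<delta>"
        by (rule abs_half_le)
    qed (use e x nonneg in auto)
    also have "\<dots> = 1 / \<epsilon>\<^sup>2 * (\<delta> * x + 2 * \<delta> ^ 3 + \<delta> * \<delta>2)"
      by (simp add: algebra_simps power2_eq_square power3_eq_cube add_divide_distrib)
    finally show ?thesis .
  qed
  have kd: "\<bar>kp (Suc l) - kp l\<bar> \<le> 1 / \<epsilon>\<^sup>2 * (6 * \<delta>)"
  proof -
    have "\<bar>kp (Suc l) - kp l\<bar> \<le> 2 / \<epsilon>\<^sup>2 * (\<bar>r (Suc l) - r l\<bar> + \<bar>d (Suc l) - d l\<bar>)"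
      unfolding kp_def using \<epsilon> by (intro kap_lipschitz) (auto simp: d_def)
    also have "\<dots> \<le> 2 / \<epsilon>\<^sup>2 * (\<delta> + 2 * \<delta>)"
      using d0 x e unfolding x_def d_def[of l, symmetric] by (intro mult_left_mono add_mono) auto
    finally show ?thesis by simp
  qed
  have d10: "\<bar>(d (Suc l))\<^sup>2 - (d l)\<^sup>2\<bar> \<le> 2 * \<delta> * x"
  proof -
    have "(d (Suc l))\<^sup>2 - (d l)\<^sup>2 = (d (Suc l) + d l) * (d (Suc l) - d l)" by (simp add: power2_eq_square algebra_simps)
    moreover have "\<bar>d (Suc l) + d l\<bar> \<le> 2 * \<delta>" using d0 d1 by linarith
    ultimately show ?thesis using x mult_right_mono[of "\<bar>d (Suc l) + d l\<bar>" "2 * \<delta>" x] by (simp add: abs_mult x_def)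
  qed
  have s1b: "s1 \<le> 2"
  proof -
    have "s1 \<le> norm (sgn (u (Suc (Suc l)))) + norm (sgn (u (Suc l)))" unfolding s1_def by (rule norm_triangle_ineq4)
    also have "\<dots> \<le> 2" by (simp add: norm_sgn)
    finally show ?thesis .
  qed
  have s: "0 \<le> s0" "0 \<le> s1" by (auto simp: s0_def s1_def)
  \<comment> \<open>Exchanges \<open>(d l)\<^sup>2\<close> for \<open>(d (Suc l))\<^sup>2\<close> in
    front of s1, so that each change of direction meets the modulus increment of its own step; the
    cost uses s1 \<le> 2.\<close>
  have ds: "(d l)\<^sup>2 * (s1 + s0) \<le> (d (Suc l))\<^sup>2 * s1 + (d l)\<^sup>2 * s0 + 4 * \<delta> * x"
  proof -
    have "((d l)\<^sup>2 - (d (Suc l))\<^sup>2) * s1 \<le> (2 * \<delta> * x) * 2"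
      using d10 s s1b nonneg x by (intro mult_mono) auto
    then show ?thesis by (simp add: algebra_simps)
  qed
  have B: "norm (of_real ((d (Suc l))\<^sup>2 * kp (Suc l)) * N (Suc l) - of_real ((d l)\<^sup>2 * kp l) * N l)
     \<le> 1 / \<epsilon>\<^sup>2 * (6 * \<delta> * x + 6 * \<delta> ^ 3 + ((d (Suc l))\<^sup>2 * s1 + (d l)\<^sup>2 * s0))"
  proof -
    have eq: "of_real ((d (Suc l))\<^sup>2 * kp (Suc l)) * N (Suc l) - of_real ((d l)\<^sup>2 * kp l) * N l
       = of_real (((d (Suc l))\<^sup>2 - (d l)\<^sup>2) * kp (Suc l) + (d l)\<^sup>2 * (kp (Suc l) - kp l)) * N (Suc l)
         + of_real ((d l)\<^sup>2 * kp l) * (N (Suc l) - N l)"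
      by (simp add: algebra_simps)
    have "norm (of_real ((d (Suc l))\<^sup>2 * kp (Suc l)) * N (Suc l) - of_real ((d l)\<^sup>2 * kp l) * N l)
       \<le> \<bar>((d (Suc l))\<^sup>2 - (d l)\<^sup>2) * kp (Suc l) + (d l)\<^sup>2 * (kp (Suc l) - kp l)\<bar> * norm (N (Suc l))
         + \<bar>(d l)\<^sup>2 * kp l\<bar> * norm (N (Suc l) - N l)"
      unfolding eq by (rule norm_of_real_mult_add_le)
    also have "\<dots> \<le> ((2 * \<delta> * x) * (1 / \<epsilon>\<^sup>2) + \<delta>\<^sup>2 * (1 / \<epsilon>\<^sup>2 * (6 * \<delta>))) * 1 + ((d l)\<^sup>2 * (1 / \<epsilon>\<^sup>2)) * (s1 + s0)"
    proof (rule add_mono[OF mult_mono[OF _ N1] mult_mono[OF _ N2]])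
      have dx: "0 \<le> 2 * \<delta> * x" using x nonneg by simp
      have dl: "\<bar>(d l)\<^sup>2\<bar> \<le> \<delta>\<^sup>2" using d_sq_bound(2)[of l] l by simp
      have "\<bar>((d (Suc l))\<^sup>2 - (d l)\<^sup>2) * kp (Suc l)\<bar> \<le> (2 * \<delta> * x) * (1 / \<epsilon>\<^sup>2)"
        unfolding abs_mult[of "(d (Suc l))\<^sup>2 - (d l)\<^sup>2"]
        by (rule mult_mono[OF d10 order_trans[OF k0 e(1)] dx abs_ge_zero])
      moreover have "\<bar>(d l)\<^sup>2 * (kp (Suc l) - kp l)\<bar> \<le> \<delta>\<^sup>2 * (1 / \<epsilon>\<^sup>2 * (6 * \<delta>))"
        unfolding abs_mult[of "(d l)\<^sup>2"] by (rule mult_mono[OF dl kd zero_le_power2 abs_ge_zero])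
      ultimately show "\<bar>((d (Suc l))\<^sup>2 - (d l)\<^sup>2) * kp (Suc l) + (d l)\<^sup>2 * (kp (Suc l) - kp l)\<bar>
          \<le> (2 * \<delta> * x) * (1 / \<epsilon>\<^sup>2) + \<delta>\<^sup>2 * (1 / \<epsilon>\<^sup>2 * (6 * \<delta>))"
        by (rule order_trans[OF abs_triangle_ineq add_mono])
      show "\<bar>(d l)\<^sup>2 * kp l\<bar> \<le> (d l)\<^sup>2 * (1 / \<epsilon>\<^sup>2)"
        unfolding abs_mult[of "(d l)\<^sup>2"] using mult_left_mono[OF order_trans[OF k0[of l] e(1)], of "(d l)\<^sup>2"] by simp
      show "0 \<le> 2 * \<delta> * x * (1 / \<epsilon>\<^sup>2) + \<delta>\<^sup>2 * (1 / \<epsilon>\<^sup>2 * (6 * \<delta>))"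
        using x e nonneg by (intro add_nonneg_nonneg mult_nonneg_nonneg) auto
    qed simp_all
    also have "\<dots> = 1 / \<epsilon>\<^sup>2 * (2 * \<delta> * x + 6 * \<delta> ^ 3 + (d l)\<^sup>2 * (s1 + s0))"
      by (simp add: algebra_simps power2_eq_square power3_eq_cube add_divide_distrib)
    also have "\<dots> \<le> 1 / \<epsilon>\<^sup>2 * (6 * \<delta> * x + 6 * \<delta> ^ 3 + ((d (Suc l))\<^sup>2 * s1 + (d l)\<^sup>2 * s0))"
      using ds e by (intro mult_left_mono) auto
    finally show ?thesis .
  qed
  have "qerr \<epsilon> (u (Suc (Suc l))) (u (Suc l)) - qerr \<epsilon> (u (Suc l)) (u l)
     = (of_real ((g (Suc (Suc l)) - g (Suc l)) / 2) * D (Suc l) - of_real ((g (Suc l) - g l) / 2) * D l)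
       + (of_real ((d (Suc l))\<^sup>2 * kp (Suc l)) * N (Suc l) - of_real ((d l)\<^sup>2 * kp l) * N l)"
    unfolding q by simp
  also have "norm \<dots> \<le> 1 / \<epsilon>\<^sup>2 * (\<delta> * x + 2 * \<delta> ^ 3 + \<delta> * \<delta>2)
      + 1 / \<epsilon>\<^sup>2 * (6 * \<delta> * x + 6 * \<delta> ^ 3 + ((d (Suc l))\<^sup>2 * s1 + (d l)\<^sup>2 * s0))"
    by (rule order_trans[OF norm_triangle_ineq add_mono[OF A B]])
  also have "\<dots> = 1 / \<epsilon>\<^sup>2 * (7 * \<delta> * x + \<delta> * \<delta>2 + 8 * \<delta> ^ 3 + ((d (Suc l))\<^sup>2 * s1 + (d l)\<^sup>2 * s0))"
    unfolding distrib_left[symmetric] by (simp add: algebra_simps)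
  finally show ?thesis unfolding x_def s0_def s1_def .
qed

text \<open>63 = 14 + 1 + 48: variation of d, second differences, and two copies of the directional
  sum. With \<delta> and V of order \<tau> and n of order 1/\<tau>, the total is of order \<tau>^2 /
  \<epsilon>^2.\<close>

lemma qerr_variation:
  assumes \<epsilon>: "0 < \<epsilon>" "\<epsilon> \<le> 1"
  shows "(\<Sum>l<n. norm (qerr \<epsilon> (u (Suc (Suc l))) (u (Suc l)) - qerr \<epsilon> (u (Suc l)) (u l)))
     \<le> 1 / \<epsilon>\<^sup>2 * (63 * \<delta> * V + 8 * real n * \<delta> ^ 3)"
proof -
  let ?w = "\<lambda>l. (d l)\<^sup>2 * norm (sgn (u (Suc l)) - sgn (u l))"
  have "(\<Sum>l<n. norm (qerr \<epsilon> (u (Suc (Suc l))) (u (Suc l)) - qerr \<epsilon> (u (Suc l)) (u l)))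
    \<le> (\<Sum>l<n. 1 / \<epsilon>\<^sup>2 * (7 * \<delta> * \<bar>d (Suc l) - d l\<bar> + \<delta> * \<delta>2 + 8 * \<delta> ^ 3 + (?w (Suc l) + ?w l)))"
    by (intro sum_mono qerr_step \<epsilon>) auto
  also have "\<dots> = 1 / \<epsilon>\<^sup>2 * (7 * \<delta> * (\<Sum>l<n. \<bar>d (Suc l) - d l\<bar>) + \<delta> * (real n * \<delta>2) + 8 * real n * \<delta> ^ 3
      + ((\<Sum>l<n. ?w (Suc l)) + (\<Sum>l<n. ?w l)))"
    by (simp add: sum_distrib_left[symmetric] sum.distrib sum_divide_distrib[symmetric] algebra_simps)
  also have "\<dots> \<le> 1 / \<epsilon>\<^sup>2 * (7 * \<delta> * (2 * V) + \<delta> * V + 8 * real n * \<delta> ^ 3 + (24 * \<delta> * V + 24 * \<delta> * V))"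
  proof (intro mult_left_mono add_mono)
    have "(\<Sum>l<n. ?w (Suc l)) \<le> (\<Sum>l\<le>n. ?w l)"
      by (simp add: sum.atMost_shift)
    then show "(\<Sum>l<n. ?w (Suc l)) \<le> 24 * \<delta> * V" using direction_variation by linarith
    have "(\<Sum>l<n. ?w l) \<le> (\<Sum>l\<le>n. ?w l)"
      by (simp add: lessThan_Suc_atMost[symmetric])
    then show "(\<Sum>l<n. ?w l) \<le> 24 * \<delta> * V" using direction_variation by linarith
  qed (use d_variation V_nonneg nonneg \<epsilon> in auto)
  finally show ?thesis by (simp add: algebra_simps)
qed

end

section \<open>Energy estimates for the discrete error\<close>

lemma abel_summation:
  fixes P W :: "nat \<Rightarrow> 'a::comm_ring_1"
  shows "(\<Sum>l<Suc k. P l * (W (Suc l) - W l)) =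
     P k * W (Suc k) - P 0 * W 0 - (\<Sum>l<k. (P (Suc l) - P l) * W (Suc l))"
  by (induction k) (simp_all add: algebra_simps)

lemma abs_scaled_sum_le:
  fixes h :: real
  assumes "0 < h" "\<And>j. j \<in> J \<Longrightarrow> \<bar>f j\<bar> \<le> g j"
  shows "\<bar>h * sum f J\<bar> \<le> h * sum g J"
proof -
  have "\<bar>sum f J\<bar> \<le> sum g J" by (rule order_trans[OF sum_abs sum_mono]) (use assms in auto)
  then show ?thesis using assms(1) by (simp add: abs_mult)
qed

lemma Re_mult_cnj_inner: "Re (z * cnj w) = inner z w"
  by (simp add: inner_complex_def)

lemma summation_by_parts_dx:
  assumes "0 < M" "W 0 = 0" "W (2 * M) = 0" "0 < h"
  shows "(\<Sum>j\<in>{1..<2 * M}. inner (dx2 h V j) (W j)) = - (\<Sum>j<2 * M. inner (dx_plus h V j) (dx_plus h W j))"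
    "(\<Sum>j\<in>{1..<2 * M}. dx2 h V j * cnj (W j)) = - (\<Sum>j<2 * M. dx_plus h V j * cnj (dx_plus h W j))"
proof -
  obtain k where k: "2 * M = Suc k" using assms by (cases "2 * M") auto
  define P where "P j = V (Suc j) - V j" for j
  have "(\<Sum>j<2 * M. dx_plus h V j * cnj (dx_plus h W j))
      = (\<Sum>j<Suc k. P j * (cnj (W (Suc j)) - cnj (W j))) / of_real (h\<^sup>2)"
    unfolding k sum_divide_distrib by (intro sum.cong) (auto simp: dx_plus_def P_def power2_eq_square)
  also have "(\<Sum>j<Suc k. P j * (cnj (W (Suc j)) - cnj (W j))) = - (\<Sum>l<k. (P (Suc l) - P l) * cnj (W (Suc l)))"
    using abel_summation[of P "\<lambda>j. cnj (W j)" k] assms(2,3) unfolding k by simp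
  also have "(\<Sum>l<k. (P (Suc l) - P l) * cnj (W (Suc l))) = (\<Sum>j\<in>{1..<2 * M}. (P j - P (j - 1)) * cnj (W j))"
    unfolding k One_nat_def sum.atLeast_Suc_lessThan_Suc_shift by (simp add: o_def atLeast0LessThan)
  also have "- (\<Sum>j\<in>{1..<2 * M}. (P j - P (j - 1)) * cnj (W j)) / of_real (h\<^sup>2) = - (\<Sum>j\<in>{1..<2 * M}. dx2 h V j * cnj (W j))"
    unfolding minus_divide_left[symmetric] sum_divide_distrib
    by (intro arg_cong[where f=uminus] sum.cong) (auto simp: dx2_def P_def)
  finally show *: "(\<Sum>j\<in>{1..<2 * M}. dx2 h V j * cnj (W j)) = - (\<Sum>j<2 * M. dx_plus h V j * cnj (dx_plus h W j))"
    by simp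
  show "(\<Sum>j\<in>{1..<2 * M}. inner (dx2 h V j) (W j)) = - (\<Sum>j<2 * M. inner (dx_plus h V j) (dx_plus h W j))"
    using arg_cong[OF *, of Re] by (simp only: Re_sum uminus_complex.sel Re_mult_cnj_inner)
qed

text \<open>Uses the mean of \<open>flog\<close> instead of \<open>Qtilde\<close>: the nonlinear
  terms then cancel exactly through the differential equation, and the residual is Lipschitz in time
  even at zeros of the solution. The difference to \<open>Qtilde\<close> is \<open>qerr\<close>,
  handled apart.\<close>

definition cn_residual :: "real \<Rightarrow> real \<Rightarrow> real \<Rightarrow> real \<Rightarrow> real \<Rightarrow> nat \<Rightarrow> (nat \<Rightarrow> nat \<Rightarrow> complex) \<Rightarrow> nat \<Rightarrow> nat \<Rightarrow> complex" where
  "cn_residual h \<tau> lam \<mu> \<epsilon> M A l j = \<i> * dt_plus \<tau> A l j + dx2 h (half_step A l) j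
         - of_real (lam * delta_coeff h M j) * half_step A l j
         - of_real \<mu> * ((flog \<epsilon> (A (Suc l) j) + flog \<epsilon> (A l j)) / 2)"

text \<open>At the interface node the scheme is only first order consistent.\<close>

definition res_weight :: "real \<Rightarrow> real \<Rightarrow> real \<Rightarrow> nat \<Rightarrow> nat \<Rightarrow> real" where
  "res_weight h \<tau> \<kappa> M j = \<kappa> * (\<tau>\<^sup>2 + h\<^sup>2 + (if j = M then h else 0))"

text \<open>A is the exact solution on the grid, U the scheme, n the last level considered. The
  constants m and \<kappa> will be fixed before \<epsilon>. \<open>R2\<close> supplies the time
  increments of the residual for summation by parts in time.\<close>

locale cnfd_grid =
  fixes h \<tau> lam \<mu> \<epsilon> m \<kappa> T a :: real and M n :: nat and A U :: "nat \<Rightarrow> nat \<Rightarrow> complex"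
  assumes M: "0 < M" and h: "0 < h" and ha: "h * real M = a" and \<tau>: "0 < \<tau>" and n\<tau>: "real n * \<tau> \<le> T"
    and \<epsilon>: "0 < \<epsilon>" "\<epsilon> \<le> 1" and m: "0 \<le> m" and \<kappa>: "0 \<le> \<kappa>"
    and scheme: "\<And>l j. l < n \<Longrightarrow> j \<in> {1..<2 * M} \<Longrightarrow>
        \<i> * dt_plus \<tau> U l j = - dx2 h (half_step U l) j
               + of_real (lam * delta_coeff h M j) * half_step U l j
               + of_real \<mu> * Qtilde \<epsilon> (U (Suc l) j) (U l j)"
    and bdry: "\<And>l. l \<le> n \<Longrightarrow> A l 0 = U l 0" "\<And>l. l \<le> n \<Longrightarrow> A l (2 * M) = U l (2 * M)"
    and init: "\<And>j. j \<le> 2 * M \<Longrightarrow> A 0 j = U 0 j"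
    and Abound: "\<And>l j. l \<le> n \<Longrightarrow> j \<le> 2 * M \<Longrightarrow> norm (A l j) \<le> m"
    and Astep: "\<And>l j. l < n \<Longrightarrow> j \<le> 2 * M \<Longrightarrow> norm (A (Suc l) j - A l j) \<le> m * \<tau>"
    and Asecond: "\<And>l j. Suc l < n \<Longrightarrow> j \<le> 2 * M \<Longrightarrow> norm (A (Suc (Suc l)) j - 2 * A (Suc l) j + A l j) \<le> m * \<tau>\<^sup>2"
    and R1: "\<And>l j. l < n \<Longrightarrow> j \<in> {1..<2 * M} \<Longrightarrow> norm (cn_residual h \<tau> lam \<mu> \<epsilon> M A l j) \<le> res_weight h \<tau> \<kappa> M j"
    and R2: "\<And>l j. Suc l < n \<Longrightarrow> j \<in> {1..<2 * M} \<Longrightarrow>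
        norm (cn_residual h \<tau> lam \<mu> \<epsilon> M A (Suc l) j - cn_residual h \<tau> lam \<mu> \<epsilon> M A l j) \<le> \<tau> * res_weight h \<tau> \<kappa> M j"
begin

abbreviation Rp :: "nat \<Rightarrow> nat \<Rightarrow> complex" where "Rp \<equiv> cn_residual h \<tau> lam \<mu> \<epsilon> M A"
abbreviation w :: "nat \<Rightarrow> real" where "w \<equiv> res_weight h \<tau> \<kappa> M"
definition e :: "nat \<Rightarrow> nat \<Rightarrow> complex" where "e l j = A l j - U l j"
definition Nn :: "nat \<Rightarrow> nat \<Rightarrow> complex" where
  "Nn l j = Qtilde \<epsilon> (A (Suc l) j) (A l j) - Qtilde \<epsilon> (U (Suc l) j) (U l j)"
definition Rr :: "nat \<Rightarrow> nat \<Rightarrow> complex" where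
  "Rr l j = Rp l j + of_real \<mu> * qerr \<epsilon> (A (Suc l) j) (A l j)"
definition N2 :: "nat \<Rightarrow> real" where "N2 l = h * (\<Sum>j\<in>{1..<2 * M}. (norm (e l j))\<^sup>2)"
definition D2 :: "nat \<Rightarrow> real" where "D2 l = h * (\<Sum>j<2 * M. (norm (dx_plus h (e l) j))\<^sup>2)"

end

text \<open>\<open>X\<close>, \<open>Y\<close> and \<open>E\<close> bound the \<open>H\<^sup>1\<close> seminorm, the \<open>L\<^sup>2\<close> norm and the maximum norm of the error over
  all time levels.\<close>

locale cnfd_err = cnfd_grid +
  fixes X Y E :: real
  assumes XYE: "0 \<le> X" "0 \<le> Y" "0 \<le> E"
    and Y: "\<And>l. l \<le> n \<Longrightarrow> N2 l \<le> Y\<^sup>2"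
    and X: "\<And>l. l \<le> n \<Longrightarrow> D2 l \<le> X\<^sup>2"
    and E: "\<And>l j. l \<le> n \<Longrightarrow> j \<le> 2 * M \<Longrightarrow> norm (e l j) \<le> E"
begin

text \<open>Bounds the pairing of all sources with a mesh function whose L2 norm is at most Y and
  whose value at the interface is at most E.\<close>

definition B0 :: real where
  "B0 = (\<kappa> * (\<tau>\<^sup>2 + h\<^sup>2) + 2 * \<bar>\<mu>\<bar> * m\<^sup>2 * \<tau>\<^sup>2 / \<epsilon>) * (sqrt (2 * a) * Y) + \<kappa> * h\<^sup>2 * E"

lemma a_pos: "0 < a" using M h ha by (metis mult_pos_pos of_nat_0_less_iff)

lemma T_nonneg: "0 \<le> T"
  using n\<tau> \<tau> mult_nonneg_nonneg[of "real n" \<tau>] by linarith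

lemma error_eq:
  assumes "l < n" "j \<in> {1..<2 * M}"
  shows "\<i> * dt_plus \<tau> e l j = - dx2 h (half_step e l) j
      + of_real (lam * delta_coeff h M j) * half_step e l j + of_real \<mu> * Nn l j + Rr l j"
proof -
  have 1: "dt_plus \<tau> e l j = dt_plus \<tau> A l j - dt_plus \<tau> U l j"
    unfolding dt_plus_def e_def by (simp add: diff_divide_distrib add_divide_distrib)
  have 2: "half_step e l k = half_step A l k - half_step U l k" for k
    unfolding half_step_def e_def by (simp add: diff_divide_distrib add_divide_distrib)
  have 3: "dx2 h (half_step e l) j = dx2 h (half_step A l) j - dx2 h (half_step U l) j"
    unfolding dx2_def 2 by (simp add: diff_divide_distrib[symmetric] algebra_simps)
  show ?thesis unfolding 1 2 3 right_diff_distrib scheme[OF assms] Nn_def Rr_def cn_residual_def qerr_def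
    by (simp add: algebra_simps)
qed

lemma e_bdry: "l \<le> n \<Longrightarrow> e l 0 = 0" "l \<le> n \<Longrightarrow> e l (2 * M) = 0"
  using bdry by (auto simp: e_def)

lemma e_init: "j \<le> 2 * M \<Longrightarrow> e 0 j = 0" using init by (simp add: e_def)

lemma half_bdry: "l < n \<Longrightarrow> half_step e l 0 = 0" "l < n \<Longrightarrow> half_step e l (2 * M) = 0"
  using e_bdry by (auto simp: half_step_def)

lemma mesh_sum_cauchy:
  assumes "h * (\<Sum>j\<in>{1..<2 * M}. (norm (v j))\<^sup>2) \<le> y\<^sup>2" "0 \<le> y"
  shows "h * (\<Sum>j\<in>{1..<2 * M}. norm (v j :: complex)) \<le> sqrt (2 * a) * y"
proof (rule power2_le_imp_le)
  let ?S = "\<Sum>j\<in>{1..<2 * M}. norm (v j)" and ?Q = "\<Sum>j\<in>{1..<2 * M}. (norm (v j))\<^sup>2"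
  have Q: "0 \<le> ?Q" by (simp add: sum_nonneg)
  have "?S\<^sup>2 = (\<Sum>j\<in>{1..<2 * M}. 1 * norm (v j))\<^sup>2" by simp
  also have "\<dots> \<le> (\<Sum>j\<in>{1..<2 * M}. 1\<^sup>2) * ?Q" by (rule Cauchy_Schwarz_ineq_sum)
  also have "\<dots> \<le> real (2 * M) * ?Q" using Q by (intro mult_right_mono) auto
  finally have "h\<^sup>2 * ?S\<^sup>2 \<le> h\<^sup>2 * (real (2 * M) * ?Q)" by (intro mult_left_mono) auto
  also have "\<dots> = (2 * a) * (h * ?Q)" unfolding ha[symmetric] by (simp add: power2_eq_square)
  also have "\<dots> \<le> (2 * a) * y\<^sup>2" using a_pos assms by (intro mult_left_mono) auto
  finally show "(h * ?S)\<^sup>2 \<le> (sqrt (2 * a) * y)\<^sup>2" using a_pos by (simp add: power_mult_distrib)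
qed (use assms a_pos in auto)

text \<open>The residual is only of order h at the interface, but this single node carries the
  quadrature weight h; that restores order h^2, at the price of the maximum norm.\<close>

lemma weighted_sum:
  assumes "h * (\<Sum>j\<in>{1..<2 * M}. (norm (v j))\<^sup>2) \<le> Y\<^sup>2" "norm (v M) \<le> E"
  shows "h * (\<Sum>j\<in>{1..<2 * M}. w j * norm (v j :: complex)) \<le> \<kappa> * (\<tau>\<^sup>2 + h\<^sup>2) * (sqrt (2 * a) * Y) + \<kappa> * h\<^sup>2 * E"
proof -
  let ?J = "{1..<2 * M}"
  have MJ: "M \<in> ?J" using M by auto
  have "(\<Sum>j\<in>?J. w j * norm (v j)) = (\<Sum>j\<in>?J. \<kappa> * (\<tau>\<^sup>2 + h\<^sup>2) * norm (v j) + (if j = M then \<kappa> * h * norm (v M) else 0))"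
    by (intro sum.cong) (auto simp: res_weight_def algebra_simps)
  also have "\<dots> = \<kappa> * (\<tau>\<^sup>2 + h\<^sup>2) * (\<Sum>j\<in>?J. norm (v j)) + \<kappa> * h * norm (v M)"
    using MJ by (simp add: sum.distrib sum_distrib_left)
  finally have "h * (\<Sum>j\<in>?J. w j * norm (v j)) = \<kappa> * (\<tau>\<^sup>2 + h\<^sup>2) * (h * (\<Sum>j\<in>?J. norm (v j))) + \<kappa> * h\<^sup>2 * norm (v M)"
    by (simp add: power2_eq_square algebra_simps)
  also have "\<dots> \<le> \<kappa> * (\<tau>\<^sup>2 + h\<^sup>2) * (sqrt (2 * a) * Y) + \<kappa> * h\<^sup>2 * E"
    using \<kappa> assms XYE by (intro add_mono mult_left_mono mesh_sum_cauchy) auto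
  finally show ?thesis .
qed

lemma Rr_bound:
  assumes "l < n" "j \<in> {1..<2 * M}" shows "norm (Rr l j) \<le> w j + 2 * \<bar>\<mu>\<bar> * m\<^sup>2 * \<tau>\<^sup>2 / \<epsilon>"
proof -
  have "norm (qerr \<epsilon> (A (Suc l) j) (A l j)) \<le> 2 / \<epsilon> * (norm (A (Suc l) j - A l j))\<^sup>2"
    by (rule qerr_bound[OF \<epsilon>(1)])
  also have "\<dots> \<le> 2 / \<epsilon> * (m * \<tau>)\<^sup>2"
    using Astep[of l j] assms \<epsilon> by (intro mult_left_mono power_mono) auto
  finally have q: "\<bar>\<mu>\<bar> * norm (qerr \<epsilon> (A (Suc l) j) (A l j)) \<le> \<bar>\<mu>\<bar> * (2 / \<epsilon> * (m * \<tau>)\<^sup>2)" by (intro mult_left_mono) auto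
  have "norm (Rr l j) \<le> norm (Rp l j) + \<bar>\<mu>\<bar> * norm (qerr \<epsilon> (A (Suc l) j) (A l j))"
    unfolding Rr_def by (rule order_trans[OF norm_triangle_ineq]) (simp add: norm_mult)
  also have "\<dots> \<le> w j + \<bar>\<mu>\<bar> * (2 / \<epsilon> * (m * \<tau>)\<^sup>2)" by (rule add_mono[OF R1[OF assms] q])
  finally show ?thesis by (simp add: power_mult_distrib mult_ac)
qed

lemma Rr_sum:
  assumes "l < n" "h * (\<Sum>j\<in>{1..<2 * M}. (norm (v j))\<^sup>2) \<le> Y\<^sup>2" "norm (v M :: complex) \<le> E"
  shows "h * (\<Sum>j\<in>{1..<2 * M}. norm (Rr l j) * norm (v j)) \<le> B0"
proof -
  let ?c = "2 * \<bar>\<mu>\<bar> * m\<^sup>2 * \<tau>\<^sup>2 / \<epsilon>"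
  have "h * (\<Sum>j\<in>{1..<2 * M}. norm (Rr l j) * norm (v j)) \<le> h * (\<Sum>j\<in>{1..<2 * M}. (w j + ?c) * norm (v j))"
    using h Rr_bound[OF assms(1)] by (intro mult_left_mono sum_mono mult_right_mono) auto
  also have "\<dots> = h * (\<Sum>j\<in>{1..<2 * M}. w j * norm (v j)) + ?c * (h * (\<Sum>j\<in>{1..<2 * M}. norm (v j)))"
    unfolding distrib_right sum.distrib sum_distrib_left[symmetric] by (simp only: distrib_left mult.left_commute)
  also have "\<dots> \<le> (\<kappa> * (\<tau>\<^sup>2 + h\<^sup>2) * (sqrt (2 * a) * Y) + \<kappa> * h\<^sup>2 * E) + ?c * (sqrt (2 * a) * Y)"
    using \<epsilon> m by (intro add_mono mult_left_mono weighted_sum[OF assms(2,3)] mesh_sum_cauchy[OF assms(2) XYE(2)]) auto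
  also have "\<dots> = B0" unfolding B0_def distrib_right by simp
  finally show ?thesis .
qed

lemma N2_nonneg: "0 \<le> N2 l" using h by (simp add: N2_def sum_nonneg)

lemma B0_nonneg: "0 \<le> B0"
  unfolding B0_def using \<kappa> \<epsilon> m XYE a_pos by (intro add_nonneg_nonneg mult_nonneg_nonneg) auto

lemma half_norm_sq: "(norm (half_step e l j))\<^sup>2 \<le> ((norm (e (Suc l) j))\<^sup>2 + (norm (e l j))\<^sup>2) / 2"
proof -
  have "norm (half_step e l j) \<le> (norm (e (Suc l) j) + norm (e l j)) / 2"
    unfolding half_step_def using norm_triangle_ineq[of "e (Suc l) j" "e l j"] by (simp add: norm_divide)
  then have "(norm (half_step e l j))\<^sup>2 \<le> ((norm (e (Suc l) j) + norm (e l j)) / 2)\<^sup>2"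
    by (intro power_mono) auto
  also have "\<dots> \<le> ((norm (e (Suc l) j))\<^sup>2 + (norm (e l j))\<^sup>2) / 2"
    using sum_squares_bound[of "norm (e (Suc l) j)" "norm (e l j)"] by (simp add: power2_sum power_divide)
  finally show ?thesis .
qed

lemma half_sum: "l < n \<Longrightarrow> h * (\<Sum>j\<in>{1..<2 * M}. (norm (half_step e l j))\<^sup>2) \<le> Y\<^sup>2"
proof -
  assume l: "l < n"
  have "h * (\<Sum>j\<in>{1..<2 * M}. (norm (half_step e l j))\<^sup>2) \<le> h * (\<Sum>j\<in>{1..<2 * M}. ((norm (e (Suc l) j))\<^sup>2 + (norm (e l j))\<^sup>2) / 2)"
    using h by (intro mult_left_mono sum_mono half_norm_sq) auto
  also have "\<dots> = (N2 (Suc l) + N2 l) / 2"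
    unfolding N2_def by (simp add: sum_divide_distrib[symmetric] sum.distrib distrib_left)
  also have "\<dots> \<le> Y\<^sup>2" using Y[of l] Y[of "Suc l"] l by simp
  finally show ?thesis .
qed

lemma half_bound: "l < n \<Longrightarrow> norm (half_step e l M) \<le> E"
  using E[of l M] E[of "Suc l" M] norm_triangle_ineq[of "e (Suc l) M" "e l M"]
  by (simp add: half_step_def norm_divide)

text \<open>Imaginary part of the error equation against the half step: the Laplacian contributes
  nothing after summation by parts, and the delta term is a real multiple of a squared
  modulus.\<close>

lemma L2_step:
  assumes l: "l < n"
  shows "N2 (Suc l) - N2 l \<le> 8 * \<bar>\<mu>\<bar> * \<tau> * (N2 (Suc l) + N2 l) + 2 * \<tau> * B0"
proof -
  let ?J = "{1..<2 * M}" and ?b = "half_step e l"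
  have pt: "(norm (e (Suc l) j))\<^sup>2 - (norm (e l j))\<^sup>2 \<le> - 2 * \<tau> * Im (dx2 h ?b j * cnj (?b j))
       + 8 * \<bar>\<mu>\<bar> * \<tau> * ((norm (e (Suc l) j))\<^sup>2 + (norm (e l j))\<^sup>2) + 2 * \<tau> * (norm (Rr l j) * norm (?b j))" if j: "j \<in> ?J" for j
  proof -
    have "(norm (e (Suc l) j))\<^sup>2 - (norm (e l j))\<^sup>2 = 2 * \<tau> * Im ((\<i> * dt_plus \<tau> e l j) * cnj (?b j))"
      unfolding cmod_power2 dt_plus_def half_step_def using \<tau>
      by (simp add: field_simps power2_eq_square)
    also have "(\<i> * dt_plus \<tau> e l j) * cnj (?b j) = - (dx2 h ?b j * cnj (?b j))
        + of_real (lam * delta_coeff h M j) * (?b j * cnj (?b j)) + of_real \<mu> * (Nn l j * cnj (?b j)) + Rr l j * cnj (?b j)"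
      unfolding error_eq[OF l j] by (simp add: algebra_simps)
    also have "Im \<dots> = - Im (dx2 h ?b j * cnj (?b j)) + \<mu> * Im (Nn l j * cnj (?b j)) + Im (Rr l j * cnj (?b j))"
    proof -
      have "Im (of_real x * (z * cnj z)) = 0" for x z by (simp add: complex_mult_cnj)
      moreover have "Im (of_real x * z) = x * Im z" for x z by simp
      ultimately show ?thesis by (simp only: plus_complex.sel uminus_complex.sel)
    qed
    also have "2 * \<tau> * \<dots> \<le> 2 * \<tau> * (- Im (dx2 h ?b j * cnj (?b j)) + \<bar>\<mu>\<bar> * (4 * ((norm (e (Suc l) j))\<^sup>2 + (norm (e l j))\<^sup>2))
         + norm (Rr l j) * norm (?b j))"
    proof (intro mult_left_mono add_mono order_refl)
      have "\<bar>Im (Nn l j * cnj (e (Suc l) j + e l j))\<bar> \<le> 8 * ((norm (e (Suc l) j))\<^sup>2 + (norm (e l j))\<^sup>2)"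
        unfolding Nn_def e_def by (rule Im_Qtilde_diff[OF \<epsilon>(1)])
      moreover have "Im (Nn l j * cnj (?b j)) = Im (Nn l j * cnj (e (Suc l) j + e l j)) / 2"
      proof -
        have eq: "Nn l j * cnj (?b j) = of_real (1 / 2) * (Nn l j * cnj (e (Suc l) j + e l j))"
          by (simp add: half_step_def)
        have "Im (of_real (1 / 2) * z) = Im z / 2" for z by simp
        then show ?thesis unfolding eq .
      qed
      ultimately have "\<bar>Im (Nn l j * cnj (?b j))\<bar> \<le> 4 * ((norm (e (Suc l) j))\<^sup>2 + (norm (e l j))\<^sup>2)" by linarith
      then have "\<bar>\<mu> * Im (Nn l j * cnj (?b j))\<bar> \<le> \<bar>\<mu>\<bar> * (4 * ((norm (e (Suc l) j))\<^sup>2 + (norm (e l j))\<^sup>2))"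
        unfolding abs_mult by (intro mult_left_mono) auto
      then show "\<mu> * Im (Nn l j * cnj (?b j)) \<le> \<bar>\<mu>\<bar> * (4 * ((norm (e (Suc l) j))\<^sup>2 + (norm (e l j))\<^sup>2))" by linarith
      show "Im (Rr l j * cnj (?b j)) \<le> norm (Rr l j) * norm (?b j)"
        using abs_Im_le_cmod[of "Rr l j * cnj (?b j)"] by (simp add: norm_mult)
    qed (use \<tau> in auto)
    also have "\<dots> = - 2 * \<tau> * Im (dx2 h ?b j * cnj (?b j))
       + 8 * \<bar>\<mu>\<bar> * \<tau> * ((norm (e (Suc l) j))\<^sup>2 + (norm (e l j))\<^sup>2) + 2 * \<tau> * (norm (Rr l j) * norm (?b j))"
      by (simp add: algebra_simps)
    finally show ?thesis .
  qed
  have "N2 (Suc l) - N2 l = h * (\<Sum>j\<in>?J. (norm (e (Suc l) j))\<^sup>2 - (norm (e l j))\<^sup>2)"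
    by (simp add: N2_def sum_subtractf right_diff_distrib)
  also have "\<dots> \<le> h * (\<Sum>j\<in>?J. - 2 * \<tau> * Im (dx2 h ?b j * cnj (?b j))
       + 8 * \<bar>\<mu>\<bar> * \<tau> * ((norm (e (Suc l) j))\<^sup>2 + (norm (e l j))\<^sup>2) + 2 * \<tau> * (norm (Rr l j) * norm (?b j)))"
    using h by (intro mult_left_mono sum_mono pt) auto
  also have "\<dots> = - 2 * \<tau> * h * Im (\<Sum>j\<in>?J. dx2 h ?b j * cnj (?b j)) + 8 * \<bar>\<mu>\<bar> * \<tau> * (N2 (Suc l) + N2 l)
       + 2 * \<tau> * (h * (\<Sum>j\<in>?J. norm (Rr l j) * norm (?b j)))"
    unfolding N2_def sum.distrib sum_distrib_left[symmetric] Im_sum by (simp add: algebra_simps)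
  also have "Im (\<Sum>j\<in>?J. dx2 h ?b j * cnj (?b j)) = 0"
    unfolding summation_by_parts_dx(2)[OF M half_bdry[OF l] h, of ?b]
    by (simp add: Im_sum complex_mult_cnj)
  also have "- 2 * \<tau> * h * 0 + 8 * \<bar>\<mu>\<bar> * \<tau> * (N2 (Suc l) + N2 l) + 2 * \<tau> * (h * (\<Sum>j\<in>?J. norm (Rr l j) * norm (?b j)))
      \<le> - 2 * \<tau> * h * 0 + 8 * \<bar>\<mu>\<bar> * \<tau> * (N2 (Suc l) + N2 l) + 2 * \<tau> * B0"
    using \<tau> by (intro add_left_mono mult_left_mono Rr_sum l half_sum half_bound) auto
  finally show ?thesis by simp
qed

lemma L2_bound:
  assumes small: "16 * \<bar>\<mu>\<bar> * \<tau> \<le> 1" and l: "l \<le> n"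
  shows "N2 l \<le> 4 * T * exp (32 * \<bar>\<mu>\<bar> * T) * B0"
proof -
  define c where "c = 8 * \<bar>\<mu>\<bar> * \<tau>"
  have c: "0 \<le> c" "c \<le> 1 / 2" using small \<tau> by (auto simp: c_def)
  \<comment> \<open>Implicit Gronwall step: for c at most 1/2, (1 + c) / (1 - c) is at most 1 + 4c.
    With c = 8 |\<mu>| \<tau> this yields the 32 in the exponent.\<close>
  have step: "x' \<le> exp (4 * c) * x + 4 * b" if "x' - x \<le> c * (x' + x) + 2 * b" "0 \<le> x" "0 \<le> x'" "0 \<le> b" for x x' b :: real
  proof -
    have "(1 - c) * x' \<le> (1 + c) * x + 2 * b" using that by (simp add: algebra_simps)
    also have "(1 + c) * x + 2 * b \<le> ((1 - c) * (1 + 4 * c)) * x + (1 - c) * (4 * b)"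
    proof (intro add_mono mult_right_mono)
      have "c * c \<le> 1 / 2 * c" using c by (intro mult_right_mono) auto
      then show "1 + c \<le> (1 - c) * (1 + 4 * c)" using c by (simp add: algebra_simps)
      have "1 / 2 * (4 * b) \<le> (1 - c) * (4 * b)" using c that by (intro mult_right_mono) auto
      then show "2 * b \<le> (1 - c) * (4 * b)" by simp
    qed (use that in auto)
    also have "\<dots> = (1 - c) * ((1 + 4 * c) * x + 4 * b)" by (simp add: algebra_simps)
    finally have "x' \<le> (1 + 4 * c) * x + 4 * b" using c by (subst (asm) mult_le_cancel_left_pos) auto
    also have "\<dots> \<le> exp (4 * c) * x + 4 * b"
      using that exp_ge_add_one_self[of "4 * c"] by (intro add_right_mono mult_right_mono) auto
    finally show ?thesis .
  qed
  have "N2 l \<le> 4 * (real l * \<tau>) * exp (4 * c * real l) * B0" using l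
  proof (induction l)
    case 0
    have "N2 0 = 0" unfolding N2_def using e_init by simp
    then show ?case by simp
  next
    case (Suc l)
    have "N2 (Suc l) \<le> exp (4 * c) * N2 l + 4 * (\<tau> * B0)"
      using L2_step[of l] Suc.prems N2_nonneg B0_nonneg \<tau> by (intro step) (auto simp: c_def)
    also have "\<dots> \<le> exp (4 * c) * (4 * (real l * \<tau>) * exp (4 * c * real l) * B0) + 4 * (\<tau> * B0)"
      using Suc by (intro add_right_mono mult_left_mono) auto
    also have "exp (4 * c) * (4 * (real l * \<tau>) * exp (4 * c * real l) * B0) = exp (4 * c * real (Suc l)) * (4 * (real l * \<tau>) * B0)"
      by (simp add: exp_add[symmetric] algebra_simps mult_exp_exp)
    also have "4 * (\<tau> * B0) \<le> exp (4 * c * real (Suc l)) * (4 * (\<tau> * B0))"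
      using c \<tau> B0_nonneg mult_right_mono[of 1 "exp (4 * c * real (Suc l))" "4 * (\<tau> * B0)"] by simp
    finally show ?case by (simp add: algebra_simps)
  qed
  also have "\<dots> \<le> 4 * T * exp (32 * \<bar>\<mu>\<bar> * T) * B0"
  proof (rule mult_right_mono[OF mult_mono B0_nonneg])
    have lT: "real l * \<tau> \<le> T" by (rule order_trans[OF mult_right_mono n\<tau>]) (use l \<tau> in auto)
    then show "4 * (real l * \<tau>) \<le> 4 * T" by simp
    show "exp (4 * c * real l) \<le> exp (32 * \<bar>\<mu>\<bar> * T)"
      using mult_left_mono[OF lT, of "32 * \<bar>\<mu>\<bar>"] by (simp add: c_def mult_ac)
  qed (use T_nonneg in auto)
  finally show ?thesis .
qed

end

section \<open>Energy estimate in the discrete H1 seminorm\<close>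

lemma power2_norm_diff_inner:
  fixes z w :: complex
  shows "inner ((z + w) / 2) (z - w) = ((norm z)\<^sup>2 - (norm w)\<^sup>2) / 2"
proof -
  have eq: "(z + w) / 2 = (1 / 2) *\<^sub>R (z + w)" by (simp add: scaleR_conv_of_real)
  have "inner ((z + w) / 2) (z - w) = inner (z + w) (z - w) / 2" unfolding eq inner_scaleR_left by simp
  also have "inner (z + w) (z - w) = (norm z)\<^sup>2 - (norm w)\<^sup>2"
    by (simp add: power2_norm_eq_inner inner_add_left inner_add_right inner_diff_left inner_diff_right inner_commute)
  finally show ?thesis .
qed

context cnfd_err
begin

text \<open>Real part of the error equation against the time increment: i times a number is
  orthogonal to that number, so the time derivative drops out and the linear terms become
  differences of squares.\<close>

lemma H1_step:
  assumes l: "l < n"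
  shows "(D2 (Suc l) - D2 l) / 2 + lam / 2 * ((norm (e (Suc l) M))\<^sup>2 - (norm (e l M))\<^sup>2)
     = - (\<mu> * (h * (\<Sum>j\<in>{1..<2 * M}. inner (Nn l j) (e (Suc l) j - e l j)))
          + h * (\<Sum>j\<in>{1..<2 * M}. inner (Rr l j) (e (Suc l) j - e l j)))"
proof -
  let ?J = "{1..<2 * M}" and ?b = "half_step e l" and ?d = "\<lambda>j. e (Suc l) j - e l j"
  have MJ: "M \<in> ?J" using M by auto
  have sc: "inner (of_real x * z) v = x * inner z v" for x and z v :: complex
    by (simp add: scaleR_conv_of_real[symmetric])
  have pt: "0 = - inner (dx2 h ?b j) (?d j) + (if j = M then lam / h * inner (?b M) (?d M) else 0)
      + \<mu> * inner (Nn l j) (?d j) + inner (Rr l j) (?d j)" if j: "j \<in> ?J" for j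
  proof -
    have "inner (\<i> * dt_plus \<tau> e l j) (?d j) = 0"
      unfolding dt_plus_def inner_complex_def by (simp add: algebra_simps add_divide_distrib diff_divide_distrib)
    then show ?thesis unfolding error_eq[OF l j] inner_add_left inner_minus_left sc
      by (cases "j = M") (simp_all add: delta_coeff_def)
  qed
  have "0 = h * (\<Sum>j\<in>?J. - inner (dx2 h ?b j) (?d j) + (if j = M then lam / h * inner (?b M) (?d M) else 0)
      + \<mu> * inner (Nn l j) (?d j) + inner (Rr l j) (?d j))"
    using pt by simp
  also have "\<dots> = - (h * (\<Sum>j\<in>?J. inner (dx2 h ?b j) (?d j))) + lam * inner (?b M) (?d M)
     + \<mu> * (h * (\<Sum>j\<in>?J. inner (Nn l j) (?d j))) + h * (\<Sum>j\<in>?J. inner (Rr l j) (?d j))"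
    unfolding sum.distrib sum_negf sum_distrib_left[symmetric] using MJ h
    by (simp add: distrib_left right_diff_distrib)
  also have "(\<Sum>j\<in>?J. inner (dx2 h ?b j) (?d j)) = - (\<Sum>j<2 * M. inner (dx_plus h ?b j) (dx_plus h ?d j))"
    by (rule summation_by_parts_dx(1)) (use M h e_bdry l in auto)
  also have "(\<Sum>j<2 * M. inner (dx_plus h ?b j) (dx_plus h ?d j))
      = (\<Sum>j<2 * M. ((norm (dx_plus h (e (Suc l)) j))\<^sup>2 - (norm (dx_plus h (e l) j))\<^sup>2) / 2)"
  proof (intro sum.cong refl)
    fix j
    have 1: "dx_plus h ?b j = (dx_plus h (e (Suc l)) j + dx_plus h (e l) j) / 2"
      unfolding dx_plus_def half_step_def by (simp add: add_divide_distrib diff_divide_distrib mult.commute)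
    have 2: "dx_plus h ?d j = dx_plus h (e (Suc l)) j - dx_plus h (e l) j"
      unfolding dx_plus_def by (simp add: diff_divide_distrib)
    show "inner (dx_plus h ?b j) (dx_plus h ?d j) = ((norm (dx_plus h (e (Suc l)) j))\<^sup>2 - (norm (dx_plus h (e l) j))\<^sup>2) / 2"
      unfolding 1 2 by (rule power2_norm_diff_inner)
  qed
  also have "- (h * - (\<Sum>j<2 * M. ((norm (dx_plus h (e (Suc l)) j))\<^sup>2 - (norm (dx_plus h (e l) j))\<^sup>2) / 2)) = (D2 (Suc l) - D2 l) / 2"
    unfolding D2_def sum_divide_distrib[symmetric] sum_subtractf by (simp add: right_diff_distrib)
  also have "inner (?b M) (?d M) = ((norm (e (Suc l) M))\<^sup>2 - (norm (e l M))\<^sup>2) / 2"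
    unfolding half_step_def Suc_eq_plus1[symmetric] by (rule power2_norm_diff_inner)
  finally show ?thesis by simp
qed

lemma D2_0: "D2 0 = 0"
  unfolding D2_def dx_plus_def using e_init by (simp add: sum.neutral)

lemma H1_sum:
  assumes "k \<le> n"
  shows "D2 k / 2 + lam / 2 * (norm (e k M))\<^sup>2
     = - (\<mu> * (h * (\<Sum>j\<in>{1..<2 * M}. \<Sum>l<k. inner (Nn l j) (e (Suc l) j - e l j)))
          + h * (\<Sum>j\<in>{1..<2 * M}. \<Sum>l<k. inner (Rr l j) (e (Suc l) j - e l j)))"
  using assms
proof (induction k)
  case 0
  show ?case using D2_0 e_init[of M] by simp
next
  case (Suc k)
  have "D2 (Suc k) / 2 + lam / 2 * (norm (e (Suc k) M))\<^sup>2 = (D2 k / 2 + lam / 2 * (norm (e k M))\<^sup>2)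
      + ((D2 (Suc k) - D2 k) / 2 + lam / 2 * ((norm (e (Suc k) M))\<^sup>2 - (norm (e k M))\<^sup>2))"
    by (simp add: algebra_simps diff_divide_distrib)
  also have "(D2 (Suc k) - D2 k) / 2 + lam / 2 * ((norm (e (Suc k) M))\<^sup>2 - (norm (e k M))\<^sup>2) =
     - (\<mu> * (h * (\<Sum>j\<in>{1..<2 * M}. inner (Nn k j) (e (Suc k) j - e k j)))
          + h * (\<Sum>j\<in>{1..<2 * M}. inner (Rr k j) (e (Suc k) j - e k j)))"
    using Suc.prems by (intro H1_step) auto
  finally show ?case using Suc unfolding sum.lessThan_Suc sum.distrib by (simp add: distrib_left)
qed

text \<open>The increments of \<open>Grel\<close> telescope and start from 0 because the scheme
  starts on the exact data; each remainder carries a factor \<tau>, so at most n of them cost only a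
  factor T.\<close>

lemma nonlinear_work:
  assumes k: "k \<le> n"
  shows "\<bar>h * (\<Sum>j\<in>{1..<2 * M}. \<Sum>l<k. inner (Nn l j) (e (Suc l) j - e l j))\<bar>
     \<le> (6 / \<epsilon> + 2 * m + 2 * E + 24 / \<epsilon> * m * T) * Y\<^sup>2"
proof -
  let ?J = "{1..<2 * M}"
  let ?G = "\<lambda>l j. Grel \<epsilon> (A l j) (U l j)"
  have Gb: "\<bar>?G k j\<bar> \<le> (6 / \<epsilon> + 2 * m + 2 * E) * (norm (e k j))\<^sup>2" if j: "j \<in> ?J" for j
  proof -
    have "\<bar>?G k j\<bar> \<le> (6 / \<epsilon> + 2 * norm (A k j) + 2 * norm (e k j)) * (norm (e k j))\<^sup>2"
      using Grel_bound[OF \<epsilon>, of "A k j" "U k j"] by (simp add: e_def norm_minus_commute)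
    also have "\<dots> \<le> (6 / \<epsilon> + 2 * m + 2 * E) * (norm (e k j))\<^sup>2"
      using Abound[of k j] E[of k j] j k by (intro mult_right_mono add_mono) auto
    finally show ?thesis .
  qed
  have stp: "\<bar>inner (Nn l j) (e (Suc l) j - e l j) - (?G (Suc l) j - ?G l j)\<bar>
      \<le> 12 / \<epsilon> * m * \<tau> * ((norm (e (Suc l) j))\<^sup>2 + (norm (e l j))\<^sup>2)" if l: "l < k" and j: "j \<in> ?J" for l j
  proof -
    have "inner (Nn l j) (e (Suc l) j - e l j) = inner (Qtilde \<epsilon> (U (Suc l) j) (U l j) - Qtilde \<epsilon> (A (Suc l) j) (A l j))
        ((U (Suc l) j - A (Suc l) j) - (U l j - A l j))"
      unfolding Nn_def e_def inner_diff_left inner_diff_right by simp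
    then have "\<bar>inner (Nn l j) (e (Suc l) j - e l j) - (?G (Suc l) j - ?G l j)\<bar>
      \<le> 12 / \<epsilon> * norm (A (Suc l) j - A l j) * ((norm (e (Suc l) j))\<^sup>2 + (norm (e l j))\<^sup>2)"
      using Qtilde_diff_work[OF \<epsilon>(1), of "U (Suc l) j" "U l j" "A (Suc l) j" "A l j"]
      by (simp add: e_def norm_minus_commute)
    also have "\<dots> \<le> 12 / \<epsilon> * (m * \<tau>) * ((norm (e (Suc l) j))\<^sup>2 + (norm (e l j))\<^sup>2)"
      using Astep[of l j] l k j \<epsilon> by (intro mult_right_mono mult_left_mono) auto
    finally show ?thesis by (simp add: mult.assoc)
  qed
  have inner_sum: "\<bar>\<Sum>l<k. inner (Nn l j) (e (Suc l) j - e l j)\<bar> \<le> (6 / \<epsilon> + 2 * m + 2 * E) * (norm (e k j))\<^sup>2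
       + 12 / \<epsilon> * m * \<tau> * (\<Sum>l<k. (norm (e (Suc l) j))\<^sup>2 + (norm (e l j))\<^sup>2)" if j: "j \<in> ?J" for j
  proof -
    have "(\<Sum>l<k. ?G (Suc l) j - ?G l j) = ?G k j - ?G 0 j" by (rule sum_lessThan_telescope)
    also have "?G 0 j = 0" using init[of j] j by (simp add: Grel_def)
    finally have t: "(\<Sum>l<k. inner (Nn l j) (e (Suc l) j - e l j)) = ?G k j + (\<Sum>l<k. inner (Nn l j) (e (Suc l) j - e l j) - (?G (Suc l) j - ?G l j))"
      by (simp add: sum_subtractf)
    have "\<bar>\<Sum>l<k. inner (Nn l j) (e (Suc l) j - e l j) - (?G (Suc l) j - ?G l j)\<bar>
        \<le> (\<Sum>l<k. 12 / \<epsilon> * m * \<tau> * ((norm (e (Suc l) j))\<^sup>2 + (norm (e l j))\<^sup>2))"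
      by (rule order_trans[OF sum_abs sum_mono]) (use stp j in auto)
    then show ?thesis unfolding t sum_distrib_left[symmetric] using Gb[OF j] by linarith
  qed
  have "\<bar>h * (\<Sum>j\<in>?J. \<Sum>l<k. inner (Nn l j) (e (Suc l) j - e l j))\<bar>
      \<le> h * (\<Sum>j\<in>?J. (6 / \<epsilon> + 2 * m + 2 * E) * (norm (e k j))\<^sup>2
       + 12 / \<epsilon> * m * \<tau> * (\<Sum>l<k. (norm (e (Suc l) j))\<^sup>2 + (norm (e l j))\<^sup>2))"
    by (rule abs_scaled_sum_le[OF h inner_sum])
  also have "\<dots> = (6 / \<epsilon> + 2 * m + 2 * E) * N2 k + 12 / \<epsilon> * m * \<tau> * (\<Sum>l<k. N2 (Suc l) + N2 l)"
  proof -
    have "(\<Sum>l<k. N2 (Suc l) + N2 l) = h * (\<Sum>j\<in>?J. \<Sum>l<k. (norm (e (Suc l) j))\<^sup>2 + (norm (e l j))\<^sup>2)"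
      unfolding N2_def distrib_left[symmetric] sum.distrib[symmetric] sum_distrib_left[symmetric]
      by (subst sum.swap) simp
    then show ?thesis unfolding N2_def sum.distrib[where A="?J"] sum_distrib_left[symmetric] by (simp add: algebra_simps)
  qed
  also have "\<dots> \<le> (6 / \<epsilon> + 2 * m + 2 * E) * Y\<^sup>2 + 12 / \<epsilon> * m * \<tau> * (real n * (2 * Y\<^sup>2))"
  proof (intro add_mono mult_left_mono)
    show "N2 k \<le> Y\<^sup>2" using Y k by simp
    have "(\<Sum>l<k. N2 (Suc l) + N2 l) \<le> (\<Sum>l<k. 2 * Y\<^sup>2)"
    proof (rule sum_mono)
      fix l assume "l \<in> {..<k}"
      then show "N2 (Suc l) + N2 l \<le> 2 * Y\<^sup>2" using Y[of l] Y[of "Suc l"] k by simp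
    qed
    also have "\<dots> \<le> real n * (2 * Y\<^sup>2)" using k by (simp add: mult_right_mono)
    finally show "(\<Sum>l<k. N2 (Suc l) + N2 l) \<le> real n * (2 * Y\<^sup>2)" .
  qed (use \<epsilon> m \<tau> XYE in auto)
  also have "12 / \<epsilon> * m * \<tau> * (real n * (2 * Y\<^sup>2)) = 24 / \<epsilon> * m * (real n * \<tau>) * Y\<^sup>2" by simp
  also have "\<dots> \<le> 24 / \<epsilon> * m * T * Y\<^sup>2" using \<epsilon> m n\<tau> by (intro mult_right_mono mult_left_mono) auto
  finally show ?thesis by (simp add: algebra_simps)
qed

text \<open>Time increments of the error are not under control, so summation by parts in time moves
  the difference onto the sources. The variation of \<open>qerr\<close> is bounded node by node as a
  sum in time, with no rate per step, so the error has to leave that sum through its maximum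
  E.\<close>

lemma residual_work:
  assumes k: "k \<le> n"
  shows "\<bar>h * (\<Sum>j\<in>{1..<2 * M}. \<Sum>l<k. inner (Rr l j) (e (Suc l) j - e l j))\<bar>
     \<le> (1 + T) * B0 + 2 * a * \<bar>\<mu>\<bar> * (63 * m\<^sup>2 * (1 + T) + 8 * T * m ^ 3) * \<tau>\<^sup>2 / \<epsilon>\<^sup>2 * E"
proof (cases k)
  case 0
  have "0 \<le> (1 + T) * B0 + 2 * a * \<bar>\<mu>\<bar> * (63 * m\<^sup>2 * (1 + T) + 8 * T * m ^ 3) * \<tau>\<^sup>2 / \<epsilon>\<^sup>2 * E"
    using B0_nonneg T_nonneg a_pos m XYE by (intro add_nonneg_nonneg mult_nonneg_nonneg divide_nonneg_nonneg) auto
  then show ?thesis using 0 by simp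
next
  case (Suc k')
  let ?J = "{1..<2 * M}"
  let ?q = "\<lambda>l j. qerr \<epsilon> (A (Suc l) j) (A l j)"
  let ?c = "(63 * m\<^sup>2 * (1 + T) + 8 * T * m ^ 3) * \<tau>\<^sup>2 / \<epsilon>\<^sup>2"
  have k': "k' < n" using Suc k by simp
  have ab: "(\<Sum>l<k. inner (Rr l j) (e (Suc l) j - e l j)) = inner (Rr k' j) (e k j) - (\<Sum>l<k'. inner (Rr (Suc l) j - Rr l j) (e (Suc l) j))"
    if j: "j \<in> ?J" for j
  proof -
    have "(\<Sum>l<k. Rr l j * (cnj (e (Suc l) j) - cnj (e l j))) = Rr k' j * cnj (e k j) - (\<Sum>l<k'. (Rr (Suc l) j - Rr l j) * cnj (e (Suc l) j))"
      using abel_summation[of "\<lambda>l. Rr l j" "\<lambda>l. cnj (e l j)" k'] e_init[of j] j unfolding Suc by simp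
    from arg_cong[OF this, of Re] show ?thesis
      by (simp only: complex_cnj_diff[symmetric] Re_sum minus_complex.sel Re_mult_cnj_inner)
  qed
  have pt: "\<bar>\<Sum>l<k. inner (Rr l j) (e (Suc l) j - e l j)\<bar> \<le> norm (Rr k' j) * norm (e k j)
      + \<tau> * (\<Sum>l<k'. w j * norm (e (Suc l) j)) + \<bar>\<mu>\<bar> * ?c * E" if j: "j \<in> ?J" for j
  proof -
    \<comment> \<open>Over k steps \<open>qerr\<close> has k' = k - 1 increments, which is the
      number of second differences available.\<close>
    interpret s: smooth_seq "\<lambda>l. A l j" "m * \<tau>" "m * \<tau>\<^sup>2" k'
      using Astep[of _ j] Asecond[of _ j] j k' m by unfold_locales auto
    have V: "s.V \<le> m * \<tau> * (1 + T)"
    proof -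
      have "real k' * \<tau> \<le> T" by (rule order_trans[OF mult_right_mono n\<tau>]) (use k' \<tau> in auto)
      then have "(m * \<tau>) * (real k' * \<tau>) \<le> (m * \<tau>) * T" using m \<tau> by (intro mult_left_mono) auto
      then show ?thesis unfolding s.V_def by (simp add: power2_eq_square algebra_simps)
    qed
    have "(\<Sum>l<k'. norm (?q (Suc l) j - ?q l j)) \<le> 1 / \<epsilon>\<^sup>2 * (63 * (m * \<tau>) * s.V + 8 * real k' * (m * \<tau>) ^ 3)"
      by (rule s.qerr_variation[OF \<epsilon>])
    also have "\<dots> \<le> 1 / \<epsilon>\<^sup>2 * (63 * (m * \<tau>) * (m * \<tau> * (1 + T)) + 8 * T * m ^ 3 * \<tau>\<^sup>2)"
    proof (intro mult_left_mono add_mono V)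
      have "real k' * \<tau> \<le> T" by (rule order_trans[OF mult_right_mono n\<tau>]) (use k' \<tau> in auto)
      then have "(8 * m ^ 3 * \<tau>\<^sup>2) * (real k' * \<tau>) \<le> (8 * m ^ 3 * \<tau>\<^sup>2) * T" using m by (intro mult_left_mono) auto
      then show "8 * real k' * (m * \<tau>) ^ 3 \<le> 8 * T * m ^ 3 * \<tau>\<^sup>2"
        by (simp add: power_mult_distrib power2_eq_square power3_eq_cube mult_ac)
    qed (use m \<tau> in auto)
    also have "\<dots> = ?c" by (simp add: algebra_simps power2_eq_square add_divide_distrib)
    finally have TV: "(\<Sum>l<k'. norm (?q (Suc l) j - ?q l j)) \<le> ?c" .
    have "\<bar>\<Sum>l<k'. inner (Rr (Suc l) j - Rr l j) (e (Suc l) j)\<bar>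
        \<le> (\<Sum>l<k'. \<tau> * (w j * norm (e (Suc l) j)) + \<bar>\<mu>\<bar> * (norm (?q (Suc l) j - ?q l j) * E))"
    proof (rule order_trans[OF sum_abs sum_mono])
      fix l assume l: "l \<in> {..<k'}"
      have "Rr (Suc l) j - Rr l j = (Rp (Suc l) j - Rp l j) + of_real \<mu> * (?q (Suc l) j - ?q l j)"
        unfolding Rr_def by (simp add: algebra_simps)
      then have "norm (Rr (Suc l) j - Rr l j) \<le> norm (Rp (Suc l) j - Rp l j) + \<bar>\<mu>\<bar> * norm (?q (Suc l) j - ?q l j)"
        using norm_triangle_ineq[of "Rp (Suc l) j - Rp l j" "of_real \<mu> * (?q (Suc l) j - ?q l j)"]
        by (simp add: norm_mult)
      also have "\<dots> \<le> \<tau> * w j + \<bar>\<mu>\<bar> * norm (?q (Suc l) j - ?q l j)" using R2[of l j] l k' j by simp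
      finally have "norm (Rr (Suc l) j - Rr l j) * norm (e (Suc l) j) \<le> (\<tau> * w j + \<bar>\<mu>\<bar> * norm (?q (Suc l) j - ?q l j)) * norm (e (Suc l) j)"
        by (intro mult_right_mono) auto
      also have "\<dots> = \<tau> * (w j * norm (e (Suc l) j)) + \<bar>\<mu>\<bar> * (norm (?q (Suc l) j - ?q l j) * norm (e (Suc l) j))"
        by (simp add: algebra_simps)
      also have "\<dots> \<le> \<tau> * (w j * norm (e (Suc l) j)) + \<bar>\<mu>\<bar> * (norm (?q (Suc l) j - ?q l j) * E)"
        using E[of "Suc l" j] l k' j by (intro add_left_mono mult_left_mono) auto
      finally show "\<bar>inner (Rr (Suc l) j - Rr l j) (e (Suc l) j)\<bar> \<le> \<tau> * (w j * norm (e (Suc l) j)) + \<bar>\<mu>\<bar> * (norm (?q (Suc l) j - ?q l j) * E)"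
        using Cauchy_Schwarz_ineq2[of "Rr (Suc l) j - Rr l j" "e (Suc l) j"] by linarith
    qed
    also have "\<dots> = \<tau> * (\<Sum>l<k'. w j * norm (e (Suc l) j)) + \<bar>\<mu>\<bar> * ((\<Sum>l<k'. norm (?q (Suc l) j - ?q l j)) * E)"
      by (simp add: sum.distrib sum_distrib_left sum_distrib_right)
    also have "\<dots> \<le> \<tau> * (\<Sum>l<k'. w j * norm (e (Suc l) j)) + \<bar>\<mu>\<bar> * (?c * E)"
      using TV XYE by (intro add_left_mono mult_left_mono mult_right_mono) auto
    finally have "\<bar>\<Sum>l<k'. inner (Rr (Suc l) j - Rr l j) (e (Suc l) j)\<bar> \<le> \<tau> * (\<Sum>l<k'. w j * norm (e (Suc l) j)) + \<bar>\<mu>\<bar> * ?c * E"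
      by (simp only: mult.assoc)
    then show ?thesis unfolding ab[OF j] using Cauchy_Schwarz_ineq2[of "Rr k' j" "e k j"] by linarith
  qed
  have Nl: "h * (\<Sum>j\<in>?J. (norm (e l j))\<^sup>2) \<le> Y\<^sup>2" if "l \<le> n" for l using Y[OF that] by (simp add: N2_def)
  have "\<bar>h * (\<Sum>j\<in>?J. \<Sum>l<k. inner (Rr l j) (e (Suc l) j - e l j))\<bar>
     \<le> h * (\<Sum>j\<in>?J. norm (Rr k' j) * norm (e k j) + \<tau> * (\<Sum>l<k'. w j * norm (e (Suc l) j)) + \<bar>\<mu>\<bar> * ?c * E)"
    by (rule abs_scaled_sum_le[OF h pt])
  also have "\<dots> = h * (\<Sum>j\<in>?J. norm (Rr k' j) * norm (e k j))
      + \<tau> * (\<Sum>l<k'. h * (\<Sum>j\<in>?J. w j * norm (e (Suc l) j))) + h * real (2 * M - 1) * (\<bar>\<mu>\<bar> * ?c * E)"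
  proof -
    have "(\<Sum>j\<in>?J. \<Sum>l<k'. w j * norm (e (Suc l) j)) = (\<Sum>l<k'. \<Sum>j\<in>?J. w j * norm (e (Suc l) j))"
      by (rule sum.swap)
    then show ?thesis
      unfolding sum.distrib sum_distrib_left[symmetric] by (simp add: algebra_simps)
  qed
  also have "\<dots> \<le> B0 + \<tau> * (real n * B0) + 2 * a * (\<bar>\<mu>\<bar> * ?c * E)"
  proof (intro add_mono mult_left_mono mult_right_mono)
    show "h * (\<Sum>j\<in>?J. norm (Rr k' j) * norm (e k j)) \<le> B0"
      by (rule Rr_sum[OF k' Nl[OF k]]) (use E[of k M] k in auto)
    have "(\<Sum>l<k'. h * (\<Sum>j\<in>?J. w j * norm (e (Suc l) j))) \<le> (\<Sum>l<k'. B0)"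
    proof (rule sum_mono)
      fix l assume l: "l \<in> {..<k'}"
      have "h * (\<Sum>j\<in>?J. w j * norm (e (Suc l) j)) \<le> \<kappa> * (\<tau>\<^sup>2 + h\<^sup>2) * (sqrt (2 * a) * Y) + \<kappa> * h\<^sup>2 * E"
        by (rule weighted_sum[OF Nl]) (use E[of "Suc l" M] l k' in auto)
      also have "\<dots> \<le> B0" unfolding B0_def distrib_right
        using \<epsilon> m XYE a_pos by simp
      finally show "h * (\<Sum>j\<in>?J. w j * norm (e (Suc l) j)) \<le> B0" .
    qed
    also have "\<dots> \<le> real n * B0" using k' B0_nonneg by (simp add: mult_right_mono)
    finally show "(\<Sum>l<k'. h * (\<Sum>j\<in>?J. w j * norm (e (Suc l) j))) \<le> real n * B0" .
    have "h * real (2 * M - 1) \<le> h * real (2 * M)" using h by (intro mult_left_mono) auto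
    then show "h * real (2 * M - 1) \<le> 2 * a" using ha by simp
    show "0 \<le> \<bar>\<mu>\<bar> * ?c * E" using m T_nonneg XYE by (intro mult_nonneg_nonneg divide_nonneg_nonneg) auto
  qed (use \<tau> in auto)
  also have "\<tau> * (real n * B0) = (real n * \<tau>) * B0" by simp
  also have "B0 + (real n * \<tau>) * B0 + 2 * a * (\<bar>\<mu>\<bar> * ?c * E) \<le> B0 + T * B0 + 2 * a * (\<bar>\<mu>\<bar> * ?c * E)"
    using B0_nonneg n\<tau> by (intro add_right_mono add_left_mono mult_right_mono) auto
  finally show ?thesis by (simp add: algebra_simps)
qed

text \<open>The delta strength may have either sign, so the interface energy is moved to the right
  and bounded by the maximum norm.\<close>

lemma H1_bound:
  assumes k: "k \<le> n"
  shows "D2 k \<le> \<bar>lam\<bar> * E\<^sup>2 + 2 * \<bar>\<mu>\<bar> * ((6 / \<epsilon> + 2 * m + 2 * E + 24 / \<epsilon> * m * T) * Y\<^sup>2)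
     + 2 * ((1 + T) * B0 + 2 * a * \<bar>\<mu>\<bar> * (63 * m\<^sup>2 * (1 + T) + 8 * T * m ^ 3) * \<tau>\<^sup>2 / \<epsilon>\<^sup>2 * E)"
proof -
  define P where "P = h * (\<Sum>j\<in>{1..<2 * M}. \<Sum>l<k. inner (Nn l j) (e (Suc l) j - e l j))"
  define Q where "Q = h * (\<Sum>j\<in>{1..<2 * M}. \<Sum>l<k. inner (Rr l j) (e (Suc l) j - e l j))"
  have eq: "D2 k = - lam * (norm (e k M))\<^sup>2 - 2 * (\<mu> * P) - 2 * Q"
    using H1_sum[OF k] unfolding P_def[symmetric] Q_def[symmetric] by (simp add: field_simps)
  have "- lam * (norm (e k M))\<^sup>2 \<le> \<bar>lam\<bar> * (norm (e k M))\<^sup>2" by (intro mult_right_mono) auto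
  also have "\<dots> \<le> \<bar>lam\<bar> * E\<^sup>2" using E[of k M] k by (intro mult_left_mono power_mono) auto
  finally have 1: "- lam * (norm (e k M))\<^sup>2 \<le> \<bar>lam\<bar> * E\<^sup>2" .
  have "- (\<mu> * P) \<le> \<bar>\<mu>\<bar> * \<bar>P\<bar>" by (metis abs_ge_minus_self abs_mult)
  also have "\<dots> \<le> \<bar>\<mu>\<bar> * ((6 / \<epsilon> + 2 * m + 2 * E + 24 / \<epsilon> * m * T) * Y\<^sup>2)"
    unfolding P_def by (intro mult_left_mono nonlinear_work k) auto
  finally have 2: "- (\<mu> * P) \<le> \<bar>\<mu>\<bar> * ((6 / \<epsilon> + 2 * m + 2 * E + 24 / \<epsilon> * m * T) * Y\<^sup>2)" .
  have 3: "- Q \<le> (1 + T) * B0 + 2 * a * \<bar>\<mu>\<bar> * (63 * m\<^sup>2 * (1 + T) + 8 * T * m ^ 3) * \<tau>\<^sup>2 / \<epsilon>\<^sup>2 * E"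
    using residual_work[OF k] unfolding Q_def[symmetric] by linarith
  have "x - 2 * y - 2 * z \<le> a + 2 * b + 2 * c" if "x \<le> a" "- y \<le> b" "- z \<le> c" for x y z a b c :: real
    using that by linarith
  from this[OF 1 2 3] show ?thesis unfolding eq by (simp only: mult.assoc)
qed

end

section \<open>Closing the estimates\<close>

text \<open>Telescopes the squared modulus from the boundary. The zero at the far end makes the
  shifted sum of squares equal to the unshifted one, so both Cauchy-Schwarz bounds use the same
  y.\<close>

lemma discrete_agmon:
  assumes "V 0 = 0" "0 < h" "j \<le> N"
    "h * (\<Sum>i<N. (norm (V i))\<^sup>2) \<le> y\<^sup>2" "h * (\<Sum>i<N. (norm (dx_plus h V i))\<^sup>2) \<le> x\<^sup>2" "V N = 0" "0 \<le> x" "0 \<le> y"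
  shows "(norm (V j :: complex))\<^sup>2 \<le> 2 * (x * y)"
proof -
  let ?d = "\<lambda>i. norm (dx_plus h V i)" and ?v = "\<lambda>i. norm (V i)"
  have st: "(?v (Suc i))\<^sup>2 - (?v i)\<^sup>2 \<le> h * (?d i * ?v (Suc i)) + h * (?d i * ?v i)" for i
  proof -
    have "?d i * h = norm (V (Suc i) - V i)" using assms(2) by (simp add: dx_plus_def norm_divide)
    then have "?v (Suc i) - ?v i \<le> h * ?d i" using norm_triangle_ineq2[of "V (Suc i)" "V i"] by (simp add: mult.commute)
    then have "(?v (Suc i) - ?v i) * (?v (Suc i) + ?v i) \<le> (h * ?d i) * (?v (Suc i) + ?v i)"
      by (intro mult_right_mono) auto
    then show ?thesis by (simp add: power2_eq_square algebra_simps)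
  qed
  have cs: "h * (\<Sum>i<N. ?d i * f i) \<le> x * y" if f: "h * (\<Sum>i<N. (f i)\<^sup>2) \<le> y\<^sup>2" "\<And>i. 0 \<le> f i" for f :: "nat \<Rightarrow> real"
  proof (rule power2_le_imp_le)
    have "(\<Sum>i<N. ?d i * f i)\<^sup>2 \<le> (\<Sum>i<N. (?d i)\<^sup>2) * (\<Sum>i<N. (f i)\<^sup>2)" by (rule Cauchy_Schwarz_ineq_sum)
    then have "h\<^sup>2 * (\<Sum>i<N. ?d i * f i)\<^sup>2 \<le> h\<^sup>2 * ((\<Sum>i<N. (?d i)\<^sup>2) * (\<Sum>i<N. (f i)\<^sup>2))" by (intro mult_left_mono) auto
    also have "\<dots> = (h * (\<Sum>i<N. (?d i)\<^sup>2)) * (h * (\<Sum>i<N. (f i)\<^sup>2))" by (simp add: power2_eq_square)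
    also have "\<dots> \<le> x\<^sup>2 * y\<^sup>2" using f assms by (intro mult_mono) (auto intro!: sum_nonneg mult_nonneg_nonneg)
    finally show "(h * (\<Sum>i<N. ?d i * f i))\<^sup>2 \<le> (x * y)\<^sup>2" by (simp add: power_mult_distrib)
  qed (use assms in auto)
  have "(\<Sum>i<N. (?v (Suc i))\<^sup>2) = (\<Sum>i<N. (?v i)\<^sup>2)"
    using sum_lessThan_telescope[of "\<lambda>i. (?v i)\<^sup>2" N] assms by (simp add: sum_subtractf)
  then have c1: "h * (\<Sum>i<N. ?d i * ?v (Suc i)) \<le> x * y" using assms by (intro cs) auto
  have c2: "h * (\<Sum>i<N. ?d i * ?v i) \<le> x * y" using assms by (intro cs) auto
  have "(?v j)\<^sup>2 = (\<Sum>i<j. (?v (Suc i))\<^sup>2 - (?v i)\<^sup>2)"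
    using sum_lessThan_telescope[of "\<lambda>i. (?v i)\<^sup>2" j] assms by simp
  also have "\<dots> \<le> (\<Sum>i<j. h * (?d i * ?v (Suc i)) + h * (?d i * ?v i))" by (intro sum_mono st)
  also have "\<dots> \<le> (\<Sum>i<N. h * (?d i * ?v (Suc i)) + h * (?d i * ?v i))"
    using assms by (intro sum_mono2) auto
  also have "\<dots> = h * (\<Sum>i<N. ?d i * ?v (Suc i)) + h * (\<Sum>i<N. ?d i * ?v i)"
    by (simp add: sum.distrib sum_distrib_left)
  finally show ?thesis using c1 c2 by linarith
qed

text \<open>If \<open>X\<close> exceeds the bound then \<open>s\<close> and \<open>\<eta>\<close> are at most of order \<open>\<epsilon>\<^sup>2 X\<close>; the hypotheses then give
  successively \<open>Y = O(\<epsilon> X)\<close>, \<open>E = O(\<epsilon>\<^bsup>1/2\<^esup> X)\<close> and \<open>X\<^sup>2 = O(\<epsilon>\<^bsup>1/2\<^esup> X\<^sup>2)\<close>.\<close>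

lemma bootstrap_core:
  fixes C \<omega> \<epsilon> s \<eta> X Y E :: real
  defines "k \<equiv> 4 * C / \<omega>"
  defines "Q \<equiv> 2 * k + k\<^sup>2 + 2 * C * (k\<^sup>2 + 4 * k) + 2 * k / \<omega> + 2 / \<omega> * sqrt (2 * k)"
  assumes C: "1 \<le> C" and \<omega>: "0 < \<omega>" "\<omega> \<le> 1" and \<epsilon>: "0 < \<epsilon>" "\<epsilon> \<le> 1" and small: "C * Q * sqrt \<epsilon> < 1"
    and s: "0 \<le> s" "s \<le> \<epsilon>\<^sup>2" and \<eta>: "0 \<le> \<eta>" "\<eta> \<le> \<epsilon>\<^sup>2" and nn: "0 \<le> X" "0 \<le> Y" "0 \<le> E"
    and Y: "Y\<^sup>2 \<le> C * ((s / \<epsilon> + \<eta>) * Y + \<eta> * E)"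
    and X: "X\<^sup>2 \<le> C * (E\<^sup>2 + Y\<^sup>2 / \<epsilon> + E * Y\<^sup>2 + (s / \<epsilon> + \<eta>) * Y + (s / \<epsilon>\<^sup>2 + \<eta>) * E)"
    and E: "E\<^sup>2 \<le> 2 * (X * Y)"
  shows "X \<le> (\<omega> * s + \<eta>) / \<epsilon>\<^sup>2"
proof (rule ccontr)
  assume "\<not> X \<le> (\<omega> * s + \<eta>) / \<epsilon>\<^sup>2"
  \<comment> \<open>The negated conclusion bounds both sources by the unknown:
    \<open>\<omega> * s\<close> and \<eta> are each at most
    \<open>\<epsilon>\<^sup>2 * X\<close>.\<close>
  then have big: "\<omega> * s + \<eta> < \<epsilon>\<^sup>2 * X" using \<epsilon> by (simp add: not_le pos_divide_less_eq mult.commute)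
  have ws: "0 \<le> \<omega> * s" using \<omega> s by simp
  have e2: "\<epsilon>\<^sup>2 \<le> \<epsilon>" using \<epsilon> by (simp add: power2_eq_square mult_left_le)
  have Xp: "0 < X" using big ws \<eta> \<epsilon> nn by (cases "X = 0") auto
  have eta: "\<eta> \<le> \<epsilon>\<^sup>2 * X" using big ws by linarith
  have s1: "s / \<epsilon>\<^sup>2 \<le> X / \<omega>"
  proof -
    have "\<omega> * s \<le> \<epsilon>\<^sup>2 * X" using big \<eta> by linarith
    then show ?thesis using \<omega> \<epsilon> by (simp add: field_simps)
  qed
  have s2: "s / \<epsilon> \<le> \<epsilon> / \<omega> * X"
  proof -
    have "s / \<epsilon> = \<epsilon> * (s / \<epsilon>\<^sup>2)" using \<epsilon> by (simp add: power2_eq_square)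
    also have "\<dots> \<le> \<epsilon> * (X / \<omega>)" using s1 \<epsilon> by (intro mult_left_mono) auto
    finally show ?thesis by simp
  qed
  have ew: "\<epsilon> \<le> \<epsilon> / \<omega>" using \<omega> \<epsilon> by (simp add: le_divide_eq)
  have eta2: "\<eta> \<le> \<epsilon> / \<omega> * X"
  proof -
    have "\<epsilon>\<^sup>2 * X \<le> \<epsilon> / \<omega> * X" using e2 ew nn by (intro mult_right_mono) auto
    then show ?thesis using eta by linarith
  qed
  have k: "4 \<le> k" "0 \<le> k"
  proof -
    have "4 * \<omega> \<le> 4 * C" using \<omega> C by simp
    then show "4 \<le> k" using \<omega> unfolding k_def by (simp add: pos_le_divide_eq)
    then show "0 \<le> k" by simp
  qed
  have EXY: "E \<le> X + Y"
  proof (rule power2_le_imp_le)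
    show "E\<^sup>2 \<le> (X + Y)\<^sup>2" unfolding power2_sum using E zero_le_power2[of X] zero_le_power2[of Y] by linarith
  qed (use nn in auto)
  \<comment> \<open>The three terms with X Y have total coefficient 3 C \<epsilon> / \<omega> =
    (3/4) k \<epsilon>. If Y exceeded k \<epsilon> X, a quarter of the left side would remain and
    have to be beaten by the term with X^2; this is the origin of k = 4 C / \<omega>.\<close>
  have Yk: "Y \<le> k * \<epsilon> * X"
  proof (rule ccontr)
    assume n: "\<not> Y \<le> k * \<epsilon> * X"
    have kp: "0 < k * \<epsilon> * X" using k \<epsilon> Xp by simp
    have Yp: "0 < Y" using n kp by linarith
    have "Y\<^sup>2 \<le> C * ((\<epsilon> / \<omega> * X + \<epsilon> / \<omega> * X) * Y + (\<epsilon>\<^sup>2 * X * X + \<epsilon> / \<omega> * X * Y))"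
    proof -
      have "(s / \<epsilon> + \<eta>) * Y \<le> (\<epsilon> / \<omega> * X + \<epsilon> / \<omega> * X) * Y" by (rule mult_right_mono[OF add_mono[OF s2 eta2] nn(2)])
      moreover have "\<eta> * E \<le> \<eta> * (X + Y)" using EXY \<eta> by (intro mult_left_mono) auto
      moreover have "\<eta> * X \<le> \<epsilon>\<^sup>2 * X * X" "\<eta> * Y \<le> \<epsilon> / \<omega> * X * Y"
        by (rule mult_right_mono[OF eta nn(1)], rule mult_right_mono[OF eta2 nn(2)])
      ultimately have "(s / \<epsilon> + \<eta>) * Y + \<eta> * E \<le> (\<epsilon> / \<omega> * X + \<epsilon> / \<omega> * X) * Y + (\<epsilon>\<^sup>2 * X * X + \<epsilon> / \<omega> * X * Y)"
        by (simp only: distrib_left)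
      then have "C * ((s / \<epsilon> + \<eta>) * Y + \<eta> * E) \<le> C * ((\<epsilon> / \<omega> * X + \<epsilon> / \<omega> * X) * Y + (\<epsilon>\<^sup>2 * X * X + \<epsilon> / \<omega> * X * Y))"
        using C by (intro mult_left_mono) auto
      then show ?thesis using Y by linarith
    qed
    also have "\<dots> = (3 / 4) * (k * \<epsilon> * X * Y) + C * \<epsilon>\<^sup>2 * X * X"
      unfolding k_def by (simp add: algebra_simps)
    finally have u: "Y\<^sup>2 \<le> (3 / 4) * (k * \<epsilon> * X * Y) + C * \<epsilon>\<^sup>2 * X * X" .
    have "k * \<epsilon> * X * Y \<le> Y\<^sup>2" unfolding power2_eq_square using n Yp by (intro mult_right_mono) auto
    then have "(1 / 4) * (k * \<epsilon> * X * Y) \<le> C * \<epsilon>\<^sup>2 * X * X" using u by linarith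
    moreover have "(1 / 4) * (k * \<epsilon> * X * Y) = (C * \<epsilon> * X) * (Y / \<omega>)" by (simp add: k_def)
    moreover have "C * \<epsilon>\<^sup>2 * X * X = (C * \<epsilon> * X) * (\<epsilon> * X)" by (simp add: power2_eq_square)
    ultimately have "(C * \<epsilon> * X) * (Y / \<omega>) \<le> (C * \<epsilon> * X) * (\<epsilon> * X)" by linarith
    then have "Y / \<omega> \<le> \<epsilon> * X" using C \<epsilon> Xp by (subst (asm) mult_le_cancel_left_pos) auto
    then have "Y \<le> \<epsilon> * X * \<omega>" using \<omega> by (simp add: pos_divide_le_eq)
    also have "\<dots> \<le> \<epsilon> * X * k" using k \<omega> \<epsilon> nn by (intro mult_left_mono) auto
    finally show False using n by (simp add: mult_ac)
  qed
  define r where "r = sqrt \<epsilon>"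
  have r: "0 < r" "r \<le> 1" "r\<^sup>2 = \<epsilon>" "\<epsilon> \<le> r"
  proof -
    show "0 < r" "r \<le> 1" "r\<^sup>2 = \<epsilon>" using \<epsilon> by (auto simp: r_def)
    then show "\<epsilon> \<le> r" by (metis less_imp_le mult_left_le power2_eq_square)
  qed
  have E2: "E\<^sup>2 \<le> 2 * k * \<epsilon> * X\<^sup>2"
  proof -
    have "X * Y \<le> X * (k * \<epsilon> * X)" using Yk nn by (intro mult_left_mono) auto
    then show ?thesis using E by (simp add: power2_eq_square mult_ac)
  qed
  have Y2: "Y\<^sup>2 \<le> k\<^sup>2 * \<epsilon>\<^sup>2 * X\<^sup>2" using power_mono[OF Yk nn(2), of 2] by (simp add: power_mult_distrib)
  have E1: "E \<le> sqrt (2 * k) * r * X"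
  proof (rule power2_le_imp_le)
    show "E\<^sup>2 \<le> (sqrt (2 * k) * r * X)\<^sup>2" using E2 k r by (simp add: power_mult_distrib)
  qed (use k r nn in auto)
  have X2: "0 < X\<^sup>2" using Xp by simp
  have t1: "E\<^sup>2 \<le> 2 * k * r * X\<^sup>2"
  proof -
    have "2 * k * \<epsilon> * X\<^sup>2 \<le> 2 * k * r * X\<^sup>2" using r(4) k by (intro mult_right_mono mult_left_mono) auto
    then show ?thesis using E2 by linarith
  qed
  have t2: "Y\<^sup>2 / \<epsilon> \<le> k\<^sup>2 * r * X\<^sup>2"
  proof -
    have "Y\<^sup>2 / \<epsilon> \<le> k\<^sup>2 * \<epsilon>\<^sup>2 * X\<^sup>2 / \<epsilon>" using Y2 \<epsilon> by (intro divide_right_mono) auto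
    also have "\<dots> = k\<^sup>2 * \<epsilon> * X\<^sup>2" using \<epsilon> by (simp add: power2_eq_square)
    also have "\<dots> \<le> k\<^sup>2 * r * X\<^sup>2" using r by (intro mult_right_mono mult_left_mono) auto
    finally show ?thesis .
  qed
  have sme: "s / \<epsilon> + \<eta> \<le> 2 * \<epsilon>" "\<eta> \<le> 2 * \<epsilon>"
  proof -
    have "s / \<epsilon> \<le> \<epsilon>\<^sup>2 / \<epsilon>" using s \<epsilon> by (intro divide_right_mono) auto
    then have "s / \<epsilon> \<le> \<epsilon>" using \<epsilon> by (simp add: power2_eq_square)
    then show "s / \<epsilon> + \<eta> \<le> 2 * \<epsilon>" "\<eta> \<le> 2 * \<epsilon>" using \<eta> e2 \<epsilon> by linarith+
  qed
  \<comment> \<open>The cubic term: the inequality for Y^2 is inserted once more, and since s and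
    \<eta> are at most \<epsilon>^2 the sources are at most 2 \<epsilon>, so E Y^2 is \<epsilon>
    times a quadratic expression.\<close>
  have t3: "E * Y\<^sup>2 \<le> 2 * C * (k\<^sup>2 + 4 * k) * r * X\<^sup>2"
  proof -
    have "E * Y\<^sup>2 \<le> E * (C * ((s / \<epsilon> + \<eta>) * Y + \<eta> * E))" using Y nn by (intro mult_left_mono) auto
    also have "\<dots> \<le> E * (C * (2 * \<epsilon> * Y + 2 * \<epsilon> * E))"
      using sme nn C by (intro mult_left_mono add_mono mult_right_mono) auto
    also have "\<dots> = 2 * C * \<epsilon> * (E * Y + E\<^sup>2)" by (simp add: algebra_simps power2_eq_square)
    also have "\<dots> \<le> 2 * C * \<epsilon> * (Y\<^sup>2 + 2 * E\<^sup>2)"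
    proof -
      have "E * Y \<le> Y\<^sup>2 + E\<^sup>2" using sum_squares_bound[of E Y] mult_nonneg_nonneg[OF nn(3) nn(2)] by linarith
      then show ?thesis using C \<epsilon> by (intro mult_left_mono) auto
    qed
    also have "\<dots> \<le> 2 * C * r * (k\<^sup>2 * X\<^sup>2 + 2 * (2 * k * X\<^sup>2))"
    proof (intro mult_mono add_mono mult_left_mono r(4))
      have "k\<^sup>2 * \<epsilon>\<^sup>2 * X\<^sup>2 \<le> k\<^sup>2 * 1 * X\<^sup>2" using \<epsilon> by (intro mult_right_mono mult_left_mono) (auto simp: power_le_one)
      then show "Y\<^sup>2 \<le> k\<^sup>2 * X\<^sup>2" using Y2 by simp
      have "2 * k * \<epsilon> * X\<^sup>2 \<le> 2 * k * 1 * X\<^sup>2" using \<epsilon> k by (intro mult_right_mono mult_left_mono) auto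
      then show "E\<^sup>2 \<le> 2 * k * X\<^sup>2" using E2 by simp
    qed (use C r nn in auto)
    also have "\<dots> = 2 * C * (k\<^sup>2 + 4 * k) * r * X\<^sup>2" by (simp add: algebra_simps)
    finally show ?thesis .
  qed
  have t4: "(s / \<epsilon> + \<eta>) * Y \<le> 2 * k / \<omega> * r * X\<^sup>2"
  proof -
    have "s / \<epsilon> + \<eta> \<le> 2 * \<epsilon> / \<omega> * X"
    proof -
      have "2 * \<epsilon> / \<omega> * X = \<epsilon> / \<omega> * X + \<epsilon> / \<omega> * X" by simp
      then show ?thesis using add_mono[OF s2 eta2] by (simp only:)
    qed
    then have "(s / \<epsilon> + \<eta>) * Y \<le> (2 * \<epsilon> / \<omega> * X) * (k * \<epsilon> * X)"
      by (rule mult_mono[OF _ Yk]) (use nn \<omega> \<epsilon> in auto)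
    also have "\<dots> = (2 * k / \<omega> * X\<^sup>2) * (\<epsilon> * \<epsilon>)" by (simp add: power2_eq_square)
    also have "\<dots> \<le> (2 * k / \<omega> * X\<^sup>2) * (1 * r)" using r \<epsilon> k \<omega> by (intro mult_left_mono mult_mono) auto
    finally show ?thesis by (simp add: mult_ac)
  qed
  have t5: "(s / \<epsilon>\<^sup>2 + \<eta>) * E \<le> 2 / \<omega> * sqrt (2 * k) * r * X\<^sup>2"
  proof -
    have "\<eta> \<le> X / \<omega>"
    proof -
      have "\<epsilon> / \<omega> * X \<le> 1 / \<omega> * X" using \<epsilon> \<omega> nn by (intro mult_right_mono divide_right_mono) auto
      then show ?thesis using eta2 by simp
    qed
    then have "s / \<epsilon>\<^sup>2 + \<eta> \<le> 2 / \<omega> * X" using s1 by simp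
    then have "(s / \<epsilon>\<^sup>2 + \<eta>) * E \<le> (2 / \<omega> * X) * (sqrt (2 * k) * r * X)"
      using E1 nn \<omega> by (intro mult_mono) auto
    then show ?thesis by (simp add: power2_eq_square mult_ac)
  qed
  \<comment> \<open>Every term has gained at least sqrt \<epsilon>; the last one, which stems from
    the variation of \<open>qerr\<close>, is the one with nothing more to spare.\<close>
  have "E\<^sup>2 + Y\<^sup>2 / \<epsilon> + E * Y\<^sup>2 + (s / \<epsilon> + \<eta>) * Y + (s / \<epsilon>\<^sup>2 + \<eta>) * E \<le> Q * r * X\<^sup>2"
  proof -
    have "Q * r * X\<^sup>2 = 2 * k * r * X\<^sup>2 + k\<^sup>2 * r * X\<^sup>2 + 2 * C * (k\<^sup>2 + 4 * k) * r * X\<^sup>2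
       + 2 * k / \<omega> * r * X\<^sup>2 + 2 / \<omega> * sqrt (2 * k) * r * X\<^sup>2"
      unfolding Q_def by (simp only: distrib_right)
    then show ?thesis using add_mono[OF add_mono[OF add_mono[OF add_mono[OF t1 t2] t3] t4] t5] by simp
  qed
  then have "C * (E\<^sup>2 + Y\<^sup>2 / \<epsilon> + E * Y\<^sup>2 + (s / \<epsilon> + \<eta>) * Y + (s / \<epsilon>\<^sup>2 + \<eta>) * E) \<le> C * (Q * r * X\<^sup>2)"
    using C by (intro mult_left_mono) auto
  then have "X\<^sup>2 \<le> C * (Q * r * X\<^sup>2)" using X by linarith
  also have "\<dots> = (C * Q * sqrt \<epsilon>) * X\<^sup>2" by (simp add: r_def)
  also have "\<dots> < 1 * X\<^sup>2" using small X2 by (intro mult_strict_right_mono) auto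
  finally show False by simp
qed

text \<open>Only the coefficient of s is critical: \<epsilon>0 has to come from C and \<omega>
  alone, whereas K and \<rho> may depend on \<epsilon>.\<close>

lemma bootstrap:
  fixes C \<omega> :: real
  assumes C: "1 \<le> C" and \<omega>: "0 < \<omega>" "\<omega> \<le> 1"
  shows "\<exists>\<epsilon>0>0. \<epsilon>0 \<le> 1 \<and> (\<forall>\<epsilon>. 0 < \<epsilon> \<and> \<epsilon> \<le> \<epsilon>0 \<longrightarrow> (\<exists>K>0. \<exists>\<rho>>0. \<forall>s \<eta> X Y E.
     0 \<le> s \<and> s \<le> \<rho> \<and> 0 \<le> \<eta> \<and> \<eta> \<le> \<rho> \<and> 0 \<le> X \<and> 0 \<le> Y \<and> 0 \<le> E \<and>
     Y\<^sup>2 \<le> C * ((s / \<epsilon> + \<eta>) * Y + \<eta> * E) \<and>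
     X\<^sup>2 \<le> C * (E\<^sup>2 + Y\<^sup>2 / \<epsilon> + E * Y\<^sup>2 + (s / \<epsilon> + \<eta>) * Y + (s / \<epsilon>\<^sup>2 + \<eta>) * E) \<and>
     E\<^sup>2 \<le> 2 * (X * Y) \<longrightarrow>
     X \<le> \<omega> * s / \<epsilon>\<^sup>2 + K * \<eta> \<and> Y \<le> \<omega> * s / \<epsilon>\<^sup>2 + K * \<eta> \<and> E \<le> \<omega> * s / \<epsilon>\<^sup>2 + K * \<eta>))"
proof -
  \<comment> \<open>A third, because Y costs one copy more than X, and E \<le> X + Y brings the
    total to three.\<close>
  define v where "v = \<omega> / 3"
  have v: "0 < v" "v \<le> 1" using \<omega> by (auto simp: v_def)
  define k where "k = 4 * C / v"
  define Q where "Q = 2 * k + k\<^sup>2 + 2 * C * (k\<^sup>2 + 4 * k) + 2 * k / v + 2 / v * sqrt (2 * k)"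
  have k: "0 < k" using C v by (simp add: k_def)
  have Q: "0 < Q" unfolding Q_def using k C v by (intro add_pos_nonneg) (auto intro!: add_nonneg_nonneg mult_nonneg_nonneg)
  \<comment> \<open>The bound v / C turns \<open>C * (s / \<epsilon>)\<close> into at most
    \<open>v * s / \<epsilon>\<^sup>2\<close>; the bound with Q meets the smallness condition of
    \<open>bootstrap_core\<close>.\<close>
  define \<epsilon>0 where "\<epsilon>0 = min 1 (min (v / C) ((1 / (2 * C * Q))\<^sup>2))"
  have e0: "0 < \<epsilon>0" "\<epsilon>0 \<le> 1" using v C Q by (auto simp: \<epsilon>0_def)
  have main: "X \<le> \<omega> * s / \<epsilon>\<^sup>2 + (2 / \<epsilon>\<^sup>2 + 3 * C) * \<eta> \<and> Y \<le> \<omega> * s / \<epsilon>\<^sup>2 + (2 / \<epsilon>\<^sup>2 + 3 * C) * \<eta> \<and> E \<le> \<omega> * s / \<epsilon>\<^sup>2 + (2 / \<epsilon>\<^sup>2 + 3 * C) * \<eta>"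
    if e: "0 < \<epsilon>" "\<epsilon> \<le> \<epsilon>0" and s: "0 \<le> s" "s \<le> \<epsilon>\<^sup>2" and \<eta>: "0 \<le> \<eta>" "\<eta> \<le> \<epsilon>\<^sup>2" and nn: "0 \<le> X" "0 \<le> Y" "0 \<le> E"
    and Y: "Y\<^sup>2 \<le> C * ((s / \<epsilon> + \<eta>) * Y + \<eta> * E)"
    and X: "X\<^sup>2 \<le> C * (E\<^sup>2 + Y\<^sup>2 / \<epsilon> + E * Y\<^sup>2 + (s / \<epsilon> + \<eta>) * Y + (s / \<epsilon>\<^sup>2 + \<eta>) * E)"
    and E: "E\<^sup>2 \<le> 2 * (X * Y)" for \<epsilon> s \<eta> X Y E
  proof -
    have e1: "\<epsilon> \<le> 1" "\<epsilon> \<le> v / C" "\<epsilon> \<le> (1 / (2 * C * Q))\<^sup>2" using e by (auto simp: \<epsilon>0_def)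
    have "sqrt \<epsilon> \<le> 1 / (2 * C * Q)" using real_sqrt_le_mono[OF e1(3)] C Q by simp
    then have "C * Q * sqrt \<epsilon> \<le> C * Q * (1 / (2 * C * Q))" using C Q by (intro mult_left_mono) auto
    also have "\<dots> < 1" using C Q by simp
    finally have sm: "C * Q * sqrt \<epsilon> < 1" .
    have "X \<le> (v * s + \<eta>) / \<epsilon>\<^sup>2"
      using bootstrap_core[OF C v e(1) e1(1) _ s \<eta> nn Y X E] sm unfolding Q_def k_def by blast
    then have X1: "X \<le> v * s / \<epsilon>\<^sup>2 + \<eta> / \<epsilon>\<^sup>2" by (simp add: add_divide_distrib)
    have EXY: "E \<le> X + Y"
    proof (rule power2_le_imp_le)
      show "E\<^sup>2 \<le> (X + Y)\<^sup>2" unfolding power2_sum using E zero_le_power2[of X] zero_le_power2[of Y] by linarith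
    qed (use nn in auto)
    have Y1: "Y \<le> C * (s / \<epsilon> + 2 * \<eta>) + C * \<eta> + X"
    proof (rule ccontr)
      assume n: "\<not> Y \<le> C * (s / \<epsilon> + 2 * \<eta>) + C * \<eta> + X"
      define p q where "p = C * (s / \<epsilon> + 2 * \<eta>)" and "q = C * \<eta>"
      have pq: "0 \<le> p" "0 \<le> q" using C s \<eta> e by (auto simp: p_def q_def)
      have YX: "X \<le> Y" "0 < Y" "p + q < Y" using n pq nn by (auto simp: p_def[symmetric] q_def[symmetric])
      have "Y\<^sup>2 \<le> C * ((s / \<epsilon> + \<eta>) * Y + \<eta> * (X + Y))"
        using Y mult_left_mono[OF mult_left_mono[OF EXY \<eta>(1)], of C] C by (simp add: distrib_left)
      also have "\<dots> = p * Y + q * X" by (simp add: p_def q_def algebra_simps)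
      also have "\<dots> \<le> p * Y + q * Y" using YX pq by (intro add_left_mono mult_left_mono) auto
      also have "\<dots> = (p + q) * Y" by (simp add: distrib_right)
      also have "\<dots> < Y * Y" using YX by (intro mult_strict_right_mono) auto
      finally show False by (simp add: power2_eq_square)
    qed
    have "C * (s / \<epsilon>) \<le> v * s / \<epsilon>\<^sup>2"
    proof -
      have "C * \<epsilon> \<le> v" using e1(2) C by (simp add: pos_le_divide_eq mult.commute)
      then have "C * \<epsilon> * (s / \<epsilon>\<^sup>2) \<le> v * (s / \<epsilon>\<^sup>2)" using s by (intro mult_right_mono) auto
      then show ?thesis using e by (simp add: power2_eq_square)
    qed
    then have Y2: "Y \<le> v * s / \<epsilon>\<^sup>2 + 3 * (C * \<eta>) + X" using Y1 by (simp add: distrib_left)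
    define S H where "S = v * s / \<epsilon>\<^sup>2" and "H = \<eta> / \<epsilon>\<^sup>2"
    have SH: "0 \<le> S" "0 \<le> H" "0 \<le> C * \<eta>" using v s \<eta> C by (auto simp: S_def H_def)
    have om: "\<omega> * s / \<epsilon>\<^sup>2 + (2 / \<epsilon>\<^sup>2 + 3 * C) * \<eta> = 3 * S + 2 * H + 3 * (C * \<eta>)"
      by (simp add: S_def H_def v_def algebra_simps)
    show ?thesis unfolding om using X1 Y2 EXY SH unfolding S_def[symmetric] H_def[symmetric] by linarith
  qed
  have "\<exists>K>0. \<exists>\<rho>>0. \<forall>s \<eta> X Y E.
     0 \<le> s \<and> s \<le> \<rho> \<and> 0 \<le> \<eta> \<and> \<eta> \<le> \<rho> \<and> 0 \<le> X \<and> 0 \<le> Y \<and> 0 \<le> E \<and>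
     Y\<^sup>2 \<le> C * ((s / \<epsilon> + \<eta>) * Y + \<eta> * E) \<and>
     X\<^sup>2 \<le> C * (E\<^sup>2 + Y\<^sup>2 / \<epsilon> + E * Y\<^sup>2 + (s / \<epsilon> + \<eta>) * Y + (s / \<epsilon>\<^sup>2 + \<eta>) * E) \<and>
     E\<^sup>2 \<le> 2 * (X * Y) \<longrightarrow>
     X \<le> \<omega> * s / \<epsilon>\<^sup>2 + K * \<eta> \<and> Y \<le> \<omega> * s / \<epsilon>\<^sup>2 + K * \<eta> \<and> E \<le> \<omega> * s / \<epsilon>\<^sup>2 + K * \<eta>"
    if e: "0 < \<epsilon>" "\<epsilon> \<le> \<epsilon>0" for \<epsilon>
  proof (intro exI conjI allI impI)
    show "0 < 2 / \<epsilon>\<^sup>2 + 3 * C" "0 < \<epsilon>\<^sup>2" using e C by (auto intro!: add_pos_pos)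
  qed (use main[OF e] in blast)+
  then show ?thesis using e0 by blast
qed

context cnfd_err
begin

text \<open>Brings the sources into the form that \<open>bootstrap\<close> expects; since \<epsilon>
  \<le> 1, the residual part in \<tau>^2 is absorbed by \<tau>^2 / \<epsilon>.\<close>

lemma B0_le: "B0 \<le> ((\<kappa> + 2 * \<bar>\<mu>\<bar> * m\<^sup>2) * sqrt (2 * a) + \<kappa>) * ((\<tau>\<^sup>2 / \<epsilon> + h\<^sup>2) * Y + h\<^sup>2 * E)"
proof -
  define s \<eta> c where "s = \<tau>\<^sup>2" and "\<eta> = h\<^sup>2" and "c = 2 * \<bar>\<mu>\<bar> * m\<^sup>2"
  have nn: "0 \<le> s" "0 \<le> \<eta>" "0 \<le> c" by (auto simp: s_def \<eta>_def c_def)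
  have se: "s \<le> s / \<epsilon>" using nn \<epsilon> by (simp add: le_divide_eq mult_left_le)
  define P D where "P = s / \<epsilon> + \<eta>" and "D = sqrt (2 * a)"
  have PD: "0 \<le> P" "0 \<le> D" using nn \<epsilon> a_pos by (auto simp: P_def D_def)
  have "\<kappa> * (s + \<eta>) + c * s / \<epsilon> \<le> (\<kappa> + c) * P"
  proof -
    have "\<kappa> * (s + \<eta>) \<le> \<kappa> * P" using se \<kappa> by (intro mult_left_mono) (auto simp: P_def)
    moreover have "c * s / \<epsilon> \<le> c * P" using nn by (simp add: P_def distrib_left)
    ultimately show ?thesis by (simp only: distrib_right)
  qed
  then have "(\<kappa> * (s + \<eta>) + c * s / \<epsilon>) * (D * Y) \<le> ((\<kappa> + c) * P) * (D * Y)"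
    using PD XYE by (intro mult_right_mono) auto
  moreover have "0 \<le> \<kappa> * (P * Y)" "0 \<le> (\<kappa> + c) * D * (\<eta> * E)"
    using nn \<kappa> \<epsilon> XYE PD by auto
  moreover have "((\<kappa> + c) * D + \<kappa>) * (P * Y + \<eta> * E) = ((\<kappa> + c) * P) * (D * Y) + \<kappa> * (P * Y) + (\<kappa> + c) * D * (\<eta> * E) + \<kappa> * \<eta> * E"
    by (simp add: algebra_simps)
  ultimately have "(\<kappa> * (s + \<eta>) + c * s / \<epsilon>) * (D * Y) + \<kappa> * \<eta> * E \<le> ((\<kappa> + c) * D + \<kappa>) * (P * Y + \<eta> * E)"
    by linarith
  then show ?thesis unfolding B0_def s_def[symmetric] \<eta>_def[symmetric] c_def[symmetric] P_def D_def .
qed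

lemma agmon: "l \<le> n \<Longrightarrow> j \<le> 2 * M \<Longrightarrow> (norm (e l j))\<^sup>2 \<le> 2 * (X * Y)"
proof -
  assume l: "l \<le> n" and j: "j \<le> 2 * M"
  have "(\<Sum>i<2 * M. (norm (e l i))\<^sup>2) = (\<Sum>i\<in>{1..<2 * M}. (norm (e l i))\<^sup>2)"
    by (rule sum.mono_neutral_right) (use e_bdry[OF l] in \<open>auto simp: Suc_le_eq\<close>)
  then show ?thesis
    using discrete_agmon[of "e l" h j "2 * M" Y X] e_bdry[OF l] h j Y[OF l] X[OF l] XYE
    by (simp add: N2_def D2_def)
qed

end

context cnfd_grid
begin

lemma N2_mesh: "l \<le> n \<Longrightarrow> mesh_norm h M (e l) = sqrt (N2 l)"
proof -
  assume l: "l \<le> n"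
  have "e l 0 = 0" using bdry(1)[OF l] by (simp add: e_def)
  then have "(\<Sum>i<2 * M. (norm (e l i))\<^sup>2) = (\<Sum>i\<in>{1..<2 * M}. (norm (e l i))\<^sup>2)"
    by (intro sum.mono_neutral_right) (auto simp: Suc_le_eq)
  then show ?thesis by (simp add: mesh_norm_def N2_def)
qed

lemma D2_mesh: "mesh_norm h M (dx_plus h (e l)) = sqrt (D2 l)"
  by (simp add: mesh_norm_def D2_def)

text \<open>Maxima over finitely many levels and nodes are attained, so every estimate for a single
  level becomes an inequality between the three numbers X, Y and E.\<close>

lemma maximal_norms:
  obtains X Y E where "cnfd_err h \<tau> lam \<mu> \<epsilon> m \<kappa> T a M n A U X Y E"
    "\<exists>l\<le>n. Y\<^sup>2 = N2 l" "\<exists>l\<le>n. X\<^sup>2 = D2 l" "\<exists>l\<le>n. \<exists>j\<le>2 * M. E = norm (e l j)"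
proof -
  have N: "0 \<le> N2 l" "0 \<le> D2 l" for l using h by (auto simp: N2_def D2_def sum_nonneg)
  define Y X E where "Y = sqrt (Max (N2 ` {..n}))" and "X = sqrt (Max (D2 ` {..n}))"
    and "E = Max ((\<lambda>(l, j). norm (e l j)) ` ({..n} \<times> {..2 * M}))"
  have "Max (N2 ` {..n}) \<in> N2 ` {..n}" "Max (D2 ` {..n}) \<in> D2 ` {..n}"
    "E \<in> (\<lambda>(l, j). norm (e l j)) ` ({..n} \<times> {..2 * M})" unfolding E_def by (intro Max_in; auto)+
  note mx = this
  obtain l1 where l1: "l1 \<le> n" "Max (N2 ` {..n}) = N2 l1" using mx(1) by (elim imageE) simp
  obtain l2 where l2: "l2 \<le> n" "Max (D2 ` {..n}) = D2 l2" using mx(2) by (elim imageE) simp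
  obtain l3 j3 where l3: "l3 \<le> n" "j3 \<le> 2 * M" "E = norm (e l3 j3)" using mx(3) by (elim imageE) auto
  note l = l1 l2 l3
  have Y2: "Y\<^sup>2 = N2 l1" and X2: "X\<^sup>2 = D2 l2" using l N by (auto simp: Y_def X_def)
  have "cnfd_err h \<tau> lam \<mu> \<epsilon> m \<kappa> T a M n A U X Y E"
  proof unfold_locales
    show "0 \<le> X" "0 \<le> Y" "0 \<le> E" using l N by (auto simp: X_def Y_def)
    fix l assume ln: "l \<le> n"
    show "N2 l \<le> Y\<^sup>2" unfolding Y2 l(2)[symmetric] using ln by (intro Max_ge) auto
    show "D2 l \<le> X\<^sup>2" unfolding X2 l(4)[symmetric] using ln by (intro Max_ge) auto
    fix j assume "j \<le> 2 * M"
    then show "norm (e l j) \<le> E" unfolding E_def using ln by (intro Max_ge) auto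
  qed
  then show ?thesis using that Y2 X2 l by blast
qed

end

text \<open>The coefficient of \<open>\<tau>\<^sup>2 / \<epsilon>\<^sup>2\<close> can be any
  prescribed \<omega>, paid for by a smaller \<epsilon>0; this freedom is what meets the fixed
  constant of the claim.\<close>

lemma cnfd_discrete:
  fixes a lam \<mu> m \<kappa> T \<omega> :: real
  assumes a: "0 < a" and T: "0 \<le> T" and m: "0 \<le> m" and \<kappa>: "0 \<le> \<kappa>" and \<omega>: "0 < \<omega>" "\<omega> \<le> 1"
  shows "\<exists>\<epsilon>0>0. \<epsilon>0 \<le> 1 \<and> (\<forall>\<epsilon>. 0 < \<epsilon> \<and> \<epsilon> \<le> \<epsilon>0 \<longrightarrow> (\<exists>K>0. \<exists>\<rho>>0. \<forall>h \<tau> M n A U.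
     cnfd_grid h \<tau> lam \<mu> \<epsilon> m \<kappa> T a M n A U \<and> h \<le> \<rho> \<and> \<tau> \<le> \<rho> \<longrightarrow>
     (\<forall>l\<le>n. mesh_norm h M (\<lambda>j. A l j - U l j) \<le> \<omega> * \<tau>\<^sup>2 / \<epsilon>\<^sup>2 + K * h\<^sup>2 \<and>
        mesh_norm h M (dx_plus h (\<lambda>j. A l j - U l j)) \<le> \<omega> * \<tau>\<^sup>2 / \<epsilon>\<^sup>2 + K * h\<^sup>2 \<and>
        (\<forall>j\<le>2 * M. norm (A l j - U l j) \<le> \<omega> * \<tau>\<^sup>2 / \<epsilon>\<^sup>2 + K * h\<^sup>2))))"
proof -
  define C1 where "C1 = (\<kappa> + 2 * \<bar>\<mu>\<bar> * m\<^sup>2) * sqrt (2 * a) + \<kappa>"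
  define C2 where "C2 = 4 * T * exp (32 * \<bar>\<mu>\<bar> * T) * C1"
  define C3 where "C3 = 2 * \<bar>\<mu>\<bar> * (6 + 2 * m + 24 * m * T)"
  define C4 where "C4 = 2 * (2 * a * \<bar>\<mu>\<bar> * (63 * m\<^sup>2 * (1 + T) + 8 * T * m ^ 3))"
  define C5 where "C5 = 2 * (1 + T) * C1"
  define C where "C = 1 + C2 + C3 + C4 + C5 + \<bar>lam\<bar> + 4 * \<bar>\<mu>\<bar>"
  have c1: "0 \<le> C1" using \<kappa> a by (auto simp: C1_def intro!: add_nonneg_nonneg mult_nonneg_nonneg)
  have cs: "0 \<le> C1" "0 \<le> C2" "0 \<le> C3" "0 \<le> C4" "0 \<le> C5"
    using c1 T m a by (auto simp: C2_def C3_def C4_def C5_def intro!: add_nonneg_nonneg mult_nonneg_nonneg)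
  have Cle: "1 \<le> C" "C2 \<le> C" "C3 \<le> C" "C4 + C5 \<le> C" "\<bar>lam\<bar> \<le> C" "4 * \<bar>\<mu>\<bar> \<le> C"
    using cs by (auto simp: C_def)
  obtain \<epsilon>0 where e0: "0 < \<epsilon>0" "\<epsilon>0 \<le> 1" and boot: "\<And>\<epsilon>. 0 < \<epsilon> \<Longrightarrow> \<epsilon> \<le> \<epsilon>0 \<Longrightarrow> \<exists>K>0. \<exists>\<rho>>0. \<forall>s \<eta> X Y E.
     0 \<le> s \<and> s \<le> \<rho> \<and> 0 \<le> \<eta> \<and> \<eta> \<le> \<rho> \<and> 0 \<le> X \<and> 0 \<le> Y \<and> 0 \<le> E \<and>
     Y\<^sup>2 \<le> C * ((s / \<epsilon> + \<eta>) * Y + \<eta> * E) \<and>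
     X\<^sup>2 \<le> C * (E\<^sup>2 + Y\<^sup>2 / \<epsilon> + E * Y\<^sup>2 + (s / \<epsilon> + \<eta>) * Y + (s / \<epsilon>\<^sup>2 + \<eta>) * E) \<and>
     E\<^sup>2 \<le> 2 * (X * Y) \<longrightarrow>
     X \<le> \<omega> * s / \<epsilon>\<^sup>2 + K * \<eta> \<and> Y \<le> \<omega> * s / \<epsilon>\<^sup>2 + K * \<eta> \<and> E \<le> \<omega> * s / \<epsilon>\<^sup>2 + K * \<eta>"
    using bootstrap[OF Cle(1) \<omega>] by blast
  have "\<exists>K>0. \<exists>\<rho>>0. \<forall>h \<tau> M n A U.
     cnfd_grid h \<tau> lam \<mu> \<epsilon> m \<kappa> T a M n A U \<and> h \<le> \<rho> \<and> \<tau> \<le> \<rho> \<longrightarrow>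
     (\<forall>l\<le>n. mesh_norm h M (\<lambda>j. A l j - U l j) \<le> \<omega> * \<tau>\<^sup>2 / \<epsilon>\<^sup>2 + K * h\<^sup>2 \<and>
        mesh_norm h M (dx_plus h (\<lambda>j. A l j - U l j)) \<le> \<omega> * \<tau>\<^sup>2 / \<epsilon>\<^sup>2 + K * h\<^sup>2 \<and>
        (\<forall>j\<le>2 * M. norm (A l j - U l j) \<le> \<omega> * \<tau>\<^sup>2 / \<epsilon>\<^sup>2 + K * h\<^sup>2))"
    if \<epsilon>: "0 < \<epsilon>" "\<epsilon> \<le> \<epsilon>0" for \<epsilon>
  proof -
    obtain K \<rho> where K: "0 < K" "0 < \<rho>" and bs: "\<And>s \<eta> X Y E.
     0 \<le> s \<Longrightarrow> s \<le> \<rho> \<Longrightarrow> 0 \<le> \<eta> \<Longrightarrow> \<eta> \<le> \<rho> \<Longrightarrow> 0 \<le> X \<Longrightarrow> 0 \<le> Y \<Longrightarrow> 0 \<le> E \<Longrightarrow>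
     Y\<^sup>2 \<le> C * ((s / \<epsilon> + \<eta>) * Y + \<eta> * E) \<Longrightarrow>
     X\<^sup>2 \<le> C * (E\<^sup>2 + Y\<^sup>2 / \<epsilon> + E * Y\<^sup>2 + (s / \<epsilon> + \<eta>) * Y + (s / \<epsilon>\<^sup>2 + \<eta>) * E) \<Longrightarrow>
     E\<^sup>2 \<le> 2 * (X * Y) \<Longrightarrow>
     X \<le> \<omega> * s / \<epsilon>\<^sup>2 + K * \<eta> \<and> Y \<le> \<omega> * s / \<epsilon>\<^sup>2 + K * \<eta> \<and> E \<le> \<omega> * s / \<epsilon>\<^sup>2 + K * \<eta>"
      using boot[OF \<epsilon>] by metis
    \<comment> \<open>At most 1 and \<rho>, so that the squares of h and \<tau> stay below \<rho>,
      and small enough for the Gronwall condition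
      \<open>16 * \<bar>\<mu>\<bar> * \<tau> \<le> 1\<close>.\<close>
    define \<rho>' where "\<rho>' = min (min 1 \<rho>) (1 / (16 * \<bar>\<mu>\<bar> + 1))"
    have r': "0 < \<rho>'" "\<rho>' \<le> 1" "\<rho>' \<le> \<rho>" "\<rho>' \<le> 1 / (16 * \<bar>\<mu>\<bar> + 1)" using K by (auto simp: \<rho>'_def)
    have sq: "x\<^sup>2 \<le> \<rho>" if "0 < x" "x \<le> \<rho>'" for x
    proof -
      have "x\<^sup>2 \<le> x" using that r' by (simp add: power2_eq_square mult_left_le)
      then show ?thesis using that r' by linarith
    qed
    have main: "mesh_norm h M (\<lambda>j. A l j - U l j) \<le> \<omega> * \<tau>\<^sup>2 / \<epsilon>\<^sup>2 + K * h\<^sup>2 \<and>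
        mesh_norm h M (dx_plus h (\<lambda>j. A l j - U l j)) \<le> \<omega> * \<tau>\<^sup>2 / \<epsilon>\<^sup>2 + K * h\<^sup>2 \<and>
        (\<forall>j\<le>2 * M. norm (A l j - U l j) \<le> \<omega> * \<tau>\<^sup>2 / \<epsilon>\<^sup>2 + K * h\<^sup>2)"
      if g: "cnfd_grid h \<tau> lam \<mu> \<epsilon> m \<kappa> T a M n A U" and small: "h \<le> \<rho>'" "\<tau> \<le> \<rho>'" and l: "l \<le> n"
      for h \<tau> M n A U l
    proof -
      interpret g: cnfd_grid h \<tau> lam \<mu> \<epsilon> m \<kappa> T a M n A U by (rule g)
      obtain X Y E where "cnfd_err h \<tau> lam \<mu> \<epsilon> m \<kappa> T a M n A U X Y E"
        and att: "\<exists>l\<le>n. Y\<^sup>2 = g.N2 l" "\<exists>l\<le>n. X\<^sup>2 = g.D2 l" "\<exists>l\<le>n. \<exists>j\<le>2 * M. E = norm (g.e l j)"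
        by (rule g.maximal_norms)
      then interpret c: cnfd_err h \<tau> lam \<mu> \<epsilon> m \<kappa> T a M n A U X Y E by simp
      have "16 * \<bar>\<mu>\<bar> * \<tau> \<le> (16 * \<bar>\<mu>\<bar> + 1) * \<rho>'" using small g.\<tau> by (intro mult_mono) auto
      also have "\<dots> \<le> (16 * \<bar>\<mu>\<bar> + 1) * (1 / (16 * \<bar>\<mu>\<bar> + 1))" using r' by (intro mult_left_mono) auto
      also have "\<dots> = 1" by (simp add: add_nonneg_eq_0_iff)
      finally have st: "16 * \<bar>\<mu>\<bar> * \<tau> \<le> 1" .
      define s \<eta> where "s = \<tau>\<^sup>2" and "\<eta> = h\<^sup>2"
      have s: "0 \<le> s" "s \<le> \<rho>" and \<eta>: "0 \<le> \<eta>" "\<eta> \<le> \<rho>" using sq small g.h g.\<tau> by (auto simp: s_def \<eta>_def)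
      define Z where "Z = (s / \<epsilon> + \<eta>) * Y + \<eta> * E"
      have Z: "0 \<le> Z" using s \<eta> c.XYE \<epsilon> by (auto simp: Z_def)
      have B0: "c.B0 \<le> C1 * Z" using c.B0_le by (simp add: C1_def Z_def s_def \<eta>_def)
      have Y2: "Y\<^sup>2 \<le> C * Z"
      proof -
        have "Y\<^sup>2 \<le> 4 * T * exp (32 * \<bar>\<mu>\<bar> * T) * c.B0" using att(1) c.L2_bound[OF st] by auto
        also have "\<dots> \<le> 4 * T * exp (32 * \<bar>\<mu>\<bar> * T) * (C1 * Z)" using B0 T by (intro mult_left_mono) auto
        also have "\<dots> = C2 * Z" by (simp add: C2_def)
        also have "\<dots> \<le> C * Z" using Cle Z by (intro mult_right_mono) auto
        finally show ?thesis .
      qed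
      have X2: "X\<^sup>2 \<le> C * (E\<^sup>2 + Y\<^sup>2 / \<epsilon> + E * Y\<^sup>2 + (s / \<epsilon> + \<eta>) * Y + (s / \<epsilon>\<^sup>2 + \<eta>) * E)"
      proof -
        obtain k where k: "k \<le> n" "X\<^sup>2 = g.D2 k" using att(2) by auto
        have "X\<^sup>2 \<le> \<bar>lam\<bar> * E\<^sup>2 + 2 * \<bar>\<mu>\<bar> * ((6 / \<epsilon> + 2 * m + 2 * E + 24 / \<epsilon> * m * T) * Y\<^sup>2)
          + 2 * ((1 + T) * c.B0 + 2 * a * \<bar>\<mu>\<bar> * (63 * m\<^sup>2 * (1 + T) + 8 * T * m ^ 3) * \<tau>\<^sup>2 / \<epsilon>\<^sup>2 * E)"
          unfolding k(2) by (rule c.H1_bound[OF k(1)])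
        also have "\<dots> \<le> C * E\<^sup>2 + (C * (Y\<^sup>2 / \<epsilon>) + C * (E * Y\<^sup>2)) + (C5 * Z + C4 * (s / \<epsilon>\<^sup>2 * E))"
        proof (intro add_mono)
          show "\<bar>lam\<bar> * E\<^sup>2 \<le> C * E\<^sup>2" using Cle by (intro mult_right_mono) auto
          have "6 / \<epsilon> + 2 * m + 2 * E + 24 / \<epsilon> * m * T \<le> (6 + 2 * m + 24 * m * T) / \<epsilon> + 2 * E"
          proof -
            have "2 * m \<le> 2 * m / \<epsilon>" using m \<epsilon> e0 by (simp add: le_divide_eq mult_left_le)
            moreover have "(6 + 2 * m + 24 * m * T) / \<epsilon> = 6 / \<epsilon> + 2 * m / \<epsilon> + 24 / \<epsilon> * m * T"
              by (simp add: add_divide_distrib)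
            ultimately show ?thesis by simp
          qed
          then have "(6 / \<epsilon> + 2 * m + 2 * E + 24 / \<epsilon> * m * T) * Y\<^sup>2 \<le> ((6 + 2 * m + 24 * m * T) / \<epsilon> + 2 * E) * Y\<^sup>2"
            by (intro mult_right_mono) auto
          then have "2 * \<bar>\<mu>\<bar> * ((6 / \<epsilon> + 2 * m + 2 * E + 24 / \<epsilon> * m * T) * Y\<^sup>2)
             \<le> 2 * \<bar>\<mu>\<bar> * (((6 + 2 * m + 24 * m * T) / \<epsilon> + 2 * E) * Y\<^sup>2)" by (intro mult_left_mono) auto
          also have "\<dots> = C3 * (Y\<^sup>2 / \<epsilon>) + 4 * \<bar>\<mu>\<bar> * (E * Y\<^sup>2)" by (simp add: C3_def algebra_simps add_divide_distrib)
          also have "\<dots> \<le> C * (Y\<^sup>2 / \<epsilon>) + C * (E * Y\<^sup>2)"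
            using Cle \<epsilon> c.XYE by (intro add_mono mult_right_mono) auto
          finally show "2 * \<bar>\<mu>\<bar> * ((6 / \<epsilon> + 2 * m + 2 * E + 24 / \<epsilon> * m * T) * Y\<^sup>2) \<le> C * (Y\<^sup>2 / \<epsilon>) + C * (E * Y\<^sup>2)" .
          have "(1 + T) * c.B0 \<le> (1 + T) * (C1 * Z)" using B0 T by (intro mult_left_mono) auto
          moreover have "C5 * Z + C4 * (s / \<epsilon>\<^sup>2 * E) = 2 * ((1 + T) * (C1 * Z) + 2 * a * \<bar>\<mu>\<bar> * (63 * m\<^sup>2 * (1 + T) + 8 * T * m ^ 3) * \<tau>\<^sup>2 / \<epsilon>\<^sup>2 * E)"
          proof -
            have "C5 * Z = 2 * ((1 + T) * (C1 * Z))" by (simp only: C5_def mult.assoc)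
            moreover have "C4 * (s / \<epsilon>\<^sup>2 * E) = 2 * (2 * a * \<bar>\<mu>\<bar> * (63 * m\<^sup>2 * (1 + T) + 8 * T * m ^ 3) * \<tau>\<^sup>2 / \<epsilon>\<^sup>2 * E)"
              by (simp add: C4_def s_def)
            ultimately show ?thesis by (simp only: distrib_left)
          qed
          ultimately show "2 * ((1 + T) * c.B0 + 2 * a * \<bar>\<mu>\<bar> * (63 * m\<^sup>2 * (1 + T) + 8 * T * m ^ 3) * \<tau>\<^sup>2 / \<epsilon>\<^sup>2 * E)
            \<le> C5 * Z + C4 * (s / \<epsilon>\<^sup>2 * E)"
            by simp
        qed
        also have "\<dots> \<le> C * E\<^sup>2 + (C * (Y\<^sup>2 / \<epsilon>) + C * (E * Y\<^sup>2)) + C * ((s / \<epsilon> + \<eta>) * Y + (s / \<epsilon>\<^sup>2 + \<eta>) * E)"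
        proof -
          define W where "W = (s / \<epsilon> + \<eta>) * Y + (s / \<epsilon>\<^sup>2 + \<eta>) * E"
          have q: "0 \<le> (s / \<epsilon> + \<eta>) * Y" "0 \<le> \<eta> * E" "0 \<le> s / \<epsilon>\<^sup>2 * E" using s \<eta> c.XYE \<epsilon> by auto
          have W: "Z \<le> W" "s / \<epsilon>\<^sup>2 * E \<le> W" "0 \<le> W" using q unfolding W_def Z_def distrib_right[of "s / \<epsilon>\<^sup>2"] by linarith+
          have "C5 * Z + C4 * (s / \<epsilon>\<^sup>2 * E) \<le> C5 * W + C4 * W" using W cs by (intro add_mono mult_left_mono) auto
          also have "\<dots> = (C4 + C5) * W" by (simp add: distrib_right)
          also have "\<dots> \<le> C * W" using Cle W by (intro mult_right_mono) auto
          finally show ?thesis unfolding W_def by linarith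
        qed
        also have "\<dots> = C * (E\<^sup>2 + Y\<^sup>2 / \<epsilon> + E * Y\<^sup>2 + (s / \<epsilon> + \<eta>) * Y + (s / \<epsilon>\<^sup>2 + \<eta>) * E)"
          by (simp only: distrib_left add.assoc)
        finally show ?thesis .
      qed
      have E2: "E\<^sup>2 \<le> 2 * (X * Y)" using att(3) c.agmon by auto
      have fin: "X \<le> \<omega> * s / \<epsilon>\<^sup>2 + K * \<eta> \<and> Y \<le> \<omega> * s / \<epsilon>\<^sup>2 + K * \<eta> \<and> E \<le> \<omega> * s / \<epsilon>\<^sup>2 + K * \<eta>"
        by (rule bs[OF s \<eta> c.XYE Y2[unfolded Z_def] X2 E2])
      have el: "(\<lambda>j. A l j - U l j) = g.e l" by (simp add: g.e_def fun_eq_iff)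
      have "mesh_norm h M (g.e l) \<le> Y"
        unfolding g.N2_mesh[OF l] using real_sqrt_le_mono[OF c.Y[OF l]] c.XYE by simp
      moreover have "mesh_norm h M (dx_plus h (g.e l)) \<le> X"
        unfolding g.D2_mesh using real_sqrt_le_mono[OF c.X[OF l]] c.XYE by simp
      moreover have "norm (A l j - U l j) \<le> E" if "j \<le> 2 * M" for j
        using c.E[OF l that] by (simp add: g.e_def)
      ultimately show ?thesis unfolding el using fin unfolding s_def \<eta>_def by (meson order_trans)
    qed
    show ?thesis using K(1) r'(1) main by blast
  qed
  then show ?thesis using e0 by blast
qed

section \<open>Mollification\<close>

text \<open>Functions of this form are closed under differentiation, see \<open>bump_has_derivative\<close>.\<close>

definition bump :: "real poly \<Rightarrow> nat \<Rightarrow> real \<Rightarrow> real" where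
  "bump p n x = (if \<bar>x\<bar> < 1 then poly p x * (1 / (1 - x\<^sup>2)) ^ n * exp (- (1 / (1 - x\<^sup>2))) else 0)"

text \<open>Numerator of the derivative over the common denominator (1 - x^2)^(n + 2); the
  polynomial \<open>[:1, 0, -1:]\<close> is 1 - x^2.\<close>

definition bump_step :: "real poly \<Rightarrow> nat \<Rightarrow> real poly" where
  "bump_step p n = pderiv p * [:1, 0, -1:]\<^sup>2 + smult (2 * real n) ([:0, 1:] * p * [:1, 0, -1:]) - [:0, 2:] * p"

lemma power_times_exp_minus_le:
  fixes v :: real
  assumes "0 < v" shows "v ^ n * exp (- v) \<le> fact (n + 2) / v\<^sup>2"
proof -
  have "v ^ (n + 2) / fact (n + 2) = (\<Sum>k\<in>{n + 2}. inverse (fact k) * v ^ k)" by (simp add: field_simps)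
  also have "\<dots> \<le> (\<Sum>k. inverse (fact k) * v ^ k)"
    using assms summable_exp[of v] by (intro sum_le_suminf) auto
  also have "\<dots> = exp v" unfolding exp_def by (simp add: scaleR_conv_of_real)
  finally have "v ^ (n + 2) \<le> fact (n + 2) * exp v" by (simp add: divide_le_eq mult.commute)
  then have "v ^ n * v\<^sup>2 \<le> fact (n + 2) * exp v" by (simp only: power_add)
  then have "v ^ n * v\<^sup>2 * exp (- v) \<le> fact (n + 2) * exp v * exp (- v)"
    by (intro mult_right_mono) auto
  also have "\<dots> = fact (n + 2)" by (simp add: exp_minus)
  finally show ?thesis using assms by (simp add: pos_le_divide_eq mult_ac)
qed

lemma one_minus_square_pos: "\<bar>x\<bar> < 1 \<Longrightarrow> 0 < 1 - x\<^sup>2" for x :: real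
  using abs_square_less_1[of x] by simp

text \<open>The exponential beats every power of 1 / (1 - y^2). Quadratic vanishing at the ends
  already gives derivative 0 there, and as it holds for the whole family it serves derivatives of
  every order at once.\<close>

lemma bump_bound: "\<exists>K\<ge>0. \<forall>y. \<bar>bump p n y\<bar> \<le> K * (max 0 (1 - y\<^sup>2))\<^sup>2"
proof -
  have "compact (poly p ` {-1..1})" by (intro compact_continuous_image) (auto intro!: continuous_intros)
  then have "bounded (poly p ` {-1..1})" by (rule compact_imp_bounded)
  then obtain B where "\<forall>z\<in>poly p ` {-1..1}. norm z \<le> B" unfolding bounded_iff by blast
  then have B: "\<And>x. x \<in> {-1..1} \<Longrightarrow> \<bar>poly p x\<bar> \<le> B" by simp
  have B0: "0 \<le> B" using order_trans[OF abs_ge_zero B[of 0]] by simp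
  show ?thesis
  proof (intro exI conjI allI)
    show "0 \<le> B * fact (n + 2)" using B0 by simp
    fix y :: real
    show "\<bar>bump p n y\<bar> \<le> B * fact (n + 2) * (max 0 (1 - y\<^sup>2))\<^sup>2"
    proof (cases "\<bar>y\<bar> < 1")
      case True
      define v where "v = 1 / (1 - y\<^sup>2)"
      have v: "0 < v" "1 - y\<^sup>2 = 1 / v" using one_minus_square_pos[OF True] by (auto simp: v_def)
      have "\<bar>bump p n y\<bar> = \<bar>poly p y\<bar> * (v ^ n * exp (- v))" using True v by (simp add: bump_def abs_mult v_def[symmetric])
      also have "\<dots> \<le> B * (fact (n + 2) / v\<^sup>2)"
      proof (intro mult_mono power_times_exp_minus_le v B0)
        show "\<bar>poly p y\<bar> \<le> B" using True by (intro B) (auto simp: abs_less_iff)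
      qed (use v in auto)
      also have "\<dots> = B * fact (n + 2) * (max 0 (1 - y\<^sup>2))\<^sup>2" unfolding v(2) using v(1) by (simp add: power_divide)
      finally show ?thesis .
    qed (use B0 in \<open>simp add: bump_def\<close>)
  qed
qed

lemma bump_has_derivative: "(bump p n has_real_derivative bump (bump_step p n) (n + 2) x) (at x)"
proof (cases "\<bar>x\<bar> < 1")
  case True
  define v where "v = 1 / (1 - x\<^sup>2)"
  have pos: "0 < 1 - x\<^sup>2" by (rule one_minus_square_pos[OF True])
  have v: "1 - x\<^sup>2 = 1 / v" "0 < v" using pos by (auto simp: v_def)
  have dv: "((\<lambda>x. 1 / (1 - x\<^sup>2)) has_real_derivative 2 * x * v\<^sup>2) (at x)"
    using pos by (auto intro!: derivative_eq_intros simp: v_def power2_eq_square field_simps)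
  have dvn: "((\<lambda>x. (1 / (1 - x\<^sup>2)) ^ n) has_real_derivative real n * (2 * x) * v ^ (n + 1)) (at x)"
  proof (cases n)
    case (Suc k)
    show ?thesis by (rule DERIV_cong[OF DERIV_power[OF dv]]) (unfold v_def[symmetric] Suc, simp add: power2_eq_square)
  qed simp
  have de: "((\<lambda>x. exp (- (1 / (1 - x\<^sup>2)))) has_real_derivative exp (- v) * (- (2 * x * v\<^sup>2))) (at x)"
    by (rule DERIV_cong[OF DERIV_fun_exp[OF DERIV_minus[OF dv]]]) (simp add: v_def[symmetric])
  have d: "((\<lambda>x. poly p x * (1 / (1 - x\<^sup>2)) ^ n * exp (- (1 / (1 - x\<^sup>2)))) has_real_derivative
     bump (bump_step p n) (n + 2) x) (at x)"
  proof (rule DERIV_cong[OF DERIV_mult[OF DERIV_mult[OF poly_DERIV dvn] de]])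
    have q: "poly (bump_step p n) x = poly (pderiv p) x * (1 / v)\<^sup>2 + 2 * real n * (x * poly p x * (1 / v)) - 2 * x * poly p x"
    proof -
      have "poly [:1, 0, -1:] x = 1 / v" unfolding v(1)[symmetric] by (simp add: power2_eq_square)
      then show ?thesis unfolding bump_step_def poly_diff poly_add poly_mult poly_power poly_smult by simp
    qed
    show "(poly (pderiv p) x * (1 / (1 - x\<^sup>2)) ^ n + real n * (2 * x) * v ^ (n + 1) * poly p x) * exp (- (1 / (1 - x\<^sup>2)))
        + exp (- v) * - (2 * x * v\<^sup>2) * (poly p x * (1 / (1 - x\<^sup>2)) ^ n) = bump (bump_step p n) (n + 2) x"
    proof -
      obtain i where i: "1 / v = i" by simp
      have iv: "i * v = 1" using v(2) i by auto
      have i1: "i * v ^ (n + 2) = v ^ (n + 1)" using iv by (simp add: mult.assoc[symmetric])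
      have "i\<^sup>2 * v ^ (n + 2) = i * (i * v ^ (n + 2))" by (simp add: power2_eq_square)
      also have "\<dots> = (i * v) * v ^ n" unfolding i1 by simp
      finally have i2: "i\<^sup>2 * v ^ (n + 2) = v ^ n" unfolding iv by simp
      have "(poly (pderiv p) x * i\<^sup>2 + 2 * real n * (x * poly p x * i) - 2 * x * poly p x) * v ^ (n + 2) * exp (- v)
        = (poly (pderiv p) x * (i\<^sup>2 * v ^ (n + 2)) + 2 * real n * (x * poly p x * (i * v ^ (n + 2))) - 2 * x * poly p x * v ^ (n + 2)) * exp (- v)"
        by (simp only: ring_distribs mult_ac)
      also have "\<dots> = (poly (pderiv p) x * v ^ n + real n * (2 * x) * v ^ (n + 1) * poly p x) * exp (- v)
        + exp (- v) * - (2 * x * v\<^sup>2) * (poly p x * v ^ n)"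
        unfolding i1 i2 by (simp add: algebra_simps power2_eq_square)
      finally show ?thesis unfolding bump_def if_P[OF True] q v_def[symmetric] i by simp
    qed
  qed
  show ?thesis
    by (rule has_field_derivative_transform_within_open[OF d, of "{-1<..<1}"]) (use True in \<open>auto simp: bump_def\<close>)
next
  case False
  obtain K where K: "0 \<le> K" "\<And>y. \<bar>bump p n y\<bar> \<le> K * (max 0 (1 - y\<^sup>2))\<^sup>2" using bump_bound by blast
  have dist: "max 0 (1 - y\<^sup>2) \<le> 2 * \<bar>y - x\<bar>" for y
  proof (cases "\<bar>y\<bar> < 1")
    case True
    have "1 - y\<^sup>2 = (1 - \<bar>y\<bar>) * (1 + \<bar>y\<bar>)" by (simp add: power2_eq_square algebra_simps)
    also have "\<dots> \<le> (1 - \<bar>y\<bar>) * 2" using True by (intro mult_left_mono) auto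
    also have "\<dots> \<le> 2 * \<bar>y - x\<bar>" using False by (simp add: abs_if split: if_splits)
    finally show ?thesis by simp
  next
    case False
    then have "1 \<le> y\<^sup>2" using abs_square_less_1[of y] by (simp add: not_less)
    then show ?thesis by simp
  qed
  have bnd: "\<bar>bump p n y\<bar> \<le> 4 * K * (y - x)\<^sup>2" for y
  proof -
    have "\<bar>bump p n y\<bar> \<le> K * (2 * \<bar>y - x\<bar>)\<^sup>2"
      using K(2)[of y] mult_left_mono[OF power_mono[OF dist[of y], of 2] K(1)] by simp
    then show ?thesis by (simp add: power_mult_distrib)
  qed
  have fx: "bump p n x = 0" "bump (bump_step p n) (n + 2) x = 0" using False by (auto simp: bump_def)
  have "((\<lambda>y. (bump p n y - bump p n x) / (y - x)) \<longlongrightarrow> 0) (at x)"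
  proof (rule Lim_null_comparison)
    show "\<forall>\<^sub>F y in at x. norm ((bump p n y - bump p n x) / (y - x)) \<le> 4 * K * \<bar>y - x\<bar>"
    proof (rule always_eventually, rule allI)
      fix y
      show "norm ((bump p n y - bump p n x) / (y - x)) \<le> 4 * K * \<bar>y - x\<bar>"
        using bnd[of y] K(1) by (cases "y = x") (auto simp: fx abs_divide pos_divide_le_eq power2_eq_square abs_mult_self_eq mult.assoc abs_mult[symmetric])
    qed
    show "((\<lambda>y. 4 * K * \<bar>y - x\<bar>) \<longlongrightarrow> 0) (at x)" by (auto intro!: tendsto_eq_intros)
  qed
  then show ?thesis unfolding fx(2) has_field_derivative_iff .
qed

lemma exists_smooth_bump:
  "\<exists>B :: nat \<Rightarrow> real \<Rightarrow> real. (\<forall>j x. (B j has_real_derivative B (Suc j) x) (at x)) \<and>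
     (\<forall>j x. 1 \<le> \<bar>x\<bar> \<longrightarrow> B j x = 0) \<and> (\<forall>x. 0 \<le> B 0 x) \<and> 0 < B 0 0"
proof -
  \<comment> \<open>Iterates the pair of polynomial and exponent, so that \<open>B j\<close> is the
    j-th derivative of \<open>B 0\<close>, the standard bump exp (-1 / (1 - x^2)).\<close>
  define P where "P = rec_nat (1, 0) (\<lambda>_ (p, n). (bump_step p n, n + 2))"
  define B where "B j = bump (fst (P j)) (snd (P j))" for j
  have PS: "P (Suc j) = (bump_step (fst (P j)) (snd (P j)), snd (P j) + 2)" for j
    unfolding P_def by (simp add: case_prod_beta)
  have P0: "P 0 = (1, 0)" by (simp add: P_def)
  show ?thesis
  proof (intro exI[of _ B] conjI allI impI)
    show "(B j has_real_derivative B (Suc j) x) (at x)" for j x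
      unfolding B_def PS by (simp only: fst_conv snd_conv) (rule bump_has_derivative)
    show "B j x = 0" if "1 \<le> \<bar>x\<bar>" for j x using that by (simp add: B_def bump_def)
    show "0 \<le> B 0 x" for x by (simp add: B_def P0 bump_def)
    show "0 < B 0 0" by (simp add: B_def P0 bump_def)
  qed
qed

text \<open>All derivatives of one bump, indexed by order. It is not normalised; its integral
  \<open>moll_mass\<close> is divided out where averages are formed.\<close>

definition moll :: "nat \<Rightarrow> real \<Rightarrow> real" where
  "moll = (SOME B. (\<forall>j x. (B j has_real_derivative B (Suc j) x) (at x)) \<and>
     (\<forall>j x. 1 \<le> \<bar>x\<bar> \<longrightarrow> B j x = 0) \<and> (\<forall>x. 0 \<le> B 0 x) \<and> 0 < B 0 0)"

lemma moll_props:
  shows moll_deriv: "(moll j has_real_derivative moll (Suc j) x) (at x)"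
    and moll_zero: "1 \<le> \<bar>x\<bar> \<Longrightarrow> moll j x = 0"
    and moll_nonneg: "0 \<le> moll 0 x"
    and moll_pos: "0 < moll 0 0"
  using someI_ex[OF exists_smooth_bump, folded moll_def] by blast+

lemma continuous_on_moll: "continuous_on S (moll j)"
  by (intro continuous_at_imp_continuous_on ballI DERIV_isCont[OF moll_deriv])

text \<open>The j-th y-derivative of the bump rescaled to radius \<eta> about x, complex-valued so
  that it can serve as a test function.\<close>

definition kern :: "real \<Rightarrow> nat \<Rightarrow> real \<Rightarrow> real \<Rightarrow> complex" where
  "kern \<eta> j x y = of_real ((1 / \<eta>) ^ j * moll j ((y - x) / \<eta>))"

lemma kern_deriv_y: "0 < \<eta> \<Longrightarrow> ((\<lambda>y. kern \<eta> j x y) has_vector_derivative kern \<eta> (Suc j) x y) (at y within S)"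
proof -
  assume \<eta>: "0 < \<eta>"
  have "((\<lambda>y. (y - x) / \<eta>) has_real_derivative 1 / \<eta>) (at y)" using \<eta> by (auto intro!: derivative_eq_intros)
  from DERIV_cmult[OF DERIV_chain2[OF moll_deriv this], of "(1 / \<eta>) ^ j" j]
  have "((\<lambda>y. (1 / \<eta>) ^ j * moll j ((y - x) / \<eta>)) has_real_derivative (1 / \<eta>) ^ Suc j * moll (Suc j) ((y - x) / \<eta>)) (at y)"
    by (rule DERIV_cong) (simp only: power_Suc mult_ac)
  then show ?thesis unfolding kern_def
    by (rule has_vector_derivative_of_real[OF has_field_derivative_at_within])
qed

lemma kern_deriv_x: "0 < \<eta> \<Longrightarrow> ((\<lambda>x. kern \<eta> j x y) has_vector_derivative - kern \<eta> (Suc j) x y) (at x within S)"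
proof -
  assume \<eta>: "0 < \<eta>"
  have "((\<lambda>x. (y - x) / \<eta>) has_real_derivative - (1 / \<eta>)) (at x)" using \<eta> by (auto intro!: derivative_eq_intros)
  from DERIV_cmult[OF DERIV_chain2[OF moll_deriv this], of "(1 / \<eta>) ^ j" j]
  have "((\<lambda>x. (1 / \<eta>) ^ j * moll j ((y - x) / \<eta>)) has_real_derivative - ((1 / \<eta>) ^ Suc j * moll (Suc j) ((y - x) / \<eta>))) (at x)"
    by (rule DERIV_cong) (simp only: power_Suc mult_ac mult_minus_left mult_minus_right)
  then show ?thesis unfolding kern_def of_real_minus[symmetric]
    by (rule has_vector_derivative_of_real[OF has_field_derivative_at_within])
qed

lemma vderiv_kern_Suc:
  assumes "0 < \<eta>" shows "vderiv (kern \<eta> i x) = kern \<eta> (Suc i) x"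
  unfolding vderiv_def by (rule ext, rule vector_derivative_at, rule kern_deriv_y, rule assms)

lemma vderiv_kern:
  assumes "0 < \<eta>" shows "(vderiv ^^ j) (kern \<eta> i x) = kern \<eta> (i + j) x"
proof (induction j)
  case 0 show ?case by simp
next
  case (Suc j)
  show ?case unfolding funpow.simps o_apply Suc vderiv_kern_Suc[OF assms] by simp
qed

lemma outside_support:
  fixes x y \<eta> :: real
  assumes "0 < \<eta>" "y \<notin> {x - \<eta><..<x + \<eta>}" shows "1 \<le> \<bar>(y - x) / \<eta>\<bar>"
proof -
  have "\<eta> \<le> \<bar>y - x\<bar>" using assms by (cases "y \<le> x - \<eta>") simp_all
  then have "\<eta> / \<eta> \<le> \<bar>y - x\<bar> / \<eta>" using assms(1) by (intro divide_right_mono) auto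
  then show ?thesis using assms(1) by (simp add: abs_divide)
qed

lemma kern_zero: "0 < \<eta> \<Longrightarrow> y \<notin> {x - \<eta><..<x + \<eta>} \<Longrightarrow> kern \<eta> j x y = 0"
  unfolding kern_def using moll_zero[OF outside_support, of \<eta> y x j] by simp

lemma test_function_kern:
  assumes "0 < \<eta>" "{x - \<eta>..x + \<eta>} \<subseteq> S" shows "test_function S (kern \<eta> j x)"
  unfolding test_function_def
proof (intro conjI allI)
  fix i y
  show "(vderiv ^^ i) (kern \<eta> j x) differentiable at y"
    unfolding vderiv_kern[OF assms(1)] by (rule differentiableI_vector[OF kern_deriv_y[OF assms(1)]])
  show "\<exists>K. compact K \<and> K \<subseteq> S \<and> (\<forall>y. y \<notin> K \<longrightarrow> kern \<eta> j x y = 0)"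
    using assms kern_zero[OF assms(1), of _ x j] by (intro exI[of _ "{x - \<eta>..x + \<eta>}"]) auto
qed

lemma continuous_on_kern: "0 < \<eta> \<Longrightarrow> continuous_on S (\<lambda>(x, y). kern \<eta> j x y)"
proof -
  assume \<eta>: "0 < \<eta>"
  have "continuous_on S (\<lambda>p. (snd p - fst p) / \<eta>)" using \<eta> by (intro continuous_intros) auto
  then have "continuous_on S (\<lambda>p. moll j ((snd p - fst p) / \<eta>))"
    by (rule continuous_on_compose2[OF continuous_on_moll[of UNIV]]) simp
  then show ?thesis unfolding kern_def case_prod_beta
    by (intro continuous_on_of_real continuous_on_mult continuous_on_const)
qed

lemma continuous_on_kern_y: "0 < \<eta> \<Longrightarrow> continuous_on S (kern \<eta> j x)"
proof -
  assume \<eta>: "0 < \<eta>"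
  have "continuous_on S (\<lambda>y. (y - x) / \<eta>)" using \<eta> by (intro continuous_intros) auto
  then have "continuous_on S (\<lambda>y. moll j ((y - x) / \<eta>))"
    by (rule continuous_on_compose2[OF continuous_on_moll[of UNIV]]) simp
  then show ?thesis unfolding kern_def
    by (intro continuous_on_of_real continuous_on_mult continuous_on_const)
qed

lemma norm_kern: "0 < \<eta> \<Longrightarrow> norm (kern \<eta> 0 x y) = moll 0 ((y - x) / \<eta>)"
  using moll_nonneg[of "(y - x) / \<eta>"] unfolding kern_def by (simp only: norm_of_real power_0 mult_1 abs_of_nonneg)

definition moll_mass :: real where "moll_mass = integral {-1..1} (moll 0)"

lemma moll_mass_pos: "0 < moll_mass"
proof -
  have i: "moll 0 integrable_on {-1..1}" by (intro integrable_continuous_interval continuous_on_moll)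
  have "0 \<le> moll_mass" unfolding moll_mass_def by (intro integral_nonneg i moll_nonneg)
  moreover have "moll_mass \<noteq> 0"
  proof
    assume "moll_mass = 0"
    then have "(moll 0 has_integral 0) (cbox (-1) 1)" using i unfolding moll_mass_def by (simp add: has_integral_iff)
    then have "moll 0 0 = 0"
      by (rule has_integral_0_cbox_imp_0[OF continuous_on_moll moll_nonneg]) (simp_all add: box_real)
    then show False using moll_pos by simp
  qed
  ultimately show ?thesis by simp
qed

lemma kern_integral:
  assumes "0 < \<eta>" "{x - \<eta>..x + \<eta>} \<subseteq> {c..d}"
  shows "((\<lambda>y. moll 0 ((y - x) / \<eta>)) has_integral \<eta> * moll_mass) {c..d}"
proof -
  have "(moll 0 has_integral moll_mass) (cbox (-1) 1)"
    unfolding moll_mass_def box_real by (intro integrable_integral integrable_continuous_interval continuous_on_moll)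
  from has_integral_affinity'[OF this, of "1 / \<eta>" "- x / \<eta>"] assms(1)
  have "((\<lambda>y. moll 0 ((1 / \<eta>) *\<^sub>R y + - x / \<eta>)) has_integral moll_mass /\<^sub>R (1 / \<eta>) ^ DIM(real))
     (cbox ((- 1 - - x / \<eta>) /\<^sub>R (1 / \<eta>)) ((1 - - x / \<eta>) /\<^sub>R (1 / \<eta>)))" by simp
  moreover have "(- 1 - - x / \<eta>) /\<^sub>R (1 / \<eta>) = x - \<eta>" "(1 - - x / \<eta>) /\<^sub>R (1 / \<eta>) = x + \<eta>"
    using assms(1) by (simp_all add: right_diff_distrib distrib_left)
  moreover have "(1 / \<eta>) *\<^sub>R y + - x / \<eta> = (y - x) / \<eta>" for y by (simp add: diff_divide_distrib)
  moreover have "moll_mass /\<^sub>R (1 / \<eta>) ^ DIM(real) = \<eta> * moll_mass" by simp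
  ultimately have "((\<lambda>y. moll 0 ((y - x) / \<eta>)) has_integral \<eta> * moll_mass) {x - \<eta>..x + \<eta>}"
    by (simp only: box_real)
  then show ?thesis
  proof (rule has_integral_on_superset)
    fix y assume "y \<notin> {x - \<eta>..x + \<eta>}"
    then show "moll 0 ((y - x) / \<eta>) = 0" using assms(1) by (intro moll_zero outside_support) auto
  qed (use assms in auto)
qed

section \<open>From weak bounds to classical derivatives\<close>

lemma norm_diff_le_vector_derivative:
  fixes f :: "real \<Rightarrow> 'a::real_normed_vector"
  assumes "\<And>s. s \<in> closed_segment x y \<Longrightarrow> (f has_vector_derivative f' s) (at s within closed_segment x y)"
    "\<And>s. s \<in> closed_segment x y \<Longrightarrow> norm (f' s) \<le> B"
  shows "norm (f y - f x) \<le> B * \<bar>y - x\<bar>"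
proof -
  have "norm (f y - f x) \<le> B * norm (y - x)"
  proof (rule differentiable_bound[OF convex_closed_segment[of x y]])
    fix s assume s: "s \<in> closed_segment x y"
    show "(f has_derivative (\<lambda>h. h *\<^sub>R f' s)) (at s within closed_segment x y)"
      using assms(1)[OF s] by (simp add: has_vector_derivative_def)
    show "onorm (\<lambda>h. h *\<^sub>R f' s) \<le> B"
    proof (rule onorm_le)
      fix h :: real
      show "norm (h *\<^sub>R f' s) \<le> B * norm h"
        using mult_right_mono[OF assms(2)[OF s] norm_ge_zero[of h]] by (simp add: mult.commute)
    qed
  qed auto
  then show ?thesis by simp
qed

lemma closed_segment_subset_interval:
  fixes x y c d :: real
  assumes "x \<in> {c<..<d}" "y \<in> {c<..<d}" shows "closed_segment x y \<subseteq> {c<..<d}"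
  using assms by (auto simp: closed_segment_eq_real_ivl split: if_splits)

lemma closed_segment_abs_le:
  fixes x y s :: real
  assumes "s \<in> closed_segment x y" shows "\<bar>s - x\<bar> \<le> \<bar>y - x\<bar>"
  using assms by (auto simp: closed_segment_eq_real_ivl split: if_splits)

lemma taylor1_lipschitz:
  fixes f :: "real \<Rightarrow> 'a::real_normed_vector"
  assumes d: "\<And>s. s \<in> {c<..<d} \<Longrightarrow> (f has_vector_derivative f' s) (at s)"
    and L: "\<And>s t. s \<in> {c<..<d} \<Longrightarrow> t \<in> {c<..<d} \<Longrightarrow> norm (f' s - f' t) \<le> M * \<bar>s - t\<bar>"
    and xy: "x \<in> {c<..<d}" "y \<in> {c<..<d}" and M: "0 \<le> M"
  shows "norm (f y - f x - (y - x) *\<^sub>R f' x) \<le> M * (y - x)\<^sup>2"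
proof -
  let ?g = "\<lambda>s. f s - s *\<^sub>R f' x"
  note sub = closed_segment_subset_interval[OF xy]
  have "norm (?g y - ?g x) \<le> (M * \<bar>y - x\<bar>) * \<bar>y - x\<bar>"
  proof (rule norm_diff_le_vector_derivative)
    fix s assume s: "s \<in> closed_segment x y"
    have "(?g has_vector_derivative (f' s - 1 *\<^sub>R f' x)) (at s within closed_segment x y)"
      by (intro has_vector_derivative_diff has_vector_derivative_at_within[OF d])
        (use s sub in \<open>auto intro!: derivative_eq_intros\<close>)
    then show "(?g has_vector_derivative (f' s - f' x)) (at s within closed_segment x y)" by simp
    have "norm (f' s - f' x) \<le> M * \<bar>s - x\<bar>" using s sub xy by (intro L) auto
    also have "\<dots> \<le> M * \<bar>y - x\<bar>" using closed_segment_abs_le[OF s] M by (intro mult_left_mono)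
    finally show "norm (f' s - f' x) \<le> M * \<bar>y - x\<bar>" .
  qed
  moreover have "?g y - ?g x = f y - f x - (y - x) *\<^sub>R f' x" by (simp add: scaleR_diff_left)
  moreover have "(M * \<bar>y - x\<bar>) * \<bar>y - x\<bar> = M * (y - x)\<^sup>2" by (simp add: power2_eq_square)
  ultimately show ?thesis by simp
qed

text \<open>Derivatives converge pointwise under a uniform Lipschitz bound; no uniform convergence is needed,
  since difference quotients of step \<open>s\<close> approximate all derivatives up to \<open>M \<bar>s\<bar>\<close>.\<close>

lemma limit_of_derivatives:
  fixes f :: "nat \<Rightarrow> real \<Rightarrow> 'a::banach"
  assumes \<eta>: "\<eta> \<longlonglongrightarrow> 0"
    and d: "\<And>n s. s \<in> {c + \<eta> n<..<d - \<eta> n} \<Longrightarrow> (f n has_vector_derivative f' n s) (at s)"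
    and L: "\<And>n s t. s \<in> {c + \<eta> n<..<d - \<eta> n} \<Longrightarrow> t \<in> {c + \<eta> n<..<d - \<eta> n} \<Longrightarrow> norm (f' n s - f' n t) \<le> M * \<bar>s - t\<bar>"
    and g: "\<And>x. x \<in> {c<..<d} \<Longrightarrow> (\<lambda>n. f n x) \<longlonglongrightarrow> g x" and M: "0 \<le> M"
  shows "\<exists>g'. \<forall>x\<in>{c<..<d}. (\<lambda>n. f' n x) \<longlonglongrightarrow> g' x \<and> (g has_vector_derivative g' x) (at x)"
proof -
  have ev: "\<forall>\<^sub>F n in sequentially. x \<in> {c + \<eta> n<..<d - \<eta> n}" if x: "x \<in> {c<..<d}" for x
  proof -
    have "0 < min (x - c) (d - x)" using x by auto
    from order_tendstoD(2)[OF \<eta> this] show ?thesis by (rule eventually_mono) auto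
  qed
  have ev2: "\<forall>\<^sub>F n in sequentially. norm (f n y - f n x - (y - x) *\<^sub>R f' n x) \<le> M * (y - x)\<^sup>2"
    if "x \<in> {c<..<d}" "y \<in> {c<..<d}" for x y
    using ev[OF that(1)] ev[OF that(2)] by eventually_elim (rule taylor1_lipschitz[OF d L _ _ M])
  have conv: "convergent (\<lambda>n. f' n x)" if x: "x \<in> {c<..<d}" for x
  proof (rule Cauchy_convergent, rule metric_CauchyI)
    fix e :: real assume e: "0 < e"
    \<comment> \<open>The step s is fixed before the indices: after division by s each of the two
      Taylor errors is at most e/4, and the convergence at x and x + s contributes another
      e/4.\<close>
    define s where "s = min ((d - x) / 2) (e / (4 * (M + 1)))"
    have "0 < (d - x) / 2" "0 < e / (4 * (M + 1))" using x e M by (auto intro!: divide_pos_pos)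
    then have s: "0 < s" "s \<le> e / (4 * (M + 1))" and sd: "s \<le> (d - x) / 2"
      unfolding s_def by (simp_all only: min.cobounded1 min.cobounded2 min_less_iff_conj)
    have s2: "x + s \<in> {c<..<d}" using s sd x by auto
    have Ms: "M * s \<le> e / 4"
    proof -
      have "M * s \<le> (M + 1) * s" using s by (intro mult_right_mono) auto
      also have "\<dots> \<le> (M + 1) * (e / (4 * (M + 1)))" using s M by (intro mult_left_mono) auto
      also have "\<dots> = e / 4"
      proof -
        have "p * (e / (4 * p)) = e / 4" if "0 < p" for p using that by simp
        then show ?thesis using M by (simp only: add_nonneg_pos zero_less_one)
      qed
      finally show ?thesis .
    qed
    have "Cauchy (\<lambda>n. f n (x + s) - f n x)"
      by (intro convergent_Cauchy convergentI[OF tendsto_diff[OF g[OF s2] g[OF x]]])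
    then obtain N1 where N1: "\<And>m n. m \<ge> N1 \<Longrightarrow> n \<ge> N1 \<Longrightarrow> norm ((f m (x + s) - f m x) - (f n (x + s) - f n x)) < s * (e / 4)"
      using metric_CauchyD[of "\<lambda>n. f n (x + s) - f n x" "s * (e / 4)"] s e by (auto simp: dist_norm)
    obtain N2 where N2: "\<And>n. n \<ge> N2 \<Longrightarrow> norm (f n (x + s) - f n x - s *\<^sub>R f' n x) \<le> M * s\<^sup>2"
      using ev2[OF x s2] unfolding eventually_sequentially by auto
    have "dist (f' m x) (f' n x) < e" if mn: "m \<ge> max N1 N2" "n \<ge> max N1 N2" for m n
    proof -
      let ?a = "\<lambda>n. f n (x + s) - f n x"
      have "s *\<^sub>R (f' m x - f' n x) = (?a m - ?a n) - (?a m - s *\<^sub>R f' m x) + (?a n - s *\<^sub>R f' n x)"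
        by (simp add: scaleR_diff_right)
      then have "norm (s *\<^sub>R (f' m x - f' n x)) \<le> norm (?a m - ?a n) + norm (?a m - s *\<^sub>R f' m x) + norm (?a n - s *\<^sub>R f' n x)"
        using norm_triangle_ineq[of "(?a m - ?a n) - (?a m - s *\<^sub>R f' m x)" "?a n - s *\<^sub>R f' n x"]
          norm_triangle_ineq4[of "?a m - ?a n" "?a m - s *\<^sub>R f' m x"] by simp
      also have "\<dots> < s * (e / 4) + M * s\<^sup>2 + M * s\<^sup>2" using N1[of m n] N2[of m] N2[of n] mn by auto
      also have "\<dots> = s * (e / 4 + (M * s + M * s))" by (simp add: algebra_simps power2_eq_square)
      also have "\<dots> \<le> s * e" using Ms s e by (intro mult_left_mono) auto
      finally show ?thesis using s by (simp add: dist_norm)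
    qed
    then show "\<exists>N. \<forall>m\<ge>N. \<forall>n\<ge>N. dist (f' m x) (f' n x) < e" by blast
  qed
  define g' where "g' x = lim (\<lambda>n. f' n x)" for x
  have g'l: "(\<lambda>n. f' n x) \<longlonglongrightarrow> g' x" if "x \<in> {c<..<d}" for x
    unfolding g'_def using conv[OF that] by (simp add: convergent_LIMSEQ_iff)
  have key: "norm (g y - g x - (y - x) *\<^sub>R g' x) \<le> M * (y - x)\<^sup>2" if x: "x \<in> {c<..<d}" and y: "y \<in> {c<..<d}" for x y
  proof (rule tendsto_upperbound[OF _ ev2[OF x y]])
    show "(\<lambda>n. norm (f n y - f n x - (y - x) *\<^sub>R f' n x)) \<longlonglongrightarrow> norm (g y - g x - (y - x) *\<^sub>R g' x)"
      by (intro tendsto_intros g g'l x y)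
  qed simp
  have "(g has_vector_derivative g' x) (at x)" if x: "x \<in> {c<..<d}" for x
    unfolding has_vector_derivative_def has_derivative_iff_norm
  proof (intro conjI bounded_linear_scaleR_left)
    show "((\<lambda>y. norm (g y - g x - (y - x) *\<^sub>R g' x) / norm (y - x)) \<longlongrightarrow> 0) (at x)"
    proof (rule Lim_null_comparison)
      have "\<forall>\<^sub>F y in at x. y \<in> {c<..<d}"
        by (rule eventually_at_in_open') (use x in auto)
      then show "\<forall>\<^sub>F y in at x. norm (norm (g y - g x - (y - x) *\<^sub>R g' x) / norm (y - x)) \<le> M * \<bar>y - x\<bar>"
      proof eventually_elim
        case (elim y)
        show ?case
        proof (cases "y = x")
          case False
          have "norm (g y - g x - (y - x) *\<^sub>R g' x) \<le> (M * \<bar>y - x\<bar>) * \<bar>y - x\<bar>"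
            using key[OF x elim] by (simp add: power2_eq_square)
          then show ?thesis using False by (simp add: pos_divide_le_eq)
        qed simp
      qed
      show "((\<lambda>y. M * \<bar>y - x\<bar>) \<longlongrightarrow> 0) (at x)" by (auto intro!: tendsto_eq_intros)
    qed
  qed
  then show ?thesis using g'l by blast
qed

text \<open>\<open>D i\<close> is the \<open>i\<close>-th derivative of \<open>D 0\<close>; the Lipschitz bound on \<open>D (k - 1)\<close> stands for the bound on the
  \<open>k\<close>-th weak derivative.\<close>

definition creg :: "nat \<Rightarrow> real \<Rightarrow> real \<Rightarrow> real \<Rightarrow> (nat \<Rightarrow> real \<Rightarrow> complex) \<Rightarrow> bool" where
  "creg k M c d D \<longleftrightarrow> 0 \<le> M \<and>
     (\<forall>i<k. \<forall>x\<in>{c<..<d}. norm (D i x) \<le> M) \<and>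
     (\<forall>i<k. \<forall>x\<in>{c<..<d}. \<forall>y\<in>{c<..<d}. norm (D i x - D i y) \<le> M * \<bar>x - y\<bar>) \<and>
     (\<forall>i. Suc i < k \<longrightarrow> (\<forall>x\<in>{c<..<d}. (D i has_vector_derivative D (Suc i) x) (at x)))"

lemma cregD:
  assumes "creg k M c d D"
  shows "0 \<le> M" "\<And>i x. i < k \<Longrightarrow> x \<in> {c<..<d} \<Longrightarrow> norm (D i x) \<le> M"
    "\<And>i x y. i < k \<Longrightarrow> x \<in> {c<..<d} \<Longrightarrow> y \<in> {c<..<d} \<Longrightarrow> norm (D i x - D i y) \<le> M * \<bar>x - y\<bar>"
    "\<And>i x. Suc i < k \<Longrightarrow> x \<in> {c<..<d} \<Longrightarrow> (D i has_vector_derivative D (Suc i) x) (at x)"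
  using assms unfolding creg_def by auto

text \<open>Only the functions are assumed to converge, on intervals tending to the given one;
  \<open>limit_of_derivatives\<close> produces the derivatives one order at a time. The top order k
  - 1 has no derivative and just keeps its Lipschitz bound in the limit.\<close>

lemma creg_limit:
  assumes \<eta>: "\<eta> \<longlonglongrightarrow> 0" and D: "\<And>n. creg k M (c + \<eta> n) (d - \<eta> n) (Dn n)"
    and g: "\<And>x. x \<in> {c<..<d} \<Longrightarrow> (\<lambda>n. Dn n 0 x) \<longlonglongrightarrow> g x"
  shows "\<exists>D. creg k M c d D \<and> D 0 = g \<and> (\<forall>i<k. \<forall>x\<in>{c<..<d}. (\<lambda>n. Dn n i x) \<longlonglongrightarrow> D i x)"
proof -
  have M: "0 \<le> M" using cregD(1)[OF D] .
  have nxt: "\<exists>g'. \<forall>x\<in>{c<..<d}. (\<lambda>n. Dn n (Suc i) x) \<longlonglongrightarrow> g' x \<and> (h has_vector_derivative g' x) (at x)"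
    if i: "Suc i < k" and h: "\<And>x. x \<in> {c<..<d} \<Longrightarrow> (\<lambda>n. Dn n i x) \<longlonglongrightarrow> h x" for i h
    using \<eta> cregD(4)[OF D i] cregD(3)[OF D i] h M by (rule limit_of_derivatives)
  define P where "P i h \<longleftrightarrow> (i < k \<longrightarrow> (\<forall>x\<in>{c<..<d}. (\<lambda>n. Dn n i x) \<longlonglongrightarrow> h x))" for i and h :: "real \<Rightarrow> complex"
  define Q where "Q i h h' \<longleftrightarrow> (Suc i < k \<longrightarrow> (\<forall>x\<in>{c<..<d}. (h has_vector_derivative h' x) (at x)))" for i :: nat and h h' :: "real \<Rightarrow> complex"
  have "\<exists>D. \<forall>i. P i (D i) \<and> Q i (D i) (D (Suc i)) \<and> (i = 0 \<longrightarrow> D i = g)"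
  proof -
    \<comment> \<open>Dependent choice of the next derivative; from order k on the guards in P and Q
      make any function acceptable.\<close>
    have "\<exists>f. \<forall>n. (P n (f n) \<and> (n = 0 \<longrightarrow> f n = g)) \<and> Q n (f n) (f (Suc n))"
    proof (rule dependent_nat_choice)
      show "\<exists>x. P 0 x \<and> (0 = (0::nat) \<longrightarrow> x = g)" using g by (auto simp: P_def)
      fix h i assume h: "P i h \<and> (i = 0 \<longrightarrow> h = g)"
      show "\<exists>y. (P (Suc i) y \<and> (Suc i = 0 \<longrightarrow> y = g)) \<and> Q i h y"
      proof (cases "Suc i < k")
        case True
        then show ?thesis using nxt[OF True, of h] h unfolding P_def Q_def by auto
      qed (simp add: P_def Q_def)
    qed
    then show ?thesis by blast
  qed
  then obtain D where DP: "\<And>i. P i (D i)" and DQ: "\<And>i. Q i (D i) (D (Suc i))" and D0: "D 0 = g" by blast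
  have lim: "(\<lambda>n. Dn n i x) \<longlonglongrightarrow> D i x" if "i < k" "x \<in> {c<..<d}" for i x using DP[of i] that by (simp add: P_def)
  have ev: "\<forall>\<^sub>F n in sequentially. x \<in> {c + \<eta> n<..<d - \<eta> n}" if x: "x \<in> {c<..<d}" for x
  proof -
    have "0 < min (x - c) (d - x)" using x by auto
    from order_tendstoD(2)[OF \<eta> this] show ?thesis by (rule eventually_mono) auto
  qed
  have "creg k M c d D"
    unfolding creg_def
  proof (intro conjI allI impI ballI M)
    fix i x assume i: "i < k" and x: "x \<in> {c<..<d}"
    show "norm (D i x) \<le> M"
    proof (rule tendsto_upperbound[OF tendsto_norm[OF lim[OF i x]]])
      show "\<forall>\<^sub>F n in sequentially. norm (Dn n i x) \<le> M" using ev[OF x] by eventually_elim (rule cregD(2)[OF D i])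
    qed simp
    fix y assume y: "y \<in> {c<..<d}"
    show "norm (D i x - D i y) \<le> M * \<bar>x - y\<bar>"
    proof (rule tendsto_upperbound[OF tendsto_norm[OF tendsto_diff[OF lim[OF i x] lim[OF i y]]]])
      show "\<forall>\<^sub>F n in sequentially. norm (Dn n i x - Dn n i y) \<le> M * \<bar>x - y\<bar>"
        using ev[OF x] ev[OF y] by eventually_elim (rule cregD(3)[OF D i])
    qed simp
  next
    fix i x assume "Suc i < k" "x \<in> {c<..<d}"
    then show "(D i has_vector_derivative D (Suc i) x) (at x)" using DQ[of i] by (simp add: Q_def)
  qed
  then show ?thesis using D0 lim by blast
qed

lemma abs_integral_le:
  fixes f :: "real \<Rightarrow> 'a::euclidean_space"
  assumes "f integrable_on S" "g integrable_on S" "\<And>x. x \<in> S \<Longrightarrow> norm (f x) \<le> g x"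
  shows "norm (integral S f) \<le> integral S g"
  using integral_norm_bound_integral[OF assms] .

lemma kern_mass:
  assumes "0 < \<eta>" "{x - \<eta>..x + \<eta>} \<subseteq> {c..d}"
  shows "integral {c..d} (\<lambda>y. norm (kern \<eta> 0 x y)) = \<eta> * moll_mass"
  unfolding norm_kern[OF assms(1)] by (rule integral_unique[OF kern_integral[OF assms]])

lemma kern_approx_identity:
  fixes g :: "real \<Rightarrow> complex"
  assumes cont: "continuous_on {c..d} g" and x: "x \<in> {c<..<d}" and \<eta>: "\<And>n. 0 < \<eta> n" and \<eta>0: "\<eta> \<longlonglongrightarrow> 0"
  shows "(\<lambda>n. integral {c..d} (\<lambda>y. kern (\<eta> n) 0 x y * g y) / of_real (\<eta> n * moll_mass)) \<longlonglongrightarrow> g x"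
proof -
  define Z where "Z n = \<eta> n * moll_mass" for n
  have Z: "0 < Z n" for n using \<eta> moll_mass_pos by (simp add: Z_def)
  define F where "F n = integral {c..d} (\<lambda>y. kern (\<eta> n) 0 x y * g y) / of_real (Z n)" for n
  have int: "(\<lambda>y. kern (\<eta> n) i x y * g y) integrable_on {c..d}" for n i x
    by (intro integrable_continuous_interval continuous_on_mult continuous_on_kern_y \<eta> cont)
  have mass: "integral {c..d} (\<lambda>y. norm (kern (\<eta> n) 0 x y)) = Z n" if x: "x \<in> {c + \<eta> n<..<d - \<eta> n}" for x n
    unfolding Z_def using x by (intro kern_mass \<eta>) auto
  have "F \<longlonglongrightarrow> g x"
  proof (rule metric_LIMSEQ_I)
    fix r :: real assume r: "0 < r"
    have "continuous (at x within {c..d}) g" using cont x by (auto simp: continuous_on_eq_continuous_within)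
    then obtain e where e: "0 < e" "\<And>y. y \<in> {c..d} \<Longrightarrow> dist y x < e \<Longrightarrow> dist (g y) (g x) < r / 2"
      using r unfolding continuous_within_eps_delta by (metis half_gt_zero)
    have "0 < min e (min (x - c) (d - x))" using x e by auto
    from order_tendstoD(2)[OF \<eta>0 this] obtain N where N: "\<And>n. n \<ge> N \<Longrightarrow> \<eta> n < min e (min (x - c) (d - x))"
      unfolding eventually_sequentially by blast
    have "dist (F n) (g x) < r" if n: "n \<ge> N" for n
    proof -
      have x': "x \<in> {c + \<eta> n<..<d - \<eta> n}" and ne: "\<eta> n < e" using N[OF n] by auto
      have k0: "kern (\<eta> n) 0 x y = of_real (norm (kern (\<eta> n) 0 x y))" for y
        using moll_nonneg by (simp add: kern_def)
      have nint: "(\<lambda>y. norm (kern (\<eta> n) 0 x y)) integrable_on {c..d}"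
        by (intro integrable_continuous_interval continuous_on_norm continuous_on_kern_y \<eta>)
      have "((\<lambda>y. of_real (norm (kern (\<eta> n) 0 x y)) * g x) has_integral of_real (Z n) * g x) {c..d}"
        using has_integral_mult_left[OF has_integral_of_real[OF integrable_integral[OF nint]], of "g x"]
        unfolding mass[OF x'] by (simp add: o_def)
      then have c: "((\<lambda>y. kern (\<eta> n) 0 x y * g x) has_integral of_real (Z n) * g x) {c..d}" unfolding k0[symmetric] .
      have df: "((\<lambda>y. kern (\<eta> n) 0 x y * g y - kern (\<eta> n) 0 x y * g x) has_integral
          integral {c..d} (\<lambda>y. kern (\<eta> n) 0 x y * g y) - of_real (Z n) * g x) {c..d}"
        by (intro has_integral_diff c integrable_integral int)
      have "norm (integral {c..d} (\<lambda>y. kern (\<eta> n) 0 x y * g y - kern (\<eta> n) 0 x y * g x)) \<le> integral {c..d} (\<lambda>y. norm (kern (\<eta> n) 0 x y) * (r / 2))"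
      proof (rule abs_integral_le)
        show "(\<lambda>y. kern (\<eta> n) 0 x y * g y - kern (\<eta> n) 0 x y * g x) integrable_on {c..d}" using df by blast
        show "(\<lambda>y. norm (kern (\<eta> n) 0 x y) * (r / 2)) integrable_on {c..d}" using nint by (rule integrable_on_mult_left)
        fix y assume y: "y \<in> {c..d}"
        show "norm (kern (\<eta> n) 0 x y * g y - kern (\<eta> n) 0 x y * g x) \<le> norm (kern (\<eta> n) 0 x y) * (r / 2)"
        proof (cases "y \<in> {x - \<eta> n<..<x + \<eta> n}")
          case True
          then have "dist y x < e" using ne by (auto simp: dist_norm abs_less_iff)
          then have "norm (g y - g x) \<le> r / 2" using e(2)[OF y] by (simp add: dist_norm)
          then show ?thesis unfolding right_diff_distrib[symmetric] norm_mult by (intro mult_left_mono) auto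
        next
          case False
          then show ?thesis using kern_zero[OF \<eta>] by simp
        qed
      qed
      also have "\<dots> = Z n * (r / 2)" using mass[OF x'] by simp
      finally have "norm (integral {c..d} (\<lambda>y. kern (\<eta> n) 0 x y * g y) - of_real (Z n) * g x) \<le> Z n * (r / 2)"
        using integral_unique[OF df] by simp
      moreover have "F n - g x = (integral {c..d} (\<lambda>y. kern (\<eta> n) 0 x y * g y) - of_real (Z n) * g x) / of_real (Z n)"
        using Z[of n] by (simp add: F_def diff_divide_distrib)
      ultimately have "norm (F n - g x) \<le> r / 2" using Z[of n] by (simp add: norm_divide pos_divide_le_eq mult.commute)
      then show ?thesis using r by (simp add: dist_norm)
    qed
    then show "\<exists>N. \<forall>n\<ge>N. dist (F n) (g x) < r" by blast
  qed
  then show ?thesis by (simp add: F_def[abs_def] Z_def)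
qed

text \<open>The mollifications satisfy the bounds on a slightly smaller interval, and by \<open>creg_limit\<close> so does their
  limit.\<close>

lemma weak_bounds_imp_creg:
  fixes g :: "real \<Rightarrow> complex"
  assumes cd: "c < d" and cont: "continuous_on {c..d} g" and k: "0 < k" and M: "0 \<le> M"
    and weak: "\<And>i \<phi>. i \<le> k \<Longrightarrow> test_function {c<..<d} \<phi> \<Longrightarrow>
      norm (integral {c..d} (\<lambda>y. (vderiv ^^ i) \<phi> y * g y)) \<le> M * integral {c..d} (\<lambda>y. norm (\<phi> y))"
  shows "\<exists>D. creg k M c d D \<and> D 0 = g"
proof -
  define \<eta> where "\<eta> n = (d - c) / (4 * real (Suc n))" for n
  have \<eta>: "0 < \<eta> n" for n using cd by (simp add: \<eta>_def)
  have \<eta>0: "\<eta> \<longlonglongrightarrow> 0"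
  proof -
    have "(\<lambda>n. (d - c) / 4 * (1 / real (Suc n))) \<longlonglongrightarrow> (d - c) / 4 * 0"
      by (intro tendsto_mult tendsto_const) (rule LIMSEQ_Suc[OF lim_1_over_n])
    then show ?thesis unfolding \<eta>_def by simp
  qed
  define Z where "Z n = \<eta> n * moll_mass" for n
  have Z: "0 < Z n" for n using \<eta> moll_mass_pos by (simp add: Z_def)
  \<comment> \<open>The sign corrects for moving derivatives of the kernel from y to x, so
    \<open>Dn n i\<close> is the i-th derivative of the normalised mollification.\<close>
  define Dn where "Dn n i x = ((-1) ^ i / of_real (Z n)) * integral {c..d} (\<lambda>y. kern (\<eta> n) i x y * g y)" for n i x
  have ci: "continuous_on {c..d} (\<lambda>y. kern (\<eta> n) i x y * g y)" for n i x
    by (intro continuous_on_mult continuous_on_kern_y \<eta> cont)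
  have int: "(\<lambda>y. kern (\<eta> n) i x y * g y) integrable_on {c..d}" for n i x
    by (rule integrable_continuous_interval[OF ci])
  have sub: "{x - \<eta> n..x + \<eta> n} \<subseteq> {c<..<d}" if "x \<in> {c + \<eta> n<..<d - \<eta> n}" for x n using that by auto
  have mass: "integral {c..d} (\<lambda>y. norm (kern (\<eta> n) 0 x y)) = Z n" if x: "x \<in> {c + \<eta> n<..<d - \<eta> n}" for x n
    unfolding Z_def using x by (intro kern_mass \<eta>) auto
  have bd: "norm (Dn n i x) \<le> M" if i: "i \<le> k" and x: "x \<in> {c + \<eta> n<..<d - \<eta> n}" for n i x
  proof -
    have "norm (integral {c..d} (\<lambda>y. (vderiv ^^ i) (kern (\<eta> n) 0 x) y * g y)) \<le> M * integral {c..d} (\<lambda>y. norm (kern (\<eta> n) 0 x y))"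
      by (rule weak[OF i test_function_kern[OF \<eta> sub[OF x]]])
    then have "norm (integral {c..d} (\<lambda>y. kern (\<eta> n) i x y * g y)) \<le> M * Z n"
      unfolding vderiv_kern[OF \<eta>] mass[OF x] by simp
    then have "norm (integral {c..d} (\<lambda>y. kern (\<eta> n) i x y * g y)) / Z n \<le> M" using Z[of n] by (simp add: pos_divide_le_eq)
    then show ?thesis using Z[of n] by (simp add: Dn_def norm_mult norm_divide norm_power)
  qed
  have dv: "(Dn n i has_vector_derivative Dn n (Suc i) x) (at x)" for n i x
  proof -
    have "((\<lambda>x. integral (cbox c d) (\<lambda>y. kern (\<eta> n) i x y * g y)) has_vector_derivative
        integral (cbox c d) (\<lambda>y. - kern (\<eta> n) (Suc i) x y * g y)) (at x within UNIV)"
    proof (rule leibniz_rule_vector_derivative)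
      fix x y
      show "((\<lambda>x. kern (\<eta> n) i x y * g y) has_vector_derivative - kern (\<eta> n) (Suc i) x y * g y) (at x within UNIV)"
        by (rule has_vector_derivative_mult_left[OF kern_deriv_x[OF \<eta>]])
      show "(\<lambda>y. kern (\<eta> n) i x y * g y) integrable_on cbox c d" using int by simp
    next
      have "continuous_on (UNIV \<times> {c..d}) (\<lambda>p. g (snd p))"
        by (rule continuous_on_compose2[OF cont continuous_on_snd[OF continuous_on_id]]) auto
      then show "continuous_on (UNIV \<times> cbox c d) (\<lambda>(x, y). - kern (\<eta> n) (Suc i) x y * g y)"
        unfolding case_prod_beta box_real
        by (intro continuous_on_mult continuous_on_minus continuous_on_kern[OF \<eta>, unfolded case_prod_beta])
    qed auto
    from has_vector_derivative_mult_right[OF this, of "(-1) ^ i / of_real (Z n)"]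
    have "(Dn n i has_vector_derivative ((-1) ^ i / of_real (Z n)) * integral {c..d} (\<lambda>y. - kern (\<eta> n) (Suc i) x y * g y)) (at x)"
      unfolding Dn_def box_real by simp
    moreover have "((-1) ^ i / of_real (Z n)) * integral {c..d} (\<lambda>y. - kern (\<eta> n) (Suc i) x y * g y) = Dn n (Suc i) x"
      unfolding Dn_def by simp
    ultimately show ?thesis by simp
  qed
  have cr: "creg k M (c + \<eta> n) (d - \<eta> n) (Dn n)" for n
    unfolding creg_def
  proof (intro conjI allI impI ballI M)
    fix i x assume i: "i < k" and x: "x \<in> {c + \<eta> n<..<d - \<eta> n}"
    show "norm (Dn n i x) \<le> M" using bd i x by simp
    fix y assume y: "y \<in> {c + \<eta> n<..<d - \<eta> n}"
    have "norm (Dn n i x - Dn n i y) \<le> M * \<bar>x - y\<bar>"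
    proof (rule norm_diff_le_vector_derivative)
      fix s assume "s \<in> closed_segment y x"
      then have s: "s \<in> {c + \<eta> n<..<d - \<eta> n}" using closed_segment_subset_interval[OF y x] by auto
      show "(Dn n i has_vector_derivative Dn n (Suc i) s) (at s within closed_segment y x)"
        by (rule has_vector_derivative_at_within[OF dv])
      show "norm (Dn n (Suc i) s) \<le> M" using bd[of "Suc i"] i s by simp
    qed
    then show "norm (Dn n i x - Dn n i y) \<le> M * \<bar>x - y\<bar>" .
  qed (rule dv)
  have lim: "(\<lambda>n. Dn n 0 x) \<longlonglongrightarrow> g x" if x: "x \<in> {c<..<d}" for x
    using kern_approx_identity[OF cont x \<eta> \<eta>0] by (simp add: Dn_def Z_def)
  show ?thesis using creg_limit[OF \<eta>0 cr lim] by blast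
qed

lemma test_function_vderiv: "test_function S \<phi> \<Longrightarrow> test_function S ((vderiv ^^ j) \<phi>)"
proof -
  assume t: "test_function S \<phi>"
  then obtain K where K: "compact K" "K \<subseteq> S" "\<And>x. x \<notin> K \<Longrightarrow> \<phi> x = 0" unfolding test_function_def by blast
  have z: "(vderiv ^^ j) \<phi> x = 0" if "x \<notin> K" for x
    using that
  proof (induction j arbitrary: x)
    case 0 then show ?case using K by simp
  next
    case (Suc j)
    have "open (- K)" using K by (simp add: compact_imp_closed open_Compl)
    have "((vderiv ^^ j) \<phi> has_vector_derivative 0) (at x)"
      by (rule has_vector_derivative_transform_within_open[OF has_vector_derivative_const[of 0] \<open>open (- K)\<close>])
        (use Suc in auto)
    then have "vector_derivative ((vderiv ^^ j) \<phi>) (at x) = 0" by (rule vector_derivative_at)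
    moreover have "vderiv f x = vector_derivative f (at x)" for f by (simp add: vderiv_def)
    ultimately show ?case by simp
  qed
  show ?thesis unfolding test_function_def
  proof (intro conjI allI)
    fix i x
    have "(vderiv ^^ i) ((vderiv ^^ j) \<phi>) = (vderiv ^^ (i + j)) \<phi>" by (simp add: funpow_add)
    then show "(vderiv ^^ i) ((vderiv ^^ j) \<phi>) differentiable at x" using t by (simp add: test_function_def)
    show "\<exists>K. compact K \<and> K \<subseteq> S \<and> (\<forall>x. x \<notin> K \<longrightarrow> (vderiv ^^ j) \<phi> x = 0)" using K z by blast
  qed
qed

lemma test_function_mono: "test_function S \<phi> \<Longrightarrow> S \<subseteq> S' \<Longrightarrow> test_function S' \<phi>"
  unfolding test_function_def by blast

lemma test_function_continuous: "test_function S \<phi> \<Longrightarrow> continuous_on A \<phi>"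
proof -
  assume "test_function S \<phi>"
  then have "\<forall>x. (vderiv ^^ 0) \<phi> differentiable at x" unfolding test_function_def by blast
  then show ?thesis by (simp add: continuous_at_imp_continuous_on differentiable_imp_continuous_within)
qed

lemma test_function_zero: "test_function S \<phi> \<Longrightarrow> x \<notin> S \<Longrightarrow> \<phi> x = 0"
  unfolding test_function_def by blast

text \<open>Passes from the Lebesgue integral over the open or punctured interval, in which the
  norms are defined, to the gauge integral over the closed interval, in which the computations are
  done.\<close>

lemma lebesgue_on_punctured_integral:
  fixes f :: "real \<Rightarrow> 'a::euclidean_space"
  assumes "continuous_on {c..d} f" "S \<subseteq> {c..d}" "S \<in> sets lebesgue" "negligible ({c..d} - S)"
  shows "integrable (lebesgue_on S) f" "integral\<^sup>L (lebesgue_on S) f = integral {c..d} f"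
proof -
  have "f absolutely_integrable_on {c..d}" by (rule absolutely_integrable_continuous_real[OF assms(1)])
  then have "f absolutely_integrable_on S" by (rule set_integrable_subset) (use assms in auto)
  then show i: "integrable (lebesgue_on S) f"
    using assms(3) by (simp add: integrable_restrict_space set_integrable_def)
  have "integral\<^sup>L (lebesgue_on S) f = integral S f" by (rule lebesgue_integral_eq_integral[OF i assms(3)])
  also have "\<dots> = integral {c..d} f"
  proof (rule integral_spike_set)
    show "negligible {x \<in> S - {c..d}. f x \<noteq> 0}"
    proof -
      have "{x \<in> S - {c..d}. f x \<noteq> 0} = {}" using assms(2) by auto
      then show ?thesis by (simp only: negligible_empty)
    qed
    show "negligible {x \<in> {c..d} - S. f x \<noteq> 0}" by (rule negligible_subset[OF assms(4)]) auto
  qed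
  finally show "integral\<^sup>L (lebesgue_on S) f = integral {c..d} f" .
qed

text \<open>A non-integrable F has integral 0 by default, so the bound covers weak derivatives whose
  pairings have not been shown measurable.\<close>

lemma norm_lebesgue_integral_bound:
  fixes F :: "'a \<Rightarrow> complex" and \<psi> :: "'a \<Rightarrow> complex"
  assumes i: "integrable N (\<lambda>x. norm (\<psi> x))" and b: "AE x in N. norm (F x) \<le> c * norm (\<psi> x)" and c: "0 \<le> c"
  shows "norm (integral\<^sup>L N F) \<le> c * integral\<^sup>L N (\<lambda>x. norm (\<psi> x))"
proof (cases "integrable N F")
  case True
  have "norm (integral\<^sup>L N F) \<le> integral\<^sup>L N (\<lambda>x. norm (F x))" by simp
  also have "\<dots> \<le> integral\<^sup>L N (\<lambda>x. c * norm (\<psi> x))"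
    using True i b by (intro integral_mono_AE) auto
  finally show ?thesis by simp
next
  case False
  then show ?thesis using c by (simp add: not_integrable_integral_eq)
qed

lemma esssup_less_AE:
  assumes "esssup N f < c" shows "AE x in N. f x \<le> c"
proof -
  have "AE x in N. f x \<le> esssup N f" by (rule esssup_AE)
  then show ?thesis by (rule AE_mp) (use assms in \<open>auto intro!: AE_I2\<close>)
qed

lemma Linf_pairing_bound:
  assumes S: "S \<subseteq> {c..d}" "S \<in> sets lebesgue" "negligible ({c..d} - S)"
    and \<psi>: "test_function S \<psi>" and f: "Linf_norm S f < ennreal m" and m: "0 \<le> m"
  shows "norm (LINT x|lebesgue_on S. f x * \<psi> x) \<le> m * integral {c..d} (\<lambda>x. norm (\<psi> x))"
proof -
  have cn: "continuous_on {c..d} (\<lambda>x. norm (\<psi> x))"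
    by (intro continuous_on_norm test_function_continuous[OF \<psi>])
  note i = lebesgue_on_punctured_integral[OF cn S]
  have "f \<in> borel_measurable (lebesgue_on S)" using f by (cases "f \<in> borel_measurable (lebesgue_on S)") (auto simp: Linf_norm_def)
  then have "esssup (lebesgue_on S) (\<lambda>x. ennreal (norm (f x))) < ennreal m" using f by (simp add: Linf_norm_def)
  then have "AE x in lebesgue_on S. ennreal (norm (f x)) \<le> ennreal m" by (rule esssup_less_AE)
  then have "AE x in lebesgue_on S. norm (f x * \<psi> x) \<le> m * norm (\<psi> x)"
    by (rule AE_mp) (use m in \<open>auto intro!: AE_I2 mult_right_mono simp: norm_mult\<close>)
  from norm_lebesgue_integral_bound[OF i(1) this m] show ?thesis unfolding i(2) .
qed

text \<open>The strict inequality lets weak derivatives be extracted from the infimum; afterwards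
  only their effect on test functions is kept, so the conclusion speaks of f alone.\<close>

lemma sobolev_pairing_bound:
  assumes S: "S \<subseteq> {c..d}" "S \<in> sets lebesgue" "negligible ({c..d} - S)"
    and \<psi>: "test_function S \<psi>" and f: "sobolev_norm Linf_norm k S f < ennreal m" and m: "0 \<le> m" and j: "j \<le> k"
  shows "norm (LINT x|lebesgue_on S. f x * (vderiv ^^ j) \<psi> x) \<le> m * integral {c..d} (\<lambda>x. norm (\<psi> x))"
proof -
  obtain g where g: "\<And>j. j \<le> k \<Longrightarrow> has_weak_deriv j S f (g j)" and s: "(\<Sum>j\<le>k. Linf_norm S (g j)) < ennreal m"
    using f unfolding sobolev_norm_def INF_less_iff by auto
  have "Linf_norm S (g j) \<le> (\<Sum>j\<le>k. Linf_norm S (g j))"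
    using j by (intro member_le_sum) auto
  then have l: "Linf_norm S (g j) < ennreal m" using s by (rule le_less_trans)
  have "(LINT x|lebesgue_on S. f x * (vderiv ^^ j) \<psi> x) = (-1) ^ j * (LINT x|lebesgue_on S. g j x * \<psi> x)"
    using g[OF j] \<psi> unfolding has_weak_deriv_def by blast
  then have "norm (LINT x|lebesgue_on S. f x * (vderiv ^^ j) \<psi> x) = norm (LINT x|lebesgue_on S. g j x * \<psi> x)"
    by (simp add: norm_mult norm_power)
  then show ?thesis using Linf_pairing_bound[OF S \<psi> l m] by simp
qed

text \<open>Removes both the infimum over time derivatives and the essential supremum, leaving an
  inequality about v and test functions alone. N stays abstract so that the plain and the Sobolev
  case share the proof.\<close>

lemma bochner_pairing_bound:
  assumes S: "S \<subseteq> {c..d}" "S \<in> sets lebesgue" "negligible ({c..d} - S)" and T: "0 < T"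
    and \<phi>: "test_function {0<..<T} \<phi>" and \<psi>: "test_function S \<psi>"
    and v: "bochner_Winf_norm k T S N v \<le> ennreal m" and m: "0 \<le> m" and i: "i \<le> k"
    and N: "\<And>f m. N f < ennreal m \<Longrightarrow> 0 \<le> m \<Longrightarrow>
        norm (LINT x|lebesgue_on S. f x * (vderiv ^^ j) \<psi> x) \<le> m * integral {c..d} (\<lambda>x. norm (\<psi> x))"
  shows "norm (LINT t|lebesgue_on {0..T}. (vderiv ^^ i) \<phi> t * (LINT x|lebesgue_on S. v t x * (vderiv ^^ j) \<psi> x))
     \<le> m * (integral {0..T} (\<lambda>t. norm (\<phi> t)) * integral {c..d} (\<lambda>x. norm (\<psi> x)))"
proof -
  define A B where "A = integral {0..T} (\<lambda>t. norm (\<phi> t))" and "B = integral {c..d} (\<lambda>x. norm (\<psi> x))"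
  have cn: "continuous_on {0..T} (\<lambda>t. norm (\<phi> t))" by (intro continuous_on_norm test_function_continuous[OF \<phi>])
  have AB: "0 \<le> A" "0 \<le> B" unfolding A_def B_def
    using integrable_continuous_interval[OF cn]
      integrable_continuous_interval[OF continuous_on_norm[OF test_function_continuous[OF \<psi>]], of c d]
    by (auto intro!: integral_nonneg)
  have T': "{0..T} \<in> sets lebesgue" "negligible ({0..T} - {0..T})" by auto
  note iT = lebesgue_on_punctured_integral[OF cn subset_refl T']
  have "norm (LINT t|lebesgue_on {0..T}. (vderiv ^^ i) \<phi> t * (LINT x|lebesgue_on S. v t x * (vderiv ^^ j) \<psi> x)) \<le> m * (A * B) + \<delta>"
    if \<delta>: "0 < \<delta>" for \<delta>
  proof -
    \<comment> \<open>Slack, because the infimum need not be attained: m + q selects w, m + 2q makes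
      the inequality for N strict, and 2 q (A B + 1) = \<delta>.\<close>
    define q where "q = \<delta> / (2 * (A * B + 1))"
    have q: "0 < q" using \<delta> AB by (auto simp: q_def intro!: divide_pos_pos add_nonneg_pos mult_nonneg_nonneg)
    have "bochner_Winf_norm k T S N v < ennreal (m + q)"
      by (rule le_less_trans[OF v]) (use q m in \<open>simp add: ennreal_less_iff\<close>)
    then obtain w where w: "w 0 = v" "\<And>i. i \<le> k \<Longrightarrow> has_weak_time_deriv i T S v (w i)"
      and es: "esssup (lebesgue_on {0..T}) (\<lambda>t. \<Sum>i\<le>k. N (w i t)) < ennreal (m + q)"
      unfolding bochner_Winf_norm_def INF_less_iff by auto
    have "AE t in lebesgue_on {0..T}. (\<Sum>i\<le>k. N (w i t)) \<le> ennreal (m + q)" by (rule esssup_less_AE[OF es])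
    then have "AE t in lebesgue_on {0..T}. norm (\<phi> t * (LINT x|lebesgue_on S. w i t x * (vderiv ^^ j) \<psi> x)) \<le> ((m + 2 * q) * B) * norm (\<phi> t)"
    proof (rule AE_mp, intro AE_I2 impI)
      fix t assume s: "(\<Sum>i\<le>k. N (w i t)) \<le> ennreal (m + q)"
      have "N (w i t) \<le> (\<Sum>i\<le>k. N (w i t))" using i by (intro member_le_sum) auto
      then have "N (w i t) \<le> ennreal (m + q)" using s by (rule order_trans)
      then have "N (w i t) < ennreal (m + 2 * q)" by (rule le_less_trans) (use q m in \<open>simp add: ennreal_less_iff\<close>)
      then have "norm (LINT x|lebesgue_on S. w i t x * (vderiv ^^ j) \<psi> x) \<le> (m + 2 * q) * B"
        unfolding B_def by (rule N) (use q m in auto)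
      then show "norm (\<phi> t * (LINT x|lebesgue_on S. w i t x * (vderiv ^^ j) \<psi> x)) \<le> ((m + 2 * q) * B) * norm (\<phi> t)"
        unfolding norm_mult by (subst mult.commute) (intro mult_right_mono, auto)
    qed
    from norm_lebesgue_integral_bound[OF iT(1) this]
    have "norm (LINT t|lebesgue_on {0..T}. \<phi> t * (LINT x|lebesgue_on S. w i t x * (vderiv ^^ j) \<psi> x)) \<le> ((m + 2 * q) * B) * A"
      unfolding iT(2) A_def[symmetric] using q m AB by simp
    also have "\<dots> = m * (A * B) + (2 * q) * (A * B)" by (simp add: algebra_simps)
    also have "(2 * q) * (A * B) \<le> (2 * q) * (A * B + 1)" using q by (intro mult_left_mono) auto
    also have "(2 * q) * (A * B + 1) = \<delta>"
    proof -
      have "0 < A * B + 1" using AB by (intro add_nonneg_pos mult_nonneg_nonneg) auto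
      moreover have "(2 * (\<delta> / (2 * p))) * p = \<delta>" if "0 < p" for p using that by simp
      ultimately show ?thesis unfolding q_def by blast
    qed
    finally have f: "norm (LINT t|lebesgue_on {0..T}. \<phi> t * (LINT x|lebesgue_on S. w i t x * (vderiv ^^ j) \<psi> x)) \<le> m * (A * B) + \<delta>" by simp
    have "(LINT t|lebesgue_on {0..T}. (vderiv ^^ i) \<phi> t * (LINT x|lebesgue_on S. v t x * (vderiv ^^ j) \<psi> x)) =
        (-1) ^ i * (LINT t|lebesgue_on {0..T}. \<phi> t * (LINT x|lebesgue_on S. w i t x * (vderiv ^^ j) \<psi> x))"
      using w(2)[OF i] \<phi> test_function_vderiv[OF \<psi>, of j] unfolding has_weak_time_deriv_def by blast
    then show ?thesis using f by (simp add: norm_mult norm_power)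
  qed
  then show ?thesis unfolding A_def B_def by (rule field_le_epsilon)
qed

lemma creg_scale:
  assumes "creg k (M * B) c d D" "0 < B" "0 \<le> M"
  shows "creg k M c d (\<lambda>i x. D i x / of_real B)"
  unfolding creg_def
proof (intro conjI allI impI ballI assms(3))
  note D = cregD[OF assms(1)]
  fix i x assume i: "i < k" and x: "x \<in> {c<..<d}"
  show "norm (D i x / of_real B) \<le> M"
    using D(2)[OF i x] assms(2) by (simp add: norm_divide pos_divide_le_eq)
  fix y assume y: "y \<in> {c<..<d}"
  show "norm (D i x / of_real B - D i y / of_real B) \<le> M * \<bar>x - y\<bar>"
    using D(3)[OF i x y] assms(2) unfolding diff_divide_distrib[symmetric]
    by (simp add: norm_divide pos_divide_le_eq mult_ac)
next
  fix i x assume "Suc i < k" "x \<in> {c<..<d}"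
  from has_vector_derivative_mult_left[OF cregD(4)[OF assms(1) this], of "1 / of_real B"]
  show "((\<lambda>x. D i x / of_real B) has_vector_derivative D (Suc i) x / of_real B) (at x)" by simp
qed

lemma half_over_Suc:
  fixes r :: real
  assumes "0 < r" shows "0 < r / 2 * (1 / real (Suc n))" "r / 2 * (1 / real (Suc n)) < r"
proof -
  show "0 < r / 2 * (1 / real (Suc n))" using assms by simp
  have "r / 2 * (1 / real (Suc n)) \<le> r / 2 * 1" using assms by (intro mult_left_mono) auto
  also have "\<dots> < r" using assms by simp
  finally show "r / 2 * (1 / real (Suc n)) < r" .
qed

lemma exists_approx_seq:
  assumes "0 < a" "x \<in> {-a..a}"
  shows "\<exists>\<xi>. (\<forall>n. \<xi> n \<in> {-a<..<a} - {0}) \<and> \<xi> \<longlonglongrightarrow> (x::real)"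
proof (cases "x = 0")
  case True
  have "(\<lambda>n. a / 2 * (1 / real (Suc n))) \<longlonglongrightarrow> a / 2 * 0"
    by (intro tendsto_mult tendsto_const) (rule LIMSEQ_Suc[OF lim_1_over_n])
  moreover have "a / 2 * (1 / real (Suc n)) \<in> {-a<..<a} - {0}" for n
  proof -
    have "q \<in> {-a<..<a} - {0}" if "0 < q" "q < a" for q using that assms(1) by simp
    from this[OF half_over_Suc[OF assms(1)]] show ?thesis .
  qed
  ultimately show ?thesis using True by (intro exI[of _ "\<lambda>n. a / 2 * (1 / real (Suc n))"]) simp
next
  case False
  have "(\<lambda>n. x * (1 - 1 / 2 * (1 / real (Suc n)))) \<longlonglongrightarrow> x * (1 - 1 / 2 * 0)"
    by (intro tendsto_mult tendsto_const tendsto_diff) (rule LIMSEQ_Suc[OF lim_1_over_n])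
  moreover have "x * (1 - 1 / 2 * (1 / real (Suc n))) \<in> {-a<..<a} - {0}" for n
  proof -
    define q where "q = 1 - 1 / 2 * (1 / real (Suc n))"
    have "1 / real (Suc n) \<le> 1" "0 < 1 / real (Suc n)" by auto
    then have q: "0 < q" "q < 1" unfolding q_def by linarith+
    have "\<bar>x\<bar> * q < \<bar>x\<bar> * 1" using q False by (intro mult_strict_left_mono) auto
    moreover have "\<bar>x * q\<bar> = \<bar>x\<bar> * q" using q by (simp add: abs_mult)
    moreover have "\<bar>x\<bar> \<le> a" using assms by auto
    ultimately have "\<bar>x * q\<bar> < a" by linarith
    then show ?thesis using q False unfolding q_def[symmetric] by auto
  qed
  ultimately show ?thesis by (intro exI[of _ "\<lambda>n. x * (1 - 1 / 2 * (1 / real (Suc n)))"]) simp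
qed

section \<open>Regularity of the solution\<close>

text \<open>\<open>b4\<close> yields time regularity of order four at each point, \<open>b1\<close>
  spatial regularity of order four that is Lipschitz in time.\<close>

locale solution_reg =
  fixes a T M1 :: real and u :: "real \<Rightarrow> real \<Rightarrow> complex"
  assumes a: "0 < a" and T: "0 < T" and M1: "0 \<le> M1"
    and cont: "continuous_on ({-a..a} \<times> {0..T}) (\<lambda>(x, t). u x t)"
    and b1: "bochner_Winf_norm 1 T ({-a<..<a} - {0}) (sobolev_norm Linf_norm 4 ({-a<..<a} - {0})) (\<lambda>t x. u x t) \<le> ennreal M1"
    and b4: "bochner_Winf_norm 4 T ({-a<..<a} - {0}) (Linf_norm ({-a<..<a} - {0})) (\<lambda>t x. u x t) \<le> ennreal M1"
begin

abbreviation S :: "real set" where "S \<equiv> {-a<..<a} - {0}"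

lemma S_props: "S \<subseteq> {-a..a}" "S \<in> sets lebesgue" "negligible ({-a..a} - S)"
proof -
  show "S \<subseteq> {-a..a}" by auto
  show "S \<in> sets lebesgue" by auto
  have "{-a..a} - S \<subseteq> {-a, 0, a}" by auto
  then show "negligible ({-a..a} - S)" by (rule negligible_subset[rotated]) (simp add: negligible_finite)
qed

lemma cont_x: "t \<in> {0..T} \<Longrightarrow> continuous_on {-a..a} (\<lambda>x. u x t)"
  by (rule continuous_on_compose2[OF cont, of _ "\<lambda>x. (x, t)", simplified]) (auto intro!: continuous_intros)

lemma cont_t: "x \<in> {-a..a} \<Longrightarrow> continuous_on {0..T} (\<lambda>t. u x t)"
  by (rule continuous_on_compose2[OF cont, of _ "\<lambda>t. (x, t)", simplified]) (auto intro!: continuous_intros)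

text \<open>Testing in space turns u into a continuous scalar function of time, to which the
  one-dimensional \<open>weak_bounds_imp_creg\<close> applies without any vector-valued
  integration.\<close>

definition pair :: "(real \<Rightarrow> complex) \<Rightarrow> real \<Rightarrow> complex" where
  "pair \<psi> t = integral {-a..a} (\<lambda>x. \<psi> x * u x t)"

lemma pair_continuous:
  assumes "continuous_on {-a..a} \<psi>" shows "continuous_on {0..T} (pair \<psi>)"
proof -
  have "continuous_on ({0..T} \<times> cbox (-a) a) (\<lambda>(t, x). \<psi> x * u x t)"
    unfolding case_prod_beta box_real
  proof (intro continuous_on_mult)
    show "continuous_on ({0..T} \<times> {-a..a}) (\<lambda>p. \<psi> (snd p))"
      by (rule continuous_on_compose2[OF assms continuous_on_snd[OF continuous_on_id]]) auto
    show "continuous_on ({0..T} \<times> {-a..a}) (\<lambda>p. u (snd p) (fst p))"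
      by (rule continuous_on_compose2[OF cont, of _ "\<lambda>p. (snd p, fst p)", simplified]) (auto intro!: continuous_intros)
  qed
  then have "continuous_on {0..T} (\<lambda>t. integral (cbox (-a) a) (\<lambda>x. \<psi> x * u x t))"
    by (rule integral_continuous_on_param)
  then show ?thesis unfolding pair_def[abs_def] box_real .
qed

lemma pair_weak_bound:
  assumes \<phi>: "test_function {0<..<T} \<phi>" and \<psi>: "test_function S \<psi>" and ij: "i \<le> 4 \<and> j = 0 \<or> i \<le> 1 \<and> j \<le> 4"
  shows "norm (integral {0..T} (\<lambda>t. (vderiv ^^ i) \<phi> t * pair ((vderiv ^^ j) \<psi>) t))
     \<le> (M1 * integral {-a..a} (\<lambda>x. norm (\<psi> x))) * integral {0..T} (\<lambda>t. norm (\<phi> t))"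
proof -
  note \<phi>i = test_function_vderiv[OF \<phi>, of i] and \<psi>j = test_function_vderiv[OF \<psi>, of j]
  have inner: "(LINT x|lebesgue_on S. u x t * (vderiv ^^ j) \<psi> x) = pair ((vderiv ^^ j) \<psi>) t" if t: "t \<in> {0..T}" for t
  proof -
    have c: "continuous_on {-a..a} (\<lambda>x. (vderiv ^^ j) \<psi> x * u x t)"
      by (intro continuous_on_mult test_function_continuous[OF \<psi>j] cont_x t)
    show ?thesis using lebesgue_on_punctured_integral(2)[OF c S_props] by (simp add: pair_def mult.commute)
  qed
  have c: "continuous_on {0..T} (\<lambda>t. (vderiv ^^ i) \<phi> t * pair ((vderiv ^^ j) \<psi>) t)"
    by (intro continuous_on_mult test_function_continuous[OF \<phi>i] pair_continuous test_function_continuous[OF \<psi>j])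
  have T': "{0..T} \<in> sets lebesgue" "negligible ({0..T} - {0..T})" by auto
  have "integral {0..T} (\<lambda>t. (vderiv ^^ i) \<phi> t * pair ((vderiv ^^ j) \<psi>) t)
     = (LINT t|lebesgue_on {0..T}. (vderiv ^^ i) \<phi> t * pair ((vderiv ^^ j) \<psi>) t)"
    using lebesgue_on_punctured_integral(2)[OF c subset_refl T'] by simp
  also have "\<dots> = (LINT t|lebesgue_on {0..T}. (vderiv ^^ i) \<phi> t * (LINT x|lebesgue_on S. u x t * (vderiv ^^ j) \<psi> x))"
    by (intro Bochner_Integration.integral_cong refl) (simp add: inner)
  also have "norm \<dots> \<le> M1 * (integral {0..T} (\<lambda>t. norm (\<phi> t)) * integral {-a..a} (\<lambda>x. norm (\<psi> x)))"
    using ij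
  proof
    assume "i \<le> 4 \<and> j = 0"
    then show ?thesis
      using bochner_pairing_bound[OF S_props T \<phi> \<psi> b4 M1, of i j] Linf_pairing_bound[OF S_props \<psi>] by simp
  next
    assume "i \<le> 1 \<and> j \<le> 4"
    then show ?thesis
      using bochner_pairing_bound[OF S_props T \<phi> \<psi> b1 M1, of i j] sobolev_pairing_bound[OF S_props \<psi>] by simp
  qed
  finally show ?thesis by (simp add: mult_ac)
qed

lemma test_norm_integral_nonneg: "test_function A \<psi> \<Longrightarrow> 0 \<le> integral {c..d} (\<lambda>x. norm (\<psi> x))"
  by (intro integral_nonneg integrable_continuous_interval continuous_on_norm test_function_continuous[of A]) auto

lemma pair_creg:
  assumes \<psi>: "test_function S \<psi>" and kj: "k = 4 \<and> j = 0 \<or> k = 1 \<and> j \<le> 4"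
  shows "\<exists>D. creg k (M1 * integral {-a..a} (\<lambda>x. norm (\<psi> x))) 0 T D \<and> D 0 = pair ((vderiv ^^ j) \<psi>)"
proof (rule weak_bounds_imp_creg[OF T])
  show "continuous_on {0..T} (pair ((vderiv ^^ j) \<psi>))"
    by (intro pair_continuous test_function_continuous[OF test_function_vderiv[OF \<psi>]])
  show "0 < k" using kj by auto
  show "0 \<le> M1 * integral {-a..a} (\<lambda>x. norm (\<psi> x))" using M1 test_norm_integral_nonneg[OF \<psi>] by simp
  fix i \<phi> assume "i \<le> k" "test_function {0<..<T} \<phi>"
  then show "norm (integral {0..T} (\<lambda>y. (vderiv ^^ i) \<phi> y * pair ((vderiv ^^ j) \<psi>) y))
      \<le> M1 * integral {-a..a} (\<lambda>x. norm (\<psi> x)) * integral {0..T} (\<lambda>y. norm (\<phi> y))"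
    using kj by (intro pair_weak_bound \<psi>) auto
qed

text \<open>Tests against mollifiers concentrating at x; divided by their mass, the averages satisfy
  bounds independent of the radius, so \<open>creg_limit\<close> applies.\<close>

lemma time_creg_interior:
  assumes x: "x \<in> S" shows "\<exists>D. creg 4 M1 0 T D \<and> D 0 = u x"
proof -
  define r where "r = min \<bar>x\<bar> (a - \<bar>x\<bar>)"
  have r: "0 < r" using x by (auto simp: r_def)
  define \<eta> where "\<eta> n = r / 2 * (1 / real (Suc n))" for n
  have \<eta>: "0 < \<eta> n" for n using r by (simp add: \<eta>_def)
  have \<eta>r: "\<eta> n < r" for n unfolding \<eta>_def by (rule half_over_Suc(2)[OF r])
  have \<eta>0: "\<eta> \<longlonglongrightarrow> 0"
  proof -
    have "(\<lambda>n. r / 2 * (1 / real (Suc n))) \<longlonglongrightarrow> r / 2 * 0"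
      by (intro tendsto_mult tendsto_const) (rule LIMSEQ_Suc[OF lim_1_over_n])
    then show ?thesis unfolding \<eta>_def by simp
  qed
  have sub: "{x - \<eta> n..x + \<eta> n} \<subseteq> S" for n using \<eta>r[of n] by (auto simp: r_def abs_if split: if_splits)
  define Z where "Z n = \<eta> n * moll_mass" for n
  have Z: "0 < Z n" for n using \<eta> moll_mass_pos by (simp add: Z_def)
  have mass: "integral {-a..a} (\<lambda>y. norm (kern (\<eta> n) 0 x y)) = Z n" for n
    unfolding Z_def using sub[of n] S_props(1) by (intro kern_mass \<eta>) blast
  have "\<exists>D. creg 4 (M1 * Z n) 0 T D \<and> D 0 = pair (kern (\<eta> n) 0 x)" for n
    using pair_creg[OF test_function_kern[OF \<eta> sub], of 4 0 n 0] unfolding mass by simp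
  then obtain D where D: "\<And>n. creg 4 (M1 * Z n) 0 T (D n)" "\<And>n. D n 0 = pair (kern (\<eta> n) 0 x)" by metis
  have cr: "creg 4 M1 (0 + 0) (T - 0) (\<lambda>i t. D n i t / of_real (Z n))" for n
    using creg_scale[OF D(1) Z M1] by simp
  have "\<exists>E. creg 4 M1 0 T E \<and> E 0 = u x \<and> (\<forall>i<4. \<forall>t\<in>{0<..<T}. (\<lambda>n. D n i t / of_real (Z n)) \<longlonglongrightarrow> E i t)"
  proof (rule creg_limit[OF tendsto_const cr])
    fix t assume t: "t \<in> {0<..<T}"
    show "(\<lambda>n. D n 0 t / of_real (Z n)) \<longlonglongrightarrow> u x t"
      unfolding D(2) pair_def Z_def
      by (rule kern_approx_identity[OF cont_x _ \<eta> \<eta>0]) (use t x in auto)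
  qed
  then show ?thesis by blast
qed

text \<open>Continuity of u in x carries time regularity, and the time derivatives with it, from
  interior points to the interface and the boundary.\<close>

lemma time_creg_limit:
  assumes "\<And>n. \<xi> n \<in> {-a..a}" "\<xi> \<longlonglongrightarrow> x" "x \<in> {-a..a}" "\<And>n. creg 4 M1 0 T (D n)" "\<And>n. D n 0 = u (\<xi> n)"
  shows "\<exists>E. creg 4 M1 0 T E \<and> E 0 = u x \<and> (\<forall>i<4. \<forall>t\<in>{0<..<T}. (\<lambda>n. D n i t) \<longlonglongrightarrow> E i t)"
proof -
  have "creg 4 M1 (0 + 0) (T - 0) (D n)" for n using assms(4) by simp
  then show ?thesis
  proof (rule creg_limit[OF tendsto_const])
    fix t assume t: "t \<in> {0<..<T}"
    show "(\<lambda>n. D n 0 t) \<longlonglongrightarrow> u x t" unfolding assms(5)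
      by (rule continuous_on_tendsto_compose[OF cont_x assms(2,3)]) (use t assms(1) in auto)
  qed
qed

lemma time_creg: "x \<in> {-a..a} \<Longrightarrow> \<exists>D. creg 4 M1 0 T D \<and> D 0 = u x"
proof -
  assume x: "x \<in> {-a..a}"
  obtain \<xi> where \<xi>: "\<And>n. \<xi> n \<in> S" "\<xi> \<longlonglongrightarrow> x" using exists_approx_seq[OF a x] by blast
  obtain D where D: "\<And>n. creg 4 M1 0 T (D n)" "\<And>n. D n 0 = u (\<xi> n)" using time_creg_interior[OF \<xi>(1)] by metis
  have "\<xi> n \<in> {-a..a}" for n using \<xi>(1)[of n] by auto
  from time_creg_limit[OF this \<xi>(2) x D] show ?thesis by blast
qed

definition DT :: "real \<Rightarrow> nat \<Rightarrow> real \<Rightarrow> complex" where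
  "DT x = (SOME D. creg 4 M1 0 T D \<and> D 0 = u x)"

lemma DT: "x \<in> {-a..a} \<Longrightarrow> creg 4 M1 0 T (DT x)" "x \<in> {-a..a} \<Longrightarrow> DT x 0 = u x"
  using someI_ex[OF time_creg, of x] by (auto simp: DT_def)

lemma DT1_deriv: "x \<in> {-a..a} \<Longrightarrow> t \<in> {0<..<T} \<Longrightarrow> (u x has_vector_derivative DT x 1 t) (at t)"
  using cregD(4)[OF DT(1), of x 0 t] DT(2)[of x] by simp

text \<open>Continuity of the time derivative in x, in particular across the interface, is what
  later makes the second space derivative match from both sides through the equation.\<close>

lemma DT1_continuous:
  assumes "\<And>n. \<xi> n \<in> {-a..a}" "\<xi> \<longlonglongrightarrow> x" "x \<in> {-a..a}" "t \<in> {0<..<T}"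
  shows "(\<lambda>n. DT (\<xi> n) 1 t) \<longlonglongrightarrow> DT x 1 t"
proof -
  obtain E where E: "creg 4 M1 0 T E" "E 0 = u x" "\<And>i t. i < 4 \<Longrightarrow> t \<in> {0<..<T} \<Longrightarrow> (\<lambda>n. DT (\<xi> n) i t) \<longlonglongrightarrow> E i t"
    using time_creg_limit[OF assms(1-3) DT(1)[OF assms(1)] DT(2)[OF assms(1)]] by blast
  have "(u x has_vector_derivative E 1 t) (at t)" using cregD(4)[OF E(1), of 0 t] E(2) assms(4) by simp
  then have "E 1 t = DT x 1 t" using DT1_deriv[OF assms(3,4)] by (rule vector_derivative_unique_at)
  then show ?thesis using E(3)[of 1 t] assms(4) by simp
qed

lemma integral_supported:
  fixes f :: "real \<Rightarrow> complex"
  assumes "continuous_on {-a..a} f" "-a \<le> p" "q \<le> a" "\<And>x. x \<notin> {p<..<q} \<Longrightarrow> f x = 0"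
  shows "integral {-a..a} f = integral {p..q} f"
proof -
  have "continuous_on {p..q} f" by (rule continuous_on_subset[OF assms(1)]) (use assms in auto)
  then have "(f has_integral integral {p..q} f) {p..q}" by (intro integrable_integral integrable_continuous_interval)
  then have "(f has_integral integral {p..q} f) {-a..a}"
    by (rule has_integral_on_superset) (use assms in auto)
  then show ?thesis by (rule integral_unique)
qed

lemma norm_integral_supported:
  assumes "test_function {p<..<q} \<psi>" "-a \<le> p" "q \<le> a"
  shows "integral {-a..a} (\<lambda>x. norm (\<psi> x)) = integral {p..q} (\<lambda>x. norm (\<psi> x))"
proof -
  have "((\<lambda>x. norm (\<psi> x)) has_integral integral {p..q} (\<lambda>x. norm (\<psi> x))) {p..q}"
    by (intro integrable_integral integrable_continuous_interval continuous_on_norm test_function_continuous[OF assms(1)])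
  then have "((\<lambda>x. norm (\<psi> x)) has_integral integral {p..q} (\<lambda>x. norm (\<psi> x))) {-a..a}"
    by (rule has_integral_on_superset) (use assms test_function_zero[OF assms(1)] in force)+
  then show ?thesis by (rule integral_unique)
qed

lemma space_creg_aux:
  assumes pq: "p = -a \<and> q = 0 \<or> p = 0 \<and> q = a" and g: "continuous_on {-a..a} g" and M: "0 \<le> M"
    and b: "\<And>\<psi> j. test_function S \<psi> \<Longrightarrow> j \<le> 4 \<Longrightarrow>
       norm (integral {-a..a} (\<lambda>x. (vderiv ^^ j) \<psi> x * g x)) \<le> M * integral {-a..a} (\<lambda>x. norm (\<psi> x))"
  shows "\<exists>D. creg 4 M p q D \<and> D 0 = g"
proof (rule weak_bounds_imp_creg)
  have pq': "-a \<le> p" "q \<le> a" "{p<..<q} \<subseteq> S" using pq a by auto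
  show "p < q" using pq a by auto
  show "continuous_on {p..q} g" by (rule continuous_on_subset[OF g]) (use pq' in auto)
  fix i \<psi> assume i: "i \<le> (4::nat)" and \<psi>: "test_function {p<..<q} \<psi>"
  have \<psi>S: "test_function S \<psi>" by (rule test_function_mono[OF \<psi> pq'(3)])
  have "integral {-a..a} (\<lambda>x. (vderiv ^^ i) \<psi> x * g x) = integral {p..q} (\<lambda>x. (vderiv ^^ i) \<psi> x * g x)"
    by (rule integral_supported[OF _ pq'(1,2)])
      (use test_function_zero[OF test_function_vderiv[OF \<psi>]] in
        \<open>auto intro!: continuous_on_mult test_function_continuous[OF test_function_vderiv[OF \<psi>]] g\<close>)
  then show "norm (integral {p..q} (\<lambda>y. (vderiv ^^ i) \<psi> y * g y)) \<le> M * integral {p..q} (\<lambda>y. norm (\<psi> y))"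
    using b[OF \<psi>S i] norm_integral_supported[OF \<psi> pq'(1,2)] by simp
qed (use M in auto)

text \<open>The pairings are continuous in time, so the essential bound holds at every t and not
  just at almost every one.\<close>

lemma space_creg:
  assumes pq: "p = -a \<and> q = 0 \<or> p = 0 \<and> q = a" and t: "t \<in> {0<..<T}"
  shows "\<exists>D. creg 4 M1 p q D \<and> D 0 = (\<lambda>x. u x t)"
proof (rule space_creg_aux[OF pq cont_x M1])
  fix \<psi> and j :: nat assume \<psi>: "test_function S \<psi>" and j: "j \<le> 4"
  obtain D where D: "creg 1 (M1 * integral {-a..a} (\<lambda>x. norm (\<psi> x))) 0 T D" "D 0 = pair ((vderiv ^^ j) \<psi>)"
    using pair_creg[OF \<psi>, of 1 j] j by auto
  show "norm (integral {-a..a} (\<lambda>x. (vderiv ^^ j) \<psi> x * u x t)) \<le> M1 * integral {-a..a} (\<lambda>x. norm (\<psi> x))"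
    using cregD(2)[OF D(1), of 0 t] t unfolding D(2) pair_def by simp
qed (use t in auto)

text \<open>Stands for a bound on the time derivative of the fourth space derivative: the pairings
  are Lipschitz in time, so the difference of two times inherits spatial regularity with the factor
  \<open>\<bar>t - s\<bar>\<close>.\<close>

lemma space_diff_creg:
  assumes pq: "p = -a \<and> q = 0 \<or> p = 0 \<and> q = a" and t: "t \<in> {0<..<T}" "s \<in> {0<..<T}"
  shows "\<exists>D. creg 4 (M1 * \<bar>t - s\<bar>) p q D \<and> D 0 = (\<lambda>x. u x t - u x s)"
proof (rule space_creg_aux[OF pq])
  show "continuous_on {-a..a} (\<lambda>x. u x t - u x s)" by (intro continuous_on_diff cont_x) (use t in auto)
  show "0 \<le> M1 * \<bar>t - s\<bar>" using M1 by simp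
  fix \<psi> and j :: nat assume \<psi>: "test_function S \<psi>" and j: "j \<le> 4"
  obtain D where D: "creg 1 (M1 * integral {-a..a} (\<lambda>x. norm (\<psi> x))) 0 T D" "D 0 = pair ((vderiv ^^ j) \<psi>)"
    using pair_creg[OF \<psi>, of 1 j] j by auto
  have i: "(\<lambda>x. (vderiv ^^ j) \<psi> x * u x r) integrable_on {-a..a}" if "r \<in> {0<..<T}" for r
    using that by (intro integrable_continuous_interval continuous_on_mult cont_x
      test_function_continuous[OF test_function_vderiv[OF \<psi>]]) auto
  have "integral {-a..a} (\<lambda>x. (vderiv ^^ j) \<psi> x * (u x t - u x s)) = D 0 t - D 0 s"
    unfolding D(2) pair_def right_diff_distrib by (rule integral_diff[OF i i]) (use t in auto)
  then show "norm (integral {-a..a} (\<lambda>x. (vderiv ^^ j) \<psi> x * (u x t - u x s))) \<le> M1 * \<bar>t - s\<bar> * integral {-a..a} (\<lambda>x. norm (\<psi> x))"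
    using cregD(3)[OF D(1), of 0 t s] t by (simp add: mult_ac)
qed

end

section \<open>Spatial and temporal consistency\<close>

lemma vector_integrated_bound:
  fixes f :: "real \<Rightarrow> complex"
  assumes h: "0 \<le> h" and d: "\<And>s. s \<in> {0..h} \<Longrightarrow> (f has_vector_derivative f' s) (at s)"
    and b: "\<And>s. s \<in> {0..h} \<Longrightarrow> norm (f' s) \<le> B"
  shows "norm (f h - f 0) \<le> B * h"
proof -
  have "norm (f h - f 0) \<le> B * \<bar>h - 0\<bar>"
    by (rule norm_diff_le_vector_derivative)
      (use h d b in \<open>auto simp: closed_segment_eq_real_ivl intro: has_vector_derivative_at_within\<close>)
  then show ?thesis using h by simp
qed

lemma creg_taylor1:
  assumes D: "creg k M p q D" and i: "Suc i < k" and xy: "x \<in> {p<..<q}" "y \<in> {p<..<q}"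
  shows "norm (D i y - D i x - (y - x) *\<^sub>R D (Suc i) x) \<le> M * (y - x)\<^sup>2"
  by (rule taylor1_lipschitz[OF cregD(4)[OF D i] cregD(3)[OF D i] xy cregD(1)[OF D]])

lemma creg_comp_deriv:
  assumes D: "creg k M p q D" and i: "Suc i < k" and x: "x + \<sigma> * s \<in> {p<..<q}"
  shows "((\<lambda>s. D i (x + \<sigma> * s)) has_vector_derivative \<sigma> *\<^sub>R D (Suc i) (x + \<sigma> * s)) (at s)"
proof -
  have "((\<lambda>s. x + \<sigma> * s) has_vector_derivative \<sigma>) (at s)"
    unfolding has_real_derivative_iff_has_vector_derivative[symmetric] by (auto intro!: derivative_eq_intros)
  from vector_diff_chain_at[OF this cregD(4)[OF D i x]] show ?thesis by (simp add: o_def)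
qed

text \<open>The direction \<sigma> is 1 or -1, so that one proof serves both sides of the
  interface.\<close>

lemma creg_taylor2:
  assumes D: "creg k M p q D" and k: "2 < k" and x: "x \<in> {p<..<q}" "x + \<sigma> * h \<in> {p<..<q}" and h: "0 \<le> h" and \<sigma>: "\<bar>\<sigma>\<bar> = 1"
  shows "norm (D 0 (x + \<sigma> * h) - D 0 x - (\<sigma> * h) *\<^sub>R D 1 x - (h\<^sup>2 / 2) *\<^sub>R D 2 x) \<le> M * h ^ 3"
proof -
  have \<sigma>2: "\<sigma> * \<sigma> = 1" using \<sigma> by (metis abs_mult_self_eq mult_1)
  have in_pq: "x + \<sigma> * s \<in> {p<..<q}" if s: "s \<in> {0..h}" for s
  proof (cases "0 \<le> \<sigma>")
    case True then have "\<sigma> = 1" using \<sigma> by simp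
    then show ?thesis using s x by auto
  next
    case False then have "\<sigma> = -1" using \<sigma> by simp
    then show ?thesis using s x by auto
  qed
  let ?f = "\<lambda>s. D 0 (x + \<sigma> * s) - s *\<^sub>R (\<sigma> *\<^sub>R D 1 x) - (s\<^sup>2 / 2) *\<^sub>R D 2 x"
  let ?f' = "\<lambda>s. \<sigma> *\<^sub>R D 1 (x + \<sigma> * s) - 1 *\<^sub>R (\<sigma> *\<^sub>R D 1 x) - s *\<^sub>R D 2 x"
  have "norm (?f h - ?f 0) \<le> (M * h\<^sup>2) * h"
  proof (rule vector_integrated_bound[OF h])
    fix s assume s: "s \<in> {0..h}"
    have dq: "((\<lambda>s. s\<^sup>2 / 2) has_vector_derivative s) (at s)" "((\<lambda>s::real. s) has_vector_derivative 1) (at s)"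
      unfolding has_real_derivative_iff_has_vector_derivative[symmetric] by (auto intro!: derivative_eq_intros)
    have d0: "((\<lambda>s. D 0 (x + \<sigma> * s)) has_vector_derivative \<sigma> *\<^sub>R D 1 (x + \<sigma> * s)) (at s)"
      using creg_comp_deriv[OF D _ in_pq[OF s], of 0] k by simp
    show "(?f has_vector_derivative ?f' s) (at s)"
      by (rule has_vector_derivative_diff[OF has_vector_derivative_diff[OF d0
            bounded_linear.has_vector_derivative[OF bounded_linear_scaleR_left dq(2)]]
            bounded_linear.has_vector_derivative[OF bounded_linear_scaleR_left dq(1)]])
    have "?f' s = \<sigma> *\<^sub>R (D 1 (x + \<sigma> * s) - D 1 x - ((x + \<sigma> * s) - x) *\<^sub>R D (Suc 1) x)"
      using \<sigma>2 by (simp add: scaleR_diff_right numeral_2_eq_2 mult.assoc[symmetric])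
    then have "norm (?f' s) = norm (D 1 (x + \<sigma> * s) - D 1 x - ((x + \<sigma> * s) - x) *\<^sub>R D (Suc 1) x)" using \<sigma> by simp
    also have "\<dots> \<le> M * ((x + \<sigma> * s) - x)\<^sup>2"
      by (rule creg_taylor1[OF D _ x(1) in_pq[OF s]]) (use k in simp)
    also have "\<dots> = M * s\<^sup>2" using \<sigma>2 by (simp add: power2_eq_square)
    also have "\<dots> \<le> M * h\<^sup>2" using s cregD(1)[OF D] by (intro mult_left_mono power_mono) auto
    finally show "norm (?f' s) \<le> M * h\<^sup>2" .
  qed
  moreover have "?f h - ?f 0 = D 0 (x + \<sigma> * h) - D 0 x - (\<sigma> * h) *\<^sub>R D 1 x - (h\<^sup>2 / 2) *\<^sub>R D 2 x"
    by (simp add: mult.commute)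
  moreover have "(M * h\<^sup>2) * h = M * h ^ 3" by (simp add: power2_eq_square power3_eq_cube)
  ultimately show ?thesis by (simp only:)
qed

text \<open>There is no fourth derivative to expand with. The symmetric sum of \<open>D 2\<close>
  cancels the third derivative and is bounded through the Lipschitz constant of \<open>D 3\<close>;
  two integrations in the step then give order four.\<close>

lemma creg_central:
  assumes D: "creg k M p q D" and k: "3 < k" and x: "x - h \<in> {p<..<q}" "x + h \<in> {p<..<q}" and h: "0 \<le> h"
  shows "norm (D 0 (x + h) + D 0 (x - h) - 2 * D 0 x - of_real (h\<^sup>2) * D 2 x) \<le> 2 * M * h ^ 4"
proof -
  have x0: "x \<in> {p<..<q}" using x h by auto
  have inn: "x + 1 * s \<in> {p<..<q}" "x + (-1) * s \<in> {p<..<q}" if "s \<in> {0..h}" for s using that x by auto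
  let ?g = "\<lambda>s. D 1 (x + 1 * s) - D 1 (x + (-1) * s) - s *\<^sub>R (2 *\<^sub>R D 2 x)"
  let ?g' = "\<lambda>s. 1 *\<^sub>R D (Suc 1) (x + 1 * s) - (-1) *\<^sub>R D (Suc 1) (x + (-1) * s) - 1 *\<^sub>R (2 *\<^sub>R D 2 x)"
  have id: "((\<lambda>s::real. s) has_vector_derivative 1) (at s)" for s
    unfolding has_real_derivative_iff_has_vector_derivative[symmetric] by (auto intro!: derivative_eq_intros)
  have g: "norm (?g r - ?g 0) \<le> (2 * M * h\<^sup>2) * r" if r: "r \<in> {0..h}" for r
  proof (rule vector_integrated_bound)
    fix s assume "s \<in> {0..r}" then have s: "s \<in> {0..h}" using r by auto
    show "(?g has_vector_derivative ?g' s) (at s)"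
      by (rule has_vector_derivative_diff[OF has_vector_derivative_diff[OF creg_comp_deriv[OF D _ inn(1)[OF s]] creg_comp_deriv[OF D _ inn(2)[OF s]]]
            bounded_linear.has_vector_derivative[OF bounded_linear_scaleR_left id]]) (use k in auto)
    have t1: "norm (D 2 (x + s) - D 2 x - ((x + s) - x) *\<^sub>R D (Suc 2) x) \<le> M * ((x + s) - x)\<^sup>2"
      by (rule creg_taylor1[OF D _ x0]) (use k inn(1)[OF s] in auto)
    have t2: "norm (D 2 (x - s) - D 2 x - ((x - s) - x) *\<^sub>R D (Suc 2) x) \<le> M * ((x - s) - x)\<^sup>2"
      by (rule creg_taylor1[OF D _ x0]) (use k inn(2)[OF s] in auto)
    have "?g' s = (D 2 (x + s) - D 2 x - ((x + s) - x) *\<^sub>R D (Suc 2) x) + (D 2 (x - s) - D 2 x - ((x - s) - x) *\<^sub>R D (Suc 2) x)"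
      by (simp add: numeral_2_eq_2 scaleR_2[unfolded numeral_2_eq_2])
    then have "norm (?g' s) \<le> M * ((x + s) - x)\<^sup>2 + M * ((x - s) - x)\<^sup>2"
      using norm_triangle_mono[OF t1 t2] by simp
    also have "\<dots> = 2 * M * s\<^sup>2" by simp
    also have "\<dots> \<le> 2 * M * h\<^sup>2" using s cregD(1)[OF D] by (intro mult_left_mono power_mono) auto
    finally show "norm (?g' s) \<le> 2 * M * h\<^sup>2" .
  qed (use r in auto)
  let ?f = "\<lambda>s. D 0 (x + 1 * s) + D 0 (x + (-1) * s) - (s\<^sup>2 / 2) *\<^sub>R (2 *\<^sub>R D 2 x)"
  let ?f' = "\<lambda>s. 1 *\<^sub>R D (Suc 0) (x + 1 * s) + (-1) *\<^sub>R D (Suc 0) (x + (-1) * s) - s *\<^sub>R (2 *\<^sub>R D 2 x)"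
  have "norm (?f h - ?f 0) \<le> (2 * M * h ^ 3) * h"
  proof (rule vector_integrated_bound[OF h])
    fix s assume s: "s \<in> {0..h}"
    have dq: "((\<lambda>s. s\<^sup>2 / 2) has_vector_derivative s) (at s)"
      unfolding has_real_derivative_iff_has_vector_derivative[symmetric] by (auto intro!: derivative_eq_intros)
    show "(?f has_vector_derivative ?f' s) (at s)"
      by (rule has_vector_derivative_diff[OF has_vector_derivative_add[OF creg_comp_deriv[OF D _ inn(1)[OF s]] creg_comp_deriv[OF D _ inn(2)[OF s]]]
            bounded_linear.has_vector_derivative[OF bounded_linear_scaleR_left dq]]) (use k in auto)
    have "?f' s = ?g s - ?g 0" by simp
    then have "norm (?f' s) \<le> (2 * M * h\<^sup>2) * s" using g[OF s] by simp
    also have "\<dots> \<le> (2 * M * h\<^sup>2) * h" using s cregD(1)[OF D] by (intro mult_left_mono) auto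
    finally show "norm (?f' s) \<le> 2 * M * h ^ 3" by (simp add: power2_eq_square power3_eq_cube)
  qed
  moreover have "?f h - ?f 0 = D 0 (x + h) + D 0 (x - h) - 2 * D 0 x - of_real (h\<^sup>2) * D 2 x"
    by (simp add: scaleR_conv_of_real)
  moreover have "(2 * M * h ^ 3) * h = 2 * M * h ^ 4" by (simp add: power_Suc numeral_eq_Suc)
  ultimately show ?thesis by (simp only:)
qed

text \<open>As a function of the step s, the trapezoidal error has as derivative half of a
  first-order Taylor remainder seen from t + s. The order i is left free because the estimate is
  also applied to a derivative.\<close>

lemma creg_trapezoid:
  assumes D: "creg k M p q D" and i: "Suc (Suc i) < k" and t: "t \<in> {p<..<q}" "t + \<tau> \<in> {p<..<q}" and \<tau>: "0 \<le> \<tau>"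
  shows "norm (D i (t + \<tau>) - D i t - of_real (\<tau> / 2) * (D (Suc i) (t + \<tau>) + D (Suc i) t)) \<le> M / 2 * \<tau> ^ 3"
proof -
  have inn: "t + 1 * s \<in> {p<..<q}" if "s \<in> {0..\<tau>}" for s using that t by auto
  let ?f = "\<lambda>s. D i (t + 1 * s) - s *\<^sub>R ((1/2) *\<^sub>R D (Suc i) t) - (s / 2) *\<^sub>R D (Suc i) (t + 1 * s)"
  let ?f' = "\<lambda>s. 1 *\<^sub>R D (Suc i) (t + 1 * s) - 1 *\<^sub>R ((1/2) *\<^sub>R D (Suc i) t)
      - ((s / 2) *\<^sub>R (1 *\<^sub>R D (Suc (Suc i)) (t + 1 * s)) + (1 / 2) *\<^sub>R D (Suc i) (t + 1 * s))"
  have id: "((\<lambda>s::real. s) has_vector_derivative 1) (at s)" for s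
    unfolding has_real_derivative_iff_has_vector_derivative[symmetric] by (auto intro!: derivative_eq_intros)
  have id2: "((\<lambda>s::real. s / 2) has_field_derivative 1 / 2) (at s)" for s
    by (auto intro!: derivative_eq_intros)
  have "norm (?f \<tau> - ?f 0) \<le> (M / 2 * \<tau>\<^sup>2) * \<tau>"
  proof (rule vector_integrated_bound[OF \<tau>])
    fix s assume s: "s \<in> {0..\<tau>}"
    show "(?f has_vector_derivative ?f' s) (at s)"
    proof (intro has_vector_derivative_diff)
      show "((\<lambda>s. D i (t + 1 * s)) has_vector_derivative 1 *\<^sub>R D (Suc i) (t + 1 * s)) (at s)"
        using creg_comp_deriv[OF D _ inn[OF s], of i] i by simp
      show "((\<lambda>s. s *\<^sub>R ((1/2) *\<^sub>R D (Suc i) t)) has_vector_derivative 1 *\<^sub>R ((1/2) *\<^sub>R D (Suc i) t)) (at s)"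
        by (rule bounded_linear.has_vector_derivative[OF bounded_linear_scaleR_left id])
      show "((\<lambda>s. (s / 2) *\<^sub>R D (Suc i) (t + 1 * s)) has_vector_derivative
          (s / 2) *\<^sub>R (1 *\<^sub>R D (Suc (Suc i)) (t + 1 * s)) + (1 / 2) *\<^sub>R D (Suc i) (t + 1 * s)) (at s)"
        by (rule has_vector_derivative_scaleR[OF id2 creg_comp_deriv[OF D i inn[OF s]]])
    qed
    have "?f' s = - ((1 / 2) *\<^sub>R (D (Suc i) t - D (Suc i) (t + s) - (t - (t + s)) *\<^sub>R D (Suc (Suc i)) (t + s)))"
    proof -
      have "D (Suc i) (t + s) = (1 / 2) *\<^sub>R D (Suc i) (t + s) + (1 / 2) *\<^sub>R D (Suc i) (t + s)"
        by (simp add: scaleR_left_distrib[symmetric])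
      then show ?thesis by (simp add: scaleR_diff_right algebra_simps)
    qed
    then have "norm (?f' s) = 1 / 2 * norm (D (Suc i) t - D (Suc i) (t + s) - (t - (t + s)) *\<^sub>R D (Suc (Suc i)) (t + s))" by simp
    also have "\<dots> \<le> 1 / 2 * (M * (t - (t + s))\<^sup>2)"
      using inn[OF s] t by (intro mult_left_mono creg_taylor1[OF D i]) auto
    also have "\<dots> \<le> M / 2 * \<tau>\<^sup>2"
    proof -
      have "M * s\<^sup>2 \<le> M * \<tau>\<^sup>2" using s cregD(1)[OF D] by (intro mult_left_mono power_mono) auto
      then show ?thesis by simp
    qed
    finally show "norm (?f' s) \<le> M / 2 * \<tau>\<^sup>2" .
  qed
  moreover have "?f \<tau> - ?f 0 = D i (t + \<tau>) - D i t - of_real (\<tau> / 2) * (D (Suc i) (t + \<tau>) + D (Suc i) t)"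
    by (simp add: scaleR_conv_of_real algebra_simps)
  moreover have "(M / 2 * \<tau>\<^sup>2) * \<tau> = M / 2 * \<tau> ^ 3" by (simp add: power2_eq_square power3_eq_cube)
  ultimately show ?thesis by (simp only:)
qed

text \<open>The shift by \<tau> commutes with differentiation, so the increment is the integral of
  the trapezoidal error of \<open>D 1\<close>; the integration wins the extra factor \<tau>.\<close>

lemma creg_trapezoid_step:
  assumes D: "creg 4 M p q D" and t: "t \<in> {p<..<q}" "t + \<tau> + \<tau> \<in> {p<..<q}" and \<tau>: "0 \<le> \<tau>"
  shows "norm ((D 0 (t + \<tau> + \<tau>) - D 0 (t + \<tau>) - of_real (\<tau> / 2) * (D 1 (t + \<tau> + \<tau>) + D 1 (t + \<tau>)))
      - (D 0 (t + \<tau>) - D 0 t - of_real (\<tau> / 2) * (D 1 (t + \<tau>) + D 1 t))) \<le> M / 2 * \<tau> ^ 4"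
proof -
  let ?F = "\<lambda>i s. D i ((t + \<tau>) + 1 * s) - D i (t + 1 * s) - (\<tau> / 2) *\<^sub>R (D (Suc i) ((t + \<tau>) + 1 * s) + D (Suc i) (t + 1 * s))"
  have inn: "t + 1 * s \<in> {p<..<q}" "(t + \<tau>) + 1 * s \<in> {p<..<q}" if "s \<in> {0..\<tau>}" for s using that t \<tau> by auto
  have "norm (?F 0 \<tau> - ?F 0 0) \<le> (M / 2 * \<tau> ^ 3) * \<tau>"
  proof (rule vector_integrated_bound[OF \<tau>])
    fix s assume s: "s \<in> {0..\<tau>}"
    show "(?F 0 has_vector_derivative (1 *\<^sub>R D (Suc 0) ((t + \<tau>) + 1 * s) - 1 *\<^sub>R D (Suc 0) (t + 1 * s)
        - (\<tau> / 2) *\<^sub>R (1 *\<^sub>R D (Suc (Suc 0)) ((t + \<tau>) + 1 * s) + 1 *\<^sub>R D (Suc (Suc 0)) (t + 1 * s)))) (at s)"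
      by (intro has_vector_derivative_diff has_vector_derivative_add creg_comp_deriv[OF D] inn[OF s]
            bounded_linear.has_vector_derivative[OF bounded_linear_scaleR_right]) auto
    show "norm (1 *\<^sub>R D (Suc 0) ((t + \<tau>) + 1 * s) - 1 *\<^sub>R D (Suc 0) (t + 1 * s)
        - (\<tau> / 2) *\<^sub>R (1 *\<^sub>R D (Suc (Suc 0)) ((t + \<tau>) + 1 * s) + 1 *\<^sub>R D (Suc (Suc 0)) (t + 1 * s))) \<le> M / 2 * \<tau> ^ 3"
      using creg_trapezoid[OF D, of "Suc 0" "t + s" \<tau>] inn[OF s] \<tau> by (simp add: scaleR_conv_of_real add_ac)
  qed
  moreover have "(M / 2 * \<tau> ^ 3) * \<tau> = M / 2 * \<tau> ^ 4" by (simp add: power_Suc numeral_eq_Suc)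
  moreover have "?F 0 \<tau> - ?F 0 0 = (D 0 (t + \<tau> + \<tau>) - D 0 (t + \<tau>) - of_real (\<tau> / 2) * (D 1 (t + \<tau> + \<tau>) + D 1 (t + \<tau>)))
      - (D 0 (t + \<tau>) - D 0 t - of_real (\<tau> / 2) * (D 1 (t + \<tau>) + D 1 t))"
    by (simp add: scaleR_conv_of_real)
  ultimately show ?thesis by (simp only:)
qed

text \<open>The expansion is made between \<sigma> s and \<sigma> (h - s) and s tends to 0, because
  \<open>creg\<close> says nothing at the ends: the inner end is the interface, and with one cell
  per side the outer end is the boundary.\<close>

lemma creg_edge:
  assumes D: "creg k M p q D" and k: "2 < k" and h: "0 < h" and \<sigma>: "\<bar>\<sigma>\<bar> = 1"
    and inn: "\<And>s. 0 < s \<Longrightarrow> s < h \<Longrightarrow> \<sigma> * s \<in> {p<..<q}"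
    and l0: "((\<lambda>s. D 0 (\<sigma> * s)) \<longlongrightarrow> g0) (at_right 0)" and l1: "((\<lambda>s. D 1 (\<sigma> * s)) \<longlongrightarrow> d) (at_right 0)"
    and l2: "((\<lambda>s. D 2 (\<sigma> * s)) \<longlongrightarrow> w) (at_right 0)" and lh: "((\<lambda>s. D 0 (\<sigma> * (h - s))) \<longlongrightarrow> gh) (at_right 0)"
  shows "norm (gh - g0 - (\<sigma> * h) *\<^sub>R d - (h\<^sup>2 / 2) *\<^sub>R w) \<le> M * h ^ 3"
proof (rule tendsto_le[OF trivial_limit_at_right_real])
  have s: "((\<lambda>s. h - 2 * s) \<longlongrightarrow> h - 2 * 0) (at_right 0)"
    by (intro tendsto_intros)
  then have s: "((\<lambda>s. h - 2 * s) \<longlongrightarrow> h) (at_right 0)" by simp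
  show "((\<lambda>s. M * (h - 2 * s) ^ 3) \<longlongrightarrow> M * h ^ 3) (at_right 0)" by (intro tendsto_intros s)
  show "((\<lambda>s. norm (D 0 (\<sigma> * (h - s)) - D 0 (\<sigma> * s) - (\<sigma> * (h - 2 * s)) *\<^sub>R D 1 (\<sigma> * s) - ((h - 2 * s)\<^sup>2 / 2) *\<^sub>R D 2 (\<sigma> * s)))
      \<longlongrightarrow> norm (gh - g0 - (\<sigma> * h) *\<^sub>R d - (h\<^sup>2 / 2) *\<^sub>R w)) (at_right 0)"
    by (intro tendsto_intros s l0 l1 l2 lh) simp
  have "eventually (\<lambda>s. s < h / 2) (at_right 0)" using h by (auto simp: eventually_at_right_field intro!: exI[of _ "h / 2"])
  then show "eventually (\<lambda>s. norm (D 0 (\<sigma> * (h - s)) - D 0 (\<sigma> * s) - (\<sigma> * (h - 2 * s)) *\<^sub>R D 1 (\<sigma> * s) - ((h - 2 * s)\<^sup>2 / 2) *\<^sub>R D 2 (\<sigma> * s)) \<le> M * (h - 2 * s) ^ 3) (at_right 0)"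
    using eventually_at_right_less[of 0]
  proof eventually_elim
    case (elim s)
    have e: "\<sigma> * (h - s) = \<sigma> * s + \<sigma> * (h - 2 * s)" by (simp add: algebra_simps)
    have i: "\<sigma> * s \<in> {p<..<q}" "\<sigma> * (h - s) \<in> {p<..<q}" by (rule inn; use elim in linarith)+
    have "0 \<le> h - 2 * s" using elim by linarith
    from creg_taylor2[OF D k i(1) i(2)[unfolded e] this \<sigma>] show ?case unfolding e .
  qed
qed

lemma creg_central_closed:
  assumes D: "creg k M p q D" and k: "3 < k" and x: "p \<le> x - h" "x + h \<le> q" and h: "0 < h"
    and c: "continuous_on {p..q} (D 0)"
  shows "norm (D 0 (x + h) + D 0 (x - h) - 2 * D 0 x - of_real (h\<^sup>2) * D 2 x) \<le> 2 * M * h ^ 4"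
proof (rule tendsto_le[OF trivial_limit_at_right_real])
  have ev: "eventually (\<lambda>s. s < h) (at_right 0)" using h by (auto simp: eventually_at_right_field intro!: exI[of _ h])
  have s: "((\<lambda>s. h - s) \<longlongrightarrow> h - 0) (at_right 0)"
    by (intro tendsto_intros)
  then have s: "((\<lambda>s. h - s) \<longlongrightarrow> h) (at_right 0)" by simp
  have m: "eventually (\<lambda>s. x + (h - s) \<in> {p..q}) (at_right 0)" "eventually (\<lambda>s. x - (h - s) \<in> {p..q}) (at_right 0)"
    using ev eventually_at_right_less[of 0] by (eventually_elim, use x in auto)+
  have "((\<lambda>s. D 0 (x + (h - s))) \<longlongrightarrow> D 0 (x + h)) (at_right 0)"
    by (rule continuous_on_tendsto_compose[OF c _ _ m(1)]) (intro tendsto_intros s, use x h in auto)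
  moreover have "((\<lambda>s. D 0 (x - (h - s))) \<longlongrightarrow> D 0 (x - h)) (at_right 0)"
    by (rule continuous_on_tendsto_compose[OF c _ _ m(2)]) (intro tendsto_intros s, use x h in auto)
  ultimately show "((\<lambda>s. norm (D 0 (x + (h - s)) + D 0 (x - (h - s)) - 2 * D 0 x - of_real ((h - s)\<^sup>2) * D 2 x))
      \<longlongrightarrow> norm (D 0 (x + h) + D 0 (x - h) - 2 * D 0 x - of_real (h\<^sup>2) * D 2 x)) (at_right 0)"
    by (intro tendsto_intros s)
  show "((\<lambda>s. 2 * M * (h - s) ^ 4) \<longlongrightarrow> 2 * M * h ^ 4) (at_right 0)" by (intro tendsto_intros s)
  show "eventually (\<lambda>s. norm (D 0 (x + (h - s)) + D 0 (x - (h - s)) - 2 * D 0 x - of_real ((h - s)\<^sup>2) * D 2 x) \<le> 2 * M * (h - s) ^ 4) (at_right 0)"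
    using ev eventually_at_right_less[of 0]
  proof eventually_elim
    case (elim s)
    show ?case by (rule creg_central[OF D k]) (use elim x in auto)
  qed
qed

lemma norm_divide_square_le:
  fixes z w :: complex
  assumes "norm (z - of_real (h\<^sup>2) * w) \<le> B * h\<^sup>2" "0 < h"
  shows "norm (z / of_real (h\<^sup>2) - w) \<le> B"
proof -
  have "z / of_real (h\<^sup>2) - w = (z - of_real (h\<^sup>2) * w) / of_real (h\<^sup>2)" using assms by (simp add: diff_divide_distrib)
  then have "norm (z / of_real (h\<^sup>2) - w) = norm (z - of_real (h\<^sup>2) * w) / h\<^sup>2" by (simp add: norm_divide norm_power)
  then show ?thesis using assms by (simp add: pos_divide_le_eq)
qed

text \<open>At the interface the two one-sided expansions are added: the slopes leave h times the
  jump, which is what the discrete delta produces, and the curvatures agree because W has the same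
  limit on both sides. The function g is general so that differences of the solution at two times
  are covered.\<close>

lemma spatial_consistency:
  assumes a: "0 < a" and N: "0 < N" and h: "h = a / real N" and g: "continuous_on {-a..a} g"
    and DL: "creg 4 M (-a) 0 DL" "DL 0 = g" and DR: "creg 4 M 0 a DR" "DR 0 = g"
    and WL: "\<And>x. x \<in> {-a<..<0} \<Longrightarrow> DL 2 x = W x" and WR: "\<And>x. x \<in> {0<..<a} \<Longrightarrow> DR 2 x = W x"
    and W0: "(W \<longlongrightarrow> W 0) (at_left 0)" "(W \<longlongrightarrow> W 0) (at_right 0)"
    and d: "(DL 1 \<longlongrightarrow> dm) (at_left 0)" "(DR 1 \<longlongrightarrow> dp) (at_right 0)" "dp - dm = of_real lam * g 0"
    and j: "j \<in> {1..<2 * N}"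
  shows "norm (dx2 h (\<lambda>j. g (grid_x a N j)) j - of_real (lam * delta_coeff h N j) * g (grid_x a N j) - W (grid_x a N j))
    \<le> res_weight h 0 (2 * M) N j"
proof -
  have hp: "0 < h" and hN: "real N * h = a" using a N by (auto simp: h)
  have M0: "0 \<le> M" using cregD(1)[OF DL(1)] .
  define x where "x = grid_x a N j"
  have xh: "grid_x a N (j + 1) = x + h" "grid_x a N (j - 1) = x - h"
    using j by (auto simp: x_def grid_x_def h[symmetric] of_nat_diff algebra_simps)
  have x: "x = -a + real j * h" by (simp add: x_def grid_x_def h)
  have dx: "dx2 h (\<lambda>j. g (grid_x a N j)) j = (g (x + h) - 2 * g x + g (x - h)) / of_real (h\<^sup>2)"
    unfolding dx2_def xh x_def ..
  have h4: "2 * M * h ^ 4 = (2 * M * h\<^sup>2) * h\<^sup>2" by (simp add: power2_eq_square numeral_eq_Suc)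
  have cL: "continuous_on {-a..0} (DL 0)" "continuous_on {0..a} (DR 0)"
    unfolding DL(2) DR(2) using a by (auto intro!: continuous_on_subset[OF g])
  consider "j < N" | "j = N" | "N < j" by linarith
  then show ?thesis
  proof cases
    case 1
    have "1 * h \<le> real j * h" "(real j + 1) * h \<le> real N * h" using j 1 hp by (auto intro!: mult_right_mono)
    then have xx: "-a \<le> x - h" "x + h \<le> 0" unfolding x hN by (auto simp: algebra_simps)
    have "DL 2 x = W x" using xx hp by (intro WL) auto
    with creg_central_closed[OF DL(1) _ xx hp cL(1)]
    have "norm ((g (x + h) - 2 * g x + g (x - h)) - of_real (h\<^sup>2) * W x) \<le> (2 * M * h\<^sup>2) * h\<^sup>2"
      unfolding DL(2) h4 by (simp add: algebra_simps)
    from norm_divide_square_le[OF this hp] show ?thesis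
      using 1 unfolding dx x_def[symmetric] by (simp add: delta_coeff_def res_weight_def)
  next
    case 3
    have "(real N + 1) * h \<le> real j * h" "(real j + 1) * h \<le> (2 * real N) * h" using j 3 hp by (auto intro!: mult_right_mono)
    then have xx: "0 \<le> x - h" "x + h \<le> a" unfolding x using hN by (auto simp: algebra_simps)
    have "DR 2 x = W x" using xx hp by (intro WR) auto
    with creg_central_closed[OF DR(1) _ xx hp cL(2)]
    have "norm ((g (x + h) - 2 * g x + g (x - h)) - of_real (h\<^sup>2) * W x) \<le> (2 * M * h\<^sup>2) * h\<^sup>2"
      unfolding DR(2) h4 by (simp add: algebra_simps)
    from norm_divide_square_le[OF this hp] show ?thesis
      using 3 unfolding dx x_def[symmetric] by (simp add: delta_coeff_def res_weight_def)
  next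
    case 2
    have x0: "x = 0" unfolding x 2 hN by simp
    have ha: "h \<le> a" using N a by (simp add: h divide_le_eq)
    have ev: "eventually (\<lambda>s. s < h) (at_right 0)" using hp by (auto simp: eventually_at_right_field intro!: exI[of _ h])
    have lim: "((\<lambda>s. g (\<sigma> * s)) \<longlongrightarrow> g 0) (at_right 0)" "((\<lambda>s. g (\<sigma> * (h - s))) \<longlongrightarrow> g (\<sigma> * h)) (at_right 0)"
      if \<sigma>: "\<sigma> = 1 \<or> \<sigma> = -1" for \<sigma>
    proof -
      have s: "((\<lambda>s. \<sigma> * s) \<longlongrightarrow> \<sigma> * 0) (at_right 0)" "((\<lambda>s. \<sigma> * (h - s)) \<longlongrightarrow> \<sigma> * (h - 0)) (at_right 0)"
        by (intro tendsto_intros)+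
      have m: "eventually (\<lambda>s. \<sigma> * s \<in> {-a..a}) (at_right 0)" "eventually (\<lambda>s. \<sigma> * (h - s) \<in> {-a..a}) (at_right 0)"
        using ev eventually_at_right_less[of 0] by (eventually_elim, use \<sigma> ha in auto)+
      show "((\<lambda>s. g (\<sigma> * s)) \<longlongrightarrow> g 0) (at_right 0)"
        by (rule continuous_on_tendsto_compose[OF g _ _ m(1)]) (use s a in auto)
      show "((\<lambda>s. g (\<sigma> * (h - s))) \<longlongrightarrow> g (\<sigma> * h)) (at_right 0)"
        by (rule continuous_on_tendsto_compose[OF g _ _ m(2)]) (use s a ha hp \<sigma> in auto)
    qed
    have R: "norm (g (1 * h) - g 0 - (1 * h) *\<^sub>R dp - (h\<^sup>2 / 2) *\<^sub>R W 0) \<le> M * h ^ 3"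
    proof (rule creg_edge[OF DR(1) _ hp])
      show "((\<lambda>s. DR 2 (1 * s)) \<longlongrightarrow> W 0) (at_right 0)"
        by (rule Lim_transform_eventually[OF W0(2)])
          (use ev eventually_at_right_less[of 0] in \<open>eventually_elim, use WR ha in auto\<close>)
    qed (use lim[of 1] d(2) ha in \<open>auto simp: DR(2)\<close>)
    have L: "norm (g ((-1) * h) - g 0 - ((-1) * h) *\<^sub>R dm - (h\<^sup>2 / 2) *\<^sub>R W 0) \<le> M * h ^ 3"
    proof (rule creg_edge[OF DL(1) _ hp])
      have "((\<lambda>s. W (- s)) \<longlongrightarrow> W 0) (at_right 0)" using W0(1) unfolding filterlim_at_left_to_right by simp
      then show "((\<lambda>s. DL 2 ((-1) * s)) \<longlongrightarrow> W 0) (at_right 0)"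
        by (rule Lim_transform_eventually)
          (use ev eventually_at_right_less[of 0] in \<open>eventually_elim, use WL ha in auto\<close>)
      show "((\<lambda>s. DL 1 ((-1) * s)) \<longlongrightarrow> dm) (at_right 0)"
        using d(1) unfolding filterlim_at_left_to_right by simp
    qed (use lim[of "-1"] ha in \<open>auto simp: DL(2)\<close>)
    define P Q where "P = g (1 * h) - g 0 - (1 * h) *\<^sub>R dp - (h\<^sup>2 / 2) *\<^sub>R W 0"
      and "Q = g ((-1) * h) - g 0 - ((-1) * h) *\<^sub>R dm - (h\<^sup>2 / 2) *\<^sub>R W 0"
    have dp: "dp = dm + of_real lam * g 0" using d(3) by (simp add: algebra_simps)
    have PQ: "P + Q = (g (x + h) - 2 * g x + g (x - h)) - of_real (h\<^sup>2) * (of_real (lam * (1 / h)) * g 0 + W 0)"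
      unfolding P_def Q_def dp x0 using hp by (simp add: scaleR_conv_of_real field_simps power2_eq_square)
    have "norm (P + Q) \<le> M * h ^ 3 + M * h ^ 3"
      using norm_triangle_mono[OF R L] unfolding P_def Q_def .
    then have "norm ((g (x + h) - 2 * g x + g (x - h)) - of_real (h\<^sup>2) * (of_real (lam * (1 / h)) * g 0 + W 0)) \<le> (2 * M * h) * h\<^sup>2"
      unfolding PQ by (simp add: power2_eq_square power3_eq_cube)
    from norm_divide_square_le[OF this hp]
    have "norm ((g (x + h) - 2 * g x + g (x - h)) / of_real (h\<^sup>2) - of_real (lam * (1 / h)) * g 0 - W 0) \<le> 2 * M * h"
      by (simp only: diff_diff_eq)
    also have "\<dots> \<le> 2 * M * (h\<^sup>2 + h)" using M0 by (intro mult_left_mono) auto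
    finally show ?thesis
      using 2 unfolding dx x_def[symmetric] x0 by (simp add: delta_coeff_def res_weight_def)
  qed
qed

lemma creg_derivs_unique:
  assumes D: "creg k M p q D" and k: "2 < k" and x: "x \<in> {p<..<q}"
    and f: "\<And>x. x \<in> {p<..<q} \<Longrightarrow> (D 0 has_vector_derivative f1 x) (at x)"
      "\<And>x. x \<in> {p<..<q} \<Longrightarrow> (f1 has_vector_derivative f2 x) (at x)"
  shows "D 1 x = f1 x" "D 2 x = f2 x"
proof -
  have eq: "D 1 y = f1 y" if "y \<in> {p<..<q}" for y
    using cregD(4)[OF D, of 0 y] f(1)[OF that] that k by (intro vector_derivative_unique_at) auto
  show "D 1 x = f1 x" by (rule eq[OF x])
  have "(D 1 has_vector_derivative f2 x) (at x)"
    by (rule has_vector_derivative_transform_within_open[OF f(2)[OF x] open_greaterThanLessThan x eq[symmetric]])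
  moreover have "(D 1 has_vector_derivative D 2 x) (at x)"
    using cregD(4)[OF D, of 1 x] x k by (simp add: numeral_2_eq_2)
  ultimately show "D 2 x = f2 x" by (rule vector_derivative_unique_at[rotated])
qed

lemma continuous_flog:
  assumes "0 < \<epsilon>" shows "continuous_on UNIV (flog \<epsilon>)"
proof -
  have "\<epsilon> + norm z \<noteq> 0" for z :: complex using assms by (smt (verit) norm_ge_zero)
  then show ?thesis unfolding flog_def[abs_def] by (intro continuous_intros) auto
qed

lemma res_weight_scale: "res_weight h \<tau> (c * \<kappa>) N j = c * res_weight h \<tau> \<kappa> N j"
  by (simp add: res_weight_def)

lemma average_second_difference:
  fixes p q r :: "'a::field_char_0"
  shows "((p' + p) / 2 - 2 * ((q' + q) / 2) + (r' + r) / 2) / H = ((p' - 2 * q' + r') / H + (p - 2 * q + r) / H) / 2"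
  by (cases "H = 0") (simp_all add: field_simps)

section \<open>The residual of the exact solution on the grid\<close>

locale lse_solution = solution_reg a T M1 u for a T M1 :: real and u :: "real \<Rightarrow> real \<Rightarrow> complex" +
  fixes lam \<mu> \<epsilon> :: real and ut ux uxx :: "real \<Rightarrow> real \<Rightarrow> complex"
  assumes \<epsilon>: "0 < \<epsilon>"
    and pde: "\<And>x t. t \<in> {0<..<T} \<Longrightarrow> x \<in> {-a<..<a} - {0} \<Longrightarrow>
           ((\<lambda>s. u x s) has_vector_derivative ut x t) (at t) \<and>
           ((\<lambda>y. u y t) has_vector_derivative ux x t) (at x) \<and>
           ((\<lambda>y. ux y t) has_vector_derivative uxx x t) (at x) \<and>
           \<i> * ut x t =
             - uxx x t + of_real \<mu> * u x t * of_real (ln ((\<epsilon> + norm (u x t))\<^sup>2))"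
    and interface: "\<And>t. t \<in> {0<..<T} \<Longrightarrow> \<exists>dp dm. ((\<lambda>x. ux x t) \<longlongrightarrow> dp) (at_right 0) \<and>
                 ((\<lambda>x. ux x t) \<longlongrightarrow> dm) (at_left 0) \<and>
                 dp - dm = of_real lam * u 0 t"
begin

text \<open>The second space derivative as dictated by the equation; written through
  \<open>DT\<close> it is defined and continuous also at the interface and at the boundary.\<close>

definition curv :: "real \<Rightarrow> real \<Rightarrow> complex" where
  "curv t x = - \<i> * DT x 1 t + of_real \<mu> * flog \<epsilon> (u x t)"

lemma uxx_eq_curv:
  assumes "t \<in> {0<..<T}" "x \<in> S" shows "uxx x t = curv t x"
proof -
  note p = pde[OF assms]
  have "ut x t = DT x 1 t"
    by (rule vector_derivative_unique_at[OF _ DT1_deriv]) (use p assms in auto)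
  moreover have "0 < \<epsilon> + norm (u x t)" using \<epsilon> by (intro add_pos_nonneg) auto
  then have "ln ((\<epsilon> + norm (u x t))\<^sup>2) = 2 * ln (\<epsilon> + norm (u x t))" by (simp add: ln_realpow)
  moreover have "uxx x t = - \<i> * ut x t + of_real \<mu> * u x t * of_real (ln ((\<epsilon> + norm (u x t))\<^sup>2))"
    using p by (simp add: algebra_simps)
  ultimately show ?thesis by (simp add: curv_def flog_def)
qed

lemma curv_continuous:
  assumes "t \<in> {0<..<T}" shows "continuous_on {-a..a} (curv t)"
proof -
  have "continuous_on {-a..a} (\<lambda>x. DT x 1 t)"
    unfolding continuous_on_sequentially o_def using DT1_continuous assms by blast
  moreover have "continuous_on {-a..a} (\<lambda>x. flog \<epsilon> (u x t))"
    by (rule continuous_on_compose2[OF continuous_flog[OF \<epsilon>] cont_x]) (use assms in auto)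
  ultimately show ?thesis unfolding curv_def[abs_def] by (intro continuous_intros)
qed

lemma curv_tendsto:
  assumes "t \<in> {0<..<T}" shows "(curv t \<longlongrightarrow> curv t 0) (at_left 0)" "(curv t \<longlongrightarrow> curv t 0) (at_right 0)"
proof -
  have "(curv t \<longlongrightarrow> curv t 0) (at 0 within {-a..a})"
    using curv_continuous[OF assms] a by (simp add: continuous_on_def)
  then have "(curv t \<longlongrightarrow> curv t 0) (at 0)" using a by (simp add: at_within_Icc_at)
  then show "(curv t \<longlongrightarrow> curv t 0) (at_left 0)" "(curv t \<longlongrightarrow> curv t 0) (at_right 0)"
    by (simp_all add: filterlim_at_split)
qed

definition defect :: "nat \<Rightarrow> real \<Rightarrow> nat \<Rightarrow> complex" where
  "defect N t j = dx2 (a / real N) (\<lambda>j. u (grid_x a N j) t) j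
     - of_real (lam * delta_coeff (a / real N) N j) * u (grid_x a N j) t - curv t (grid_x a N j)"

lemma at_side_derivs:
  assumes f: "(f \<longlongrightarrow> l) F" and e: "eventually (\<lambda>x. x \<in> {p<..<q}) F" and D: "\<And>x. x \<in> {p<..<q} \<Longrightarrow> D x = f x"
  shows "(D \<longlongrightarrow> l) F"
  by (rule Lim_transform_eventually[OF f]) (use e D in \<open>auto elim!: eventually_mono\<close>)

lemma eventually_sides: "eventually (\<lambda>x. x \<in> {-a<..<0}) (at_left 0)" "eventually (\<lambda>x. x \<in> {0<..<a}) (at_right 0)"
  using a by (auto intro!: eventually_at_leftI[of "-a"] eventually_at_rightI[of 0 a])

lemma defect_bound:
  assumes t: "t \<in> {0<..<T}" and N: "0 < N" and j: "j \<in> {1..<2 * N}"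
  shows "norm (defect N t j) \<le> res_weight (a / real N) 0 (2 * M1) N j"
proof -
  obtain DL DR where DL: "creg 4 M1 (-a) 0 DL" "DL 0 = (\<lambda>x. u x t)" and DR: "creg 4 M1 0 a DR" "DR 0 = (\<lambda>x. u x t)"
    using space_creg[of "-a" 0 t] space_creg[of 0 a t] t by blast
  have dL: "DL 1 x = ux x t" "DL 2 x = uxx x t" if "x \<in> {-a<..<0}" for x
    by (rule creg_derivs_unique[OF DL(1) _ that, of "\<lambda>x. ux x t" "\<lambda>x. uxx x t"]; use pde[OF t] DL(2) in auto)+
  have dR: "DR 1 x = ux x t" "DR 2 x = uxx x t" if "x \<in> {0<..<a}" for x
    by (rule creg_derivs_unique[OF DR(1) _ that, of "\<lambda>x. ux x t" "\<lambda>x. uxx x t"]; use pde[OF t] DR(2) in auto)+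
  obtain dp dm where d: "((\<lambda>x. ux x t) \<longlongrightarrow> dp) (at_right 0)" "((\<lambda>x. ux x t) \<longlongrightarrow> dm) (at_left 0)" "dp - dm = of_real lam * u 0 t"
    using interface[OF t] by blast
  show ?thesis unfolding defect_def
  proof (rule spatial_consistency[OF a N refl cont_x DL DR _ _ curv_tendsto[OF t] _ _ d(3) j])
    show "t \<in> {0..T}" using t by auto
    show "(DL 1 \<longlongrightarrow> dm) (at_left 0)" by (rule at_side_derivs[OF d(2) eventually_sides(1) dL(1)])
    show "(DR 1 \<longlongrightarrow> dp) (at_right 0)" by (rule at_side_derivs[OF d(1) eventually_sides(2) dR(1)])
  qed (use dL(2) dR(2) uxx_eq_curv[OF t] in auto)
qed

text \<open>The interface condition is linear in the solution, and the curvature enters only as the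
  function W. Hence the spatial estimate applies to the difference of two times, whose regularity
  constant is \<open>M1 * \<bar>t - s\<bar>\<close>.\<close>

lemma defect_diff_bound:
  assumes t: "t \<in> {0<..<T}" "s \<in> {0<..<T}" and N: "0 < N" and j: "j \<in> {1..<2 * N}"
  shows "norm (defect N t j - defect N s j) \<le> \<bar>t - s\<bar> * res_weight (a / real N) 0 (2 * M1) N j"
proof -
  obtain DL DR where DL: "creg 4 (M1 * \<bar>t - s\<bar>) (-a) 0 DL" "DL 0 = (\<lambda>x. u x t - u x s)"
    and DR: "creg 4 (M1 * \<bar>t - s\<bar>) 0 a DR" "DR 0 = (\<lambda>x. u x t - u x s)"
    using space_diff_creg[of "-a" 0 t s] space_diff_creg[of 0 a t s] t by blast
  have dd: "((\<lambda>x. u x t - u x s) has_vector_derivative ux x t - ux x s) (at x)"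
    "((\<lambda>x. ux x t - ux x s) has_vector_derivative uxx x t - uxx x s) (at x)" if "x \<in> S" for x
    using pde[OF t(1) that] pde[OF t(2) that] by (auto intro!: has_vector_derivative_diff)
  have dL: "DL 1 x = ux x t - ux x s" "DL 2 x = uxx x t - uxx x s" if "x \<in> {-a<..<0}" for x
    by (rule creg_derivs_unique[OF DL(1) _ that, of "\<lambda>x. ux x t - ux x s" "\<lambda>x. uxx x t - uxx x s"]; use dd DL(2) in auto)+
  have dR: "DR 1 x = ux x t - ux x s" "DR 2 x = uxx x t - uxx x s" if "x \<in> {0<..<a}" for x
    by (rule creg_derivs_unique[OF DR(1) _ that, of "\<lambda>x. ux x t - ux x s" "\<lambda>x. uxx x t - uxx x s"]; use dd DR(2) in auto)+
  obtain dp dm where d: "((\<lambda>x. ux x t) \<longlongrightarrow> dp) (at_right 0)" "((\<lambda>x. ux x t) \<longlongrightarrow> dm) (at_left 0)" "dp - dm = of_real lam * u 0 t"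
    using interface[OF t(1)] by blast
  obtain dp' dm' where d': "((\<lambda>x. ux x s) \<longlongrightarrow> dp') (at_right 0)" "((\<lambda>x. ux x s) \<longlongrightarrow> dm') (at_left 0)" "dp' - dm' = of_real lam * u 0 s"
    using interface[OF t(2)] by blast
  let ?h = "a / real N" and ?x = "grid_x a N"
  have "norm (dx2 ?h (\<lambda>j. u (?x j) t - u (?x j) s) j - of_real (lam * delta_coeff ?h N j) * (u (?x j) t - u (?x j) s)
      - (curv t (?x j) - curv s (?x j))) \<le> res_weight ?h 0 (2 * (M1 * \<bar>t - s\<bar>)) N j"
  proof (rule spatial_consistency[OF a N refl _ DL DR, where W = "\<lambda>x. curv t x - curv s x"])
    show "continuous_on {-a..a} (\<lambda>x. u x t - u x s)" by (intro continuous_on_diff cont_x) (use t in auto)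
    show "((\<lambda>x. curv t x - curv s x) \<longlongrightarrow> curv t 0 - curv s 0) (at_left 0)"
      "((\<lambda>x. curv t x - curv s x) \<longlongrightarrow> curv t 0 - curv s 0) (at_right 0)"
      by (intro tendsto_diff curv_tendsto t)+
    show "(DL 1 \<longlongrightarrow> dm - dm') (at_left 0)"
      by (rule at_side_derivs[OF tendsto_diff[OF d(2) d'(2)] eventually_sides(1) dL(1)])
    show "(DR 1 \<longlongrightarrow> dp - dp') (at_right 0)"
      by (rule at_side_derivs[OF tendsto_diff[OF d(1) d'(1)] eventually_sides(2) dR(1)])
    have "dp - dp' - (dm - dm') = (dp - dm) - (dp' - dm')" by simp
    then show "dp - dp' - (dm - dm') = of_real lam * (u 0 t - u 0 s)" unfolding d(3) d'(3) by (simp add: right_diff_distrib)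
    show "j \<in> {1..<2 * N}" by (rule j)
  qed (use dL(2) dR(2) uxx_eq_curv t in auto)
  moreover have "dx2 ?h (\<lambda>j. u (?x j) t - u (?x j) s) j - of_real (lam * delta_coeff ?h N j) * (u (?x j) t - u (?x j) s)
      - (curv t (?x j) - curv s (?x j)) = defect N t j - defect N s j"
  proof -
    have "dx2 ?h (\<lambda>j. u (?x j) t - u (?x j) s) j = dx2 ?h (\<lambda>j. u (?x j) t) j - dx2 ?h (\<lambda>j. u (?x j) s) j"
      by (simp only: dx2_def diff_divide_distrib[symmetric]) (simp add: algebra_simps)
    then show ?thesis unfolding defect_def by (simp add: right_diff_distrib)
  qed
  moreover have "2 * (M1 * \<bar>t - s\<bar>) = \<bar>t - s\<bar> * (2 * M1)" by simp
  ultimately show ?thesis by (simp only: res_weight_scale)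
qed

text \<open>The residual with real time and step as arguments instead of a level index, so that both
  can be contracted together.\<close>

definition Res :: "nat \<Rightarrow> real \<Rightarrow> nat \<Rightarrow> real \<Rightarrow> complex" where
  "Res N \<tau> j t = \<i> * ((u (grid_x a N j) (t + \<tau>) - u (grid_x a N j) t) / of_real \<tau>)
     + (dx2 (a / real N) (\<lambda>j. u (grid_x a N j) (t + \<tau>)) j + dx2 (a / real N) (\<lambda>j. u (grid_x a N j) t) j) / 2
     - of_real (lam * delta_coeff (a / real N) N j) * ((u (grid_x a N j) (t + \<tau>) + u (grid_x a N j) t) / 2)
     - of_real \<mu> * ((flog \<epsilon> (u (grid_x a N j) (t + \<tau>)) + flog \<epsilon> (u (grid_x a N j) t)) / 2)"

definition trap :: "real \<Rightarrow> real \<Rightarrow> real \<Rightarrow> complex" where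
  "trap \<tau> x t = DT x 0 (t + \<tau>) - DT x 0 t - of_real (\<tau> / 2) * (DT x 1 (t + \<tau>) + DT x 1 t)"

lemma grid_x_in: "0 < N \<Longrightarrow> j \<le> 2 * N \<Longrightarrow> grid_x a N j \<in> {-a..a}"
proof -
  assume N: "0 < N" "j \<le> 2 * N"
  have "real j * (a / real N) \<le> real (2 * N) * (a / real N)" using N a by (intro mult_right_mono) auto
  then show ?thesis using N a by (simp add: grid_x_def)
qed

text \<open>Inserting \<open>curv\<close> cancels the means of \<open>flog\<close>, which leaves the
  trapezoidal error of u in time and the mean of two spatial defects.\<close>

lemma Res_eq:
  assumes N: "0 < N" "j \<le> 2 * N" and \<tau>: "\<tau> \<noteq> 0"
  shows "Res N \<tau> j t = \<i> * (trap \<tau> (grid_x a N j) t / of_real \<tau>) + (defect N (t + \<tau>) j + defect N t j) / 2"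
  unfolding Res_def trap_def defect_def curv_def DT(2)[OF grid_x_in[OF N]]
  using \<tau> by (simp add: field_simps)

lemma Res_bound_open:
  assumes N: "0 < N" and j: "j \<in> {1..<2 * N}" and t: "t \<in> {0<..<T}" "t + \<tau> \<in> {0<..<T}" and \<tau>: "0 < \<tau>"
  shows "norm (Res N \<tau> j t) \<le> res_weight (a / real N) \<tau> (2 * M1) N j"
proof -
  have j': "j \<le> 2 * N" using j by auto
  let ?x = "grid_x a N j" let ?w = "res_weight (a / real N) 0 (2 * M1) N j"
  have "norm (trap \<tau> ?x t) \<le> M1 / 2 * \<tau> ^ 3"
    unfolding trap_def using creg_trapezoid[OF DT(1)[OF grid_x_in[OF N j']], of 0 t \<tau>] t \<tau> by simp
  then have "norm (trap \<tau> ?x t) / \<tau> \<le> M1 / 2 * \<tau> ^ 3 / \<tau>" using \<tau> by (intro divide_right_mono) auto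
  also have "\<dots> = M1 / 2 * \<tau>\<^sup>2" using \<tau> by (simp add: power2_eq_square power3_eq_cube)
  finally have 1: "norm (\<i> * (trap \<tau> ?x t / of_real \<tau>)) \<le> M1 / 2 * \<tau>\<^sup>2" using \<tau> by (simp add: norm_mult norm_divide)
  have "norm (defect N (t + \<tau>) j + defect N t j) \<le> ?w + ?w"
    by (intro norm_triangle_mono defect_bound t N j)
  then have 2: "norm ((defect N (t + \<tau>) j + defect N t j) / 2) \<le> ?w" by simp
  have "norm (Res N \<tau> j t) \<le> M1 / 2 * \<tau>\<^sup>2 + ?w"
    unfolding Res_eq[OF N j' less_imp_neq[OF \<tau>, symmetric]] by (rule norm_triangle_mono[OF 1 2])
  also have "\<dots> \<le> (2 * M1) * \<tau>\<^sup>2 + ?w" using M1 by (intro add_right_mono mult_right_mono) auto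
  also have "\<dots> = res_weight (a / real N) \<tau> (2 * M1) N j" unfolding res_weight_def by (simp add: algebra_simps)
  finally show ?thesis .
qed

lemma Res_diff_bound_open:
  assumes N: "0 < N" and j: "j \<in> {1..<2 * N}" and t: "t \<in> {0<..<T}" "t + \<tau> + \<tau> \<in> {0<..<T}" and \<tau>: "0 < \<tau>"
  shows "norm (Res N \<tau> j (t + \<tau>) - Res N \<tau> j t) \<le> \<tau> * res_weight (a / real N) \<tau> (2 * M1) N j"
proof -
  have j': "j \<le> 2 * N" using j by auto
  have t1: "t + \<tau> \<in> {0<..<T}" using t \<tau> by auto
  let ?x = "grid_x a N j" let ?w = "res_weight (a / real N) 0 (2 * M1) N j"
  have "norm (trap \<tau> ?x (t + \<tau>) - trap \<tau> ?x t) \<le> M1 / 2 * \<tau> ^ 4"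
    unfolding trap_def using creg_trapezoid_step[OF DT(1)[OF grid_x_in[OF N j']], of t \<tau>] t \<tau> by simp
  then have "norm (trap \<tau> ?x (t + \<tau>) - trap \<tau> ?x t) / \<tau> \<le> M1 / 2 * \<tau> ^ 4 / \<tau>" using \<tau> by (intro divide_right_mono) auto
  also have "\<dots> = \<tau> * (M1 / 2 * \<tau>\<^sup>2)" using \<tau> by (simp add: numeral_eq_Suc)
  finally have 1: "norm (\<i> * ((trap \<tau> ?x (t + \<tau>) - trap \<tau> ?x t) / of_real \<tau>)) \<le> \<tau> * (M1 / 2 * \<tau>\<^sup>2)"
    using \<tau> by (simp add: norm_mult norm_divide)
  have "norm (defect N (t + \<tau> + \<tau>) j - defect N (t + \<tau>) j + (defect N (t + \<tau>) j - defect N t j))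
      \<le> \<bar>t + \<tau> + \<tau> - (t + \<tau>)\<bar> * ?w + \<bar>t + \<tau> - t\<bar> * ?w"
    by (intro norm_triangle_mono defect_diff_bound t t1 N j)
  then have 2: "norm ((defect N (t + \<tau> + \<tau>) j - defect N (t + \<tau>) j + (defect N (t + \<tau>) j - defect N t j)) / 2) \<le> \<tau> * ?w"
    using \<tau> by simp
  have "Res N \<tau> j (t + \<tau>) - Res N \<tau> j t = \<i> * ((trap \<tau> ?x (t + \<tau>) - trap \<tau> ?x t) / of_real \<tau>)
      + (defect N (t + \<tau> + \<tau>) j - defect N (t + \<tau>) j + (defect N (t + \<tau>) j - defect N t j)) / 2"
    unfolding Res_eq[OF N j' less_imp_neq[OF \<tau>, symmetric]]
    by (simp add: diff_divide_distrib add_divide_distrib right_diff_distrib)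
  then have "norm (Res N \<tau> j (t + \<tau>) - Res N \<tau> j t) \<le> \<tau> * (M1 / 2 * \<tau>\<^sup>2) + \<tau> * ?w"
    using norm_triangle_mono[OF 1 2] by simp
  also have "\<dots> \<le> \<tau> * ((2 * M1) * \<tau>\<^sup>2) + \<tau> * ?w" using M1 \<tau> by (intro add_right_mono mult_right_mono mult_left_mono) auto
  also have "\<dots> = \<tau> * res_weight (a / real N) \<tau> (2 * M1) N j" unfolding res_weight_def by (simp add: algebra_simps)
  finally show ?thesis .
qed

text \<open>Estimates valid on the open time interval extend to \<open>[0,T]\<close> by contracting time towards \<open>T/2\<close>,
  an affine map that keeps equidistant times equidistant.\<close>

definition contr :: "real \<Rightarrow> real \<Rightarrow> real" where
  "contr s t = t + s * (T / 2 - t)"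

lemma contr_add: "contr s (t + \<tau>) = contr s t + (1 - s) * \<tau>"
  by (simp add: contr_def algebra_simps)

lemma contr_in: "t \<in> {0..T} \<Longrightarrow> 0 < s \<Longrightarrow> s < 1 \<Longrightarrow> contr s t \<in> {0<..<T}"
proof -
  assume t: "t \<in> {0..T}" and s: "0 < s" "s < 1"
  have e: "contr s t = (1 - s) * t + s * (T / 2)" "T - contr s t = (1 - s) * (T - t) + s * (T / 2)"
    by (simp_all add: contr_def algebra_simps)
  have p: "0 \<le> (1 - s) * t" "0 \<le> (1 - s) * (T - t)" "0 < s * (T / 2)" using t s T by auto
  have "0 < contr s t" unfolding e(1) by (rule add_nonneg_pos[OF p(1,3)])
  moreover have "0 < T - contr s t" unfolding e(2) by (rule add_nonneg_pos[OF p(2,3)])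
  ultimately show ?thesis by simp
qed

lemma eventually_contr: "eventually (\<lambda>s. 0 < s \<and> s < (1::real)) (at_right 0)"
  by (rule eventually_at_rightI[of 0 1]) auto

lemma one_minus_tendsto: "((\<lambda>s::real. (1 - s) * \<tau>) \<longlongrightarrow> \<tau>) (at_right 0)"
proof -
  have "((\<lambda>s::real. (1 - s) * \<tau>) \<longlongrightarrow> (1 - 0) * \<tau>) (at_right 0)" by (intro tendsto_intros)
  then show ?thesis by simp
qed

lemma contr_tendsto:
  assumes "x \<in> {-a..a}" "t \<in> {0..T}" shows "((\<lambda>s. u x (contr s t)) \<longlongrightarrow> u x t) (at_right 0)"
proof (rule continuous_on_tendsto_compose[OF cont_t[OF assms(1)] _ assms(2)])
  have "((\<lambda>s. contr s t) \<longlongrightarrow> t + 0 * (T / 2 - t)) (at_right 0)" unfolding contr_def by (intro tendsto_intros)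
  then show "((\<lambda>s. contr s t) \<longlongrightarrow> t) (at_right 0)" by simp
  show "eventually (\<lambda>s. contr s t \<in> {0..T}) (at_right 0)"
    using eventually_contr by eventually_elim (use contr_in[OF assms(2)] in force)
qed

lemma flog_tendsto: "(f \<longlongrightarrow> z) F \<Longrightarrow> ((\<lambda>s. flog \<epsilon> (f s)) \<longlongrightarrow> flog \<epsilon> z) F"
  by (rule continuous_on_tendsto_compose[OF continuous_flog[OF \<epsilon>]]) auto

lemma Res_tendsto:
  assumes N: "0 < N" and j: "j \<in> {1..<2 * N}" and t: "t \<in> {0..T}" "t + \<tau> \<in> {0..T}" and \<tau>: "0 < \<tau>"
  shows "((\<lambda>s. Res N ((1 - s) * \<tau>) j (contr s t)) \<longlongrightarrow> Res N \<tau> j t) (at_right 0)"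
proof -
  have \<tau>': "complex_of_real \<tau> \<noteq> 0" using \<tau> by simp
  have g: "grid_x a N j \<in> {-a..a}" "grid_x a N (j + 1) \<in> {-a..a}" "grid_x a N (j - 1) \<in> {-a..a}"
    using j by (auto intro!: grid_x_in N simp del: atLeastAtMost_iff)
  have h: "complex_of_real ((a / real N)\<^sup>2) \<noteq> 0" using a N by simp
  show ?thesis
    unfolding Res_def dx2_def contr_add[symmetric]
    by (intro tendsto_intros flog_tendsto contr_tendsto g t one_minus_tendsto \<tau>' h) auto
qed

lemma res_weight_tendsto: "((\<lambda>s. res_weight h ((1 - s) * \<tau>) \<kappa> N j) \<longlongrightarrow> res_weight h \<tau> \<kappa> N j) (at_right 0)"
  unfolding res_weight_def by (intro tendsto_intros one_minus_tendsto)

lemma Res_bound: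
  assumes N: "0 < N" and j: "j \<in> {1..<2 * N}" and t: "0 \<le> t" "t + \<tau> \<le> T" and \<tau>: "0 < \<tau>"
  shows "norm (Res N \<tau> j t) \<le> res_weight (a / real N) \<tau> (2 * M1) N j"
proof (rule tendsto_le[OF trivial_limit_at_right_real res_weight_tendsto])
  have t': "t \<in> {0..T}" "t + \<tau> \<in> {0..T}" using t \<tau> by auto
  show "((\<lambda>s. norm (Res N ((1 - s) * \<tau>) j (contr s t))) \<longlongrightarrow> norm (Res N \<tau> j t)) (at_right 0)"
    by (intro tendsto_norm Res_tendsto N j t' \<tau>)
  show "eventually (\<lambda>s. norm (Res N ((1 - s) * \<tau>) j (contr s t)) \<le> res_weight (a / real N) ((1 - s) * \<tau>) (2 * M1) N j) (at_right 0)"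
    using eventually_contr
  proof eventually_elim
    case (elim s)
    show ?case
      by (rule Res_bound_open[OF N j]) (use contr_in[OF t'(1)] contr_in[OF t'(2)] elim \<tau> in \<open>auto simp: contr_add\<close>)
  qed
qed

lemma Res_diff_bound:
  assumes N: "0 < N" and j: "j \<in> {1..<2 * N}" and t: "0 \<le> t" "t + \<tau> + \<tau> \<le> T" and \<tau>: "0 < \<tau>"
  shows "norm (Res N \<tau> j (t + \<tau>) - Res N \<tau> j t) \<le> \<tau> * res_weight (a / real N) \<tau> (2 * M1) N j"
proof (rule tendsto_le[OF trivial_limit_at_right_real tendsto_mult[OF one_minus_tendsto res_weight_tendsto]])
  have t': "t \<in> {0..T}" "t + \<tau> \<in> {0..T}" "t + \<tau> + \<tau> \<in> {0..T}" using t \<tau> by auto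
  show "((\<lambda>s. norm (Res N ((1 - s) * \<tau>) j (contr s (t + \<tau>)) - Res N ((1 - s) * \<tau>) j (contr s t)))
      \<longlongrightarrow> norm (Res N \<tau> j (t + \<tau>) - Res N \<tau> j t)) (at_right 0)"
    by (intro tendsto_norm tendsto_diff Res_tendsto N j t' \<tau>)
  show "eventually (\<lambda>s. norm (Res N ((1 - s) * \<tau>) j (contr s (t + \<tau>)) - Res N ((1 - s) * \<tau>) j (contr s t))
      \<le> (1 - s) * \<tau> * res_weight (a / real N) ((1 - s) * \<tau>) (2 * M1) N j) (at_right 0)"
    using eventually_contr
  proof eventually_elim
    case (elim s)
    have "contr s t \<in> {0<..<T}" "contr s t + (1 - s) * \<tau> + (1 - s) * \<tau> \<in> {0<..<T}"
      unfolding contr_add[symmetric] by (intro contr_in t'; use elim in simp)+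
    then show ?case unfolding contr_add by (rule Res_diff_bound_open[OF N j]) (use elim \<tau> in simp)
  qed
qed

lemma u_bound:
  assumes x: "x \<in> {-a..a}" and t: "t \<in> {0..T}" shows "norm (u x t) \<le> M1"
proof (rule tendsto_upperbound[OF tendsto_norm[OF contr_tendsto[OF x t]] _ trivial_limit_at_right_real])
  show "eventually (\<lambda>s. norm (u x (contr s t)) \<le> M1) (at_right 0)"
    using eventually_contr
  proof eventually_elim
    case (elim s)
    show ?case using cregD(2)[OF DT(1)[OF x], of 0 "contr s t"] contr_in[OF t] elim DT(2)[OF x] by simp
  qed
qed

lemma u_step:
  assumes x: "x \<in> {-a..a}" and t: "0 \<le> t" "t + \<tau> \<le> T" and \<tau>: "0 < \<tau>"
  shows "norm (u x (t + \<tau>) - u x t) \<le> M1 * \<tau>"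
proof -
  have t': "t \<in> {0..T}" "t + \<tau> \<in> {0..T}" using t \<tau> by auto
  have "((\<lambda>s. norm (u x (contr s (t + \<tau>)) - u x (contr s t))) \<longlongrightarrow> norm (u x (t + \<tau>) - u x t)) (at_right 0)"
    by (intro tendsto_norm tendsto_diff contr_tendsto x t')
  then show ?thesis
  proof (rule tendsto_le[OF trivial_limit_at_right_real tendsto_mult[OF tendsto_const one_minus_tendsto]])
    show "eventually (\<lambda>s. norm (u x (contr s (t + \<tau>)) - u x (contr s t)) \<le> M1 * ((1 - s) * \<tau>)) (at_right 0)"
      using eventually_contr
    proof eventually_elim
      case (elim s)
      have "\<bar>contr s (t + \<tau>) - contr s t\<bar> = (1 - s) * \<tau>" using elim \<tau> by (simp add: contr_add)
      then show ?case
        using cregD(3)[OF DT(1)[OF x], of 0 "contr s (t + \<tau>)" "contr s t"] contr_in[OF t'(1)] contr_in[OF t'(2)] elim DT(2)[OF x] by simp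
    qed
  qed
qed

text \<open>Two Taylor expansions about the middle time are added, which explains the factor 2;
  their first-order terms cancel because contracted times remain equidistant.\<close>

lemma u_second:
  assumes x: "x \<in> {-a..a}" and t: "0 \<le> t" "t + \<tau> + \<tau> \<le> T" and \<tau>: "0 < \<tau>"
  shows "norm (u x (t + \<tau> + \<tau>) - 2 * u x (t + \<tau>) + u x t) \<le> (2 * M1) * \<tau>\<^sup>2"
proof -
  have t': "t \<in> {0..T}" "t + \<tau> \<in> {0..T}" "t + \<tau> + \<tau> \<in> {0..T}" using t \<tau> by auto
  have "((\<lambda>s. norm (u x (contr s (t + \<tau> + \<tau>)) - 2 * u x (contr s (t + \<tau>)) + u x (contr s t)))
      \<longlongrightarrow> norm (u x (t + \<tau> + \<tau>) - 2 * u x (t + \<tau>) + u x t)) (at_right 0)"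
    by (intro tendsto_intros contr_tendsto x t')
  moreover have "((\<lambda>s::real. (2 * M1) * ((1 - s) * \<tau>)\<^sup>2) \<longlongrightarrow> (2 * M1) * \<tau>\<^sup>2) (at_right 0)"
    by (intro tendsto_intros one_minus_tendsto)
  moreover have "eventually (\<lambda>s. norm (u x (contr s (t + \<tau> + \<tau>)) - 2 * u x (contr s (t + \<tau>)) + u x (contr s t)) \<le> (2 * M1) * ((1 - s) * \<tau>)\<^sup>2) (at_right 0)"
    using eventually_contr
  proof eventually_elim
      case (elim s)
      define t0 t1 t2 where "t0 = contr s t" and "t1 = contr s (t + \<tau>)" and "t2 = contr s (t + \<tau> + \<tau>)"
      have r: "t2 - t1 = (1 - s) * \<tau>" "t0 - t1 = - ((1 - s) * \<tau>)" unfolding t0_def t1_def t2_def contr_add by simp_all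
      have i: "t0 \<in> {0<..<T}" "t1 \<in> {0<..<T}" "t2 \<in> {0<..<T}"
        unfolding t0_def t1_def t2_def by (intro contr_in t'; use elim in simp)+
      have "norm ((DT x 0 t2 - DT x 0 t1 - (t2 - t1) *\<^sub>R DT x (Suc 0) t1) + (DT x 0 t0 - DT x 0 t1 - (t0 - t1) *\<^sub>R DT x (Suc 0) t1))
          \<le> M1 * (t2 - t1)\<^sup>2 + M1 * (t0 - t1)\<^sup>2"
        by (intro norm_triangle_mono creg_taylor1[OF DT(1)[OF x]] i) auto
      moreover have "(DT x 0 t2 - DT x 0 t1 - (t2 - t1) *\<^sub>R DT x (Suc 0) t1) + (DT x 0 t0 - DT x 0 t1 - (t0 - t1) *\<^sub>R DT x (Suc 0) t1)
          = u x t2 - 2 * u x t1 + u x t0"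
        unfolding r DT(2)[OF x] by (simp add: algebra_simps)
      moreover have "M1 * (t2 - t1)\<^sup>2 + M1 * (t0 - t1)\<^sup>2 = (2 * M1) * ((1 - s) * \<tau>)\<^sup>2" unfolding r by (simp add: power2_eq_square)
      ultimately show ?case unfolding t0_def t1_def t2_def by (simp only:)
  qed
  ultimately show ?thesis by (intro tendsto_le[OF trivial_limit_at_right_real])
qed

lemma cn_residual_eq_Res:
  "cn_residual (a / real N) \<tau> lam \<mu> \<epsilon> N (\<lambda>l j. u (grid_x a N j) (real l * \<tau>)) l j = Res N \<tau> j (real l * \<tau>)"
proof -
  have e: "real (l + 1) * \<tau> = real l * \<tau> + \<tau>" by (simp add: algebra_simps)
  have s: "Suc l = l + 1" by simp
  have "dx2 (a / real N) (half_step (\<lambda>l j. u (grid_x a N j) (real l * \<tau>)) l) j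
    = (dx2 (a / real N) (\<lambda>j. u (grid_x a N j) (real l * \<tau> + \<tau>)) j + dx2 (a / real N) (\<lambda>j. u (grid_x a N j) (real l * \<tau>)) j) / 2"
    unfolding dx2_def half_step_def e by (rule average_second_difference)
  then show ?thesis unfolding cn_residual_def Res_def dt_plus_def half_step_def s e by simp
qed

text \<open>Both m and \<kappa> are 2 M1: the factor comes from the second time difference and from
  the spatial defect.\<close>

lemma cnfd_gridI:
  assumes N: "0 < N" and \<tau>: "0 < \<tau>" and n: "real n * \<tau> \<le> T" and \<epsilon>1: "\<epsilon> \<le> 1"
    and b: "\<And>t. t \<in> {0..T} \<Longrightarrow> u (-a) t = 0" "\<And>t. t \<in> {0..T} \<Longrightarrow> u a t = 0"
    and U0: "\<And>j. j \<le> 2 * N \<Longrightarrow> U 0 j = u (grid_x a N j) 0"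
    and UZ: "\<And>k. in_Zh0 N (U (k + 1))"
    and sch: "\<And>k j. j \<in> {1..2 * N - 1} \<Longrightarrow> \<i> * dt_plus \<tau> U k j =
               - dx2 (a / real N) (half_step U k) j
               + of_real (lam * delta_coeff (a / real N) N j) * half_step U k j
               + of_real \<mu> * Qtilde \<epsilon> (U (k + 1) j) (U k j)"
  shows "cnfd_grid (a / real N) \<tau> lam \<mu> \<epsilon> (2 * M1) (2 * M1) T a N n (\<lambda>l j. u (grid_x a N j) (real l * \<tau>)) U"
proof unfold_locales
  have tl: "0 \<le> real l * \<tau>" "real l * \<tau> \<le> T" if "l \<le> n" for l
  proof -
    show "0 \<le> real l * \<tau>" using \<tau> by simp
    have "real l * \<tau> \<le> real n * \<tau>" using that \<tau> by (intro mult_right_mono) auto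
    then show "real l * \<tau> \<le> T" using n by simp
  qed
  have Suc\<tau>: "real (Suc l) * \<tau> = real l * \<tau> + \<tau>" for l by (simp add: algebra_simps)
  have x0: "grid_x a N 0 = -a" "grid_x a N (2 * N) = a" using N by (simp_all add: grid_x_def)
  show "0 < N" "0 < a / real N" "a / real N * real N = a" "0 < \<tau>" "real n * \<tau> \<le> T" "0 < \<epsilon>" "\<epsilon> \<le> 1"
    "0 \<le> 2 * M1"
    using N a \<tau> n \<epsilon> \<epsilon>1 M1 by auto
  show "u (grid_x a N j) (real 0 * \<tau>) = U 0 j" if "j \<le> 2 * N" for j using U0[OF that] by simp
  fix l
  { assume "l \<le> n"
    note t = tl[OF this]
    have "u (-a) (real l * \<tau>) = 0" "u a (real l * \<tau>) = 0" by (intro b; use t in simp)+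
    moreover have "U l 0 = 0 \<and> U l (2 * N) = 0"
    proof (cases l)
      case 0 then show ?thesis using U0[of 0] U0[of "2 * N"] b T by (simp add: x0)
    next
      case (Suc k) then show ?thesis using UZ[of k] by (simp add: in_Zh0_def)
    qed
    ultimately show "u (grid_x a N 0) (real l * \<tau>) = U l 0" "u (grid_x a N (2 * N)) (real l * \<tau>) = U l (2 * N)"
      by (simp_all add: x0)
    fix j assume "j \<le> 2 * N"
    have "norm (u (grid_x a N j) (real l * \<tau>)) \<le> M1" by (rule u_bound[OF grid_x_in[OF N \<open>j \<le> 2 * N\<close>]]) (use t in simp)
    then show "norm (u (grid_x a N j) (real l * \<tau>)) \<le> 2 * M1" using M1 by simp }
  { assume l: "l < n"
    have t: "0 \<le> real l * \<tau>" "real l * \<tau> + \<tau> \<le> T" using tl[of l] tl[of "Suc l"] l unfolding Suc\<tau> by auto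
    { fix j assume j: "j \<le> 2 * N"
      show "norm (u (grid_x a N j) (real (Suc l) * \<tau>) - u (grid_x a N j) (real l * \<tau>)) \<le> 2 * M1 * \<tau>"
      proof -
        have "M1 * \<tau> \<le> 2 * M1 * \<tau>" using M1 \<tau> by simp
        with u_step[OF grid_x_in[OF N j] t \<tau>] show ?thesis unfolding Suc\<tau> by linarith
      qed }
    { fix j assume j: "j \<in> {1..<2 * N}"
      then have "j \<in> {1..2 * N - 1}" by auto
      from sch[OF this, of l] show "\<i> * dt_plus \<tau> U l j = - dx2 (a / real N) (half_step U l) j
               + of_real (lam * delta_coeff (a / real N) N j) * half_step U l j
               + of_real \<mu> * Qtilde \<epsilon> (U (Suc l) j) (U l j)" by simp
      show "norm (cn_residual (a / real N) \<tau> lam \<mu> \<epsilon> N (\<lambda>l j. u (grid_x a N j) (real l * \<tau>)) l j) \<le> res_weight (a / real N) \<tau> (2 * M1) N j"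
        unfolding cn_residual_eq_Res by (rule Res_bound[OF N j t \<tau>]) } }
  { assume l: "Suc l < n"
    have t: "0 \<le> real l * \<tau>" "real l * \<tau> + \<tau> + \<tau> \<le> T" using tl[of l] tl[of "Suc (Suc l)"] l unfolding Suc\<tau> by auto
    { fix j assume j: "j \<le> 2 * N"
      show "norm (u (grid_x a N j) (real (Suc (Suc l)) * \<tau>) - 2 * u (grid_x a N j) (real (Suc l) * \<tau>) + u (grid_x a N j) (real l * \<tau>)) \<le> 2 * M1 * \<tau>\<^sup>2"
        unfolding Suc\<tau> by (rule u_second[OF grid_x_in[OF N j] t \<tau>]) }
    { fix j assume j: "j \<in> {1..<2 * N}"
      show "norm (cn_residual (a / real N) \<tau> lam \<mu> \<epsilon> N (\<lambda>l j. u (grid_x a N j) (real l * \<tau>)) (Suc l) j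
          - cn_residual (a / real N) \<tau> lam \<mu> \<epsilon> N (\<lambda>l j. u (grid_x a N j) (real l * \<tau>)) l j) \<le> \<tau> * res_weight (a / real N) \<tau> (2 * M1) N j"
        unfolding cn_residual_eq_Res Suc\<tau> by (rule Res_diff_bound[OF N j t \<tau>]) } }
qed

end

section \<open>The error bound\<close>

lemma ennreal_add_leD:
  fixes p q r s :: ennreal
  assumes "p + q + r + s \<le> B" shows "p \<le> B" "s \<le> B"
proof -
  have "p \<le> p + q + r + s" by (simp add: add.assoc)
  then show "p \<le> B" using assms by (rule order_trans)
  have "s \<le> p + q + r + s" by (simp add: add.commute[of "p + q + r"])
  then show "s \<le> B" using assms by (rule order_trans)
qed

lemma lse_solution_exists:
  assumes "0 < a" "0 < T" "0 < M1" "0 < \<epsilon>" and sol: "solves a lam \<mu> \<epsilon> u0 Tstar u" and T: "ereal T < Tstar"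
    and A: "assumption_A a lam T M1 u"
  shows "\<exists>ut ux uxx. lse_solution a T M1 u lam \<mu> \<epsilon> ut ux uxx"
proof -
  have before: "ereal t < Tstar" if "t \<le> T" for t using that T by (meson ereal_less_eq(3) order_le_less_trans)
  obtain ut ux uxx where pde: "\<forall>t. 0 < t \<and> ereal t < Tstar \<longrightarrow>
        (\<forall>x\<in>{-a<..<a} - {0}.
           ((\<lambda>s. u x s) has_vector_derivative ut x t) (at t) \<and>
           ((\<lambda>y. u y t) has_vector_derivative ux x t) (at x) \<and>
           ((\<lambda>y. ux y t) has_vector_derivative uxx x t) (at x) \<and>
           \<i> * ut x t =
             - uxx x t + of_real \<mu> * u x t * of_real (ln ((\<epsilon> + norm (u x t))\<^sup>2))) \<and>
        (\<exists>dp dm. ((\<lambda>x. ux x t) \<longlongrightarrow> dp) (at_right 0) \<and>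
                 ((\<lambda>x. ux x t) \<longlongrightarrow> dm) (at_left 0) \<and>
                 dp - dm = of_real lam * u 0 t)"
    using sol unfolding solves_def by blast
  have reg: "solution_reg a T M1 u"
  proof
    show "continuous_on ({-a..a} \<times> {0..T}) (\<lambda>(x, t). u x t)"
      by (rule continuous_on_subset[of "{-a..a} \<times> {t. 0 \<le> t \<and> ereal t < Tstar}"])
        (use sol before in \<open>auto simp: solves_def\<close>)
    have "bochner_Winf_norm 1 T ({-a<..<a} - {0}) (sobolev_norm Linf_norm 4 ({-a<..<a} - {0})) (\<lambda>t x. u x t)
       + bochner_Winf_norm 2 T ({-a<..<a} - {0}) (Linf_norm ({-a<..<a} - {0})) (\<lambda>t x. u x t)
       + bochner_Winf_norm 3 T ({-a<..<a} - {0}) (sobolev_norm Linf_norm 2 ({-a<..<a} - {0})) (\<lambda>t x. u x t)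
       + bochner_Winf_norm 4 T ({-a<..<a} - {0}) (Linf_norm ({-a<..<a} - {0})) (\<lambda>t x. u x t) \<le> ennreal M1"
      using A unfolding assumption_A_def Let_def by blast
    from ennreal_add_leD[OF this]
    show "bochner_Winf_norm 1 T ({-a<..<a} - {0}) (sobolev_norm Linf_norm 4 ({-a<..<a} - {0})) (\<lambda>t x. u x t) \<le> ennreal M1"
      "bochner_Winf_norm 4 T ({-a<..<a} - {0}) (Linf_norm ({-a<..<a} - {0})) (\<lambda>t x. u x t) \<le> ennreal M1"
      by this+
  qed (use assms in auto)
  have "lse_solution a T M1 u lam \<mu> \<epsilon> ut ux uxx"
    by (intro lse_solution.intro reg lse_solution_axioms.intro)
      (use pde before \<open>0 < \<epsilon>\<close> in auto)
  then show ?thesis by blast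
qed

lemma C_eps_ge:
  assumes "0 < M1" shows "M1 / \<epsilon>\<^sup>2 \<le> C_eps \<epsilon> M1"
proof -
  have "1 / \<epsilon>\<^sup>2 \<le> Max {\<bar>ln (\<epsilon> + M1)\<bar>, 1 / M1 ^ 4, 1 / \<epsilon>\<^sup>2}" by (intro Max_ge) auto
  then have "M1 * (1 / \<epsilon>\<^sup>2) \<le> C_eps \<epsilon> M1" unfolding C_eps_def using assms by (intro mult_left_mono) auto
  then show ?thesis by simp
qed

text \<open>The coefficient \<open>M1 / \<epsilon>\<^sup>2\<close> can swallow the constants of the
  estimates only if \<epsilon> is small. The requirement that \<epsilon> be small is therefore read
  as an \<epsilon>0 determined by a, lam, \<mu>, T and M1, before the data and the solution are
  given.\<close>

theorem theorem3p1:
  fixes a lam \<mu> T M1 :: real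
  assumes "0 < a" and "0 < T" and "0 < M1"
  shows "\<exists>\<epsilon>0>0. \<forall>\<epsilon> u0 u Tstar.
    0 < \<epsilon> \<and> \<epsilon> < \<epsilon>0 \<and>
    maximal_solution a lam \<mu> \<epsilon> u0 Tstar u \<and> ereal T < Tstar \<and> assumption_A a lam T M1 u \<longrightarrow>
    (\<exists>h0>0. \<exists>\<tau>0>0. \<exists>C>0. \<forall>M \<tau> U.
       0 < M \<and> a / real M \<le> h0 \<and> 0 < \<tau> \<and> \<tau> \<le> \<tau>0 \<and> cnfd_solution a lam \<mu> \<epsilon> u0 M \<tau> U \<longrightarrow>
       (\<forall>k. real k \<le> T / \<tau> \<longrightarrow>
          (let h = a / real M;
               e = cnfd_error a M \<tau> u U k;
               B = C_eps \<epsilon> M1 * (\<tau>\<^sup>2 + \<tau> * h) + C * h\<^sup>2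
           in mesh_norm h M e \<le> B \<and>
              mesh_norm h M (dx_plus h e) \<le> B \<and>
              mesh_norm_inf M e \<le> B)))"
proof -
  \<comment> \<open>At most 1, as \<open>cnfd_discrete\<close> demands, and at most M1, so that
    \<open>\<omega> / \<epsilon>\<^sup>2\<close> lies below \<open>C_eps\<close>.\<close>
  define \<omega> where "\<omega> = min 1 M1"
  have \<omega>: "0 < \<omega>" "\<omega> \<le> 1" "\<omega> \<le> M1" using assms(3) by (auto simp: \<omega>_def)
  obtain \<epsilon>0 where \<epsilon>0: "0 < \<epsilon>0" "\<epsilon>0 \<le> 1" and disc: "\<And>\<epsilon>. 0 < \<epsilon> \<Longrightarrow> \<epsilon> \<le> \<epsilon>0 \<Longrightarrow> \<exists>K>0. \<exists>\<rho>>0. \<forall>h \<tau> M n A U.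
     cnfd_grid h \<tau> lam \<mu> \<epsilon> (2 * M1) (2 * M1) T a M n A U \<and> h \<le> \<rho> \<and> \<tau> \<le> \<rho> \<longrightarrow>
     (\<forall>l\<le>n. mesh_norm h M (\<lambda>j. A l j - U l j) \<le> \<omega> * \<tau>\<^sup>2 / \<epsilon>\<^sup>2 + K * h\<^sup>2 \<and>
        mesh_norm h M (dx_plus h (\<lambda>j. A l j - U l j)) \<le> \<omega> * \<tau>\<^sup>2 / \<epsilon>\<^sup>2 + K * h\<^sup>2 \<and>
        (\<forall>j\<le>2 * M. norm (A l j - U l j) \<le> \<omega> * \<tau>\<^sup>2 / \<epsilon>\<^sup>2 + K * h\<^sup>2))"
    using cnfd_discrete[of a T "2 * M1" "2 * M1" \<omega> lam \<mu>] assms \<omega> by auto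
  show ?thesis
  proof (rule exI[of _ \<epsilon>0], rule conjI[OF \<epsilon>0(1)], intro allI impI, elim conjE)
    fix \<epsilon> u0 u Tstar
    assume eps: "0 < \<epsilon>" "\<epsilon> < \<epsilon>0" and max: "maximal_solution a lam \<mu> \<epsilon> u0 Tstar u" and Ts: "ereal T < Tstar"
      and A: "assumption_A a lam T M1 u"
    have sol: "solves a lam \<mu> \<epsilon> u0 Tstar u" using max by (simp add: maximal_solution_def)
    obtain ut ux uxx where "lse_solution a T M1 u lam \<mu> \<epsilon> ut ux uxx"
      using lse_solution_exists[OF assms eps(1) sol Ts A] by blast
    then interpret lse_solution a T M1 u lam \<mu> \<epsilon> ut ux uxx .
    obtain K \<rho> where K: "0 < K" "0 < \<rho>" and err: "\<forall>h \<tau> M n A U.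
       cnfd_grid h \<tau> lam \<mu> \<epsilon> (2 * M1) (2 * M1) T a M n A U \<and> h \<le> \<rho> \<and> \<tau> \<le> \<rho> \<longrightarrow>
       (\<forall>l\<le>n. mesh_norm h M (\<lambda>j. A l j - U l j) \<le> \<omega> * \<tau>\<^sup>2 / \<epsilon>\<^sup>2 + K * h\<^sup>2 \<and>
        mesh_norm h M (dx_plus h (\<lambda>j. A l j - U l j)) \<le> \<omega> * \<tau>\<^sup>2 / \<epsilon>\<^sup>2 + K * h\<^sup>2 \<and>
        (\<forall>j\<le>2 * M. norm (A l j - U l j) \<le> \<omega> * \<tau>\<^sup>2 / \<epsilon>\<^sup>2 + K * h\<^sup>2))"
      using disc[OF eps(1) less_imp_le[OF eps(2)]] by (elim exE conjE) (rule that)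
    show "\<exists>h0>0. \<exists>\<tau>0>0. \<exists>C>0. \<forall>M \<tau> U.
       0 < M \<and> a / real M \<le> h0 \<and> 0 < \<tau> \<and> \<tau> \<le> \<tau>0 \<and> cnfd_solution a lam \<mu> \<epsilon> u0 M \<tau> U \<longrightarrow>
       (\<forall>k. real k \<le> T / \<tau> \<longrightarrow>
          (let h = a / real M;
               e = cnfd_error a M \<tau> u U k;
               B = C_eps \<epsilon> M1 * (\<tau>\<^sup>2 + \<tau> * h) + C * h\<^sup>2
           in mesh_norm h M e \<le> B \<and>
              mesh_norm h M (dx_plus h e) \<le> B \<and>
              mesh_norm_inf M e \<le> B))"
    proof (rule exI[of _ \<rho>], rule conjI[OF K(2)], rule exI[of _ \<rho>], rule conjI[OF K(2)], rule exI[of _ K], rule conjI[OF K(1)],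
        intro allI impI, elim conjE)
      fix M \<tau> U and k :: nat
      assume M: "0 < M" and hh: "a / real M \<le> \<rho>" and \<tau>: "0 < \<tau>" "\<tau> \<le> \<rho>" and U: "cnfd_solution a lam \<mu> \<epsilon> u0 M \<tau> U"
        and k: "real k \<le> T / \<tau>"
      have k\<tau>: "real k * \<tau> \<le> T" using k \<tau> by (simp add: pos_le_divide_eq)
      have before: "ereal t < Tstar" if "t \<le> T" for t using that Ts by (meson ereal_less_eq(3) order_le_less_trans)
      have h0: "0 < a / real M" using M assms by simp
      \<comment> \<open>The last level considered is k itself, so the error bound is read off at l =
        k.\<close>
      have grid: "cnfd_grid (a / real M) \<tau> lam \<mu> \<epsilon> (2 * M1) (2 * M1) T a M k (\<lambda>l j. u (grid_x a M j) (real l * \<tau>)) U"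
      proof (rule cnfd_gridI[OF M \<tau>(1) k\<tau>])
        show "\<epsilon> \<le> 1" using eps \<epsilon>0 by simp
        show "u (-a) t = 0" "u a t = 0" if "t \<in> {0..T}" for t using sol before[of t] that by (auto simp: solves_def)
        show "U 0 j = u (grid_x a M j) 0" if "j \<le> 2 * M" for j
          using sol U grid_x_in[OF M that] that by (auto simp: solves_def cnfd_solution_def Let_def)
      qed (use U in \<open>auto simp: cnfd_solution_def Let_def\<close>)
      let ?B = "C_eps \<epsilon> M1 * (\<tau>\<^sup>2 + \<tau> * (a / real M)) + K * (a / real M)\<^sup>2"
      have "\<omega> * \<tau>\<^sup>2 / \<epsilon>\<^sup>2 = \<omega> / \<epsilon>\<^sup>2 * \<tau>\<^sup>2" by simp
      also have "\<dots> \<le> M1 / \<epsilon>\<^sup>2 * \<tau>\<^sup>2" using \<omega>(3) by (intro mult_right_mono divide_right_mono) auto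
      also have "\<dots> \<le> C_eps \<epsilon> M1 * \<tau>\<^sup>2" by (intro mult_right_mono C_eps_ge assms) auto
      also have "\<dots> \<le> C_eps \<epsilon> M1 * (\<tau>\<^sup>2 + \<tau> * (a / real M))"
      proof (rule mult_left_mono)
        have "0 \<le> M1 / \<epsilon>\<^sup>2" using assms by simp
        then show "0 \<le> C_eps \<epsilon> M1" using C_eps_ge[OF assms(3), of \<epsilon>] by (rule order_trans)
        show "\<tau>\<^sup>2 \<le> \<tau>\<^sup>2 + \<tau> * (a / real M)" using mult_pos_pos[OF \<tau>(1) h0] by linarith
      qed
      finally have B: "\<omega> * \<tau>\<^sup>2 / \<epsilon>\<^sup>2 + K * (a / real M)\<^sup>2 \<le> ?B" by (rule add_right_mono)
      have e: "cnfd_error a M \<tau> u U k = (\<lambda>j. u (grid_x a M j) (real k * \<tau>) - U k j)"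
        by (simp add: cnfd_error_def fun_eq_iff)
      note E = err[rule_format, OF conjI[OF grid conjI[OF hh \<tau>(2)]] order_refl, folded e]
      have "norm (cnfd_error a M \<tau> u U k j) \<le> ?B" if "j \<le> 2 * M" for j
      proof -
        have "norm (cnfd_error a M \<tau> u U k j) \<le> \<omega> * \<tau>\<^sup>2 / \<epsilon>\<^sup>2 + K * (a / real M)\<^sup>2"
          using E that unfolding e by blast
        then show ?thesis using B by (rule order_trans)
      qed
      then have "mesh_norm_inf M (cnfd_error a M \<tau> u U k) \<le> ?B"
        unfolding mesh_norm_inf_def by (intro Max.boundedI) auto
      moreover have "mesh_norm (a / real M) M (cnfd_error a M \<tau> u U k) \<le> ?B"
        "mesh_norm (a / real M) M (dx_plus (a / real M) (cnfd_error a M \<tau> u U k)) \<le> ?B"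
        using E B by (auto intro: order_trans)
      ultimately show "let h = a / real M; e = cnfd_error a M \<tau> u U k; B = C_eps \<epsilon> M1 * (\<tau>\<^sup>2 + \<tau> * h) + K * h\<^sup>2
           in mesh_norm h M e \<le> B \<and> mesh_norm h M (dx_plus h e) \<le> B \<and> mesh_norm_inf M e \<le> B"
        unfolding Let_def by blast
    qed
  qed
qed

end
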